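(* Let $R$ be a ring, $\mathfrak{a}$ an ideal of $R$, $M$ a finitely generated $R$-module and $N$ an $R$-module. Suppose that $\operatorname{Supp}_R M \cap \operatorname{Supp}_R N \subseteq V(\mathfrak{a})$. Then there are isomorphisms $$H^i_{\mathfrak{a}}(M,N) \cong \operatorname{Ext}_R^i(M,N)$$ for all $i \geq 0$.
   Context: All rings are Noetherian, commutative, with $1 \neq 0$. For an ideal $\mathfrak{a}$ and $R$-modules $M,N$, the generalized local cohomology modules are $H^i_{\mathfrak{a}}(M,N) = \varinjlim_n \operatorname{Ext}^i_R(M/\mathfrak{a}^nM,N)$, with direct system induced by the natural maps $M/\mathfrak{a}^{n+1}M \to M/\mathfrak{a}^nM$. $V(\mathfrak{a})$ is the set of primes containing $\mathfrak{a}$. *)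

theory Defs
  imports "HOL-Algebra.Module" "HOL-Algebra.Ideal_Product" "HOL-Algebra.Ring_Divisibility"
begin

section \<open>Modules over a commutative ring\<close>

text \<open>A module record extends a ring record.  The fields \<open>mult\<close> and \<open>one\<close> of a module carry no
  meaning and are left \<open>undefined\<close> in the constructions below.\<close>

definition module_hom ::
  "('a, 'r) ring_scheme \<Rightarrow> ('a, 'm, 'x) module_scheme \<Rightarrow> ('a, 'n, 'y) module_scheme \<Rightarrow> ('m \<Rightarrow> 'n) set"
  where "module_hom R M N = {h \<in> carrier M \<rightarrow> carrier N.
    (\<forall>x\<in>carrier M. \<forall>y\<in>carrier M. h (x \<oplus>\<^bsub>M\<^esub> y) = h x \<oplus>\<^bsub>N\<^esub> h y) \<and>
    (\<forall>r\<in>carrier R. \<forall>x\<in>carrier M. h (r \<odot>\<^bsub>M\<^esub> x) = r \<odot>\<^bsub>N\<^esub> h x)}"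

definition module_isomorphic ::
  "('a, 'r) ring_scheme \<Rightarrow> ('a, 'm, 'x) module_scheme \<Rightarrow> ('a, 'n, 'y) module_scheme \<Rightarrow> bool"
  where "module_isomorphic R M N \<longleftrightarrow> (\<exists>h\<in>module_hom R M N. bij_betw h (carrier M) (carrier N))"

definition finitely_generated_module ::
  "('a, 'r) ring_scheme \<Rightarrow> ('a, 'm, 'x) module_scheme \<Rightarrow> bool"
  where "finitely_generated_module R M \<longleftrightarrow> (\<exists>A\<subseteq>carrier M. finite A \<and>
    (\<forall>x\<in>carrier M. \<exists>c\<in>A \<rightarrow> carrier R. x = (\<Oplus>\<^bsub>M\<^esub>a\<in>A. c a \<odot>\<^bsub>M\<^esub> a)))"

definition quotient_module :: "('a, 'm, 'x) module_scheme \<Rightarrow> 'm set \<Rightarrow> ('a, 'm set) module"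
  where "quotient_module M H = \<lparr>carrier = a_rcosets\<^bsub>M\<^esub> H, monoid.mult = undefined, one = undefined,
    zero = H, add = (<+>\<^bsub>M\<^esub>), smult = (\<lambda>r X. \<Union>x\<in>X. H +>\<^bsub>M\<^esub> (r \<odot>\<^bsub>M\<^esub> x))\<rparr>"

definition Hom_module ::
  "('a, 'r) ring_scheme \<Rightarrow> ('a, 'm, 'x) module_scheme \<Rightarrow> ('a, 'n, 'y) module_scheme \<Rightarrow> ('a, 'm \<Rightarrow> 'n) module"
  where "Hom_module R M N = \<lparr>carrier = module_hom R M N \<inter> extensional (carrier M),
    monoid.mult = undefined, one = undefined,
    zero = (\<lambda>x\<in>carrier M. \<zero>\<^bsub>N\<^esub>),
    add = (\<lambda>g h. \<lambda>x\<in>carrier M. g x \<oplus>\<^bsub>N\<^esub> h x),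
    smult = (\<lambda>r h. \<lambda>x\<in>carrier M. r \<odot>\<^bsub>N\<^esub> h x)\<rparr>"


section \<open>Localization and support\<close>

definition localization_rel ::
  "'a set \<Rightarrow> ('a, 'm, 'x) module_scheme \<Rightarrow> (('m \<times> 'a) \<times> ('m \<times> 'a)) set"
  where "localization_rel S M = {((m, s), (m', s')).
    m \<in> carrier M \<and> s \<in> S \<and> m' \<in> carrier M \<and> s' \<in> S \<and>
    (\<exists>u\<in>S. u \<odot>\<^bsub>M\<^esub> (s' \<odot>\<^bsub>M\<^esub> m) = u \<odot>\<^bsub>M\<^esub> (s \<odot>\<^bsub>M\<^esub> m'))}"

abbreviation fraction :: "'a set \<Rightarrow> ('a, 'm, 'x) module_scheme \<Rightarrow> 'm \<Rightarrow> 'a \<Rightarrow> ('m \<times> 'a) set"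
  where "fraction S M m s \<equiv> localization_rel S M `` {(m, s)}"

text \<open>The module of fractions of \<open>M\<close> with respect to a multiplicative set \<open>S\<close>, with scalars
  restricted to \<open>R\<close>.\<close>

definition localization ::
  "('a, 'r) ring_scheme \<Rightarrow> 'a set \<Rightarrow> ('a, 'm, 'x) module_scheme \<Rightarrow> ('a, ('m \<times> 'a) set) module"
  where "localization R S M = \<lparr>carrier = (carrier M \<times> S) // localization_rel S M,
    monoid.mult = undefined, one = undefined,
    zero = fraction S M \<zero>\<^bsub>M\<^esub> \<one>\<^bsub>R\<^esub>,
    add = (\<lambda>X Y. \<Union>(m, s)\<in>X. \<Union>(m', s')\<in>Y.
      fraction S M (s' \<odot>\<^bsub>M\<^esub> m \<oplus>\<^bsub>M\<^esub> s \<odot>\<^bsub>M\<^esub> m') (s \<otimes>\<^bsub>R\<^esub> s')),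
    smult = (\<lambda>r X. \<Union>(m, s)\<in>X. fraction S M (r \<odot>\<^bsub>M\<^esub> m) s)\<rparr>"

definition Supp :: "('a, 'r) ring_scheme \<Rightarrow> ('a, 'm, 'x) module_scheme \<Rightarrow> 'a set set"
  where "Supp R M = {p. primeideal p R \<and>
    carrier (localization R (carrier R - p) M) \<noteq> {\<zero>\<^bsub>localization R (carrier R - p) M\<^esub>}}"

definition prime_locus :: "('a, 'r) ring_scheme \<Rightarrow> 'a set \<Rightarrow> 'a set set"
  where "prime_locus R \<aa> = {p. primeideal p R \<and> \<aa> \<subseteq> p}"


section \<open>A functorial free resolution\<close>

definition free_module :: "('a, 'r) ring_scheme \<Rightarrow> 'b set \<Rightarrow> ('a, 'b \<Rightarrow> 'a) module"
  where "free_module R B = \<lparr>carrier = {v. range v \<subseteq> carrier R \<and> finite {b. v b \<noteq> \<zero>\<^bsub>R\<^esub>} \<and>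
      {b. v b \<noteq> \<zero>\<^bsub>R\<^esub>} \<subseteq> B},
    monoid.mult = undefined, one = undefined,
    zero = (\<lambda>b. \<zero>\<^bsub>R\<^esub>), add = (\<lambda>u v b. u b \<oplus>\<^bsub>R\<^esub> v b), smult = (\<lambda>r v b. r \<otimes>\<^bsub>R\<^esub> v b)\<rparr>"

definition unit_vec :: "('a, 'r) ring_scheme \<Rightarrow> 'b \<Rightarrow> 'b \<Rightarrow> 'a"
  where "unit_vec R b = (\<lambda>b'. if b' = b then \<one>\<^bsub>R\<^esub> else \<zero>\<^bsub>R\<^esub>)"

text \<open>The linear extension to a free module of a map \<open>g\<close> on its basis, with values in \<open>V\<close>.\<close>

definition lin_ext ::
  "('a, 'r) ring_scheme \<Rightarrow> ('a, 'v, 'x) module_scheme \<Rightarrow> ('b \<Rightarrow> 'v) \<Rightarrow> ('b \<Rightarrow> 'a) \<Rightarrow> 'v"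
  where "lin_ext R V g v = (\<Oplus>\<^bsub>V\<^esub>b\<in>{b. v b \<noteq> \<zero>\<^bsub>R\<^esub>}. v b \<odot>\<^bsub>V\<^esub> g b)"

text \<open>The value in \<open>V\<close> of a formal linear combination of basis elements.\<close>

definition lin_comb :: "('a, 'v, 'x) module_scheme \<Rightarrow> ('b \<Rightarrow> 'v) \<Rightarrow> ('a \<times> 'b) list \<Rightarrow> 'v"
  where "lin_comb V g l = foldr (\<lambda>(r, b) v. r \<odot>\<^bsub>V\<^esub> g b \<oplus>\<^bsub>V\<^esub> v) l \<zero>\<^bsub>V\<^esub>"

text \<open>Every module \<open>M\<close> has a free resolution
  \<open>\<dots> \<rightarrow> F\<^sub>2 \<rightarrow> F\<^sub>1 \<rightarrow> F\<^sub>0 \<rightarrow> M \<rightarrow> 0\<close> in which \<open>F\<^sub>0\<close> is free on the elements of \<open>M\<close> and each \<open>F\<^sub>n\<^sub>+\<^sub>1\<close> is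
  free on the formal linear combinations \<open>l\<close> of basis elements of \<open>F\<^sub>n\<close> whose value lies in the
  kernel of the preceding map; the differential sends the basis element given by \<open>l\<close> to the value
  of \<open>l\<close>.  The bases of all the \<open>F\<^sub>n\<close> live in the single type below: \<open>Gen m\<close> is the generator of
  \<open>F\<^sub>0\<close> over \<open>m\<close>, and \<open>Syz l\<close> the generator over the formal combination \<open>l\<close>.
  Using formal combinations rather than their values makes the resolution a functor of \<open>M\<close>: the map
  on bases induced by \<open>f\<close> is \<open>map_syz id f\<close>.\<close>

datatype ('a, 'm) syz = Gen (gen_of: 'm) | Syz (comb_of: "('a \<times> ('a, 'm) syz) list")

definition syz_boundary :: "('a, 'r) ring_scheme \<Rightarrow> ('a, 'm) syz \<Rightarrow> ('a, 'm) syz \<Rightarrow> 'a"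
  where "syz_boundary R b = lin_comb (free_module R UNIV) (unit_vec R) (comb_of b)"

fun syz_basis :: "('a, 'r) ring_scheme \<Rightarrow> ('a, 'm, 'x) module_scheme \<Rightarrow> nat \<Rightarrow> ('a, 'm) syz set"
  where
    "syz_basis R M 0 = Gen ` carrier M"
  | "syz_basis R M (Suc 0) = Syz ` {l \<in> lists (carrier R \<times> syz_basis R M 0).
       lin_comb M gen_of l = \<zero>\<^bsub>M\<^esub>}"
  | "syz_basis R M (Suc (Suc n)) = Syz ` {l \<in> lists (carrier R \<times> syz_basis R M (Suc n)).
       lin_comb (free_module R UNIV) (syz_boundary R) l = \<zero>\<^bsub>free_module R UNIV\<^esub>}"

definition res_module ::
  "('a, 'r) ring_scheme \<Rightarrow> ('a, 'm, 'x) module_scheme \<Rightarrow> nat \<Rightarrow> ('a, ('a, 'm) syz \<Rightarrow> 'a) module"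
  where "res_module R M n = free_module R (syz_basis R M n)"

definition res_augmentation ::
  "('a, 'r) ring_scheme \<Rightarrow> ('a, 'm, 'x) module_scheme \<Rightarrow> (('a, 'm) syz \<Rightarrow> 'a) \<Rightarrow> 'm"
  where "res_augmentation R M = lin_ext R M gen_of"

text \<open>The formula for the differential \<open>F\<^sub>n\<^sub>+\<^sub>1 \<rightarrow> F\<^sub>n\<close> depends neither on \<open>n\<close> nor on \<open>M\<close>.\<close>

definition res_diff ::
  "('a, 'r) ring_scheme \<Rightarrow> (('a, 'm) syz \<Rightarrow> 'a) \<Rightarrow> ('a, 'm) syz \<Rightarrow> 'a"
  where "res_diff R = lin_ext R (free_module R UNIV) (syz_boundary R)"

definition res_map ::
  "('a, 'r) ring_scheme \<Rightarrow> ('m \<Rightarrow> 'n) \<Rightarrow> (('a, 'm) syz \<Rightarrow> 'a) \<Rightarrow> ('a, 'n) syz \<Rightarrow> 'a"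
  where "res_map R f = lin_ext R (free_module R UNIV) (\<lambda>b. unit_vec R (map_syz id f b))"


section \<open>Ext\<close>

text \<open>\<open>Ext\<close> is the cohomology of the complex \<open>Hom(F\<^sub>n, N)\<close>, for the free resolution \<open>F\<close> of \<open>M\<close>.\<close>

definition Ext_cochains ::
  "('a, 'r) ring_scheme \<Rightarrow> ('a, 'm, 'x) module_scheme \<Rightarrow> ('a, 'n, 'y) module_scheme \<Rightarrow> nat \<Rightarrow>
    ('a, (('a, 'm) syz \<Rightarrow> 'a) \<Rightarrow> 'n) module"
  where "Ext_cochains R M N n = Hom_module R (res_module R M n) N"

definition Ext_diff ::
  "('a, 'r) ring_scheme \<Rightarrow> ('a, 'm, 'x) module_scheme \<Rightarrow> nat \<Rightarrow>
    ((('a, 'm) syz \<Rightarrow> 'a) \<Rightarrow> 'n) \<Rightarrow> (('a, 'm) syz \<Rightarrow> 'a) \<Rightarrow> 'n"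
  where "Ext_diff R M n h = (\<lambda>v\<in>carrier (res_module R M (Suc n)). h (res_diff R v))"

definition Ext_cocycles ::
  "('a, 'r) ring_scheme \<Rightarrow> ('a, 'm, 'x) module_scheme \<Rightarrow> ('a, 'n, 'y) module_scheme \<Rightarrow> nat \<Rightarrow>
    ((('a, 'm) syz \<Rightarrow> 'a) \<Rightarrow> 'n) set"
  where "Ext_cocycles R M N n = {h \<in> carrier (Ext_cochains R M N n).
    Ext_diff R M n h = \<zero>\<^bsub>Ext_cochains R M N (Suc n)\<^esub>}"

fun Ext_coboundaries ::
  "('a, 'r) ring_scheme \<Rightarrow> ('a, 'm, 'x) module_scheme \<Rightarrow> ('a, 'n, 'y) module_scheme \<Rightarrow> nat \<Rightarrow>
    ((('a, 'm) syz \<Rightarrow> 'a) \<Rightarrow> 'n) set"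
  where
    "Ext_coboundaries R M N 0 = {\<zero>\<^bsub>Ext_cochains R M N 0\<^esub>}"
  | "Ext_coboundaries R M N (Suc n) = Ext_diff R M n ` carrier (Ext_cochains R M N n)"

definition Ext ::
  "('a, 'r) ring_scheme \<Rightarrow> ('a, 'm, 'x) module_scheme \<Rightarrow> ('a, 'n, 'y) module_scheme \<Rightarrow> nat \<Rightarrow>
    ('a, ((('a, 'm) syz \<Rightarrow> 'a) \<Rightarrow> 'n) set) module"
  where "Ext R M N n = quotient_module
    ((Ext_cochains R M N n)\<lparr>carrier := Ext_cocycles R M N n\<rparr>) (Ext_coboundaries R M N n)"

text \<open>The map \<open>Ext\<^sup>n(M', N) \<rightarrow> Ext\<^sup>n(M, N)\<close> induced by a homomorphism \<open>f\<close> from \<open>M\<close> to \<open>M'\<close>; it does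
  not mention \<open>M'\<close>.\<close>

definition Ext_map ::
  "('a, 'r) ring_scheme \<Rightarrow> ('a, 'm, 'x) module_scheme \<Rightarrow> ('a, 'n, 'y) module_scheme \<Rightarrow> nat \<Rightarrow>
    ('m \<Rightarrow> 'k) \<Rightarrow> ((('a, 'k) syz \<Rightarrow> 'a) \<Rightarrow> 'n) set \<Rightarrow> ((('a, 'm) syz \<Rightarrow> 'a) \<Rightarrow> 'n) set"
  where "Ext_map R M N n f X = (\<Union>h\<in>X. Ext_coboundaries R M N n +>\<^bsub>Ext_cochains R M N n\<^esub>
    (\<lambda>v\<in>carrier (res_module R M n). h (res_map R f v)))"


section \<open>Direct limits of sequences of modules\<close>

text \<open>For a sequence \<open>G 0 \<rightarrow> G 1 \<rightarrow> G 2 \<rightarrow> \<dots>\<close> with maps \<open>f n\<close> from \<open>G n\<close> to \<open>G (Suc n)\<close>, the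
  transition map from \<open>G m\<close> to \<open>G k\<close> is \<open>fold f [m..<k]\<close>.\<close>

definition direct_limit_rel ::
  "(nat \<Rightarrow> ('a, 'g, 'x) module_scheme) \<Rightarrow> (nat \<Rightarrow> 'g \<Rightarrow> 'g) \<Rightarrow> ((nat \<times> 'g) \<times> (nat \<times> 'g)) set"
  where "direct_limit_rel G f = {((m, x), (n, y)). x \<in> carrier (G m) \<and> y \<in> carrier (G n) \<and>
    (\<exists>k. m \<le> k \<and> n \<le> k \<and> fold f [m..<k] x = fold f [n..<k] y)}"

definition direct_limit ::
  "(nat \<Rightarrow> ('a, 'g, 'x) module_scheme) \<Rightarrow> (nat \<Rightarrow> 'g \<Rightarrow> 'g) \<Rightarrow> ('a, (nat \<times> 'g) set) module"
  where "direct_limit G f = \<lparr>carrier = (SIGMA n:UNIV. carrier (G n)) // direct_limit_rel G f,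
    monoid.mult = undefined, one = undefined,
    zero = direct_limit_rel G f `` {(0, \<zero>\<^bsub>G 0\<^esub>)},
    add = (\<lambda>X Y. \<Union>(m, x)\<in>X. \<Union>(n, y)\<in>Y. direct_limit_rel G f ``
      {(max m n, fold f [m..<max m n] x \<oplus>\<^bsub>G (max m n)\<^esub> fold f [n..<max m n] y)}),
    smult = (\<lambda>r X. \<Union>(n, x)\<in>X. direct_limit_rel G f `` {(n, r \<odot>\<^bsub>G n\<^esub> x)})\<rparr>"


section \<open>Generalized local cohomology\<close>

primrec ideal_power :: "('a, 'r) ring_scheme \<Rightarrow> 'a set \<Rightarrow> nat \<Rightarrow> 'a set"
  where
    "ideal_power R \<aa> 0 = carrier R"
  | "ideal_power R \<aa> (Suc n) = \<aa> \<cdot>\<^bsub>R\<^esub> ideal_power R \<aa> n"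

inductive_set ideal_smult :: "'a set \<Rightarrow> ('a, 'm, 'x) module_scheme \<Rightarrow> 'm set" for I M
  where
    smult: "\<lbrakk> r \<in> I; x \<in> carrier M \<rbrakk> \<Longrightarrow> r \<odot>\<^bsub>M\<^esub> x \<in> ideal_smult I M"
  | add: "\<lbrakk> x \<in> ideal_smult I M; y \<in> ideal_smult I M \<rbrakk> \<Longrightarrow> x \<oplus>\<^bsub>M\<^esub> y \<in> ideal_smult I M"

definition adic_quotient ::
  "('a, 'r) ring_scheme \<Rightarrow> 'a set \<Rightarrow> ('a, 'm, 'x) module_scheme \<Rightarrow> nat \<Rightarrow> ('a, 'm set) module"
  where "adic_quotient R \<aa> M n = quotient_module M (ideal_smult (ideal_power R \<aa> n) M)"

text \<open>The natural map from \<open>M/\<aa>\<^sup>n\<^sup>+\<^sup>1M\<close> to \<open>M/\<aa>\<^sup>nM\<close>.\<close>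

definition adic_projection ::
  "('a, 'r) ring_scheme \<Rightarrow> 'a set \<Rightarrow> ('a, 'm, 'x) module_scheme \<Rightarrow> nat \<Rightarrow> 'm set \<Rightarrow> 'm set"
  where "adic_projection R \<aa> M n X = (\<Union>x\<in>X. ideal_smult (ideal_power R \<aa> n) M +>\<^bsub>M\<^esub> x)"

definition gen_local_cohomology ::
  "('a, 'r) ring_scheme \<Rightarrow> 'a set \<Rightarrow> ('a, 'm, 'x) module_scheme \<Rightarrow> ('a, 'n, 'y) module_scheme \<Rightarrow> nat \<Rightarrow>
    ('a, (nat \<times> ((('a, 'm set) syz \<Rightarrow> 'a) \<Rightarrow> 'n) set) set) module"
  where "gen_local_cohomology R \<aa> M N i = direct_limit
    (\<lambda>n. Ext R (adic_quotient R \<aa> M n) N i)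
    (\<lambda>n. Ext_map R (adic_quotient R \<aa> M (Suc n)) N i (adic_projection R \<aa> M n))"


section \<open>Well-definedness\<close>

subsection \<open>\<open>F\<close> is a free resolution\<close>

lemma free_simps:
  "\<zero>\<^bsub>free_module R B\<^esub> = (\<lambda>b. \<zero>\<^bsub>R\<^esub>)"
  "u \<oplus>\<^bsub>free_module R B\<^esub> v = (\<lambda>b. u b \<oplus>\<^bsub>R\<^esub> v b)"
  "r \<odot>\<^bsub>free_module R B\<^esub> v = (\<lambda>b. r \<otimes>\<^bsub>R\<^esub> v b)"
  by (simp_all add: free_module_def)

lemma free_carrier:
  "v \<in> carrier (free_module R B) \<longleftrightarrow> (\<forall>b. v b \<in> carrier R) \<and> finite {b. v b \<noteq> \<zero>\<^bsub>R\<^esub>} \<and>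
      {b. v b \<noteq> \<zero>\<^bsub>R\<^esub>} \<subseteq> B"
  by (auto simp add: free_module_def)

context cring begin

lemma free_module_module: "module R (free_module R B)"
proof (rule moduleI)
  show "cring R" by (rule is_cring)
  show "abelian_group (free_module R B)"
  proof (rule abelian_groupI)
    fix u v assume u: "u \<in> carrier (free_module R B)" and v: "v \<in> carrier (free_module R B)"
    have "{b. u b \<oplus> v b \<noteq> \<zero>} \<subseteq> {b. u b \<noteq> \<zero>} \<union> {b. v b \<noteq> \<zero>}" by auto
    then show "u \<oplus>\<^bsub>free_module R B\<^esub> v \<in> carrier (free_module R B)"
      using u v unfolding free_carrier free_simps
      by (meson add.m_closed finite_UnI finite_subset le_supI order_trans)
  next
    fix u assume u: "u \<in> carrier (free_module R B)"
    have "{b. \<ominus> u b \<noteq> \<zero>} = {b. u b \<noteq> \<zero>}" using u unfolding free_carrier by auto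
    with u have "(\<lambda>b. \<ominus> u b) \<in> carrier (free_module R B)" unfolding free_carrier by auto
    moreover have "(\<lambda>b. \<ominus> u b) \<oplus>\<^bsub>free_module R B\<^esub> u = \<zero>\<^bsub>free_module R B\<^esub>"
      using u unfolding free_carrier free_simps by (auto simp: l_neg)
    ultimately show "\<exists>y\<in>carrier (free_module R B). y \<oplus>\<^bsub>free_module R B\<^esub> u = \<zero>\<^bsub>free_module R B\<^esub>"
      by blast
  qed (auto simp: free_carrier free_simps a_ac)
  fix a x assume a: "a \<in> carrier R" and u: "x \<in> carrier (free_module R B)"
  have "{b. a \<otimes> x b \<noteq> \<zero>} \<subseteq> {b. x b \<noteq> \<zero>}" using a by auto
  with a u show "a \<odot>\<^bsub>free_module R B\<^esub> x \<in> carrier (free_module R B)"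
    unfolding free_carrier free_simps by (auto intro: finite_subset)
qed (auto simp: free_carrier free_simps l_distr r_distr m_assoc)

lemma unit_vec_carrier: "b \<in> B \<Longrightarrow> unit_vec R b \<in> carrier (free_module R B)"
proof -
  assume b: "b \<in> B"
  have "{b'. unit_vec R b b' \<noteq> \<zero>} \<subseteq> {b}" by (auto simp: unit_vec_def)
  with b show ?thesis unfolding free_carrier
    by (auto simp: unit_vec_def intro: finite_subset)
qed

lemma free_carrier_mono: "B \<subseteq> C \<Longrightarrow> carrier (free_module R B) \<subseteq> carrier (free_module R C)"
  unfolding free_carrier subset_iff by blast

end

context module begin

lemma lin_ext_superset:
  assumes "finite S" "{b. v b \<noteq> \<zero>} \<subseteq> S" "\<And>b. v b \<in> carrier R" "g \<in> S \<rightarrow> carrier M"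
  shows "lin_ext R M g v = (\<Oplus>\<^bsub>M\<^esub>b\<in>S. v b \<odot>\<^bsub>M\<^esub> g b)"
  unfolding lin_ext_def
  using assms
  by (intro M.add.finprod_mono_neutral_cong_left) (auto simp: Pi_def)

lemma lin_ext_hom:
  assumes g: "g \<in> B \<rightarrow> carrier M"
  shows "lin_ext R M g \<in> module_hom R (free_module R B) M"
proof -
  have cl: "lin_ext R M g v \<in> carrier M" if "v \<in> carrier (free_module R B)" for v
    unfolding lin_ext_def using that g by (intro M.finsum_closed) (auto simp: free_carrier)
  have add: "lin_ext R M g (u \<oplus>\<^bsub>free_module R B\<^esub> v) = lin_ext R M g u \<oplus>\<^bsub>M\<^esub> lin_ext R M g v"
    if u: "u \<in> carrier (free_module R B)" and v: "v \<in> carrier (free_module R B)" for u v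
  proof -
    let ?S = "{b. u b \<noteq> \<zero>} \<union> {b. v b \<noteq> \<zero>}"
    have S: "finite ?S" "?S \<subseteq> B" using u v by (auto simp: free_carrier)
    have g': "g \<in> ?S \<rightarrow> carrier M" using g S by auto
    have 1: "lin_ext R M g u = (\<Oplus>\<^bsub>M\<^esub>b\<in>?S. u b \<odot>\<^bsub>M\<^esub> g b)"
      using u by (intro lin_ext_superset S(1) g') (auto simp: free_carrier)
    have 2: "lin_ext R M g v = (\<Oplus>\<^bsub>M\<^esub>b\<in>?S. v b \<odot>\<^bsub>M\<^esub> g b)"
      using v by (intro lin_ext_superset S(1) g') (auto simp: free_carrier)
    have 3: "lin_ext R M g (u \<oplus>\<^bsub>free_module R B\<^esub> v) = (\<Oplus>\<^bsub>M\<^esub>b\<in>?S. (u b \<oplus> v b) \<odot>\<^bsub>M\<^esub> g b)"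
      unfolding free_simps
      using u v by (intro lin_ext_superset S(1) g') (auto simp: free_carrier)
    have "(\<Oplus>\<^bsub>M\<^esub>b\<in>?S. (u b \<oplus> v b) \<odot>\<^bsub>M\<^esub> g b) = (\<Oplus>\<^bsub>M\<^esub>b\<in>?S. u b \<odot>\<^bsub>M\<^esub> g b \<oplus>\<^bsub>M\<^esub> v b \<odot>\<^bsub>M\<^esub> g b)"
      using u v g' by (intro M.finsum_cong' refl) (auto simp: free_carrier smult_l_distr Pi_iff)
    also have "\<dots> = (\<Oplus>\<^bsub>M\<^esub>b\<in>?S. u b \<odot>\<^bsub>M\<^esub> g b) \<oplus>\<^bsub>M\<^esub> (\<Oplus>\<^bsub>M\<^esub>b\<in>?S. v b \<odot>\<^bsub>M\<^esub> g b)"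
      using u v g' by (intro M.finsum_addf) (auto simp: free_carrier Pi_iff)
    finally show ?thesis unfolding 1 2 3 .
  qed
  have sm: "lin_ext R M g (r \<odot>\<^bsub>free_module R B\<^esub> v) = r \<odot>\<^bsub>M\<^esub> lin_ext R M g v"
    if r: "r \<in> carrier R" and v: "v \<in> carrier (free_module R B)" for r v
  proof -
    let ?S = "{b. v b \<noteq> \<zero>}"
    have S: "finite ?S" "?S \<subseteq> B" using v by (auto simp: free_carrier)
    have g': "g \<in> ?S \<rightarrow> carrier M" using g S by auto
    have "lin_ext R M g (r \<odot>\<^bsub>free_module R B\<^esub> v) = (\<Oplus>\<^bsub>M\<^esub>b\<in>?S. (r \<otimes> v b) \<odot>\<^bsub>M\<^esub> g b)"
      unfolding free_simps
      using r v by (intro lin_ext_superset S(1) g') (auto simp: free_carrier)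
    also have "\<dots> = (\<Oplus>\<^bsub>M\<^esub>b\<in>?S. r \<odot>\<^bsub>M\<^esub> (v b \<odot>\<^bsub>M\<^esub> g b))"
      using r v g' by (intro M.finsum_cong' refl) (auto simp: free_carrier smult_assoc1 Pi_iff)
    also have "\<dots> = r \<odot>\<^bsub>M\<^esub> lin_ext R M g v" unfolding lin_ext_def
      using r v g' S by (intro finsum_smult_ldistr [symmetric]) (auto simp: free_carrier)
    finally show ?thesis .
  qed
  show ?thesis unfolding module_hom_def using cl add sm by auto
qed

lemma lin_ext_unit_vec:
  assumes "g b \<in> carrier M"
  shows "lin_ext R M g (unit_vec R b) = g b"
proof -
  have "lin_ext R M g (unit_vec R b) = (\<Oplus>\<^bsub>M\<^esub>b'\<in>{b}. unit_vec R b b' \<odot>\<^bsub>M\<^esub> g b')"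
    using assms by (intro lin_ext_superset) (auto simp: unit_vec_def)
  also have "\<dots> = g b" using assms by (simp add: unit_vec_def)
  finally show ?thesis .
qed

lemma lin_comb_closed:
  assumes "l \<in> lists (carrier R \<times> B)" "g \<in> B \<rightarrow> carrier M"
  shows "lin_comb M g l \<in> carrier M"
  using assms by (induction l) (auto simp: lin_comb_def)

lemma hom_lin_comb:
  assumes V: "module R V" and h: "h \<in> module_hom R V M"
    and l: "l \<in> lists (carrier R \<times> B)" and g: "g \<in> B \<rightarrow> carrier V"
  shows "h (lin_comb V g l) = lin_comb M (h \<circ> g) l"
proof -
  interpret V: module R V by fact
  have z: "h \<zero>\<^bsub>V\<^esub> = \<zero>\<^bsub>M\<^esub>"
  proof -
    have "h (\<zero> \<odot>\<^bsub>V\<^esub> \<zero>\<^bsub>V\<^esub>) = \<zero> \<odot>\<^bsub>M\<^esub> h \<zero>\<^bsub>V\<^esub>" using h unfolding module_hom_def by blast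
    moreover have "h \<zero>\<^bsub>V\<^esub> \<in> carrier M" using h by (auto simp: module_hom_def)
    ultimately show ?thesis by simp
  qed
  show ?thesis using l
  proof (induction l)
    case Nil then show ?case by (simp add: lin_comb_def z)
  next
    case (Cons p l)
    obtain r b where p: "p = (r, b)" by force
    have rb: "r \<in> carrier R" "b \<in> B" "g b \<in> carrier V" using Cons g p by auto
    have "lin_comb V g l \<in> carrier V" using V.lin_comb_closed Cons g by auto
    then have "h (r \<odot>\<^bsub>V\<^esub> g b \<oplus>\<^bsub>V\<^esub> lin_comb V g l) = r \<odot>\<^bsub>M\<^esub> h (g b) \<oplus>\<^bsub>M\<^esub> h (lin_comb V g l)"
      using h rb by (simp add: module_hom_def)
    then show ?case using Cons p by (simp add: lin_comb_def)
  qed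
qed

lemma lin_ext_lin_comb:
  assumes l: "l \<in> lists (carrier R \<times> B)" and g: "g \<in> B \<rightarrow> carrier M"
  shows "lin_ext R M g (lin_comb (free_module R UNIV) (unit_vec R) l) = lin_comb M g l"
proof -
  have eq: "lin_comb (free_module R UNIV) (unit_vec R) l = lin_comb (free_module R B) (unit_vec R) l"
    by (simp add: lin_comb_def free_simps)
  have "lin_ext R M g (lin_comb (free_module R B) (unit_vec R) l)
      = lin_comb M (lin_ext R M g \<circ> unit_vec R) l"
    using R.unit_vec_carrier by (intro hom_lin_comb[OF R.free_module_module lin_ext_hom[OF g] l]) auto
  also have "\<dots> = lin_comb M g l"
    using l g by (induction l) (auto simp: lin_comb_def lin_ext_unit_vec Pi_iff)
  finally show ?thesis unfolding eq .
qed

end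

context cring begin

lemma lin_comb_free_closed:
  assumes "l \<in> lists (carrier R \<times> B)" 
  shows "lin_comb (free_module R UNIV) (unit_vec R) l \<in> carrier (free_module R B)"
proof -
  interpret F: module R "free_module R B" by (rule free_module_module)
  have "lin_comb (free_module R B) (unit_vec R) l \<in> carrier (free_module R B)"
    using assms unit_vec_carrier by (intro F.lin_comb_closed) auto
  then show ?thesis by (simp add: lin_comb_def free_simps)
qed

lemma free_is_lin_comb:
  assumes "v \<in> carrier (free_module R B)"
  shows "\<exists>l\<in>lists (carrier R \<times> B). lin_comb (free_module R UNIV) (unit_vec R) l = v"
proof -
  have "\<exists>l\<in>lists (carrier R \<times> B). lin_comb (free_module R UNIV) (unit_vec R) l = v"
    if "finite S" "v \<in> carrier (free_module R B)" "{b. v b \<noteq> \<zero>} = S" for S v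
    using that
  proof (induction S arbitrary: v rule: finite_induct)
    case empty
    then have "v = (\<lambda>b. \<zero>)" by auto
    then show ?case by (intro bexI[of _ "[]"]) (auto simp: lin_comb_def free_simps)
  next
    case (insert b S)
    let ?v = "v(b := \<zero>)"
    have S: "{b. ?v b \<noteq> \<zero>} = S" using insert by auto
    then have "?v \<in> carrier (free_module R B)" using insert unfolding free_carrier by auto
    then obtain l where l: "l\<in>lists (carrier R \<times> B)" "lin_comb (free_module R UNIV) (unit_vec R) l = ?v"
      using insert.IH S by blast
    have "b \<in> B" using insert unfolding free_carrier by auto
    moreover have vc: "\<And>b. v b \<in> carrier R" using insert unfolding free_carrier by auto
    moreover have "lin_comb (free_module R UNIV) (unit_vec R) ((v b, b) # l) = v"
      using l(2) vc by (auto simp: lin_comb_def free_simps unit_vec_def fun_eq_iff)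
    ultimately show ?case using l(1) by (intro bexI[of _ "(v b, b) # l"]) auto
  qed
  then show ?thesis using assms unfolding free_carrier by blast
qed

lemma syz_basis_Suc:
  assumes "b \<in> syz_basis R M (Suc n)"
  obtains l where "b = Syz l" "l \<in> lists (carrier R \<times> syz_basis R M n)"
  using assms by (cases n) auto

lemma syz_boundary_carrier:
  "syz_boundary R \<in> syz_basis R M (Suc n) \<rightarrow> carrier (res_module R M n)"
  by (auto elim!: syz_basis_Suc simp: syz_boundary_def res_module_def intro!: lin_comb_free_closed)

lemma lin_ext_free_eq:
  fixes B :: "'z set"
  assumes "g \<in> C \<rightarrow> carrier (free_module R B)" "v \<in> carrier (free_module R C)"
  shows "lin_ext R (free_module R UNIV) g v = lin_ext R (free_module R B) g v"
proof -
  interpret F: module R "free_module R B" by (rule free_module_module)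
  interpret G: module R "free_module R (UNIV::'z set)" by (rule free_module_module)
  obtain l where l: "l\<in>lists (carrier R \<times> C)" "lin_comb (free_module R UNIV) (unit_vec R) l = v"
    using free_is_lin_comb[OF assms(2)] by blast
  have g: "g \<in> C \<rightarrow> carrier (free_module R UNIV)" using assms(1) free_carrier_mono[of B UNIV] by auto
  have "lin_comb (free_module R UNIV) g l = lin_comb (free_module R B) g l"
    by (simp add: lin_comb_def free_simps)
  then show ?thesis
    using F.lin_ext_lin_comb[OF l(1) assms(1)] G.lin_ext_lin_comb[OF l(1) g] l(2) by simp
qed

lemma module_hom_cong:
  assumes "h \<in> module_hom R M N" "\<And>x. x \<in> carrier M \<Longrightarrow> h x = k x" "module R M"
  shows "k \<in> module_hom R M N"
proof -
  interpret module R M by fact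
  have "k x = h x" if "x \<in> carrier M" for x using assms(2) that by simp
  then show ?thesis using assms(1) unfolding module_hom_def by (auto simp: Pi_def)
qed

lemma res_diff_hom: "res_diff R \<in> module_hom R (res_module R M (Suc n)) (res_module R M n)"
proof -
  interpret F: module R "res_module R M n" unfolding res_module_def by (rule free_module_module)
  show ?thesis unfolding res_diff_def
    by (rule module_hom_cong[OF F.lin_ext_hom[OF syz_boundary_carrier, folded res_module_def]])
      (auto simp: res_module_def free_module_module
        intro!: lin_ext_free_eq[OF syz_boundary_carrier[unfolded res_module_def], symmetric])
qed

end

context module begin

lemma res_augmentation_hom: "res_augmentation R M \<in> module_hom R (res_module R M 0) M"
  unfolding res_augmentation_def res_module_def by (rule lin_ext_hom) auto

lemma res_augmentation_surj: "res_augmentation R M ` carrier (res_module R M 0) = carrier M"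
proof
  show "res_augmentation R M ` carrier (res_module R M 0) \<subseteq> carrier M"
    using res_augmentation_hom by (auto simp: module_hom_def)
  show "carrier M \<subseteq> res_augmentation R M ` carrier (res_module R M 0)"
  proof
    fix m assume m: "m \<in> carrier M"
    have "res_augmentation R M (unit_vec R (Gen m)) = m"
      unfolding res_augmentation_def using m by (subst lin_ext_unit_vec) auto
    moreover have "unit_vec R (Gen m) \<in> carrier (res_module R M 0)"
      unfolding res_module_def using m by (intro R.unit_vec_carrier) auto
    ultimately show "m \<in> res_augmentation R M ` carrier (res_module R M 0)" by force
  qed
qed

lemma res_diff_syz:
  assumes "l \<in> lists (carrier R \<times> B)"
  shows "res_diff R (unit_vec R (Syz l)) = lin_comb (free_module R UNIV) (unit_vec R) l"
proof -
  interpret G: module R "free_module R (UNIV::('a,'e) syz set)" by (rule R.free_module_module)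
  show ?thesis unfolding res_diff_def
    using assms R.lin_comb_free_closed[OF assms] R.free_carrier_mono[of B UNIV]
    by (subst G.lin_ext_unit_vec) (auto simp: syz_boundary_def)
qed

lemma module_hom_zero:
  assumes "module R V" "h \<in> module_hom R M V"
  shows "h \<zero>\<^bsub>M\<^esub> = \<zero>\<^bsub>V\<^esub>"
proof -
  interpret V: module R V by fact
  have "h (\<zero> \<odot>\<^bsub>M\<^esub> \<zero>\<^bsub>M\<^esub>) = \<zero> \<odot>\<^bsub>V\<^esub> h \<zero>\<^bsub>M\<^esub>" using assms(2) unfolding module_hom_def by blast
  moreover have "h \<zero>\<^bsub>M\<^esub> \<in> carrier V" using assms by (auto simp: module_hom_def)
  ultimately show ?thesis by simp
qed

lemma lin_comb_cong:
  assumes "l \<in> lists (carrier R \<times> B)" "\<And>b. b \<in> B \<Longrightarrow> g b = g' b"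
  shows "lin_comb V g l = lin_comb V g' l"
  using assms by (induction l) (auto simp: lin_comb_def)

lemma lin_comb_const_zero:
  assumes "l \<in> lists (carrier R \<times> B)" "\<And>b. b \<in> B \<Longrightarrow> g b = \<zero>\<^bsub>M\<^esub>"
  shows "lin_comb M g l = \<zero>\<^bsub>M\<^esub>"
  using assms by (induction l) (auto simp: lin_comb_def)

lemma exact_generic:
  fixes B :: "('a, 'z) syz set"
  assumes V: "module R V" and d: "d \<in> module_hom R (free_module R B) V"
    and C: "\<And>b. b \<in> C \<longleftrightarrow> (\<exists>l\<in>lists (carrier R \<times> B). b = Syz l \<and>
        d (lin_comb (free_module R UNIV) (unit_vec R) l) = \<zero>\<^bsub>V\<^esub>)"
  shows "res_diff R ` carrier (free_module R C) = {v \<in> carrier (free_module R B). d v = \<zero>\<^bsub>V\<^esub>}"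
proof -
  interpret V: module R V by fact
  interpret FB: module R "free_module R B" by (rule R.free_module_module)
  interpret G: module R "free_module R (UNIV::('a, 'z) syz set)" by (rule R.free_module_module)
  have bd: "syz_boundary R \<in> C \<rightarrow> carrier (free_module R B)"
  proof
    fix b assume "b \<in> C"
    then obtain l where "l \<in> lists (carrier R \<times> B)" "b = Syz l" using C by blast
    then show "syz_boundary R b \<in> carrier (free_module R B)"
      using R.lin_comb_free_closed by (simp add: syz_boundary_def)
  qed
  have "res_diff R (w) \<in> {v \<in> carrier (free_module R B). d v = \<zero>\<^bsub>V\<^esub>}" if w: "w \<in> carrier (free_module R C)" for w
  proof -
    obtain l where l: "l\<in>lists (carrier R \<times> C)" "lin_comb (free_module R UNIV) (unit_vec R) l = w"
      using R.free_is_lin_comb[OF w] by blast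
    have bd': "syz_boundary R \<in> C \<rightarrow> carrier (free_module R UNIV)" 
      using bd R.free_carrier_mono[of B UNIV] by auto
    have "res_diff R w = lin_comb (free_module R UNIV) (syz_boundary R) l"
      unfolding res_diff_def l(2)[symmetric] by (rule G.lin_ext_lin_comb[OF l(1) bd'])
    then have r: "res_diff R w = lin_comb (free_module R B) (syz_boundary R) l"
      by (simp add: lin_comb_def free_simps)
    have "d (res_diff R w) = lin_comb V (d \<circ> syz_boundary R) l"
      unfolding r by (rule V.hom_lin_comb[OF R.free_module_module d l(1) bd])
    also have "\<dots> = \<zero>\<^bsub>V\<^esub>"
      using l(1) by (rule V.lin_comb_const_zero) (auto simp: C syz_boundary_def)
    finally show ?thesis using r FB.lin_comb_closed[OF l(1) bd] by simp
  qed
  moreover have "v \<in> res_diff R ` carrier (free_module R C)" if v: "v \<in> carrier (free_module R B)" "d v = \<zero>\<^bsub>V\<^esub>" for v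
  proof -
    obtain l where l: "l\<in>lists (carrier R \<times> B)" "lin_comb (free_module R UNIV) (unit_vec R) l = v"
      using R.free_is_lin_comb[OF v(1)] by blast
    then have "Syz l \<in> C" using v C by auto
    then show ?thesis using res_diff_syz[OF l(1)] l(2) R.unit_vec_carrier by (metis image_eqI)
  qed
  ultimately show ?thesis by blast
qed

lemma image_Collect_bex:
  assumes "\<And>l. l \<in> L \<Longrightarrow> P l \<longleftrightarrow> Q l"
  shows "b \<in> f ` {l \<in> L. P l} \<longleftrightarrow> (\<exists>l\<in>L. b = f l \<and> Q l)"
  using assms by auto

lemma res_exact_0:
  "res_diff R ` carrier (res_module R M (Suc 0)) =
   {v \<in> carrier (res_module R M 0). res_augmentation R M v = \<zero>\<^bsub>M\<^esub>}"
  unfolding res_module_def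
proof (rule exact_generic[OF module_axioms res_augmentation_hom[unfolded res_module_def]])
  fix b
  have "lin_comb M gen_of l = res_augmentation R M (lin_comb (free_module R UNIV) (unit_vec R) l)"
    if "l \<in> lists (carrier R \<times> syz_basis R M 0)" for l
    unfolding res_augmentation_def by (rule lin_ext_lin_comb[OF that, symmetric]) auto
  then show "b \<in> syz_basis R M (Suc 0) \<longleftrightarrow> (\<exists>l\<in>lists (carrier R \<times> syz_basis R M 0). b = Syz l \<and>
        res_augmentation R M (lin_comb (free_module R UNIV) (unit_vec R) l) = \<zero>\<^bsub>M\<^esub>)"
    unfolding syz_basis.simps(2) by (intro image_Collect_bex) simp
qed

lemma res_exact_Suc:
  "res_diff R ` carrier (res_module R M (Suc (Suc n))) =
   {v \<in> carrier (res_module R M (Suc n)). res_diff R v = \<zero>\<^bsub>res_module R M n\<^esub>}"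
  unfolding res_module_def
proof (rule exact_generic[OF R.free_module_module R.res_diff_hom[of M n, unfolded res_module_def]])
  fix b
  interpret G: module R "free_module R (UNIV::('a, 'c) syz set)" by (rule R.free_module_module)
  have "lin_comb (free_module R UNIV) (syz_boundary R) l = res_diff R (lin_comb (free_module R UNIV) (unit_vec R) l)"
    if "l \<in> lists (carrier R \<times> syz_basis R M (Suc n))" for l
    unfolding res_diff_def
    by (rule G.lin_ext_lin_comb[OF that, symmetric])
       (use R.syz_boundary_carrier[of M n] R.free_carrier_mono[of "syz_basis R M n" UNIV] in \<open>auto simp: res_module_def\<close>)
  then show "b \<in> syz_basis R M (Suc (Suc n)) \<longleftrightarrow> (\<exists>l\<in>lists (carrier R \<times> syz_basis R M (Suc n)). b = Syz l \<and>
        res_diff R (lin_comb (free_module R UNIV) (unit_vec R) l) = \<zero>\<^bsub>free_module R (syz_basis R M n)\<^esub>)"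
    unfolding syz_basis.simps(3) free_simps by (intro image_Collect_bex) simp
qed

end


subsection \<open>\<open>Ext\<close> is a module, functorial in its first argument\<close>

context module begin

lemma module_hom_minus:
  assumes "module R V" "h \<in> module_hom R M V" "x \<in> carrier M"
  shows "h (\<ominus>\<^bsub>M\<^esub> x) = \<ominus>\<^bsub>V\<^esub> h x"
proof -
  interpret V: module R V by fact
  have "h ((\<ominus> \<one>) \<odot>\<^bsub>M\<^esub> x) = (\<ominus> \<one>) \<odot>\<^bsub>V\<^esub> h x"
    using assms(2,3) unfolding module_hom_def by blast
  moreover have "h x \<in> carrier V" using assms unfolding module_hom_def by blast
  ultimately show ?thesis using assms(3) by (simp add: smult_l_minus V.smult_l_minus)
qed

lemma Hom_module_module:
  assumes "module R V"
  shows "module R (Hom_module R V M)"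
proof -
  interpret V: module R V by fact
  note [simp] = Hom_module_def
  have mem: "f x \<in> carrier M" if "f \<in> module_hom R V M" "x \<in> carrier V" for f x
    using that unfolding module_hom_def by blast
  have addm: "(\<lambda>x\<in>carrier V. f x \<oplus>\<^bsub>M\<^esub> g x) \<in> module_hom R V M"
    if "f \<in> module_hom R V M" "g \<in> module_hom R V M" for f g
    using that mem[of f] mem[of g]
    by (auto simp: module_hom_def smult_r_distr M.a_ac)
  have smm: "(\<lambda>x\<in>carrier V. r \<odot>\<^bsub>M\<^esub> f x) \<in> module_hom R V M"
    if "f \<in> module_hom R V M" "r \<in> carrier R" for f r
    using that mem[of f]
    by (auto simp: module_hom_def smult_r_distr smult_assoc1 [symmetric] R.m_comm)
  show ?thesis
  proof (rule moduleI)
    show "cring R" by (rule R.is_cring)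
    show "abelian_group (Hom_module R V M)"
    proof (rule abelian_groupI)
      fix f assume f: "f \<in> carrier (Hom_module R V M)"
      let ?g = "(\<ominus> \<one>) \<odot>\<^bsub>Hom_module R V M\<^esub> f"
      have "?g \<in> carrier (Hom_module R V M)" using f smm by auto
      moreover have "?g \<oplus>\<^bsub>Hom_module R V M\<^esub> f = \<zero>\<^bsub>Hom_module R V M\<^esub>"
        using f mem[of f] by (auto simp: fun_eq_iff smult_l_minus M.l_neg)
      ultimately show "\<exists>y\<in>carrier (Hom_module R V M). y \<oplus>\<^bsub>Hom_module R V M\<^esub> f = \<zero>\<^bsub>Hom_module R V M\<^esub>" by blast
    next
      show "\<zero>\<^bsub>Hom_module R V M\<^esub> \<in> carrier (Hom_module R V M)"
        by (auto simp: module_hom_def)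
    next
      fix x assume "x \<in> carrier (Hom_module R V M)"
      then show "\<zero>\<^bsub>Hom_module R V M\<^esub> \<oplus>\<^bsub>Hom_module R V M\<^esub> x = x"
        using mem[of x] by (auto simp: fun_eq_iff extensional_def)
    qed (use addm mem in \<open>auto simp: fun_eq_iff M.a_ac\<close>)
  next
    fix x assume "x \<in> carrier (Hom_module R V M)"
    then show "\<one> \<odot>\<^bsub>Hom_module R V M\<^esub> x = x"
      using mem[of x] by (auto simp: fun_eq_iff extensional_def)
  qed (use smm mem in \<open>auto simp: fun_eq_iff smult_l_distr smult_r_distr smult_assoc1\<close>)
qed

lemma quotient_smult:
  assumes H: "submodule H R M" and r: "r \<in> carrier R" and x: "x \<in> carrier M"
  shows "r \<odot>\<^bsub>quotient_module M H\<^esub> (H +>\<^bsub>M\<^esub> x) = H +>\<^bsub>M\<^esub> (r \<odot>\<^bsub>M\<^esub> x)"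
proof -
  note E = submoduleE[OF H]
  have sg: "subgroup H (add_monoid M)" using H by (simp add: submodule_def)
  have "H +>\<^bsub>M\<^esub> (r \<odot>\<^bsub>M\<^esub> y) = H +>\<^bsub>M\<^esub> (r \<odot>\<^bsub>M\<^esub> x)" if yx: "y \<in> H +>\<^bsub>M\<^esub> x" for y
  proof -
    obtain h where h: "h \<in> H" "y = h \<oplus>\<^bsub>M\<^esub> x" using yx by (auto simp: a_r_coset_def')
    then have "r \<odot>\<^bsub>M\<^esub> y = r \<odot>\<^bsub>M\<^esub> h \<oplus>\<^bsub>M\<^esub> r \<odot>\<^bsub>M\<^esub> x" using E r x by (auto simp: smult_r_distr)
    moreover have "r \<odot>\<^bsub>M\<^esub> h \<in> H" using E r h by auto
    ultimately have "r \<odot>\<^bsub>M\<^esub> y \<in> H +>\<^bsub>M\<^esub> (r \<odot>\<^bsub>M\<^esub> x)" by (auto simp: a_r_coset_def')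
    then show ?thesis using M.a_repr_independence'[OF _ _ sg, folded a_r_coset_def] r x by auto
  qed
  moreover have "H +>\<^bsub>M\<^esub> x \<noteq> {}" using E by (auto simp: a_r_coset_def')
  ultimately show ?thesis by (auto simp: quotient_module_def)
qed

lemma quotient_add:
  assumes H: "submodule H R M" and x: "x \<in> carrier M" and y: "y \<in> carrier M"
  shows "(H +>\<^bsub>M\<^esub> x) \<oplus>\<^bsub>quotient_module M H\<^esub> (H +>\<^bsub>M\<^esub> y) = H +>\<^bsub>M\<^esub> (x \<oplus>\<^bsub>M\<^esub> y)"
proof -
  interpret abelian_subgroup H M
    using H by (intro abelian_subgroupI3 additive_subgroup.intro M.abelian_group_axioms) (simp add: submodule_def)
  show ?thesis using a_rcos_sum[OF x y] by (simp add: quotient_module_def)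
qed

lemma quotient_module_module:
  assumes H: "submodule H R M"
  shows "module R (quotient_module M H)"
proof -
  interpret H: abelian_subgroup H M
    using H by (intro abelian_subgroupI3 additive_subgroup.intro M.abelian_group_axioms) (simp add: submodule_def)
  have c: "carrier (quotient_module M H) = (\<lambda>x. H +>\<^bsub>M\<^esub> x) ` carrier M"
    by (auto simp: quotient_module_def A_RCOSETS_def')
  have z: "\<zero>\<^bsub>quotient_module M H\<^esub> = H +>\<^bsub>M\<^esub> \<zero>\<^bsub>M\<^esub>"
    using submoduleE(1)[OF H] by (simp add: quotient_module_def M.a_coset_add_zero)
  show ?thesis
  proof (rule moduleI)
    show "abelian_group (quotient_module M H)"
    proof (rule abelian_groupI)
      fix X assume "X \<in> carrier (quotient_module M H)"
      then obtain x where x: "x \<in> carrier M" "X = H +>\<^bsub>M\<^esub> x" by (auto simp: c)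
      then have "(H +>\<^bsub>M\<^esub> (\<ominus>\<^bsub>M\<^esub> x)) \<oplus>\<^bsub>quotient_module M H\<^esub> X = \<zero>\<^bsub>quotient_module M H\<^esub>"
        by (simp add: quotient_add[OF H] z M.l_neg)
      moreover have "H +>\<^bsub>M\<^esub> (\<ominus>\<^bsub>M\<^esub> x) \<in> carrier (quotient_module M H)" using x by (auto simp: c)
      ultimately show "\<exists>Y\<in>carrier (quotient_module M H). Y \<oplus>\<^bsub>quotient_module M H\<^esub> X = \<zero>\<^bsub>quotient_module M H\<^esub>" by blast
    qed (auto simp: c z quotient_add[OF H] M.a_ac)
  qed (auto simp: c quotient_add[OF H] quotient_smult[OF H] R.is_cring smult_l_distr smult_r_distr smult_assoc1)
qed

end

context cring begin

lemma res_module_module: "module R (res_module R M n)"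
  unfolding res_module_def by (rule free_module_module)

lemma Ext_cochains_module: "module R N \<Longrightarrow> module R (Ext_cochains R M N n)"
  unfolding Ext_cochains_def by (rule module.Hom_module_module[OF _ res_module_module])

lemma hom_comp:
  assumes "f \<in> module_hom R A B" "g \<in> module_hom R B C" shows "(\<lambda>x. g (f x)) \<in> module_hom R A C"
  using assms by (fastforce simp: module_hom_def Pi_iff)

lemma hom_restrict:
  assumes "f \<in> module_hom R A B" "module R A" shows "restrict f (carrier A) \<in> module_hom R A B"
  by (rule module_hom_cong[OF assms(1) _ assms(2)]) simp

lemma Ext_diff_hom:
  assumes "module R N"
  shows "Ext_diff R M n \<in> module_hom R (Ext_cochains R M N n) (Ext_cochains R M N (Suc n))"
proof -
  have mem: "res_diff R v \<in> carrier (res_module R M n)" if "v \<in> carrier (res_module R M (Suc n))" for v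
    using res_diff_hom[of M n] that unfolding module_hom_def by blast
  have "Ext_diff R M n h \<in> carrier (Ext_cochains R M N (Suc n))" if "h \<in> carrier (Ext_cochains R M N n)" for h
    using that hom_restrict[OF hom_comp[OF res_diff_hom[of M n], of h N] res_module_module]
    by (auto simp: Ext_diff_def Ext_cochains_def Hom_module_def)
  moreover have "\<And>x. restrict x (carrier (res_module R M (Suc n))) = (\<lambda>v. if v \<in> carrier (res_module R M (Suc n)) then x v else undefined)"
    by (auto simp: restrict_def)
  ultimately show ?thesis
    unfolding module_hom_def[of R "Ext_cochains R M N n"] using mem
    by (auto simp: Ext_diff_def Ext_cochains_def Hom_module_def fun_eq_iff)
qed


lemma res_diff_mem: "v \<in> carrier (res_module R M (Suc n)) \<Longrightarrow> res_diff R v \<in> carrier (res_module R M n)"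
  using res_diff_hom[of M n] unfolding module_hom_def by blast

lemma Ext_diff_diff:
  assumes "module R M" "module R N" "h \<in> carrier (Ext_cochains R M N n)"
  shows "Ext_diff R M (Suc n) (Ext_diff R M n h) = \<zero>\<^bsub>Ext_cochains R M N (Suc (Suc n))\<^esub>"
proof -
  interpret M: module R M by fact
  interpret F: module R "res_module R M n" by (rule res_module_module)
  have "h \<in> module_hom R (res_module R M n) N"
    using assms(3) by (simp add: Ext_cochains_def Hom_module_def)
  then have "h \<zero>\<^bsub>res_module R M n\<^esub> = \<zero>\<^bsub>N\<^esub>" by (rule F.module_hom_zero[OF assms(2)])
  moreover have "res_diff R (res_diff R v) = \<zero>\<^bsub>res_module R M n\<^esub>"
    if "v \<in> carrier (res_module R M (Suc (Suc n)))" for v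
    using M.res_exact_Suc[of n] that by blast
  ultimately have "h (res_diff R (res_diff R v)) = \<zero>\<^bsub>N\<^esub>"
    if "v \<in> carrier (res_module R M (Suc (Suc n)))" for v using that by simp
  then show ?thesis
    by (auto simp: Ext_diff_def Ext_cochains_def Hom_module_def res_diff_mem fun_eq_iff)
qed

lemma kernel_submodule:
  assumes "module R A" "module R B" "h \<in> module_hom R A B"
  shows "submodule {x \<in> carrier A. h x = \<zero>\<^bsub>B\<^esub>} R A"
proof -
  interpret A: module R A by fact
  interpret B: module R B by fact
  show ?thesis
    using A.module_hom_zero[OF assms(2,3)] A.module_hom_minus[OF assms(2,3)] assms(3)
    by (intro A.submoduleI) (auto simp: module_hom_def)
qed

lemma image_submodule:
  assumes "module R A" "module R B" "h \<in> module_hom R A B"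
  shows "submodule (h ` carrier A) R B"
proof -
  interpret A: module R A by fact
  interpret B: module R B by fact
  have a: "h x \<oplus>\<^bsub>B\<^esub> h y = h (x \<oplus>\<^bsub>A\<^esub> y)" if "x \<in> carrier A" "y \<in> carrier A" for x y
    using assms(3) that by (simp add: module_hom_def)
  have s: "r \<odot>\<^bsub>B\<^esub> h x = h (r \<odot>\<^bsub>A\<^esub> x)" if "r \<in> carrier R" "x \<in> carrier A" for r x
    using assms(3) that by (simp add: module_hom_def)
  have c: "h x \<in> carrier B" if "x \<in> carrier A" for x
    using assms(3) that by (auto simp: module_hom_def)
  show ?thesis
    using A.module_hom_zero[OF assms(2,3), symmetric] A.module_hom_minus[OF assms(2,3), symmetric]
    by (intro B.submoduleI) (auto simp: a s c)
qed

lemma submodule_restrict: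
  assumes "module R A" "submodule H R A" "submodule K R A" "H \<subseteq> K"
  shows "submodule H R (A\<lparr>carrier := K\<rparr>)"
proof -
  interpret A: module R A by fact
  interpret K: module R "A\<lparr>carrier := K\<rparr>" by (rule submodule.submodule_is_module[OF assms(3,1)])
  have "submodule H R (A\<lparr>carrier := K\<rparr>)"
    apply (rule K.module_incl_imp_submodule)
    using assms submodule.submodule_is_module[OF assms(2,1)] by auto
  then show ?thesis .
qed

lemma zero_submodule: assumes "module R A" shows "submodule {\<zero>\<^bsub>A\<^esub>} R A"
proof -
  interpret A: module R A by fact
  show ?thesis by (intro A.submoduleI) auto
qed

lemma Ext_cocycles_submodule:
  "module R N \<Longrightarrow> submodule (Ext_cocycles R M N n) R (Ext_cochains R M N n)"
  unfolding Ext_cocycles_def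
  by (intro kernel_submodule Ext_cochains_module Ext_diff_hom)

lemma Ext_coboundaries_submodule:
  "module R N \<Longrightarrow> submodule (Ext_coboundaries R M N n) R (Ext_cochains R M N n)"
  by (cases n) (auto intro!: zero_submodule image_submodule Ext_cochains_module Ext_diff_hom)

lemma Ext_coboundaries_cocycles:
  assumes "module R M" "module R N"
  shows "Ext_coboundaries R M N n \<subseteq> Ext_cocycles R M N n"
proof (cases n)
  case 0
  interpret C: module R "Ext_cochains R M N 0" by (rule Ext_cochains_module[OF assms(2)])
  show ?thesis using 0 C.module_hom_zero[OF Ext_cochains_module[OF assms(2)] Ext_diff_hom[OF assms(2)]]
    by (auto simp: Ext_cocycles_def)
next
  case (Suc k)
  then show ?thesis using Ext_diff_hom[OF assms(2), of M k] Ext_diff_diff[OF assms]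
    by (auto simp: Ext_cocycles_def module_hom_def)
qed

lemma Ext_module:
  assumes "module R M" "module R N"
  shows "module R (Ext R M N n)"
  unfolding Ext_def
  by (intro module.quotient_module_module submodule.submodule_is_module[OF Ext_cocycles_submodule]
      submodule_restrict Ext_cochains_module Ext_cocycles_submodule Ext_coboundaries_submodule
      Ext_coboundaries_cocycles assms)


lemma res_map_hom_UNIV: "res_map R f \<in> module_hom R (free_module R UNIV) (free_module R UNIV)"
  unfolding res_map_def
  by (intro module.lin_ext_hom free_module_module) (auto intro: unit_vec_carrier)

lemma res_map_unit_vec: "res_map R f (unit_vec R b) = unit_vec R (map_syz id f b)"
  unfolding res_map_def
  by (intro module.lin_ext_unit_vec[OF free_module_module]) (auto intro: unit_vec_carrier)

lemma lin_comb_map: "lin_comb V g (map (map_prod id p) l) = lin_comb V (g \<circ> p) l"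
  by (induction l) (auto simp: lin_comb_def)

lemma syz_boundary_nat:
  assumes "l \<in> lists (carrier R \<times> B)"
  shows "syz_boundary R (map_syz id f (Syz l)) = res_map R f (syz_boundary R (Syz l))"
proof -
  have "res_map R f (lin_comb (free_module R UNIV) (unit_vec R) l)
      = lin_comb (free_module R UNIV) (res_map R f \<circ> unit_vec R) l"
    by (rule module.hom_lin_comb[OF free_module_module free_module_module res_map_hom_UNIV assms])
      (auto intro: unit_vec_carrier)
  then show ?thesis
    by (simp add: syz_boundary_def lin_comb_map o_def res_map_unit_vec)
qed

lemma syz_boundary_nat_UNIV:
  assumes "b \<in> syz_basis R M (Suc n)"
  shows "syz_boundary R (map_syz id f b) = res_map R f (syz_boundary R b)"
  using assms syz_boundary_nat by (elim syz_basis_Suc) blast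

lemma map_lists:
  assumes "l \<in> lists (carrier R \<times> B)" "\<And>b. b \<in> B \<Longrightarrow> p b \<in> C"
  shows "map (map_prod id p) l \<in> lists (carrier R \<times> C)"
  using assms by (induction l) auto

lemma map_syz_basis:
  assumes M: "module R M" "module R M'" and f: "f \<in> module_hom R M M'"
  shows "b \<in> syz_basis R M n \<Longrightarrow> map_syz id f b \<in> syz_basis R M' n"
proof (induction n arbitrary: b)
  case 0
  then show ?case using f by (auto simp: module_hom_def)
next
  case (Suc n)
  let ?p = "map_prod id (map_syz id f)"
  interpret M: module R M by fact
  interpret M': module R M' by fact
  show ?case
  proof (cases n)
    case 0
    then obtain l where l: "b = Syz l" "l \<in> lists (carrier R \<times> syz_basis R M 0)" "lin_comb M gen_of l = \<zero>\<^bsub>M\<^esub>"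
      using Suc.prems by auto
    have "lin_comb M' gen_of (map ?p l) = lin_comb M' (gen_of \<circ> map_syz id f) l" by (rule lin_comb_map)
    also have "\<dots> = lin_comb M' (f \<circ> gen_of) l"
      by (rule M'.lin_comb_cong[OF l(2)]) auto
    also have "\<dots> = f (lin_comb M gen_of l)"
      by (rule M'.hom_lin_comb[OF M(1) f l(2), symmetric]) auto
    also have "\<dots> = \<zero>\<^bsub>M'\<^esub>" unfolding l(3) by (rule M.module_hom_zero[OF M(2) f])
    finally have "Syz (map ?p l) \<in> syz_basis R M' (Suc 0)"
      using map_lists[OF l(2) Suc.IH[unfolded 0]] unfolding syz_basis.simps(2)
      by (intro imageI CollectI conjI)
    moreover have "map_syz id f b = Syz (map ?p l)" by (simp add: l(1))
    ultimately show ?thesis unfolding 0 by (simp only:)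
  next
    case (Suc k)
    then obtain l where l: "b = Syz l" "l \<in> lists (carrier R \<times> syz_basis R M n)"
      "lin_comb (free_module R UNIV) (syz_boundary R) l = \<zero>\<^bsub>free_module R UNIV\<^esub>"
      using Suc.prems by auto
    have bd: "syz_boundary R \<in> syz_basis R M n \<rightarrow> carrier (free_module R UNIV)"
      using syz_boundary_carrier[of M k] free_carrier_mono[of "syz_basis R M k" UNIV] Suc
      by (auto simp: res_module_def)
    have "lin_comb (free_module R UNIV) (syz_boundary R) (map ?p l)
        = lin_comb (free_module R UNIV) (syz_boundary R \<circ> map_syz id f) l" by (rule lin_comb_map)
    also have "\<dots> = lin_comb (free_module R UNIV) (res_map R f \<circ> syz_boundary R) l"
      by (rule M'.lin_comb_cong[OF l(2)]) (auto simp: Suc intro!: syz_boundary_nat_UNIV)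
    also have "\<dots> = res_map R f (lin_comb (free_module R UNIV) (syz_boundary R) l)"
      by (rule module.hom_lin_comb[OF free_module_module free_module_module res_map_hom_UNIV l(2) bd, symmetric])
    also have "\<dots> = \<zero>\<^bsub>free_module R UNIV\<^esub>"
      unfolding l(3) by (rule module.module_hom_zero[OF free_module_module free_module_module res_map_hom_UNIV])
    finally have "Syz (map ?p l) \<in> syz_basis R M' (Suc (Suc k))"
      using map_lists[OF l(2) Suc.IH] unfolding syz_basis.simps(3) Suc
      by (intro imageI CollectI conjI)
    moreover have "map_syz id f b = Syz (map ?p l)" by (simp add: l(1))
    ultimately show ?thesis unfolding Suc by (simp only:)
  qed
qed


lemma unit_vec_ext:
  assumes "module R V" "h \<in> module_hom R (free_module R B) V" "k \<in> module_hom R (free_module R B) V"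
    "\<And>b. b \<in> B \<Longrightarrow> h (unit_vec R b) = k (unit_vec R b)" "v \<in> carrier (free_module R B)"
  shows "h v = k v"
proof -
  obtain l where l: "l\<in>lists (carrier R \<times> B)" "lin_comb (free_module R UNIV) (unit_vec R) l = v"
    using free_is_lin_comb[OF assms(5)] by blast
  have v: "v = lin_comb (free_module R B) (unit_vec R) l"
    using l(2) by (simp add: lin_comb_def free_simps)
  have u: "unit_vec R \<in> B \<rightarrow> carrier (free_module R B)" by (auto intro: unit_vec_carrier)
  have "h v = lin_comb V (h \<circ> unit_vec R) l"
    unfolding v by (rule module.hom_lin_comb[OF assms(1) free_module_module assms(2) l(1) u])
  also have "\<dots> = lin_comb V (k \<circ> unit_vec R) l"
    by (rule module.lin_comb_cong[OF assms(1) l(1)]) (simp add: assms(4))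
  also have "\<dots> = k v"
    unfolding v by (rule module.hom_lin_comb[OF assms(1) free_module_module assms(3) l(1) u, symmetric])
  finally show ?thesis .
qed

lemma res_map_hom:
  assumes M: "module R M" "module R M'" and f: "f \<in> module_hom R M M'"
  shows "res_map R f \<in> module_hom R (res_module R M n) (res_module R M' n)"
proof -
  have g: "(\<lambda>b. unit_vec R (map_syz id f b)) \<in> syz_basis R M n \<rightarrow> carrier (res_module R M' n)"
    unfolding res_module_def by (auto intro!: unit_vec_carrier map_syz_basis[OF M f])
  show ?thesis unfolding res_map_def
    by (rule module_hom_cong[OF module.lin_ext_hom[OF res_module_module g, folded res_module_def]])
      (auto simp: res_module_def free_module_module
        intro!: lin_ext_free_eq[OF g[unfolded res_module_def], symmetric])
qed

lemma res_diff_res_map: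
  assumes M: "module R M" "module R M'" and f: "f \<in> module_hom R M M'"
    and v: "v \<in> carrier (res_module R M (Suc n))"
  shows "res_diff R (res_map R f v) = res_map R f (res_diff R v)"
proof (rule unit_vec_ext[where B="syz_basis R M (Suc n)" and h="\<lambda>v. res_diff R (res_map R f v)" and k="\<lambda>v. res_map R f (res_diff R v)"])
  show "module R (res_module R M' n)" by (rule res_module_module)
  show "(\<lambda>v. res_diff R (res_map R f v)) \<in> module_hom R (free_module R (syz_basis R M (Suc n))) (res_module R M' n)"
    using hom_comp[OF res_map_hom[OF M f, of "Suc n"] res_diff_hom] by (simp add: res_module_def)
  show "(\<lambda>v. res_map R f (res_diff R v)) \<in> module_hom R (free_module R (syz_basis R M (Suc n))) (res_module R M' n)"
    using hom_comp[OF res_diff_hom[of M n] res_map_hom[OF M f, of n]] by (simp add: res_module_def)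
  show "v \<in> carrier (free_module R (syz_basis R M (Suc n)))" using v by (simp add: res_module_def)
  fix b assume b: "b \<in> syz_basis R M (Suc n)"
  have *: "res_diff R (unit_vec R c) = syz_boundary R c" if "c \<in> syz_basis R A (Suc n)" for c and A :: "('a, 'z, 'w) module_scheme"
  proof -
    have "syz_boundary R c \<in> carrier (free_module R UNIV)"
      using that syz_boundary_carrier[of A n] free_carrier_mono[of "syz_basis R A n" UNIV]
      by (auto simp: res_module_def)
    then show ?thesis unfolding res_diff_def
      by (rule module.lin_ext_unit_vec[OF free_module_module])
  qed
  show "res_diff R (res_map R f (unit_vec R b)) = res_map R f (res_diff R (unit_vec R b))"
    using b map_syz_basis[OF M f b] by (simp add: res_map_unit_vec syz_boundary_nat_UNIV *)
qed

lemma augmentation_res_map: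
  assumes M: "module R M" "module R M'" and f: "f \<in> module_hom R M M'"
    and v: "v \<in> carrier (res_module R M 0)"
  shows "res_augmentation R M' (res_map R f v) = f (res_augmentation R M v)"
proof (rule unit_vec_ext[where B="syz_basis R M 0" and h="\<lambda>v. res_augmentation R M' (res_map R f v)" and k="\<lambda>v. f (res_augmentation R M v)"])
  show "module R M'" by fact
  show "(\<lambda>v. res_augmentation R M' (res_map R f v)) \<in> module_hom R (free_module R (syz_basis R M 0)) M'"
    using hom_comp[OF res_map_hom[OF M f, of 0] module.res_augmentation_hom[OF M(2)]] by (simp add: res_module_def)
  show "(\<lambda>v. f (res_augmentation R M v)) \<in> module_hom R (free_module R (syz_basis R M 0)) M'"
    using hom_comp[OF module.res_augmentation_hom[OF M(1)] f] by (simp add: res_module_def)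
  show "v \<in> carrier (free_module R (syz_basis R M 0))" using v by (simp add: res_module_def)
  fix b assume b: "b \<in> syz_basis R M 0"
  have *: "res_augmentation R A (unit_vec R c) = gen_of c" if "c \<in> syz_basis R A 0" "module R A" for c and A :: "('a, 'z, 'w) module_scheme"
    unfolding res_augmentation_def
    using that by (intro module.lin_ext_unit_vec[OF that(2)]) auto
  show "res_augmentation R M' (res_map R f (unit_vec R b)) = f (res_augmentation R M (unit_vec R b))"
    using b map_syz_basis[OF M f b] by (auto simp: res_map_unit_vec * M)
qed

lemma Ext_pullback:
  assumes M: "module R M" "module R M'" "module R N" and f: "f \<in> module_hom R M M'"
  defines "p \<equiv> \<lambda>n h. \<lambda>v\<in>carrier (res_module R M n). h (res_map R f v)"
  shows "p n \<in> module_hom R (Ext_cochains R M' N n) (Ext_cochains R M N n)"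
    and "h \<in> carrier (Ext_cochains R M' N n) \<Longrightarrow> Ext_diff R M n (p n h) = p (Suc n) (Ext_diff R M' n h)"
proof -
  have mem: "res_map R f v \<in> carrier (res_module R M' n)" if "v \<in> carrier (res_module R M n)" for v n
    using res_map_hom[OF M(1,2) f, of n] that unfolding module_hom_def by blast
  have "p n h \<in> carrier (Ext_cochains R M N n)" if "h \<in> carrier (Ext_cochains R M' N n)" for h
    using that hom_restrict[OF hom_comp[OF res_map_hom[OF M(1,2) f, of n], of h N] res_module_module]
    by (auto simp: p_def Ext_cochains_def Hom_module_def)
  then show "p n \<in> module_hom R (Ext_cochains R M' N n) (Ext_cochains R M N n)"
    unfolding module_hom_def[of R "Ext_cochains R M' N n"] using mem
    by (auto simp: p_def Ext_cochains_def Hom_module_def fun_eq_iff)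
  show "Ext_diff R M n (p n h) = p (Suc n) (Ext_diff R M' n h)" if "h \<in> carrier (Ext_cochains R M' N n)"
    by (rule ext) (simp add: p_def Ext_diff_def mem res_diff_mem res_diff_res_map[OF M(1,2) f])
qed

lemma Ext_map_coset:
  assumes M: "module R M" "module R M'" "module R N" and f: "f \<in> module_hom R M M'"
    and h: "h \<in> Ext_cocycles R M' N n"
  defines "p \<equiv> \<lambda>n h. \<lambda>v\<in>carrier (res_module R M n). h (res_map R f v)"
  shows "p n h \<in> Ext_cocycles R M N n"
    "Ext_map R M N n f (Ext_coboundaries R M' N n +>\<^bsub>Ext_cochains R M' N n\<^esub> h)
     = Ext_coboundaries R M N n +>\<^bsub>Ext_cochains R M N n\<^esub> p n h"
proof -
  have ph: "p k \<in> module_hom R (Ext_cochains R M' N k) (Ext_cochains R M N k)" for k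
    unfolding p_def by (rule Ext_pullback(1)[OF M f])
  have pd: "Ext_diff R M k (p k h) = p (Suc k) (Ext_diff R M' k h)" if "h \<in> carrier (Ext_cochains R M' N k)" for h k
    unfolding p_def by (rule Ext_pullback(2)[OF M f that])
  interpret C: module R "Ext_cochains R M N n" by (rule Ext_cochains_module[OF M(3)])
  interpret C': module R "Ext_cochains R M' N n" by (rule Ext_cochains_module[OF M(3)])
  have hc: "h \<in> carrier (Ext_cochains R M' N n)" using h by (simp add: Ext_cocycles_def)
  have z: "p k \<zero>\<^bsub>Ext_cochains R M' N k\<^esub> = \<zero>\<^bsub>Ext_cochains R M N k\<^esub>" for k
    by (rule module.module_hom_zero[OF Ext_cochains_module[OF M(3)] Ext_cochains_module[OF M(3)] ph])
  have pc: "p n x \<in> carrier (Ext_cochains R M N n)" if "x \<in> carrier (Ext_cochains R M' N n)" for x n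
    using ph[of n] that unfolding module_hom_def by blast
  show "p n h \<in> Ext_cocycles R M N n"
    using h pd[OF hc] z[of "Suc n"] pc hc by (simp add: Ext_cocycles_def)
  have cb: "p n c \<in> Ext_coboundaries R M N n" if "c \<in> Ext_coboundaries R M' N n" for c
    using that pd pc by (cases n) (auto simp: z intro!: image_eqI pd[symmetric])
  note S = Ext_coboundaries_submodule[OF M(3), of M n] and S' = Ext_coboundaries_submodule[OF M(3), of M' n]
  have sg: "subgroup (Ext_coboundaries R M N n) (add_monoid (Ext_cochains R M N n))" using S by (simp add: submodule_def)
  have "Ext_coboundaries R M N n +>\<^bsub>Ext_cochains R M N n\<^esub> p n k = Ext_coboundaries R M N n +>\<^bsub>Ext_cochains R M N n\<^esub> p n h"
    if k: "k \<in> Ext_coboundaries R M' N n +>\<^bsub>Ext_cochains R M' N n\<^esub> h" for k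
  proof -
    obtain c where c: "c \<in> Ext_coboundaries R M' N n" "k = c \<oplus>\<^bsub>Ext_cochains R M' N n\<^esub> h"
      using k by (auto simp: a_r_coset_def')
    then have "p n k = p n c \<oplus>\<^bsub>Ext_cochains R M N n\<^esub> p n h"
      using ph[of n] hc C'.submoduleE(1)[OF S'] by (auto simp: module_hom_def)
    then have "p n k \<in> Ext_coboundaries R M N n +>\<^bsub>Ext_cochains R M N n\<^esub> p n h"
      using cb c by (auto simp: a_r_coset_def')
    then show ?thesis using C.a_repr_independence'[OF _ _ sg, folded a_r_coset_def] pc hc by auto
  qed
  moreover have "Ext_coboundaries R M' N n +>\<^bsub>Ext_cochains R M' N n\<^esub> h \<noteq> {}"
    using C'.submoduleE(2)[OF S'] by (auto simp: a_r_coset_def')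
  ultimately show "Ext_map R M N n f (Ext_coboundaries R M' N n +>\<^bsub>Ext_cochains R M' N n\<^esub> h)
     = Ext_coboundaries R M N n +>\<^bsub>Ext_cochains R M N n\<^esub> p n h"
    unfolding Ext_map_def p_def by auto
qed

lemma Ext_map_hom:
  fixes M :: "('a, 'm, 'x) module_scheme" and M' :: "('a, 'k, 'w) module_scheme" and N :: "('a, 'n, 'y) module_scheme"
  assumes M: "module R M" "module R M'" "module R N" and f: "f \<in> module_hom R M M'"
  shows "Ext_map R M N n f \<in> module_hom R (Ext R M' N n) (Ext R M N n)"
proof -
  define Z where "Z = (Ext_cochains R M N n)\<lparr>carrier := Ext_cocycles R M N n\<rparr>"
  define Z' where "Z' = (Ext_cochains R M' N n)\<lparr>carrier := Ext_cocycles R M' N n\<rparr>"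
  interpret Z: module R Z unfolding Z_def
    by (intro submodule.submodule_is_module[OF Ext_cocycles_submodule] Ext_cochains_module M)
  interpret Z': module R Z' unfolding Z'_def
    by (intro submodule.submodule_is_module[OF Ext_cocycles_submodule] Ext_cochains_module M)
  have S: "submodule (Ext_coboundaries R M N n) R Z" unfolding Z_def
    by (intro submodule_restrict Ext_cochains_module Ext_cocycles_submodule Ext_coboundaries_submodule
      Ext_coboundaries_cocycles M)
  have S': "submodule (Ext_coboundaries R M' N n) R Z'" unfolding Z'_def
    by (intro submodule_restrict Ext_cochains_module Ext_cocycles_submodule Ext_coboundaries_submodule
      Ext_coboundaries_cocycles M)
  define p :: "((('a, 'k) syz \<Rightarrow> 'a) \<Rightarrow> 'n) \<Rightarrow> (('a, 'm) syz \<Rightarrow> 'a) \<Rightarrow> 'n" where "p = (\<lambda>h. \<lambda>v\<in>carrier (res_module R M n). h (res_map R f v))"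
  have pZ: "p \<in> module_hom R Z' Z"
    using Ext_pullback(1)[OF M f, of n] Ext_map_coset(1)[OF M f, of _ n]
    unfolding Z_def Z'_def p_def module_hom_def[of R "_\<lparr>carrier := _\<rparr>"] module_hom_def[of R "Ext_cochains _ _ _ _"]
    by (auto simp: Ext_cocycles_def)
  have cs: "I +>\<^bsub>Z\<^esub> x = I +>\<^bsub>Ext_cochains R M N n\<^esub> x" for I x by (simp add: Z_def a_r_coset_def')
  have cs': "I +>\<^bsub>Z'\<^esub> x = I +>\<^bsub>Ext_cochains R M' N n\<^esub> x" for I x by (simp add: Z'_def a_r_coset_def')
  have E: "Ext_map R M N n f (Ext_coboundaries R M' N n +>\<^bsub>Z'\<^esub> h) = Ext_coboundaries R M N n +>\<^bsub>Z\<^esub> p h"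
    if "h \<in> carrier Z'" for h
    unfolding cs cs' p_def using that by (intro Ext_map_coset(2)[OF M f]) (simp add: Z'_def)
  have c: "carrier (quotient_module Z (Ext_coboundaries R M N n)) = (\<lambda>x. Ext_coboundaries R M N n +>\<^bsub>Z\<^esub> x) ` carrier Z"
    "carrier (quotient_module Z' (Ext_coboundaries R M' N n)) = (\<lambda>x. Ext_coboundaries R M' N n +>\<^bsub>Z'\<^esub> x) ` carrier Z'"
    by (auto simp: quotient_module_def A_RCOSETS_def')
  have p: "\<And>x. x \<in> carrier Z' \<Longrightarrow> p x \<in> carrier Z"
    "\<And>x y. x \<in> carrier Z' \<Longrightarrow> y \<in> carrier Z' \<Longrightarrow> p (x \<oplus>\<^bsub>Z'\<^esub> y) = p x \<oplus>\<^bsub>Z\<^esub> p y"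
    "\<And>r x. r \<in> carrier R \<Longrightarrow> x \<in> carrier Z' \<Longrightarrow> p (r \<odot>\<^bsub>Z'\<^esub> x) = r \<odot>\<^bsub>Z\<^esub> p x"
    using pZ unfolding module_hom_def by blast+
  show ?thesis
    unfolding Ext_def Z_def[symmetric] Z'_def[symmetric] module_hom_def[of R "quotient_module _ _"]
    by (auto simp: c E Z.quotient_add[OF S] Z'.quotient_add[OF S'] Z.quotient_smult[OF S] Z'.quotient_smult[OF S'] p)
qed

end


subsection \<open>Direct limits, generalized local cohomology and localization\<close>

lemma UN_const:
  assumes "a \<in> X" "\<And>p u. (p,u) \<in> X \<Longrightarrow> F p u = c"
  shows "(\<Union>(p,u)\<in>X. F p u) = c"
proof -
  have "(case z of (p,u) \<Rightarrow> F p u) = c" if "z \<in> X" for z using that assms(2) by (cases z) auto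
  then show ?thesis using assms(1) by auto
qed

locale dirsys = cring R for R (structure) +
  fixes G :: "nat \<Rightarrow> ('a, 'g, 'x) module_scheme" and f :: "nat \<Rightarrow> 'g \<Rightarrow> 'g"
  assumes G: "\<And>n. module R (G n)" and f: "\<And>n. f n \<in> module_hom R (G n) (G (Suc n))"
begin

abbreviation cl where "cl n x \<equiv> direct_limit_rel G f `` {(n, x)}"
abbreviation tr where "tr m k \<equiv> fold f [m..<k]"

lemma tr_trans: "m \<le> k \<Longrightarrow> k \<le> k' \<Longrightarrow> tr k k' (tr m k x) = tr m k' x"
  by (metis comp_apply fold_append le_add_diff_inverse upt_add_eq_append)

lemma tr_hom: "m \<le> k \<Longrightarrow> tr m k \<in> module_hom R (G m) (G k)"
proof (induction k rule: dec_induct)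
  case base then show ?case by (simp add: module_hom_def)
next
  case (step n)
  have "fold f [m..<Suc n] = (\<lambda>x. f n (tr m n x))" using step by (auto simp: fun_eq_iff)
  then show ?case using hom_comp[OF step.IH f] by simp
qed

lemma tr_closed: "m \<le> k \<Longrightarrow> x \<in> carrier (G m) \<Longrightarrow> tr m k x \<in> carrier (G k)"
  using tr_hom[of m k] unfolding module_hom_def by blast
lemma tr_add: "m \<le> k \<Longrightarrow> x \<in> carrier (G m) \<Longrightarrow> y \<in> carrier (G m) \<Longrightarrow> tr m k (x \<oplus>\<^bsub>G m\<^esub> y) = tr m k x \<oplus>\<^bsub>G k\<^esub> tr m k y"
  using tr_hom[of m k] unfolding module_hom_def by blast
lemma tr_smult: "m \<le> k \<Longrightarrow> r \<in> carrier R \<Longrightarrow> x \<in> carrier (G m) \<Longrightarrow> tr m k (r \<odot>\<^bsub>G m\<^esub> x) = r \<odot>\<^bsub>G k\<^esub> tr m k x"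
  using tr_hom[of m k] unfolding module_hom_def by blast

lemma rel_iff: "((m,x),(n,y)) \<in> direct_limit_rel G f \<longleftrightarrow> x \<in> carrier (G m) \<and> y \<in> carrier (G n) \<and>
    (\<exists>k. m \<le> k \<and> n \<le> k \<and> tr m k x = tr n k y)"
  by (simp add: direct_limit_rel_def)

lemma equiv: "equiv (SIGMA n:UNIV. carrier (G n)) (direct_limit_rel G f)"
proof (rule equivI)
  show "direct_limit_rel G f \<subseteq> (SIGMA n:UNIV. carrier (G n)) \<times> (SIGMA n:UNIV. carrier (G n))"
    by (auto simp: direct_limit_rel_def)
  show "refl_on (SIGMA n:UNIV. carrier (G n)) (direct_limit_rel G f)"
    by (auto simp: refl_on_def rel_iff)
  show "sym (direct_limit_rel G f)" by (force simp: sym_def rel_iff)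
  show "trans (direct_limit_rel G f)"
  proof (rule transI, clarify)
    fix a x b y c z assume 1: "((a,x),(b,y)) \<in> direct_limit_rel G f" "((b,y),(c,z)) \<in> direct_limit_rel G f"
    then obtain k k' where "a \<le> k" "b \<le> k" "tr a k x = tr b k y" "b \<le> k'" "c \<le> k'" "tr b k' y = tr c k' z"
      by (auto simp: rel_iff)
    then have "tr a (max k k') x = tr c (max k k') z"
      by (metis max.cobounded1 max.cobounded2 tr_trans)
    then show "((a,x),(c,z)) \<in> direct_limit_rel G f" using 1 \<open>a \<le> k\<close> \<open>c \<le> k'\<close>
      by (auto simp: rel_iff intro!: exI[of _ "max k k'"])
  qed
qed

lemma cl_eq: "x \<in> carrier (G m) \<Longrightarrow> y \<in> carrier (G n) \<Longrightarrow> cl m x = cl n y \<longleftrightarrow> (\<exists>k. m \<le> k \<and> n \<le> k \<and> tr m k x = tr n k y)"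
  using eq_equiv_class_iff[OF equiv, of "(m,x)" "(n,y)"] by (auto simp: rel_iff)

lemma cl_tr: "m \<le> k \<Longrightarrow> x \<in> carrier (G m) \<Longrightarrow> cl k (tr m k x) = cl m x"
  using tr_closed by (subst cl_eq) (auto intro!: exI[of _ k])

lemma add_cl:
  assumes x: "x \<in> carrier (G n)" and y: "y \<in> carrier (G n)"
  shows "cl n x \<oplus>\<^bsub>direct_limit G f\<^esub> cl n y = cl n (x \<oplus>\<^bsub>G n\<^esub> y)"
proof -
  have "cl (max p q) (tr p (max p q) u \<oplus>\<^bsub>G (max p q)\<^esub> tr q (max p q) v) = cl n (x \<oplus>\<^bsub>G n\<^esub> y)"
    if u: "(p,u) \<in> cl n x" and v: "(q,v) \<in> cl n y" for p q u v
  proof -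
    obtain k k' where k: "n \<le> k" "p \<le> k" "tr n k x = tr p k u" "n \<le> k'" "q \<le> k'" "tr n k' y = tr q k' v"
      and uv: "u \<in> carrier (G p)" "v \<in> carrier (G q)"
      using u v by (auto simp: rel_iff)
    define K where "K = max k k'"
    have K: "p \<le> K" "q \<le> K" "max p q \<le> K" "n \<le> K" "k \<le> K" "k' \<le> K" using k by (auto simp: K_def)
    have e: "tr n K x = tr p K u" "tr n K y = tr q K v" using k K tr_trans by metis+
    interpret P: module R "G (max p q)" by (rule G)
    interpret N: module R "G n" by (rule G)
    have c: "tr p (max p q) u \<in> carrier (G (max p q))" "tr q (max p q) v \<in> carrier (G (max p q))"
      using uv by (auto intro!: tr_closed)
    have "tr (max p q) K (tr p (max p q) u \<oplus>\<^bsub>G (max p q)\<^esub> tr q (max p q) v) = tr p K u \<oplus>\<^bsub>G K\<^esub> tr q K v"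
      using c K by (simp add: tr_add tr_trans)
    also have "\<dots> = tr n K (x \<oplus>\<^bsub>G n\<^esub> y)" using e K x y by (simp add: tr_add)
    finally show ?thesis using c x y K by (subst cl_eq) auto
  qed
  note * = this
  have "(n,x) \<in> cl n x" "(n,y) \<in> cl n y" using x y by (auto simp: rel_iff)
  then show ?thesis unfolding direct_limit_def
    by (simp only: partial_object.simps monoid.simps ring.simps module.simps) (intro UN_const *)
qed

lemma smult_cl:
  assumes x: "x \<in> carrier (G n)" and r: "r \<in> carrier R"
  shows "r \<odot>\<^bsub>direct_limit G f\<^esub> cl n x = cl n (r \<odot>\<^bsub>G n\<^esub> x)"
proof -
  have "cl p (r \<odot>\<^bsub>G p\<^esub> u) = cl n (r \<odot>\<^bsub>G n\<^esub> x)"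
    if u: "(p,u) \<in> cl n x" for p u
  proof -
    obtain k where k: "n \<le> k" "p \<le> k" "tr n k x = tr p k u" and uv: "u \<in> carrier (G p)" 
      using u by (auto simp: rel_iff)
    interpret P: module R "G p" by (rule G)
    interpret N: module R "G n" by (rule G)
    show ?thesis using k x uv r by (subst cl_eq) (auto simp: tr_smult intro!: exI[of _ k])
  qed
  note * = this
  have "(n,x) \<in> cl n x" using x by (auto simp: rel_iff)
  then show ?thesis unfolding direct_limit_def
    by (simp only: partial_object.simps monoid.simps ring.simps module.simps) (intro UN_const *)
qed

lemma zero_cl: "\<zero>\<^bsub>direct_limit G f\<^esub> = cl n \<zero>\<^bsub>G n\<^esub>"
proof -
  have "tr 0 n \<zero>\<^bsub>G 0\<^esub> = \<zero>\<^bsub>G n\<^esub>" by (rule module.module_hom_zero[OF G G tr_hom]) simp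
  moreover have "\<zero>\<^bsub>G 0\<^esub> \<in> carrier (G 0)" using G[of 0] by (meson module_def abelian_group_def abelian_monoid.zero_closed)
  ultimately show ?thesis using cl_tr[of 0 n "\<zero>\<^bsub>G 0\<^esub>"] by (simp add: direct_limit_def)
qed

lemma rep: "X \<in> carrier (direct_limit G f) \<Longrightarrow> \<exists>n. \<forall>k\<ge>n. \<exists>x\<in>carrier (G k). X = cl k x"
proof -
  assume "X \<in> carrier (direct_limit G f)"
  then obtain n x where "x \<in> carrier (G n)" "X = cl n x" by (auto simp: direct_limit_def elim!: quotientE)
  then have "\<exists>y\<in>carrier (G k). X = cl k y" if "k \<ge> n" for k using cl_tr[OF that] tr_closed[OF that] by metis
  then show ?thesis by blast
qed

lemma carr: "x \<in> carrier (G n) \<Longrightarrow> cl n x \<in> carrier (direct_limit G f)"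
  by (auto simp: direct_limit_def intro!: quotientI)

lemma rep3: assumes "X \<in> carrier (direct_limit G f)" "Y \<in> carrier (direct_limit G f)" "Z \<in> carrier (direct_limit G f)"
  obtains k x y z where "x \<in> carrier (G k)" "X = cl k x" "y \<in> carrier (G k)" "Y = cl k y" "z \<in> carrier (G k)" "Z = cl k z"
proof -
  from rep[OF assms(1)] rep[OF assms(2)] rep[OF assms(3)]
  obtain a b c where *: "\<forall>k\<ge>a. \<exists>x\<in>carrier (G k). X = cl k x" "\<forall>k\<ge>b. \<exists>x\<in>carrier (G k). Y = cl k x" "\<forall>k\<ge>c. \<exists>x\<in>carrier (G k). Z = cl k x"
    by blast
  define k where "k = max a (max b c)"
  have "a \<le> k" "b \<le> k" "c \<le> k" by (auto simp: k_def)
  with * that show thesis by meson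
qed

lemma direct_limit_module: "module R (direct_limit G f)"
proof -
  let ?D = "direct_limit G f"
  have z: "\<zero>\<^bsub>?D\<^esub> \<in> carrier ?D" using carr[of "\<zero>\<^bsub>G 0\<^esub>" 0] G[of 0] zero_cl[of 0]
    by (metis abelian_group_def abelian_monoid.zero_closed module_def)
  have all: "X \<oplus>\<^bsub>?D\<^esub> Y \<in> carrier ?D" "X \<oplus>\<^bsub>?D\<^esub> Y \<oplus>\<^bsub>?D\<^esub> Z = X \<oplus>\<^bsub>?D\<^esub> (Y \<oplus>\<^bsub>?D\<^esub> Z)" "X \<oplus>\<^bsub>?D\<^esub> Y = Y \<oplus>\<^bsub>?D\<^esub> X"
    "\<zero>\<^bsub>?D\<^esub> \<oplus>\<^bsub>?D\<^esub> X = X" "\<exists>Y\<in>carrier ?D. Y \<oplus>\<^bsub>?D\<^esub> X = \<zero>\<^bsub>?D\<^esub>" "r \<odot>\<^bsub>?D\<^esub> X \<in> carrier ?D"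
    "(r \<oplus> s) \<odot>\<^bsub>?D\<^esub> X = r \<odot>\<^bsub>?D\<^esub> X \<oplus>\<^bsub>?D\<^esub> s \<odot>\<^bsub>?D\<^esub> X"
    "r \<odot>\<^bsub>?D\<^esub> (X \<oplus>\<^bsub>?D\<^esub> Y) = r \<odot>\<^bsub>?D\<^esub> X \<oplus>\<^bsub>?D\<^esub> r \<odot>\<^bsub>?D\<^esub> Y"
    "(r \<otimes> s) \<odot>\<^bsub>?D\<^esub> X = r \<odot>\<^bsub>?D\<^esub> (s \<odot>\<^bsub>?D\<^esub> X)" "\<one> \<odot>\<^bsub>?D\<^esub> X = X"
    if XYZ: "X \<in> carrier ?D" "Y \<in> carrier ?D" "Z \<in> carrier ?D" and r: "r \<in> carrier R" "s \<in> carrier R" for X Y Z r s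
  proof -
    obtain k x y z where k: "x \<in> carrier (G k)" "X = cl k x" "y \<in> carrier (G k)" "Y = cl k y" "z \<in> carrier (G k)" "Z = cl k z"
      using rep3[OF XYZ] .
    interpret K: module R "G k" by (rule G)

    show "X \<oplus>\<^bsub>?D\<^esub> Y \<in> carrier ?D" using k by (simp add: add_cl carr)
    show "X \<oplus>\<^bsub>?D\<^esub> Y \<oplus>\<^bsub>?D\<^esub> Z = X \<oplus>\<^bsub>?D\<^esub> (Y \<oplus>\<^bsub>?D\<^esub> Z)" using k by (simp add: add_cl K.M.a_assoc)
    show "X \<oplus>\<^bsub>?D\<^esub> Y = Y \<oplus>\<^bsub>?D\<^esub> X" using k by (simp add: add_cl K.M.a_comm)
    show "\<zero>\<^bsub>?D\<^esub> \<oplus>\<^bsub>?D\<^esub> X = X" using k by (simp add: add_cl zero_cl[of k])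
    show "\<exists>Y\<in>carrier ?D. Y \<oplus>\<^bsub>?D\<^esub> X = \<zero>\<^bsub>?D\<^esub>"
      using k by (intro bexI[of _ "cl k (\<ominus>\<^bsub>G k\<^esub> x)"]) (auto simp: add_cl carr zero_cl[of k] K.M.l_neg)
    show "r \<odot>\<^bsub>?D\<^esub> X \<in> carrier ?D" using k r by (simp add: smult_cl carr)
    show "(r \<oplus> s) \<odot>\<^bsub>?D\<^esub> X = r \<odot>\<^bsub>?D\<^esub> X \<oplus>\<^bsub>?D\<^esub> s \<odot>\<^bsub>?D\<^esub> X" using k r by (simp add: smult_cl add_cl K.smult_l_distr)
    show "r \<odot>\<^bsub>?D\<^esub> (X \<oplus>\<^bsub>?D\<^esub> Y) = r \<odot>\<^bsub>?D\<^esub> X \<oplus>\<^bsub>?D\<^esub> r \<odot>\<^bsub>?D\<^esub> Y" using k r by (simp add: smult_cl add_cl K.smult_r_distr)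
    show "(r \<otimes> s) \<odot>\<^bsub>?D\<^esub> X = r \<odot>\<^bsub>?D\<^esub> (s \<odot>\<^bsub>?D\<^esub> X)" using k r by (simp add: smult_cl K.smult_assoc1)
    show "\<one> \<odot>\<^bsub>?D\<^esub> X = X" using k by (simp add: smult_cl)
  qed
  show ?thesis
  proof (rule moduleI, rule is_cring, rule abelian_groupI)
    fix X Y Z assume X: "X \<in> carrier ?D" and Y: "Y \<in> carrier ?D" and Z: "Z \<in> carrier ?D"
    note a = all[OF X Y Z zero_closed zero_closed]
    show "X \<oplus>\<^bsub>?D\<^esub> Y \<in> carrier ?D" by (rule a)
    show "X \<oplus>\<^bsub>?D\<^esub> Y \<oplus>\<^bsub>?D\<^esub> Z = X \<oplus>\<^bsub>?D\<^esub> (Y \<oplus>\<^bsub>?D\<^esub> Z)" by (rule a)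
    show "X \<oplus>\<^bsub>?D\<^esub> Y = Y \<oplus>\<^bsub>?D\<^esub> X" by (rule a)
  next
    fix X assume X: "X \<in> carrier ?D"
    note a = all[OF X z z zero_closed zero_closed]
    show "\<zero>\<^bsub>?D\<^esub> \<oplus>\<^bsub>?D\<^esub> X = X" "\<exists>Y\<in>carrier ?D. Y \<oplus>\<^bsub>?D\<^esub> X = \<zero>\<^bsub>?D\<^esub>" "\<one> \<odot>\<^bsub>?D\<^esub> X = X"
      by (rule a)+
  next
    fix X Y r s assume X: "X \<in> carrier ?D" and r: "r \<in> carrier R"
    show "r \<odot>\<^bsub>?D\<^esub> X \<in> carrier ?D" by (rule all(6)[OF X z z r zero_closed])
    show "(r \<oplus> s) \<odot>\<^bsub>?D\<^esub> X = r \<odot>\<^bsub>?D\<^esub> X \<oplus>\<^bsub>?D\<^esub> s \<odot>\<^bsub>?D\<^esub> X" if "s \<in> carrier R"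
      by (rule all(7)[OF X z z r that])
    show "(r \<otimes> s) \<odot>\<^bsub>?D\<^esub> X = r \<odot>\<^bsub>?D\<^esub> (s \<odot>\<^bsub>?D\<^esub> X)" if "s \<in> carrier R"
      by (rule all(9)[OF X z z r that])
    show "r \<odot>\<^bsub>?D\<^esub> (X \<oplus>\<^bsub>?D\<^esub> Y) = r \<odot>\<^bsub>?D\<^esub> X \<oplus>\<^bsub>?D\<^esub> r \<odot>\<^bsub>?D\<^esub> Y" if "Y \<in> carrier ?D"
      by (rule all(8)[OF X that z r zero_closed])
  qed (rule z)
qed

end

context module begin

lemma ideal_smult_submodule:
  assumes I: "ideal I R"
  shows "submodule (ideal_smult I M) R M"
proof -
  interpret I: ideal I R by fact
  have sub: "x \<in> carrier M" if "x \<in> ideal_smult I M" for x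
    using that by induction (auto simp: I.Icarr)
  have sm: "r \<odot>\<^bsub>M\<^esub> x \<in> ideal_smult I M" if r: "r \<in> carrier R" and x: "x \<in> ideal_smult I M" for r x
    using x
  proof induction
    case (smult s x)
    then have "r \<odot>\<^bsub>M\<^esub> (s \<odot>\<^bsub>M\<^esub> x) = (r \<otimes> s) \<odot>\<^bsub>M\<^esub> x" using r by (simp add: smult_assoc1 I.Icarr)
    then show ?case using smult r by (auto intro!: ideal_smult.smult I.I_l_closed)
  next
    case (add x y) then show ?case using r sub by (auto simp: smult_r_distr intro: ideal_smult.add)
  qed
  have "\<zero>\<^bsub>M\<^esub> \<in> ideal_smult I M" using ideal_smult.smult[of \<zero> I "\<zero>\<^bsub>M\<^esub>" M] I.zero_closed by simp
  moreover have "\<ominus>\<^bsub>M\<^esub> x \<in> ideal_smult I M" if "x \<in> ideal_smult I M" for x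
    using sm[of "\<ominus> \<one>" x] that sub by (simp add: smult_l_minus)
  ultimately show ?thesis using sub sm ideal_smult.add by (intro submoduleI) auto
qed

lemma ideal_power_ideal: "ideal \<aa> R \<Longrightarrow> ideal (ideal_power R \<aa> n) R"
  by (induction n) (auto intro: R.oneideal R.ideal_prod_is_ideal)

lemma ideal_power_mono:
  assumes "ideal \<aa> R" shows "ideal_power R \<aa> (Suc n) \<subseteq> ideal_power R \<aa> n"
  using R.ideal_prod_inter[OF assms ideal_power_ideal[OF assms]] by auto

lemma adic_quotient_module: "ideal \<aa> R \<Longrightarrow> module R (adic_quotient R \<aa> M n)"
  unfolding adic_quotient_def by (intro quotient_module_module ideal_smult_submodule ideal_power_ideal)

lemma adic_projection_hom:
  assumes a: "ideal \<aa> R"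
  shows "adic_projection R \<aa> M n \<in> module_hom R (adic_quotient R \<aa> M (Suc n)) (adic_quotient R \<aa> M n)"
    "x \<in> carrier M \<Longrightarrow> adic_projection R \<aa> M n (ideal_smult (ideal_power R \<aa> (Suc n)) M +>\<^bsub>M\<^esub> x)
      = ideal_smult (ideal_power R \<aa> n) M +>\<^bsub>M\<^esub> x"
proof -
  define H where "H n = ideal_smult (ideal_power R \<aa> n) M" for n
  have S: "submodule (H n) R M" for n unfolding H_def by (intro ideal_smult_submodule ideal_power_ideal a)
  have sg: "subgroup (H n) (add_monoid M)" for n using S by (simp add: submodule_def)
  have mono: "H (Suc n) \<subseteq> H n"
  proof
    fix x assume "x \<in> H (Suc n)" then show "x \<in> H n" unfolding H_def
      by induction (use ideal_power_mono[OF a] in \<open>auto intro: ideal_smult.intros\<close>)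
  qed
  have E: "adic_projection R \<aa> M n (H (Suc n) +>\<^bsub>M\<^esub> x) = H n +>\<^bsub>M\<^esub> x" if x: "x \<in> carrier M" for x
  proof -
    have "H n +>\<^bsub>M\<^esub> y = H n +>\<^bsub>M\<^esub> x" if y: "y \<in> H (Suc n) +>\<^bsub>M\<^esub> x" for y
    proof -
      have "y \<in> H n +>\<^bsub>M\<^esub> x" using y mono by (auto simp: a_r_coset_def')
      then show ?thesis using M.a_repr_independence'[OF _ _ sg, folded a_r_coset_def] x by auto
    qed
    moreover have "H (Suc n) +>\<^bsub>M\<^esub> x \<noteq> {}" using submoduleE(2)[OF S] by (auto simp: a_r_coset_def')
    ultimately show ?thesis unfolding adic_projection_def H_def[symmetric] by auto
  qed
  then show "x \<in> carrier M \<Longrightarrow> adic_projection R \<aa> M n (ideal_smult (ideal_power R \<aa> (Suc n)) M +>\<^bsub>M\<^esub> x)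
      = ideal_smult (ideal_power R \<aa> n) M +>\<^bsub>M\<^esub> x" unfolding H_def .
  have c: "carrier (quotient_module M (H k)) = (\<lambda>x. H k +>\<^bsub>M\<^esub> x) ` carrier M" for k
    by (auto simp: quotient_module_def A_RCOSETS_def')
  show "adic_projection R \<aa> M n \<in> module_hom R (adic_quotient R \<aa> M (Suc n)) (adic_quotient R \<aa> M n)"
    unfolding adic_quotient_def H_def[symmetric] module_hom_def
    by (auto simp: c E quotient_add[OF S] quotient_smult[OF S])
qed

lemma gen_local_cohomology_module:
  assumes "ideal \<aa> R" "module R N"
  shows "module R (gen_local_cohomology R \<aa> M N i)"
  unfolding gen_local_cohomology_def
  by (intro dirsys.direct_limit_module dirsys.intro dirsys_axioms.intro R.is_cring R.Ext_module R.Ext_map_hom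
     adic_quotient_module adic_projection_hom assms)

lemma localization_zero_iff:
  assumes S: "S \<subseteq> carrier R" "\<one> \<in> S" "\<And>s t. s \<in> S \<Longrightarrow> t \<in> S \<Longrightarrow> s \<otimes> t \<in> S"
  shows "carrier (localization R S M) = {\<zero>\<^bsub>localization R S M\<^esub>} \<longleftrightarrow> (\<forall>m\<in>carrier M. \<exists>u\<in>S. u \<odot>\<^bsub>M\<^esub> m = \<zero>\<^bsub>M\<^esub>)"
proof -
  have Sc: "s \<in> S \<Longrightarrow> s \<in> carrier R" for s using S by auto
  have equiv: "equiv (carrier M \<times> S) (localization_rel S M)"
  proof (rule equivI)
    show "localization_rel S M \<subseteq> (carrier M \<times> S) \<times> (carrier M \<times> S)" by (auto simp: localization_rel_def)
    show "refl_on (carrier M \<times> S) (localization_rel S M)"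
      using S by (auto simp: refl_on_def localization_rel_def)
    show "sym (localization_rel S M)" by (auto simp: sym_def localization_rel_def) metis
    show "trans (localization_rel S M)"
    proof (rule transI, clarify)
      fix m s n t l w assume "((m,s),(n,t)) \<in> localization_rel S M" "((n,t),(l,w)) \<in> localization_rel S M"
      then obtain u v where *: "m \<in> carrier M" "n \<in> carrier M" "l \<in> carrier M" "s \<in> S" "t \<in> S" "w \<in> S" "u \<in> S" "v \<in> S"
        "u \<odot>\<^bsub>M\<^esub> (t \<odot>\<^bsub>M\<^esub> m) = u \<odot>\<^bsub>M\<^esub> (s \<odot>\<^bsub>M\<^esub> n)" "v \<odot>\<^bsub>M\<^esub> (w \<odot>\<^bsub>M\<^esub> n) = v \<odot>\<^bsub>M\<^esub> (t \<odot>\<^bsub>M\<^esub> l)"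
        by (auto simp: localization_rel_def)
      have swap: "a \<odot>\<^bsub>M\<^esub> (b \<odot>\<^bsub>M\<^esub> x) = b \<odot>\<^bsub>M\<^esub> (a \<odot>\<^bsub>M\<^esub> x)" if "a \<in> S" "b \<in> S" "x \<in> carrier M" for a b x
        using that Sc by (simp add: smult_assoc1[symmetric] R.m_comm)
      have "(u \<otimes> v \<otimes> t) \<odot>\<^bsub>M\<^esub> (w \<odot>\<^bsub>M\<^esub> m) = v \<odot>\<^bsub>M\<^esub> (w \<odot>\<^bsub>M\<^esub> (u \<odot>\<^bsub>M\<^esub> (t \<odot>\<^bsub>M\<^esub> m)))"
        using *(1-8) Sc by (simp add: smult_assoc1[symmetric] R.m_ac)
      also have "\<dots> = s \<odot>\<^bsub>M\<^esub> (u \<odot>\<^bsub>M\<^esub> (v \<odot>\<^bsub>M\<^esub> (w \<odot>\<^bsub>M\<^esub> n)))"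
        unfolding *(9) using *(1-8) Sc by (simp add: smult_assoc1[symmetric] R.m_ac)
      also have "\<dots> = (u \<otimes> v \<otimes> t) \<odot>\<^bsub>M\<^esub> (s \<odot>\<^bsub>M\<^esub> l)"
        unfolding *(10) using *(1-8) Sc by (simp add: smult_assoc1[symmetric] R.m_ac)
      finally show "((m,s),(l,w)) \<in> localization_rel S M" using *(1-8) S
        by (auto simp: localization_rel_def)
    qed
  qed
  have cl: "fraction S M m s = fraction S M \<zero>\<^bsub>M\<^esub> \<one> \<longleftrightarrow> (\<exists>u\<in>S. u \<odot>\<^bsub>M\<^esub> m = \<zero>\<^bsub>M\<^esub>)" if "m \<in> carrier M" "s \<in> S" for m s
    using eq_equiv_class_iff[OF equiv, of "(m,s)" "(\<zero>\<^bsub>M\<^esub>,\<one>)"] that S Sc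
    by (auto simp: localization_rel_def)
  have "carrier (localization R S M) = (\<lambda>(m,s). fraction S M m s) ` (carrier M \<times> S)"
    by (auto simp: localization_def quotient_def)
  moreover have "fraction S M \<zero>\<^bsub>M\<^esub> \<one> \<in> (\<lambda>(m,s). fraction S M m s) ` (carrier M \<times> S)" using S by force
  moreover have "(F ` (A \<times> B) = {c}) \<longleftrightarrow> (\<forall>m\<in>A. \<forall>s\<in>B. F (m,s) = c)" if "c \<in> F ` (A \<times> B)" for F :: "'c \<times> 'a \<Rightarrow> ('c \<times> 'a) set" and A B c
    using that by blast
  moreover have "\<zero>\<^bsub>localization R S M\<^esub> = fraction S M \<zero>\<^bsub>M\<^esub> \<one>" by (simp add: localization_def)
  ultimately have "carrier (localization R S M) = {\<zero>\<^bsub>localization R S M\<^esub>} \<longleftrightarrow> 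
     (\<forall>m\<in>carrier M. \<forall>s\<in>S. fraction S M m s = fraction S M \<zero>\<^bsub>M\<^esub> \<one>)"
    by simp
  then show ?thesis using cl S by auto
qed

end

end

theory Submission
  imports Defs
begin

text \<open>Let \<open>F(L)\<close> be the given free resolution of a module \<open>L\<close>.  For a submodule \<open>L\<close> of \<open>M\<close>, \<open>F(L)\<close> is
  a subcomplex of \<open>F(M)\<close> spanned by part of the basis, so cohomology classes can be restricted to submodules
  by restricting cocycles.  Suppose that the supports of \<open>M\<close> and \<open>N\<close> meet inside \<open>V(\<aa>)\<close>.  Then for
  \<open>a \<in> \<aa>\<close> and \<open>x \<in> N\<close> some power of \<open>a\<close> lies in \<open>ann M + ann x\<close>.  Since \<open>L\<close> also has a resolution
  by finitely generated free modules, a power of \<open>a\<close> kills any given class in \<open>Ext\<^sup>n(L, N)\<close>, and the class then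
  vanishes on \<open>a\<^sup>m L\<close> for large \<open>m\<close>.  By Mayer-Vietoris and induction on \<open>n\<close> it vanishes on a submodule that
  contains a power of each generator of \<open>\<aa>\<close> times \<open>L\<close>, hence on \<open>\<aa>\<^sup>i M\<close> for large \<open>i\<close> when
  \<open>L = \<aa>\<^sup>j M\<close>.  So the direct limit of the \<open>Ext\<^sup>n(\<aa>\<^sup>i M, N)\<close> is zero, and the long exact sequence of
  \<open>0 \<rightarrow> \<aa>\<^sup>i M \<rightarrow> M \<rightarrow> M/\<aa>\<^sup>i M \<rightarrow> 0\<close>, here replaced by arguments with cocycles, shows that the direct
  limit of the \<open>Ext\<^sup>n(M/\<aa>\<^sup>i M, N)\<close> is \<open>Ext\<^sup>n(M, N)\<close>.\<close>

section \<open>Complexes of free modules modulo a subcomplex\<close>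

text \<open>N is arbitrary, so the exponents k in a decomposition of \<open>a [^] k\<close> as j +
  e, with j annihilating M and e annihilating x, need not be bounded as x runs through N; only
  finitely many values of a cocycle may therefore matter. The functorial resolution has infinite
  bases, hence the finitely generated subresolution chosen inside it. The functorial resolution is
  kept nevertheless, because its basis elements are trees with elements of the module at the leaves:
  F(A) and F(B) meet exactly in F(A \<inter> B), and a cochain on F(A) extends to F(M) by zero on
  the remaining basis. Connecting maps and Mayer-Vietoris then become additions and subtractions of
  functions. The price is that F(0) is not zero: if A is the kernel of M \<rightarrow> M', then F(A)
  is carried into F(0) and not to zero, so cocycles on quotients are first normalised to vanish on
  F(0). Gluing primitives over A and B fails when they differ by a nontrivial class on A \<inter> B;
  the overlap has to be made small while A still absorbs a power of each generator, and this is what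
  the maximal submodule replacing Artin-Rees provides.\<close>

definition agree_off :: "'i set \<Rightarrow> ('i \<Rightarrow> 'a) \<Rightarrow> ('i \<Rightarrow> 'a) \<Rightarrow> bool"
  where "agree_off T x y \<longleftrightarrow> (\<forall>b. b \<notin> T \<longrightarrow> x b = y b)"

lemma agree_off_refl [simp]: "agree_off T x x"
  by (simp add: agree_off_def)

lemma agree_off_empty [simp]: "agree_off {} x y \<longleftrightarrow> x = y"
  by (auto simp: agree_off_def)

lemma (in abelian_group) minus_eq_zeroD:
  assumes "x \<in> carrier G" "y \<in> carrier G" "x \<ominus> y = \<zero>" shows "x = y"
  using assms r_neg[of y] by (metis a_minus_def a_inv_closed add.inv_solve_right' l_zero minus_equality minus_minus)

section \<open>Finitely supported functions and homomorphisms on free modules\<close>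

context cring begin

abbreviation "Fr B \<equiv> carrier (free_module R B)"
abbreviation "free_hom B V \<equiv> module_hom R (free_module R B) V"
abbreviation "fhom B C \<equiv> module_hom R (free_module R B) (free_module R C)"

lemma Fr_closed:
  "(\<lambda>b. \<zero>) \<in> Fr B"
  "u \<in> Fr B \<Longrightarrow> v \<in> Fr B \<Longrightarrow> (\<lambda>b. u b \<oplus> v b) \<in> Fr B"
  "u \<in> Fr B \<Longrightarrow> v \<in> Fr B \<Longrightarrow> (\<lambda>b. u b \<ominus> v b) \<in> Fr B"
  "u \<in> Fr B \<Longrightarrow> r \<in> carrier R \<Longrightarrow> (\<lambda>b. r \<otimes> u b) \<in> Fr B"
proof -
  interpret F: module R "free_module R B" by (rule free_module_module)
  show "(\<lambda>b. \<zero>) \<in> Fr B" using F.M.zero_closed by (simp add: free_simps)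
  show s: "(\<lambda>b. r \<otimes> u b) \<in> Fr B" if "u \<in> Fr B" "r \<in> carrier R" for u r
    using F.smult_closed[OF that(2,1)] by (simp add: free_simps)
  show p: "(\<lambda>b. u b \<oplus> v b) \<in> Fr B" if "u \<in> Fr B" "v \<in> Fr B" for u v
    using F.M.add.m_closed[OF that] by (simp add: free_simps)
  assume u: "u \<in> Fr B" and v: "v \<in> Fr B"
  have "\<ominus> \<one> \<otimes> v b = \<ominus> v b" for b using v by (auto simp: free_carrier l_minus)
  then show "(\<lambda>b. u b \<ominus> v b) \<in> Fr B" using p[OF u s[OF v, of "\<ominus> \<one>"]] by (simp add: a_minus_def)
qed

lemma Fr_in: "v \<in> Fr B \<Longrightarrow> v b \<in> carrier R"
  by (simp add: free_carrier)

lemma Fr_mono: "v \<in> Fr B \<Longrightarrow> B \<subseteq> C \<Longrightarrow> v \<in> Fr C"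
  using free_carrier_mono by blast

lemma Fr_outside: "v \<in> Fr B \<Longrightarrow> b \<notin> B \<Longrightarrow> v b = \<zero>"
  by (auto simp: free_carrier)

lemma Fr_agree: "v \<in> Fr B \<Longrightarrow> agree_off T v (\<lambda>b. \<zero>) \<Longrightarrow> v \<in> Fr T"
  by (auto simp: free_carrier agree_off_def)

lemma Fr_empty [simp]: "Fr {} = {\<lambda>b. \<zero>}"
  by (auto simp: free_carrier fun_eq_iff)

lemma Fr_Int: "v \<in> Fr B \<Longrightarrow> v \<in> Fr C \<Longrightarrow> v \<in> Fr (B \<inter> C)"
  by (simp add: free_carrier)

lemma Fr_proj:
  assumes "v \<in> Fr B"
  shows "(\<lambda>b. if b \<in> C then v b else \<zero>) \<in> Fr (B \<inter> C)"
proof -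
  have "{b. (if b \<in> C then v b else \<zero>) \<noteq> \<zero>} \<subseteq> {b. v b \<noteq> \<zero>}" by auto
  then show ?thesis using assms unfolding free_carrier by (auto intro: finite_subset)
qed

lemma fr_hom:
  assumes "h \<in> free_hom B V" "module R V"
  shows "u \<in> Fr B \<Longrightarrow> h u \<in> carrier V"
    "u \<in> Fr B \<Longrightarrow> v \<in> Fr B \<Longrightarrow> h (\<lambda>b. u b \<oplus> v b) = h u \<oplus>\<^bsub>V\<^esub> h v"
    "u \<in> Fr B \<Longrightarrow> r \<in> carrier R \<Longrightarrow> h (\<lambda>b. r \<otimes> u b) = r \<odot>\<^bsub>V\<^esub> h u"
    "h (\<lambda>b. \<zero>) = \<zero>\<^bsub>V\<^esub>"
    "u \<in> Fr B \<Longrightarrow> v \<in> Fr B \<Longrightarrow> h (\<lambda>b. u b \<ominus> v b) = h u \<ominus>\<^bsub>V\<^esub> h v"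
proof -
  interpret F: module R "free_module R B" by (rule free_module_module)
  interpret V: module R V by fact
  show c: "h u \<in> carrier V" if "u \<in> Fr B" for u using assms(1) that by (auto simp: module_hom_def)
  show p: "h (\<lambda>b. u b \<oplus> v b) = h u \<oplus>\<^bsub>V\<^esub> h v" if "u \<in> Fr B" "v \<in> Fr B" for u v
    using assms(1) that by (simp add: module_hom_def free_simps)
  show s: "h (\<lambda>b. r \<otimes> u b) = r \<odot>\<^bsub>V\<^esub> h u" if "u \<in> Fr B" "r \<in> carrier R" for u r
    using assms(1) that by (simp add: module_hom_def free_simps)
  show "h (\<lambda>b. \<zero>) = \<zero>\<^bsub>V\<^esub>" using F.module_hom_zero[OF assms(2,1)] by (simp add: free_simps)
  assume u: "u \<in> Fr B" and v: "v \<in> Fr B"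
  have "\<ominus> \<one> \<otimes> v b = \<ominus> v b" for b using v by (auto simp: free_carrier l_minus)
  then show "h (\<lambda>b. u b \<ominus> v b) = h u \<ominus>\<^bsub>V\<^esub> h v"
    using p[OF u Fr_closed(4)[OF v, of "\<ominus> \<one>"]] s[OF v, of "\<ominus> \<one>"] c[OF v]
    by (simp add: a_minus_def V.smult_l_minus)
qed

lemma fhom:
  assumes "f \<in> fhom B C"
  shows "u \<in> Fr B \<Longrightarrow> f u \<in> Fr C"
    "u \<in> Fr B \<Longrightarrow> v \<in> Fr B \<Longrightarrow> f (\<lambda>b. u b \<oplus> v b) = (\<lambda>c. f u c \<oplus> f v c)"
    "u \<in> Fr B \<Longrightarrow> r \<in> carrier R \<Longrightarrow> f (\<lambda>b. r \<otimes> u b) = (\<lambda>c. r \<otimes> f u c)"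
    "f (\<lambda>b. \<zero>) = (\<lambda>c. \<zero>)"
    "u \<in> Fr B \<Longrightarrow> v \<in> Fr B \<Longrightarrow> f (\<lambda>b. u b \<ominus> v b) = (\<lambda>c. f u c \<ominus> f v c)"
proof -
  interpret C: module R "free_module R C" by (rule free_module_module)
  note h = fr_hom[OF assms free_module_module, unfolded free_simps]
  show f: "u \<in> Fr B \<Longrightarrow> f u \<in> Fr C" for u using h by blast
  show p: "u \<in> Fr B \<Longrightarrow> v \<in> Fr B \<Longrightarrow> f (\<lambda>b. u b \<oplus> v b) = (\<lambda>c. f u c \<oplus> f v c)" for u v using h by blast
  show s: "u \<in> Fr B \<Longrightarrow> r \<in> carrier R \<Longrightarrow> f (\<lambda>b. r \<otimes> u b) = (\<lambda>c. r \<otimes> f u c)" for u r using h by blast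
  show "f (\<lambda>b. \<zero>) = (\<lambda>c. \<zero>)" using h by blast
  assume u: "u \<in> Fr B" and v: "v \<in> Fr B"
  have "\<ominus> \<one> \<otimes> v b = \<ominus> v b" "\<ominus> \<one> \<otimes> f v c = \<ominus> f v c" for b c
    using v f[OF v] by (auto simp: free_carrier l_minus)
  then show "f (\<lambda>b. u b \<ominus> v b) = (\<lambda>c. f u c \<ominus> f v c)"
    using p[OF u Fr_closed(4)[OF v, of "\<ominus> \<one>"]] s[OF v, of "\<ominus> \<one>"] by (simp add: a_minus_def)
qed

lemma fhomI:
  assumes "\<And>u. u \<in> Fr B \<Longrightarrow> h u \<in> Fr C"
    "\<And>u v. u \<in> Fr B \<Longrightarrow> v \<in> Fr B \<Longrightarrow> h (\<lambda>b. u b \<oplus> v b) = (\<lambda>c. h u c \<oplus> h v c)"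
    "\<And>u r. u \<in> Fr B \<Longrightarrow> r \<in> carrier R \<Longrightarrow> h (\<lambda>b. r \<otimes> u b) = (\<lambda>c. r \<otimes> h u c)"
  shows "h \<in> fhom B C"
  using assms by (auto simp: module_hom_def free_simps)

lemma free_hom_subset:
  "h \<in> free_hom B V \<Longrightarrow> C \<subseteq> B \<Longrightarrow> h \<in> free_hom C V"
  using free_carrier_mono[of C B] unfolding module_hom_def free_simps by blast

lemma fhom_codomain:
  assumes "f \<in> fhom B C" "\<And>v. v \<in> Fr B \<Longrightarrow> f v \<in> Fr D"
  shows "f \<in> fhom B D"
  using assms by (auto simp: module_hom_def free_simps)

lemma free_induct [consumes 1, case_names zero step]:
  assumes v: "v \<in> Fr B" and z: "P (\<lambda>b. \<zero>)"
    and s: "\<And>r b v. r \<in> carrier R \<Longrightarrow> b \<in> B \<Longrightarrow> v \<in> Fr B \<Longrightarrow> P v \<Longrightarrow> P (\<lambda>c. r \<otimes> unit_vec R b c \<oplus> v c)"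
  shows "P v"
proof -
  obtain l where l: "l \<in> lists (carrier R \<times> B)" "lin_comb (free_module R UNIV) (unit_vec R) l = v"
    using free_is_lin_comb[OF v] by blast
  have "P (lin_comb (free_module R UNIV) (unit_vec R) l)" using l(1)
  proof (induction l)
    case Nil then show ?case using z by (simp add: lin_comb_def free_simps)
  next
    case (Cons p l)
    then show ?case using s[of "fst p" "snd p", OF _ _ lin_comb_free_closed[of l B]]
      by (cases p) (auto simp: lin_comb_def free_simps)
  qed
  then show ?thesis by (simp add: l)
qed

lemma fr_eqI:
  assumes "module R V" "h \<in> free_hom B V" "k \<in> free_hom B V"
    "\<And>b. b \<in> B \<Longrightarrow> h (unit_vec R b) = k (unit_vec R b)" "v \<in> Fr B"
  shows "h v = k v"
  using unit_vec_ext[OF assms(1-3)] assms(4,5) by blast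

text \<open>The difference of u and v lies in \<open>Fr S\<close>, so this is the map induced on
  quotients, phrased without quotients. \<open>hom_agree\<close> is the same for maps that vanish on
  \<open>Fr S\<close>.\<close>

lemma fhom_agree:
  assumes f: "f \<in> fhom B C" and S: "\<And>v. v \<in> Fr S \<Longrightarrow> f v \<in> Fr T"
    and u: "u \<in> Fr B" and v: "v \<in> Fr B" and a: "agree_off S u v"
  shows "agree_off T (f u) (f v)"
proof -
  let ?z = "\<lambda>b. u b \<ominus> v b"
  have z: "?z \<in> Fr B" using u v by (rule Fr_closed)
  have "agree_off S ?z (\<lambda>b. \<zero>)" using a Fr_in[OF v] by (auto simp: agree_off_def r_neg a_minus_def)
  then have "?z \<in> Fr S" using Fr_agree[OF z] by blast
  then have fz: "f ?z \<in> Fr T" by (rule S)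
  show ?thesis unfolding agree_off_def
  proof (intro allI impI)
    fix b assume "b \<notin> T"
    then have "f u b \<ominus> f v b = \<zero>" using Fr_outside[OF fz] fhom(5)[OF f u v] by metis
    then show "f u b = f v b" using Fr_in[OF fhom(1)[OF f u]] Fr_in[OF fhom(1)[OF f v]] by (auto dest: minus_eq_zeroD)
  qed
qed

lemma hom_agree:
  assumes V: "module R V" and f: "f \<in> free_hom B V" and S: "\<And>v. v \<in> Fr S \<Longrightarrow> f v = \<zero>\<^bsub>V\<^esub>"
    and u: "u \<in> Fr B" and v: "v \<in> Fr B" and a: "agree_off S u v"
  shows "f u = f v"
proof -
  interpret V: module R V by fact
  let ?z = "\<lambda>b. u b \<ominus> v b"
  have z: "?z \<in> Fr B" using u v by (rule Fr_closed)
  have "agree_off S ?z (\<lambda>b. \<zero>)" using a Fr_in[OF v] by (auto simp: agree_off_def r_neg a_minus_def)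
  then have "?z \<in> Fr S" using Fr_agree[OF z] by blast
  then have "f u \<ominus>\<^bsub>V\<^esub> f v = \<zero>\<^bsub>V\<^esub>" using S fr_hom(5)[OF f V u v] by simp
  then show ?thesis using fr_hom(1)[OF f V] u v by (auto dest: V.M.minus_eq_zeroD)
qed

text \<open>Projectivity of free modules relative to T: preimages are chosen on the basis and
  extended linearly, and \<open>agree_off T\<close> is compatible with linear combinations.\<close>

lemma lift_mod:
  assumes D: "D \<in> fhom Q W" and c: "c \<in> fhom B W"
    and ex: "\<And>b. b \<in> B \<Longrightarrow> \<exists>y\<in>Fr Q. agree_off T (D y) (c (unit_vec R b))"
  shows "\<exists>f\<in>fhom B Q. \<forall>v\<in>Fr B. agree_off T (D (f v)) (c v)"
proof -
  interpret Q: module R "free_module R Q" by (rule free_module_module)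
  obtain y where y: "\<And>b. b \<in> B \<Longrightarrow> y b \<in> Fr Q" "\<And>b. b \<in> B \<Longrightarrow> agree_off T (D (y b)) (c (unit_vec R b))"
    using ex by metis
  define f where "f = lin_ext R (free_module R Q) y"
  have f: "f \<in> fhom B Q" unfolding f_def using y(1) by (intro Q.lin_ext_hom) auto
  have fu: "f (unit_vec R b) = y b" if "b \<in> B" for b
    unfolding f_def using y(1)[OF that] by (rule Q.lin_ext_unit_vec)
  have "agree_off T (D (f v)) (c v)" if "v \<in> Fr B" for v
    using that
  proof (induction rule: free_induct)
    case zero show ?case by (simp add: fhom(4)[OF f] fhom(4)[OF D] fhom(4)[OF c])
  next
    case (step r b v)
    have b: "unit_vec R b \<in> Fr B" "(\<lambda>c. r \<otimes> unit_vec R b c) \<in> Fr B" "y b \<in> Fr Q" "(\<lambda>c. r \<otimes> y b c) \<in> Fr Q" "f v \<in> Fr Q"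
      using step y(1) by (auto intro!: unit_vec_carrier Fr_closed(4) fhom(1)[OF f])
    show ?case using step b y(2)[OF step(2)]
      by (simp add: fhom(2)[OF f] fhom(3)[OF f] fhom(2)[OF c] fhom(3)[OF c] fhom(2)[OF D] fhom(3)[OF D] fu agree_off_def)
  qed
  then show ?thesis using f by blast
qed

text \<open>A quotient of a free complex by the subcomplex on part of the basis is handled inside the complex
  itself: \<open>agree_off T\<close> is congruence modulo the free module on \<open>T\<close>, and \<open>exact_mod B d C\<close> says that the
  quotient of \<open>B\<close> by \<open>C\<close> is exact in degrees at least 2; degree 1, where complexes start, is
  treated separately.\<close>

definition complex :: "(nat \<Rightarrow> 'i set) \<Rightarrow> (nat \<Rightarrow> ('i \<Rightarrow> 'a) \<Rightarrow> 'i \<Rightarrow> 'a) \<Rightarrow> bool"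
  where "complex B d \<longleftrightarrow> B 0 = {} \<and> (\<forall>n. d n \<in> fhom (B n) (B (n - 1))) \<and>
    (\<forall>n. \<forall>v\<in>Fr (B (Suc n)). d n (d (Suc n) v) = (\<lambda>b. \<zero>))"

definition subcomplex :: "(nat \<Rightarrow> 'i set) \<Rightarrow> (nat \<Rightarrow> 'i set) \<Rightarrow> (nat \<Rightarrow> ('i \<Rightarrow> 'a) \<Rightarrow> 'i \<Rightarrow> 'a) \<Rightarrow> bool"
  where "subcomplex C B d \<longleftrightarrow> (\<forall>n. C n \<subseteq> B n \<and> (\<forall>v\<in>Fr (C n). d n v \<in> Fr (C (n - 1))))"

definition exact_mod :: "(nat \<Rightarrow> 'i set) \<Rightarrow> (nat \<Rightarrow> ('i \<Rightarrow> 'a) \<Rightarrow> 'i \<Rightarrow> 'a) \<Rightarrow> (nat \<Rightarrow> 'i set) \<Rightarrow> bool"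
  where "exact_mod B d C \<longleftrightarrow> (\<forall>n\<ge>2. \<forall>v\<in>Fr (B n). d n v \<in> Fr (C (n - 1)) \<longrightarrow>
    (\<exists>w\<in>Fr (B (Suc n)). agree_off (C n) (d (Suc n) w) v))"

definition chain_map_mod where
  "chain_map_mod B dB Q dQ T f \<longleftrightarrow> (\<forall>n. f n \<in> fhom (B n) (Q n)) \<and>
    (\<forall>n. \<forall>v\<in>Fr (B (Suc n)). agree_off (T n) (dQ (Suc n) (f (Suc n) v)) (f n (dB (Suc n) v)))"

section \<open>Comparison of chain maps modulo a subcomplex\<close>

lemma complexD:
  assumes "complex B d"
  shows "B 0 = {}" "d n \<in> fhom (B n) (B (n - 1))" "d (Suc n) \<in> fhom (B (Suc n)) (B n)"
    "v \<in> Fr (B (Suc n)) \<Longrightarrow> d n (d (Suc n) v) = (\<lambda>b. \<zero>)"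
    "v \<in> Fr (B (Suc n)) \<Longrightarrow> d (Suc n) v \<in> Fr (B n)"
proof -
  show "B 0 = {}" "d n \<in> fhom (B n) (B (n - 1))" "v \<in> Fr (B (Suc n)) \<Longrightarrow> d n (d (Suc n) v) = (\<lambda>b. \<zero>)" using assms by (auto simp: complex_def)
  have "d (Suc n) \<in> fhom (B (Suc n)) (B (Suc n - 1))" using assms by (simp only: complex_def)
  then show *: "d (Suc n) \<in> fhom (B (Suc n)) (B n)" by simp
  show "v \<in> Fr (B (Suc n)) \<Longrightarrow> d (Suc n) v \<in> Fr (B n)" by (rule fhom(1)[OF *])
qed

lemma subcomplexD:
  assumes "subcomplex C B d"
  shows "C n \<subseteq> B n" "v \<in> Fr (C n) \<Longrightarrow> d n v \<in> Fr (C (n - 1))" "v \<in> Fr (C (Suc n)) \<Longrightarrow> d (Suc n) v \<in> Fr (C n)"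
  using assms unfolding subcomplex_def by (auto dest: spec[of _ "Suc n"])

lemma exact_modD:
  assumes "exact_mod B d C" "n > 0" "v \<in> Fr (B (Suc n))" "d (Suc n) v \<in> Fr (C n)"
  shows "\<exists>w\<in>Fr (B (Suc (Suc n))). agree_off (C (Suc n)) (d (Suc (Suc n)) w) v"
proof -
  have "Suc n \<ge> 2" "d (Suc n) v \<in> Fr (C (Suc n - 1))" using assms by auto
  then show ?thesis using assms(1,3) unfolding exact_mod_def by blast
qed

text \<open>Every defect of the homotopy equation is a cycle modulo T and hence bounds.
  \<open>exact_mod\<close> is silent about degree 1, where Q modulo T may have homology;
  \<open>ex1\<close> supplies what is needed there, namely that the image of \<open>f 1\<close>
  bounds.\<close>

lemma null_homotopy:
  fixes B :: "nat \<Rightarrow> 'i set" and Q :: "nat \<Rightarrow> 'j set"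
  assumes B: "complex B dB" and Q: "complex Q dQ" and T: "subcomplex T Q dQ"
    and f: "chain_map_mod B dB Q dQ T f"
    and ex: "exact_mod Q dQ T"
    and ex1: "\<And>v. v \<in> Fr (B 1) \<Longrightarrow> \<exists>w\<in>Fr (Q 2). agree_off (T 1) (dQ 2 w) (f 1 v)"
  shows "\<exists>k. \<forall>n. k n \<in> fhom (B n) (Q (Suc n)) \<and>
    (\<forall>v\<in>Fr (B (Suc n)). agree_off (T (Suc n)) (\<lambda>b. dQ (Suc (Suc n)) (k (Suc n) v) b \<oplus> k n (dB (Suc n) v) b) (f (Suc n) v))"
proof -
  \<comment> \<open>\<open>P\<close> asks for the homotopy equation on cycles only. This is what the
    next degree needs, where \<open>k\<close> is evaluated at the cycle \<open>dB (Suc n) v\<close>.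
    \<open>H\<close> is the full equation between consecutive degrees.\<close>
  define P where "P n k \<longleftrightarrow> k \<in> fhom (B n) (Q (Suc n)) \<and>
    (\<forall>v\<in>Fr (B n). dB n v = (\<lambda>b. \<zero>) \<longrightarrow> agree_off (T n) (dQ (Suc n) (k v)) (f n v))" for n k
  define H where "H n k k' \<longleftrightarrow> (\<forall>v\<in>Fr (B (Suc n)).
    agree_off (T (Suc n)) (\<lambda>b. dQ (Suc (Suc n)) (k' v) b \<oplus> k (dB (Suc n) v) b) (f (Suc n) v))" for n k k'
  have fh: "f n \<in> fhom (B n) (Q n)" for n using f by (simp add: chain_map_mod_def)
  note dQh = complexD(3)[OF Q]
  note dBh = complexD(3)[OF B]
  have "P 0 (\<lambda>v b. \<zero>)" unfolding P_def
    using fhom(4)[OF fh[of 0]] fhom(4)[OF dQh[of 0]]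
    by (auto simp: complexD(1)[OF B] intro!: fhomI Fr_closed)
  moreover have "\<exists>k'. P (Suc n) k' \<and> H n k k'" if P: "P n k" for n k
  proof -
    have kh: "k \<in> fhom (B n) (Q (Suc n))"
      and kc: "\<And>v. v \<in> Fr (B n) \<Longrightarrow> dB n v = (\<lambda>b. \<zero>) \<Longrightarrow> agree_off (T n) (dQ (Suc n) (k v)) (f n v)"
      using P by (auto simp: P_def)
    \<comment> \<open>Modulo T, \<open>dQ\<close> sends both terms of \<open>c v\<close> to
      \<open>f n (dB (Suc n) v)\<close>, so \<open>c v\<close> is a relative cycle and bounds; the
      next \<open>k\<close> is a lift of \<open>c\<close> through \<open>dQ\<close>. For n = 0 the
      map \<open>c\<close> is \<open>f 1\<close> and \<open>ex1\<close> applies.\<close>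
    define c where "c = (\<lambda>v b. f (Suc n) v b \<ominus> k (dB (Suc n) v) b)"
    have mem: "f (Suc n) v \<in> Fr (Q (Suc n))" "k (dB (Suc n) v) \<in> Fr (Q (Suc n))" "dB (Suc n) v \<in> Fr (B n)" if "v \<in> Fr (B (Suc n))" for v
      using that fhom(1)[OF fh] fhom(1)[OF kh] complexD(5)[OF B] by auto
    have c: "c \<in> fhom (B (Suc n)) (Q (Suc n))"
    proof (rule fhomI)
      fix u assume u: "u \<in> Fr (B (Suc n))"
      show "c u \<in> Fr (Q (Suc n))" unfolding c_def using mem[OF u] by (intro Fr_closed)
      show "c (\<lambda>b. u b \<oplus> v b) = (\<lambda>b. c u b \<oplus> c v b)" if v: "v \<in> Fr (B (Suc n))" for v
        unfolding c_def using mem[OF u] mem[OF v] u v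
        by (auto simp: fhom(2)[OF fh] fhom(2)[OF kh] fhom(2)[OF dBh] fun_eq_iff a_minus_def minus_add a_ac Fr_in)
      show "c (\<lambda>b. r \<otimes> u b) = (\<lambda>b. r \<otimes> c u b)" if r: "r \<in> carrier R" for r
        unfolding c_def using mem[OF u] u r
        by (auto simp: fhom(3)[OF fh] fhom(3)[OF kh] fhom(3)[OF dBh] fun_eq_iff a_minus_def r_distr r_minus Fr_in)
    qed
    have "\<exists>y\<in>Fr (Q (Suc (Suc n))). agree_off (T (Suc n)) (dQ (Suc (Suc n)) y) (c v)" if v: "v \<in> Fr (B (Suc n))" for v
    proof (cases n)
      case 0
      have "k (dB (Suc n) v) = (\<lambda>b. \<zero>)" using mem(3)[OF v] 0 complexD(1)[OF B] fhom(4)[OF kh] by simp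
      then have "c v = f 1 v" using mem(1)[OF v] 0 by (auto simp: c_def fun_eq_iff a_minus_def Fr_in)
      then show ?thesis using ex1[of v] v 0 by (simp add: numeral_2_eq_2)
    next
      case (Suc m)
      have "dQ (Suc n) (c v) = (\<lambda>b. dQ (Suc n) (f (Suc n) v) b \<ominus> dQ (Suc n) (k (dB (Suc n) v)) b)"
        unfolding c_def using mem[OF v] by (intro fhom(5)[OF dQh])
      moreover have "agree_off (T n) (dQ (Suc n) (f (Suc n) v)) (f n (dB (Suc n) v))"
        using f v by (simp add: chain_map_mod_def)
      moreover have "agree_off (T n) (dQ (Suc n) (k (dB (Suc n) v))) (f n (dB (Suc n) v))"
        using kc[OF mem(3)[OF v]] complexD(4)[OF B v] by simp
      moreover have "f n (dB (Suc n) v) \<in> Fr (Q n)" using mem(3)[OF v] fhom(1)[OF fh] by blast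
      ultimately have "agree_off (T n) (dQ (Suc n) (c v)) (\<lambda>b. \<zero>)"
        by (auto simp: agree_off_def a_minus_def r_neg Fr_in)
      moreover have "c v \<in> Fr (Q (Suc n))" by (rule fhom(1)[OF c v])
      ultimately have "dQ (Suc n) (c v) \<in> Fr (T n)" using Fr_agree[OF complexD(5)[OF Q]] by blast
      then show ?thesis using exact_modD[OF ex _ \<open>c v \<in> Fr (Q (Suc n))\<close>] Suc by blast
    qed
    then obtain k' where k': "k' \<in> fhom (B (Suc n)) (Q (Suc (Suc n)))"
      "\<forall>v\<in>Fr (B (Suc n)). agree_off (T (Suc n)) (dQ (Suc (Suc n)) (k' v)) (c v)"
      using lift_mod[OF dQh c] unit_vec_carrier by meson
    have "H n k k'" unfolding H_def
    proof
      fix v assume v: "v \<in> Fr (B (Suc n))"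
      show "agree_off (T (Suc n)) (\<lambda>b. dQ (Suc (Suc n)) (k' v) b \<oplus> k (dB (Suc n) v) b) (f (Suc n) v)"
        using k'(2)[rule_format, OF v] mem[OF v] unfolding agree_off_def c_def
        by (auto simp: a_minus_def a_assoc l_neg Fr_in)
    qed
    moreover have "agree_off (T (Suc n)) (dQ (Suc (Suc n)) (k' v)) (f (Suc n) v)"
      if v: "v \<in> Fr (B (Suc n))" "dB (Suc n) v = (\<lambda>b. \<zero>)" for v
    proof -
      have "c v = f (Suc n) v" using Fr_in[OF mem(1)[OF v(1)]] by (simp add: c_def v(2) fhom(4)[OF kh] a_minus_def)
      then show ?thesis using k'(2) v by auto
    qed
    then have "P (Suc n) k'" using k'(1) unfolding P_def by blast
    ultimately show ?thesis by blast
  qed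
  ultimately have "\<exists>k. \<forall>n. P n (k n) \<and> H n (k n) (k (Suc n))" by (intro dependent_nat_choice) blast+
  then show ?thesis unfolding P_def H_def by blast
qed

text \<open>The usual degreewise lifting from a free complex into one that is exact modulo T. It can
  start because \<open>ex1\<close> makes \<open>f1\<close> send boundaries to boundaries modulo T,
  so that \<open>f1\<close> respects the homology in degree 1.\<close>

lemma extend_chain_map:
  fixes B :: "nat \<Rightarrow> 'i set" and Q :: "nat \<Rightarrow> 'j set"
  assumes B: "complex B dB" and Q: "complex Q dQ" and T: "subcomplex T Q dQ"
    and f1: "f1 \<in> fhom (B 1) (Q 1)"
    and ex: "exact_mod Q dQ T"
    and ex1: "\<And>v. v \<in> Fr (B 2) \<Longrightarrow> \<exists>w\<in>Fr (Q 2). agree_off (T 1) (dQ 2 w) (f1 (dB 2 v))"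
  shows "\<exists>f. f 1 = f1 \<and> chain_map_mod B dB Q dQ T f"
proof -
  \<comment> \<open>\<open>P n\<close> concerns the component in degree \<open>Suc n\<close>: degree
    0 is the zero module and degree 1 is prescribed. From degree 2 on the invariant is that cycles
    go to cycles modulo T.\<close>
  define P where "P n g \<longleftrightarrow> g \<in> fhom (B (Suc n)) (Q (Suc n)) \<and>
    (n = 0 \<longrightarrow> g = f1) \<and> (n > 0 \<longrightarrow> (\<forall>v\<in>Fr (B (Suc n)). dB (Suc n) v = (\<lambda>b. \<zero>) \<longrightarrow> dQ (Suc n) (g v) \<in> Fr (T n)))" for n g
  define H where "H n g g' \<longleftrightarrow> (\<forall>v\<in>Fr (B (Suc (Suc n))).
    agree_off (T (Suc n)) (dQ (Suc (Suc n)) (g' v)) (g (dB (Suc (Suc n)) v)))" for n g g'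
  note dQh = complexD(3)[OF Q]
  note dBh = complexD(3)[OF B]
  have "P 0 f1" using f1 by (auto simp: P_def)
  moreover have "\<exists>g'. P (Suc n) g' \<and> H n g g'" if P: "P n g" for n g
  proof -
    have gh: "g \<in> fhom (B (Suc n)) (Q (Suc n))"
      and g1: "n = 0 \<Longrightarrow> g = f1"
      and gc: "\<And>v. n > 0 \<Longrightarrow> v \<in> Fr (B (Suc n)) \<Longrightarrow> dB (Suc n) v = (\<lambda>b. \<zero>) \<Longrightarrow> dQ (Suc n) (g v) \<in> Fr (T n)"
      using P by (auto simp: P_def)
    define c where "c = (\<lambda>v. g (dB (Suc (Suc n)) v))"
    have c: "c \<in> fhom (B (Suc (Suc n))) (Q (Suc n))"
      unfolding c_def by (rule hom_comp[OF dBh gh])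
    have exv: "\<exists>y\<in>Fr (Q (Suc (Suc n))). agree_off (T (Suc n)) (dQ (Suc (Suc n)) y) (c v)" if v: "v \<in> Fr (B (Suc (Suc n)))" for v
    proof (cases n)
      case 0
      then show ?thesis using ex1[of v] v g1 by (simp add: c_def numeral_2_eq_2)
    next
      case (Suc m)
      have "dQ (Suc n) (c v) \<in> Fr (T n)" unfolding c_def
        using gc complexD(5)[OF B v] complexD(4)[OF B v] Suc by auto
      moreover have "c v \<in> Fr (Q (Suc n))" by (rule fhom(1)[OF c v])
      ultimately show ?thesis using exact_modD[OF ex] Suc by blast
    qed
    obtain g' where g': "g' \<in> fhom (B (Suc (Suc n))) (Q (Suc (Suc n)))"
      "\<forall>v\<in>Fr (B (Suc (Suc n))). agree_off (T (Suc n)) (dQ (Suc (Suc n)) (g' v)) (c v)"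
      using lift_mod[OF dQh c] exv unit_vec_carrier by meson
    have "H n g g'" using g'(2) by (simp add: H_def c_def)
    moreover have "dQ (Suc (Suc n)) (g' v) \<in> Fr (T (Suc n))"
      if v: "v \<in> Fr (B (Suc (Suc n)))" "dB (Suc (Suc n)) v = (\<lambda>b. \<zero>)" for v
    proof -
      have "agree_off (T (Suc n)) (dQ (Suc (Suc n)) (g' v)) (\<lambda>b. \<zero>)"
        using g'(2) fhom(4)[OF gh] v by (auto simp: c_def)
      then show ?thesis
        using Fr_agree[OF complexD(5)[OF Q]] fhom(1)[OF g'(1) v(1)] by blast
    qed
    then have "P (Suc n) g'" using g'(1) unfolding P_def by auto
    ultimately show ?thesis by blast
  qed
  ultimately have "\<exists>g. \<forall>n. P n (g n) \<and> H n (g n) (g (Suc n))" by (intro dependent_nat_choice) blast+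
  then obtain g where g: "\<And>n. P n (g n)" "\<And>n. H n (g n) (g (Suc n))" by blast
  define f where "f n = (case n of 0 \<Rightarrow> (\<lambda>v b. \<zero>) | Suc m \<Rightarrow> g m)" for n
  have f0: "f 0 \<in> fhom (B 0) (Q 0)" unfolding f_def by (auto simp: complexD(1)[OF B] intro!: fhomI Fr_closed)
  have "f 1 = f1" using g(1)[of 0] by (simp add: f_def P_def)
  moreover have "f n \<in> fhom (B n) (Q n)" for n
    using f0 g(1) by (cases n) (auto simp: f_def P_def)
  moreover have "agree_off (T n) (dQ (Suc n) (f (Suc n) v)) (f n (dB (Suc n) v))" if v: "v \<in> Fr (B (Suc n))" for n v
  proof (cases n)
    case 0
    have "f (Suc n) v \<in> Fr (Q (Suc n))" using g(1) v by (auto simp: f_def P_def intro: fhom(1))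
    from complexD(5)[OF Q this] have "dQ (Suc n) (f (Suc n) v) = (\<lambda>b. \<zero>)" using 0 complexD(1)[OF Q] by simp
    then show ?thesis using 0 by (simp add: f_def)
  next
    case (Suc m) then show ?thesis using g(2)[of m] v by (simp add: f_def H_def)
  qed
  ultimately show ?thesis unfolding chain_map_mod_def by blast
qed

section \<open>Cocycles and coboundaries with values in a module\<close>

lemma hom_add:
  assumes "module R N" "f \<in> module_hom R A N" "g \<in> module_hom R A N"
  shows "(\<lambda>x. f x \<oplus>\<^bsub>N\<^esub> g x) \<in> module_hom R A N"
proof -
  interpret N: module R N by fact
  have "f x \<in> carrier N" "g x \<in> carrier N" if "x \<in> carrier A" for x using assms that by (auto simp: module_hom_def)
  then show ?thesis using assms by (auto simp: module_hom_def N.smult_r_distr N.M.a_ac)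
qed

lemma hom_smult:
  assumes "module R N" "f \<in> module_hom R A N" "r \<in> carrier R"
  shows "(\<lambda>x. r \<odot>\<^bsub>N\<^esub> f x) \<in> module_hom R A N"
proof -
  interpret N: module R N by fact
  have "f x \<in> carrier N" if "x \<in> carrier A" for x using assms that by (auto simp: module_hom_def)
  then show ?thesis using assms by (auto simp: module_hom_def N.smult_r_distr N.smult_assoc1[symmetric] m_comm)
qed

lemma hom_diff:
  assumes "module R N" "f \<in> module_hom R A N" "g \<in> module_hom R A N"
  shows "(\<lambda>x. f x \<ominus>\<^bsub>N\<^esub> g x) \<in> module_hom R A N"
proof -
  interpret N: module R N by fact
  have "f x \<in> carrier N" "g x \<in> carrier N" if "x \<in> carrier A" for x using assms that by (auto simp: module_hom_def)
  then show ?thesis using assms by (auto simp: module_hom_def N.smult_r_distr N.M.a_ac N.smult_r_minus N.M.minus_add a_minus_def)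
qed

lemma hom_zero: "module R N \<Longrightarrow> (\<lambda>x. \<zero>\<^bsub>N\<^esub>) \<in> module_hom R A N"
proof -
  assume "module R N" then interpret N: module R N .
  show ?thesis by (simp add: module_hom_def)
qed

text \<open>Composition with the projection onto the basis elements in C, that is, extension by
  zero. The vanishing on disjoint parts of the basis lets two such extensions be added without
  interfering.\<close>

lemma free_hom_extend:
  fixes C :: "'i set"
  assumes "module R N" "g \<in> free_hom C N" "C \<subseteq> B"
  obtains g' where "g' \<in> free_hom B N" "\<And>v. v \<in> Fr C \<Longrightarrow> g' v = g v"
    "\<And>D v. v \<in> Fr D \<Longrightarrow> D \<inter> C = {} \<Longrightarrow> g' v = \<zero>\<^bsub>N\<^esub>"
proof -
  define pr where "pr v = (\<lambda>b. if b \<in> C then v b else \<zero>)" for v :: "'i \<Rightarrow> 'a"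
  have prm: "pr v \<in> Fr C" if "v \<in> Fr B" for v
    using Fr_mono[OF Fr_proj[OF that, of C]] by (auto simp: pr_def)
  have "pr \<in> fhom B C"
    by (rule fhomI[OF prm]) (auto simp: pr_def fun_eq_iff)
  from hom_comp[OF this assms(2)] have "(\<lambda>v. g (pr v)) \<in> free_hom B N" .
  moreover have "pr v = v" if "v \<in> Fr C" for v using Fr_outside[OF that] by (auto simp: pr_def)
  moreover have "pr v = (\<lambda>b. \<zero>)" if "v \<in> Fr D" "D \<inter> C = {}" for v D
    using Fr_outside[OF that(1)] that(2) by (fastforce simp: pr_def)
  ultimately show ?thesis using fr_hom(4)[OF assms(2,1)] by (intro that[of "\<lambda>v. g (pr v)"]) auto
qed

lemma Fr_Un:
  assumes "v \<in> Fr (C \<union> D)"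
  obtains x y where "x \<in> Fr C" "y \<in> Fr (D - C)" "v = (\<lambda>b. x b \<oplus> y b)"
proof
  show "(\<lambda>b. if b \<in> C then v b else \<zero>) \<in> Fr C" using Fr_mono[OF Fr_proj[OF assms, of C]] by auto
  show "(\<lambda>b. if b \<in> - C then v b else \<zero>) \<in> Fr (D - C)" using Fr_mono[OF Fr_proj[OF assms, of "- C"], of "D - C"] by auto
  show "v = (\<lambda>b. (if b \<in> C then v b else \<zero>) \<oplus> (if b \<in> - C then v b else \<zero>))"
    using Fr_in[OF assms] by (auto simp: fun_eq_iff)
qed

definition cocycle where
  "cocycle N B d n h \<longleftrightarrow> h \<in> free_hom (B n) N \<and> (\<forall>v\<in>Fr (B (Suc n)). h (d (Suc n) v) = \<zero>\<^bsub>N\<^esub>)"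

definition coboundary where
  "coboundary N B d n h \<longleftrightarrow> (\<exists>g\<in>free_hom (B (n - 1)) N. \<forall>v\<in>Fr (B n). h v = g (d n v))"

lemma cocycle_diff:
  assumes "module R N" "complex B d" "cocycle N B d n f" "cocycle N B d n g"
  shows "cocycle N B d n (\<lambda>v. f v \<ominus>\<^bsub>N\<^esub> g v)"
proof -
  interpret N: module R N by fact
  show ?thesis using assms(3,4) hom_diff[OF assms(1)] by (auto simp: cocycle_def a_minus_def)
qed

lemma cocycle_smult:
  assumes "module R N" "complex B d" "cocycle N B d n f" "r \<in> carrier R"
  shows "cocycle N B d n (\<lambda>v. r \<odot>\<^bsub>N\<^esub> f v)"
proof -
  interpret N: module R N by fact
  show ?thesis using assms(3,4) hom_smult[OF assms(1)] by (auto simp: cocycle_def)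
qed

lemma cocycle_d:
  assumes "module R N" "complex B d" "g \<in> free_hom (B (n - 1)) N"
  shows "cocycle N B d n (\<lambda>v. g (d n v))"
  using hom_comp[OF complexD(2)[OF assms(2)] assms(3)] fr_hom(4)[OF assms(3,1)] complexD(4)[OF assms(2)]
  by (auto simp: cocycle_def)

lemma coboundary_add:
  assumes "module R N" "coboundary N B d n f" "coboundary N B d n g"
  shows "coboundary N B d n (\<lambda>v. f v \<oplus>\<^bsub>N\<^esub> g v)"
proof -
  from assms obtain a b where ab: "a\<in>free_hom (B (n - 1)) N" "\<forall>v\<in>Fr (B n). f v = a (d n v)"
    "b\<in>free_hom (B (n - 1)) N" "\<forall>v\<in>Fr (B n). g v = b (d n v)"
    unfolding coboundary_def by blast
  show ?thesis unfolding coboundary_def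
    by (rule bexI[OF _ hom_add[OF assms(1) ab(1,3)]]) (simp add: ab)
qed

lemma coboundary_cong:
  "coboundary N B d n f \<Longrightarrow> (\<And>v. v \<in> Fr (B n) \<Longrightarrow> g v = f v) \<Longrightarrow> coboundary N B d n g"
  by (auto simp: coboundary_def)

lemma cocycle_subset:
  assumes "cocycle N B d n h" "subcomplex C B d"
  shows "cocycle N C d n h"
  using assms free_hom_subset[OF _ subcomplexD(1)[OF assms(2)]] free_carrier_mono[OF subcomplexD(1)[OF assms(2), of "Suc n"]]
  by (auto simp: cocycle_def)

lemma coboundary_subset:
  assumes "coboundary N B d n h" "subcomplex C B d"
  shows "coboundary N C d n h"
  using assms free_hom_subset[OF _ subcomplexD(1)[OF assms(2)]] free_carrier_mono[OF subcomplexD(1)[OF assms(2), of n]]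
  unfolding coboundary_def by (meson subset_iff)

text \<open>Degree 0 of a complex is the zero module. This starts the induction on the degree and
  takes care of the truncated \<open>n - 1\<close> at n = 0.\<close>

lemma coboundary_0:
  assumes "module R N" "complex B d" "h (\<lambda>b. \<zero>) = \<zero>\<^bsub>N\<^esub>"
  shows "coboundary N B d 0 h"
  unfolding coboundary_def using complexD(1)[OF assms(2)] hom_zero[OF assms(1)]
  by (auto simp: assms(3) intro!: bexI[of _ "\<lambda>x. \<zero>\<^bsub>N\<^esub>"])

text \<open>With a homotopy k, the cochain h f equals h dQ k + h k dB. The first term vanishes
  because h is a cocycle, and h k is a primitive of the second. Congruence modulo T is enough since
  h vanishes on \<open>Fr (T n)\<close>.\<close>

lemma null_homotopic_coboundary:
  assumes N: "module R N" and B: "complex B dB" and Q: "complex Q dQ" and T: "subcomplex T Q dQ"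
    and f: "chain_map_mod B dB Q dQ T f" and ex: "exact_mod Q dQ T"
    and ex1: "\<And>v. v \<in> Fr (B 1) \<Longrightarrow> \<exists>w\<in>Fr (Q 2). agree_off (T 1) (dQ 2 w) (f 1 v)"
    and h: "cocycle N Q dQ n h" and hT: "\<And>v. v \<in> Fr (T n) \<Longrightarrow> h v = \<zero>\<^bsub>N\<^esub>"
  shows "coboundary N B dB n (\<lambda>v. h (f n v))"
proof -
  interpret N: module R N by fact
  have hh: "h \<in> free_hom (Q n) N" and hc: "\<And>v. v \<in> Fr (Q (Suc n)) \<Longrightarrow> h (dQ (Suc n) v) = \<zero>\<^bsub>N\<^esub>"
    using h by (auto simp: cocycle_def)
  have fh: "f n \<in> fhom (B n) (Q n)" for n using f by (simp add: chain_map_mod_def)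
  show ?thesis
  proof (cases n)
    case 0
    then show ?thesis using coboundary_0[OF N B, of "\<lambda>v. h (f n v)"] fhom(4)[OF fh] fr_hom(4)[OF hh N] by simp
  next
    case (Suc m)
    obtain k where kh: "\<And>n. k n \<in> fhom (B n) (Q (Suc n))" and
      k: "\<And>n v. v \<in> Fr (B (Suc n)) \<Longrightarrow>
        agree_off (T (Suc n)) (\<lambda>b. dQ (Suc (Suc n)) (k (Suc n) v) b \<oplus> k n (dB (Suc n) v) b) (f (Suc n) v)"
      using null_homotopy[OF B Q T f ex ex1] by blast
    have "h (f n v) = h (k m (dB n v))" if v: "v \<in> Fr (B n)" for v
    proof -
      have m: "k n v \<in> Fr (Q (Suc n))" "k m (dB n v) \<in> Fr (Q n)"
        using v fhom(1)[OF kh] complexD(5)[OF B, of v m] Suc by auto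
      then have m': "dQ (Suc n) (k n v) \<in> Fr (Q n)" using complexD(5)[OF Q] by blast
      have "h (f n v) = h (\<lambda>b. dQ (Suc n) (k n v) b \<oplus> k m (dB n v) b)"
        using k[of v m] v Suc fhom(1)[OF fh v] m m'
        by (intro hom_agree[OF N hh hT, symmetric]) (auto intro!: Fr_closed)
      also have "\<dots> = h (k m (dB n v))"
        using m m' hc fr_hom(1)[OF hh N] by (simp add: fr_hom(2)[OF hh N])
      finally show ?thesis .
    qed
    moreover have "(\<lambda>v. h (k m v)) \<in> free_hom (B (n - 1)) N"
      unfolding Suc diff_Suc_1 by (rule hom_comp[OF kh hh[unfolded Suc]])
    ultimately show ?thesis unfolding coboundary_def by (intro bexI[of _ "\<lambda>v. h (k m v)"]) auto
  qed
qed

text \<open>If the quotient complex is exact in degree 1 as well, the identity is null-homotopic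
  modulo C. This disposes of a cocycle once it has been made to vanish on a subcomplex that already
  carries the homology.\<close>

lemma relative_acyclic_coboundary:
  assumes N: "module R N" and B: "complex B d" and C: "subcomplex C B d" and ex: "exact_mod B d C"
    and ex1: "\<And>v. v \<in> Fr (B 1) \<Longrightarrow> \<exists>w\<in>Fr (B 2). agree_off (C 1) (d 2 w) v"
    and h: "cocycle N B d n h" "\<And>v. v \<in> Fr (C n) \<Longrightarrow> h v = \<zero>\<^bsub>N\<^esub>"
  shows "coboundary N B d n h"
  using null_homotopic_coboundary[OF N B B C _ ex _ h, of "\<lambda>n v. v"] ex1
  by (auto simp: chain_map_mod_def module_hom_def free_simps)

end

section \<open>The resolution of a submodule\<close>

text \<open>The resolution, shifted by one so that it starts with the zero module in degree 0; this makes
  coboundaries uniform in all degrees.\<close>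

definition res_basis :: "('a, 'r) ring_scheme \<Rightarrow> ('a, 'm, 'x) module_scheme \<Rightarrow> nat \<Rightarrow> ('a, 'm) syz set" where
  "res_basis R M n = (case n of 0 \<Rightarrow> {} | Suc k \<Rightarrow> syz_basis R M k)"

definition res_d :: "('a, 'r) ring_scheme \<Rightarrow> nat \<Rightarrow> (('a, 'm) syz \<Rightarrow> 'a) \<Rightarrow> ('a, 'm) syz \<Rightarrow> 'a" where
  "res_d R n v = (if n \<le> 1 then (\<lambda>b. \<zero>\<^bsub>R\<^esub>) else res_diff R v)"

text \<open>\<open>res_d\<close> is zero in degree 1, so cycles there are taken with respect to the
  augmentation; with this convention cycles and boundaries coincide in all positive degrees.\<close>

definition res_cycle :: "('a, 'r) ring_scheme \<Rightarrow> ('a, 'm, 'x) module_scheme \<Rightarrow> nat \<Rightarrow> (('a, 'm) syz \<Rightarrow> 'a) \<Rightarrow> bool" where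
  "res_cycle R M n v \<longleftrightarrow> (if n = 1 then res_augmentation R M v = \<zero>\<^bsub>M\<^esub> else res_d R n v = (\<lambda>b. \<zero>\<^bsub>R\<^esub>))"

lemma res_basis_0 [simp]: "res_basis R M 0 = {}"
  by (simp add: res_basis_def)

lemma res_basis_Suc: "res_basis R M (Suc n) = syz_basis R M n"
  by (simp add: res_basis_def)

declare syz_basis.simps [simp del]

lemma lin_comb_restrict [simp]: "lin_comb (M\<lparr>carrier := A\<rparr>) g l = lin_comb M g l"
  by (simp add: lin_comb_def)

text \<open>A basis element is a tree whose leaves are elements of the module. The syzygy conditions
  are evaluated with the operations of M, which do not change with the carrier; the carrier
  constrains the leaves alone.\<close>

lemma syz_basis_Int:
  fixes R :: "('a, 'r) ring_scheme" and M :: "('a, 'm, 'x) module_scheme"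
  shows "syz_basis R (M\<lparr>carrier := A\<rparr>) n \<inter> syz_basis R (M\<lparr>carrier := B\<rparr>) n = syz_basis R (M\<lparr>carrier := A \<inter> B\<rparr>) n"
proof (induction n)
  case (Suc n)
  have *: "Syz ` {l \<in> lists (carrier R \<times> X). P l} \<inter> Syz ` {l \<in> lists (carrier R \<times> Y). P l} =
      Syz ` {l \<in> lists (carrier R \<times> (X \<inter> Y)). P l}" for X Y :: "('a, 'm) syz set" and P
    by (auto simp: in_lists_conv_set)
  show ?case
  proof (cases n)
    case 0
    show ?thesis using Suc.IH unfolding 0 syz_basis.simps(2) lin_comb_restrict by (simp add: *)
  next
    case (Suc m)
    show ?thesis using Suc.IH unfolding Suc syz_basis.simps(3) by (simp add: *)
  qed
qed (auto simp: syz_basis.simps)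

lemma syz_basis_mono: "A \<subseteq> B \<Longrightarrow> syz_basis R (M\<lparr>carrier := A\<rparr>) n \<subseteq> syz_basis R (M\<lparr>carrier := B\<rparr>) n"
  by (metis Int_absorb2 Int_lower2 syz_basis_Int)

lemma res_basis_Int:
  "res_basis R (M\<lparr>carrier := A\<rparr>) n \<inter> res_basis R (M\<lparr>carrier := B\<rparr>) n = res_basis R (M\<lparr>carrier := A \<inter> B\<rparr>) n"
  by (cases n) (simp_all add: res_basis_Suc syz_basis_Int)

section \<open>The shifted resolution of a module and the subcomplexes given by submodules\<close>

context cring begin

lemma res_d_simps [simp]: "res_d R 0 v = (\<lambda>b. \<zero>)" "res_d R (Suc 0) v = (\<lambda>b. \<zero>)" "res_d R (Suc (Suc n)) v = res_diff R v"
  by (simp_all add: res_d_def)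

abbreviation "res_chains M n \<equiv> Fr (res_basis R M n)"
abbreviation "res_cocycle N M \<equiv> cocycle N (res_basis R M) (res_d R)"
abbreviation "res_coboundary N M \<equiv> coboundary N (res_basis R M) (res_d R)"

lemma res_complex:
  assumes "module R M" shows "complex (res_basis R M) (res_d R)"
proof -
  interpret M: module R M by fact
  have "res_d R n \<in> fhom (res_basis R M n) (res_basis R M (n - 1))" for n
  proof (cases "n \<le> 1")
    case True then show ?thesis by (auto simp: res_d_def intro!: fhomI Fr_closed)
  next
    case False
    then obtain m where "n = Suc (Suc m)" by (metis One_nat_def not0_implies_Suc le_SucI le_refl)
    then show ?thesis using res_diff_hom[of M m] by (simp add: res_d_def[abs_def] res_module_def res_basis_Suc)
  qed
  moreover have "res_d R n (res_d R (Suc n) v) = (\<lambda>b. \<zero>)" if v: "v \<in> res_chains M (Suc n)" for n v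
  proof (cases "n \<le> 1")
    case False
    then obtain m where n: "n = Suc (Suc m)" by (metis One_nat_def not0_implies_Suc le_SucI le_refl)
    then show ?thesis using v M.res_exact_Suc[of m] by (auto simp: res_module_def free_simps res_basis_Suc)
  qed (simp add: res_d_def)
  ultimately show ?thesis unfolding complex_def
    by (intro conjI allI ballI) (rule res_basis_0, assumption, blast)
qed

lemma res_cycle_exact:
  assumes "module R M" "n > 0" "v \<in> res_chains M n"
  shows "res_cycle R M n v \<longleftrightarrow> (\<exists>w\<in>res_chains M (Suc n). res_d R (Suc n) w = v)"
proof -
  interpret M: module R M by fact
  have "res_d R (Suc n) ` res_chains M (Suc n) = {v \<in> res_chains M n. res_cycle R M n v}"
  proof (cases "n = 1")
    case True
    then show ?thesis using M.res_exact_0 by (simp add: res_cycle_def res_module_def res_basis_Suc)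
  next
    case False
    then obtain k where "n = Suc (Suc k)" using assms(2) by (metis One_nat_def not0_implies_Suc less_numeral_extra(3))
    then show ?thesis using M.res_exact_Suc[of k] by (simp add: res_cycle_def res_module_def res_basis_Suc free_simps)
  qed
  then have "v \<in> res_d R (Suc n) ` res_chains M (Suc n) \<longleftrightarrow> res_cycle R M n v" using assms(3) by simp
  then show ?thesis unfolding image_iff by metis
qed

text \<open>If C is exact, F(M) modulo C is exact above degree 1: d v is a cycle of C, so d v = d w
  with w in C; then v - w is a cycle of F(M), hence a boundary, and it is congruent to v modulo
  C.\<close>

lemma res_exact_mod:
  assumes M: "module R M" and C: "subcomplex C (res_basis R M) (res_d R)"
    and ex: "\<And>n v. n > 0 \<Longrightarrow> v \<in> Fr (C n) \<Longrightarrow> res_cycle R M n v \<Longrightarrow> \<exists>w\<in>Fr (C (Suc n)). res_d R (Suc n) w = v"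
  shows "exact_mod (res_basis R M) (res_d R) C"
  unfolding exact_mod_def
proof (intro allI impI ballI)
  fix n v assume n: "n \<ge> (2::nat)" and v: "v \<in> res_chains M n" and dv: "res_d R n v \<in> Fr (C (n - 1))"
  note cx = res_complex[OF M]
  obtain m where m: "n = Suc m" "m > 0" using n by (cases n) auto
  have vm: "v \<in> res_chains M (Suc m)" using v m by simp
  have dm: "res_d R n v \<in> res_chains M m" using complexD(5)[OF cx vm] m by simp
  have "res_cycle R M m (res_d R n v)"
    using res_cycle_exact[OF M m(2) dm] vm m by auto
  then obtain w where w: "w \<in> Fr (C n)" "res_d R n w = res_d R n v" using ex[OF m(2), of "res_d R n v"] dv m by auto
  have wB: "w \<in> res_chains M n" using Fr_mono[OF w(1)] subcomplexD(1)[OF C] by blast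
  let ?z = "\<lambda>b. v b \<ominus> w b"
  have z: "?z \<in> res_chains M n" using v wB by (rule Fr_closed)
  have "res_d R n ?z = (\<lambda>b. \<zero>)"
    using fhom(5)[OF complexD(2)[OF cx] v wB] Fr_in[OF dm] w(2) by (simp add: a_minus_def r_neg)
  then have "res_cycle R M n ?z" using n by (simp add: res_cycle_def)
  then obtain u where u: "u\<in>res_chains M (Suc n)" "res_d R (Suc n) u = ?z"
    using res_cycle_exact[OF M _ z] m by auto
  have "agree_off (C n) ?z v" using Fr_outside[OF w(1)] Fr_in[OF v] by (auto simp: agree_off_def a_minus_def)
  then show "\<exists>w\<in>res_chains M (Suc n). agree_off (C n) (res_d R (Suc n) w) v"
    using u by metis
qed

lemma submodule_module: "submodule A R M \<Longrightarrow> module R M \<Longrightarrow> module R (M\<lparr>carrier := A\<rparr>)"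
  by (rule submodule.submodule_is_module)

lemma submodule_in: "submodule A R M \<Longrightarrow> x \<in> A \<Longrightarrow> x \<in> carrier M"
  using subgroup.subset[of A "add_monoid M"] by (auto simp: submodule_def)

lemma res_basis_submodule: "A \<subseteq> carrier M \<Longrightarrow> res_basis R (M\<lparr>carrier := A\<rparr>) n \<subseteq> res_basis R M n"
  using syz_basis_mono[of A "carrier M" R M] by (cases n) (auto simp: res_basis_Suc)

lemma res_subcomplex:
  assumes "submodule A R M" "module R M"
  shows "subcomplex (res_basis R (M\<lparr>carrier := A\<rparr>)) (res_basis R M) (res_d R)"
  using complexD(2)[OF res_complex[OF submodule_module[OF assms]]] res_basis_submodule[of A M] submodule_in[OF assms(1)]
  by (fastforce simp: subcomplex_def intro: fhom(1))

lemma res_augmentation_lin_comb: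
  assumes "module R M" "l \<in> lists (carrier R \<times> syz_basis R M 0)"
  shows "res_augmentation R M (lin_comb (free_module R UNIV) (unit_vec R) l) = lin_comb M gen_of l"
  unfolding res_augmentation_def by (rule module.lin_ext_lin_comb[OF assms]) (auto simp: syz_basis.simps)

lemma res_augmentation_submodule:
  assumes "submodule A R M" "module R M" "v \<in> res_chains (M\<lparr>carrier := A\<rparr>) 1"
  shows "res_augmentation R (M\<lparr>carrier := A\<rparr>) v = res_augmentation R M v"
proof -
  obtain l where l: "l \<in> lists (carrier R \<times> syz_basis R (M\<lparr>carrier := A\<rparr>) 0)" "lin_comb (free_module R UNIV) (unit_vec R) l = v"
    using free_is_lin_comb[of v] assms(3) by (auto simp: res_basis_Suc)
  have "l \<in> lists (carrier R \<times> syz_basis R M 0)" using l(1) submodule_in[OF assms(1)] by (auto simp: in_lists_conv_set syz_basis.simps)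
  from res_augmentation_lin_comb[OF submodule_module[OF assms(1,2)] l(1)] res_augmentation_lin_comb[OF assms(2) this]
  show ?thesis by (simp add: l(2))
qed

lemma res_cycle_submodule:
  assumes "submodule A R M" "module R M" "v \<in> res_chains (M\<lparr>carrier := A\<rparr>) n"
  shows "res_cycle R (M\<lparr>carrier := A\<rparr>) n v \<longleftrightarrow> res_cycle R M n v"
  using res_augmentation_submodule[OF assms(1,2), of v] assms(3) by (auto simp: res_cycle_def)

lemma submodule_cycle_exact:
  assumes A: "submodule A R M" and M: "module R M" and n: "n > 0"
    and v: "v \<in> res_chains (M\<lparr>carrier := A\<rparr>) n" and c: "res_cycle R M n v"
  shows "\<exists>w\<in>res_chains (M\<lparr>carrier := A\<rparr>) (Suc n). res_d R (Suc n) w = v"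
  using c res_cycle_exact[OF submodule_module[OF A M] n v] res_cycle_submodule[OF A M v] by simp

lemma submodule_exact_mod:
  assumes "submodule A R M" "module R M"
  shows "exact_mod (res_basis R M) (res_d R) (res_basis R (M\<lparr>carrier := A\<rparr>))"
  by (rule res_exact_mod[OF assms(2) res_subcomplex[OF assms] submodule_cycle_exact[OF assms]])

text \<open>Over the empty subcomplex congruence is equality, which turns the relative statements
  into absolute ones.\<close>

lemma empty_subcomplex: "complex B d \<Longrightarrow> subcomplex (\<lambda>n. {}) B d"
  using fhom(4)[OF complexD(2)] by (auto simp: subcomplex_def)

lemma empty_exact_mod:
  assumes "module R M"
  shows "exact_mod (res_basis R M) (res_d R) (\<lambda>n. {})"
proof (rule res_exact_mod[OF assms empty_subcomplex[OF res_complex[OF assms]]])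
  fix n v assume "n > 0" "v \<in> Fr {}" "res_cycle R M n v"
  then show "\<exists>w\<in>Fr {}. res_d R (Suc n) w = v"
    using fhom(4)[OF complexD(2)[OF res_complex[OF assms]], of "Suc n"] by simp
qed

text \<open>The resolution of the zero module is not the zero complex, but it is exact in degree 1
  too, because everything in degree 1 has augmentation zero.\<close>

lemma zero_module_coboundary:
  assumes N: "module R N" and M: "module R M" "carrier M = {\<zero>\<^bsub>M\<^esub>}" and h: "res_cocycle N M n h"
  shows "res_coboundary N M n h"
proof (rule relative_acyclic_coboundary[OF N res_complex[OF M(1)] empty_subcomplex[OF res_complex[OF M(1)]] empty_exact_mod[OF M(1)] _ h])
  interpret M: module R M by fact
  fix v assume v: "v \<in> res_chains M 1"
  have "res_augmentation R M v \<in> carrier M" using M.res_augmentation_hom v by (auto simp: module_hom_def res_module_def res_basis_Suc)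
  then have "res_cycle R M 1 v" using M(2) by (simp add: res_cycle_def)
  then show "\<exists>w\<in>res_chains M 2. agree_off {} (res_d R 2 w) v"
    using res_cycle_exact[OF M(1) _ v] unfolding numeral_2_eq_2 One_nat_def agree_off_empty by blast
next
  show "h v = \<zero>\<^bsub>N\<^esub>" if "v \<in> Fr {}" for v using that h fr_hom(4)[OF _ N] by (auto simp: cocycle_def)
qed

lemma zero_submodule_coboundary:
  assumes N: "module R N" and M: "module R M" and h: "res_cocycle N M n h"
  shows "res_coboundary N (M\<lparr>carrier := {\<zero>\<^bsub>M\<^esub>}\<rparr>) n h"
  by (rule zero_module_coboundary[OF N submodule_module[OF zero_submodule[OF M] M] _
     cocycle_subset[OF h res_subcomplex[OF zero_submodule[OF M] M]]]) simp

end

lemma (in abelian_group) minus_self: "x \<in> carrier G \<Longrightarrow> x \<ominus> x = \<zero>"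
  by (simp add: a_minus_def r_neg)

lemma (in abelian_group) add_minus_cancel:
  "x \<in> carrier G \<Longrightarrow> y \<in> carrier G \<Longrightarrow> (x \<oplus> y) \<ominus> x = y"
  by (simp add: a_minus_def a_comm[of x y] a_assoc r_neg)

lemma submodule_zero: "submodule A R M \<Longrightarrow> \<zero>\<^bsub>M\<^esub> \<in> A"
  using subgroup.one_closed[of A "add_monoid M"] by (auto simp: submodule_def)

lemma submodule_Int:
  assumes "submodule A R M" "submodule B R M" "module R M"
  shows "submodule (A \<inter> B) R M"
proof -
  interpret M: module R M by fact
  show ?thesis using M.submoduleE[OF assms(1)] M.submoduleE[OF assms(2)] submodule_zero[OF assms(1)] submodule_zero[OF assms(2)]
    by (intro M.submoduleI) auto
qed

section \<open>Sums of two submodules and Mayer-Vietoris\<close>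

context cring begin

lemma augmentation_hom:
  "module R M \<Longrightarrow> res_augmentation R M \<in> free_hom (res_basis R M 1) M"
  using module.res_augmentation_hom[of R M] by (simp add: res_module_def res_basis_Suc)

lemma augmentation_image:
  "module R M \<Longrightarrow> res_augmentation R M ` res_chains M 1 = carrier M"
  using module.res_augmentation_surj[of R M] by (simp add: res_module_def res_basis_Suc)

lemma submodule_augmentation_image:
  assumes "submodule A R M" "module R M"
  shows "res_augmentation R M ` res_chains (M\<lparr>carrier := A\<rparr>) 1 = A"
proof -
  have "res_augmentation R M ` res_chains (M\<lparr>carrier := A\<rparr>) 1
      = res_augmentation R (M\<lparr>carrier := A\<rparr>) ` res_chains (M\<lparr>carrier := A\<rparr>) 1"
    by (rule image_cong[OF refl res_augmentation_submodule[OF assms, symmetric]])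
  then show ?thesis using augmentation_image[OF submodule_module[OF assms]] by simp
qed

text \<open>F(A) + F(B) is in general smaller than the resolution of A + B, yet it is exact as well:
  the two summands intersect in F(A \<inter> B), which is exact itself.\<close>

lemma Un_exact_mod:
  assumes A: "submodule A R M" and B: "submodule B R M" and M: "module R M"
  defines "C \<equiv> \<lambda>n. res_basis R (M\<lparr>carrier := A\<rparr>) n \<union> res_basis R (M\<lparr>carrier := B\<rparr>) n"
  shows "subcomplex C (res_basis R M) (res_d R)" "exact_mod (res_basis R M) (res_d R) C"
proof -
  let ?A = "res_basis R (M\<lparr>carrier := A\<rparr>)" and ?B = "res_basis R (M\<lparr>carrier := B\<rparr>)"
  interpret M: module R M by fact
  note cx = res_complex[OF M]
  note sA = res_subcomplex[OF A M] and sB = res_subcomplex[OF B M]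
  have dec: "\<exists>x\<in>Fr (?A n). \<exists>y\<in>Fr (?B n). v = (\<lambda>b. x b \<oplus> y b)" if v: "v \<in> Fr (C n)" for v n
  proof -
    obtain x y where "x \<in> Fr (?A n)" "y \<in> Fr (?B n - ?A n)" "v = (\<lambda>b. x b \<oplus> y b)"
      using Fr_Un[OF v[unfolded C_def]] .
    then show ?thesis using Fr_mono[of y "?B n - ?A n" "?B n"] by (intro bexI[of _ x] bexI[of _ y]) auto
  qed
  have inM: "v \<in> Fr (?A n) \<Longrightarrow> v \<in> res_chains M n" "v \<in> Fr (?B n) \<Longrightarrow> v \<in> res_chains M n" for v n
    by (rule Fr_mono[OF _ subcomplexD(1)[OF sA]] Fr_mono[OF _ subcomplexD(1)[OF sB]]; assumption)+
  have inC: "v \<in> Fr (?A n) \<Longrightarrow> v \<in> Fr (C n)" "v \<in> Fr (?B n) \<Longrightarrow> v \<in> Fr (C n)" for v n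
    by (erule Fr_mono, auto simp: C_def)+
  show sub: "subcomplex C (res_basis R M) (res_d R)"
    unfolding subcomplex_def
  proof (intro allI conjI ballI)
    fix n show "C n \<subseteq> res_basis R M n" using subcomplexD(1)[OF sA] subcomplexD(1)[OF sB] by (auto simp: C_def)
    fix v assume "v \<in> Fr (C n)"
    then obtain x y where xy: "x \<in> Fr (?A n)" "y \<in> Fr (?B n)" "v = (\<lambda>b. x b \<oplus> y b)" using dec by blast
    have "res_d R n v = (\<lambda>b. res_d R n x b \<oplus> res_d R n y b)"
      unfolding xy(3) using xy inM by (intro fhom(2)[OF complexD(2)[OF cx]]) auto
    then show "res_d R n v \<in> Fr (C (n - 1))"
      using inC(1)[OF subcomplexD(2)[OF sA xy(1)]] inC(2)[OF subcomplexD(2)[OF sB xy(2)]] by (simp add: Fr_closed)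
  qed
  show "exact_mod (res_basis R M) (res_d R) C"
  proof (rule res_exact_mod[OF M sub])
    fix n v assume n: "n > (0::nat)" and v: "v \<in> Fr (C n)" and cyc: "res_cycle R M n v"
    obtain x y where xy: "x \<in> Fr (?A n)" "y \<in> Fr (?B n)" "v = (\<lambda>b. x b \<oplus> y b)" using dec[OF v] by blast
    let ?I = "res_basis R (M\<lparr>carrier := A \<inter> B\<rparr>)"
    have I: "submodule (A \<inter> B) R M" by (rule submodule_Int[OF A B M])
    text \<open>The boundary (or augmentation) of \<open>x\<close> is minus that of \<open>y\<close>, hence comes from \<open>A \<inter> B\<close>;
      subtracting a preimage \<open>z\<close> splits \<open>v\<close> into a cycle of \<open>A\<close> and a cycle of \<open>B\<close>.\<close>
    have "\<exists>z\<in>Fr (?I n). res_cycle R M n (\<lambda>b. x b \<ominus> z b)"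
    proof (cases "n = 1")
      case True
      have ah: "res_augmentation R M \<in> free_hom (res_basis R M n) M"
        using augmentation_hom[OF M] True by simp
      have "res_augmentation R M x \<oplus>\<^bsub>M\<^esub> res_augmentation R M y = \<zero>\<^bsub>M\<^esub>"
        using cyc True xy inM by (simp add: res_cycle_def fr_hom(2)[OF ah M])
      then have eq: "res_augmentation R M x = \<ominus>\<^bsub>M\<^esub> res_augmentation R M y"
        using fr_hom(1)[OF ah M inM(1)[OF xy(1)]] fr_hom(1)[OF ah M inM(2)[OF xy(2)]] by (intro M.M.minus_equality[symmetric])
      have aA: "res_augmentation R M x \<in> A"
        using submodule_augmentation_image[OF A M] xy(1) True by blast
      have "res_augmentation R M y \<in> B"
        using submodule_augmentation_image[OF B M] xy(2) True by blast
      then have "res_augmentation R M x \<in> B" using eq M.submoduleE(3)[OF B] by simp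
      then have "res_augmentation R M x \<in> res_augmentation R M ` Fr (?I n)"
        using aA submodule_augmentation_image[OF I M] True by simp
      then obtain z where z: "z \<in> Fr (?I n)" "res_augmentation R M x = res_augmentation R M z" by blast
      have "z \<in> res_chains M n" by (rule Fr_mono[OF z(1) subcomplexD(1)[OF res_subcomplex[OF I M]]])
      then have "res_augmentation R M (\<lambda>b. x b \<ominus> z b) = \<zero>\<^bsub>M\<^esub>"
        using xy inM z fr_hom(1)[OF ah M] by (simp add: fr_hom(5)[OF ah M] M.M.minus_self)
      then show ?thesis using True z by (auto simp: res_cycle_def)
    next
      case False
      then obtain m where m: "n = Suc m" "m > 0" using n by (cases n) auto
      have dh: "res_d R n \<in> fhom (res_basis R M n) (res_basis R M m)" using complexD(3)[OF cx] m by simp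
      have "(\<lambda>b. res_d R n x b \<oplus> res_d R n y b) = (\<lambda>b. \<zero>)"
        using cyc False xy inM by (simp add: res_cycle_def fhom(2)[OF dh])
      moreover have dm: "res_d R n x \<in> res_chains M m" "res_d R n y \<in> res_chains M m" using fhom(1)[OF dh] inM xy by auto
      ultimately have "res_d R n x b = \<ominus> res_d R n y b" for b
        using Fr_in[OF dm(1)] Fr_in[OF dm(2)] by (intro minus_equality[symmetric]) (auto dest: fun_cong)
      \<comment> \<open>Being negatives of each other, the two boundaries have the same support, so
        the one of \<open>x\<close> involves only basis elements common to both resolutions.\<close>
      then have "\<And>b. res_d R n x b = \<zero> \<longleftrightarrow> res_d R n y b = \<zero>"
        using Fr_in[OF dm(2)] by (metis add.inv_eq_1_iff)
      moreover have dA: "res_d R n x \<in> Fr (?A m)" "res_d R n y \<in> Fr (?B m)"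
        using subcomplexD(3)[OF sA, of x m] subcomplexD(3)[OF sB, of y m] xy m by auto
      ultimately have "agree_off (?B m) (res_d R n x) (\<lambda>b. \<zero>)" using Fr_outside[OF dA(2)] by (auto simp: agree_off_def)
      then have "res_d R n x \<in> Fr (?I m)" unfolding res_basis_Int[symmetric] by (rule Fr_Int[OF dA(1) Fr_agree[OF dm(1)]])
      moreover have "res_cycle R M m (res_d R n x)"
        using res_cycle_exact[OF M m(2) dm(1)] inM(1)[OF xy(1)] m by auto
      ultimately obtain z where z: "z \<in> Fr (?I n)" "res_d R n z = res_d R n x"
        using submodule_cycle_exact[OF I M m(2)] m by auto
      have "z \<in> res_chains M n" by (rule Fr_mono[OF z(1) subcomplexD(1)[OF res_subcomplex[OF I M]]])
      then have "res_d R n (\<lambda>b. x b \<ominus> z b) = (\<lambda>b. \<zero>)"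
        using xy inM z Fr_in[OF dm(1)] by (simp add: fhom(5)[OF dh] minus_self)
      then show ?thesis using z False by (auto simp: res_cycle_def)
    qed
    then obtain z where z: "z \<in> Fr (?I n)" "res_cycle R M n (\<lambda>b. x b \<ominus> z b)" by blast
    have zAB: "z \<in> Fr (?A n)" "z \<in> Fr (?B n)" using Fr_mono[OF z(1)] by (metis inf_le1 res_basis_Int, metis inf_le2 res_basis_Int)
    have x': "(\<lambda>b. x b \<ominus> z b) \<in> Fr (?A n)" and y': "(\<lambda>b. y b \<oplus> z b) \<in> Fr (?B n)"
      using xy zAB by (auto intro!: Fr_closed)
    have v': "v = (\<lambda>b. (x b \<ominus> z b) \<oplus> (y b \<oplus> z b))"
      using xy(3) Fr_in[OF xy(1)] Fr_in[OF xy(2)] Fr_in[OF z(1)]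
      by (auto simp: fun_eq_iff a_minus_def a_ac r_neg1 r_neg2 r_neg)
    obtain u where u: "u \<in> Fr (?A (Suc n))" "res_d R (Suc n) u = (\<lambda>b. x b \<ominus> z b)"
      using submodule_cycle_exact[OF A M n x' z(2)] by blast
    \<comment> \<open>\<open>y + z\<close> is the difference of the boundaries \<open>v\<close> and
      \<open>x - z\<close>, hence a cycle of F(M) that lies in F(B) and therefore bounds
      there.\<close>
    have y'': "(\<lambda>b. y b \<oplus> z b) = (\<lambda>b. v b \<ominus> (x b \<ominus> z b))"
      unfolding v' using Fr_in[OF x'] Fr_in[OF y'] by (simp add: add_minus_cancel)
    obtain w0 where w0: "w0 \<in> res_chains M (Suc n)" "res_d R (Suc n) w0 = v"
      using res_cycle_exact[OF M n Fr_mono[OF v subcomplexD(1)[OF sub]]] cyc by blast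
    have "res_d R (Suc n) (\<lambda>b. w0 b \<ominus> u b) = (\<lambda>b. y b \<oplus> z b)"
      unfolding y'' using w0 u inM by (simp add: fhom(5)[OF complexD(3)[OF cx]])
    moreover have "(\<lambda>b. w0 b \<ominus> u b) \<in> res_chains M (Suc n)" using w0 u inM by (auto intro!: Fr_closed)
    ultimately have "res_cycle R M n (\<lambda>b. y b \<oplus> z b)"
      using res_cycle_exact[OF M n inM(2)[OF y']] by auto
    then obtain u' where u': "u' \<in> Fr (?B (Suc n))" "res_d R (Suc n) u' = (\<lambda>b. y b \<oplus> z b)"
      using submodule_cycle_exact[OF B M n y'] by blast
    have "res_d R (Suc n) (\<lambda>b. u b \<oplus> u' b) = v"
      unfolding v' using u u' inM by (simp add: fhom(2)[OF complexD(3)[OF cx]])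
    moreover have "(\<lambda>b. u b \<oplus> u' b) \<in> Fr (C (Suc n))" using u u' inC by (auto intro!: Fr_closed)
    ultimately show "\<exists>w\<in>Fr (C (Suc n)). res_d R (Suc n) w = v" by blast
  qed
qed

text \<open>The class of \<open>\<alpha>\<close> - \<open>\<beta>\<close> on A \<inter> B is the
  obstruction to gluing the two primitives. Once it vanishes, a glued primitive is subtracted from
  h, and the rest vanishes on F(A) + F(B), modulo which F(M) is exact because A + B is all of
  M.\<close>

lemma mayer_vietoris:
  assumes A: "submodule A R M" and B: "submodule B R M" and M: "module R M" and N: "module R N"
    and sum: "\<And>x. x \<in> carrier M \<Longrightarrow> \<exists>a\<in>A. \<exists>b\<in>B. x = a \<oplus>\<^bsub>M\<^esub> b"
    and h: "res_cocycle N M n h"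
    and \<alpha>: "\<alpha> \<in> free_hom (res_basis R (M\<lparr>carrier := A\<rparr>) (n - 1)) N"
      "\<And>v. v \<in> res_chains (M\<lparr>carrier := A\<rparr>) n \<Longrightarrow> h v = \<alpha> (res_d R n v)"
    and \<beta>: "\<beta> \<in> free_hom (res_basis R (M\<lparr>carrier := B\<rparr>) (n - 1)) N"
      "\<And>v. v \<in> res_chains (M\<lparr>carrier := B\<rparr>) n \<Longrightarrow> h v = \<beta> (res_d R n v)"
    and cob: "res_coboundary N (M\<lparr>carrier := A \<inter> B\<rparr>) (n - 1) (\<lambda>v. \<alpha> v \<ominus>\<^bsub>N\<^esub> \<beta> v)"
  shows "res_coboundary N M n h"
proof (cases n)
  case 0
  then show ?thesis using h fr_hom(4)[OF _ N] coboundary_0[OF N res_complex[OF M]] by (auto simp: cocycle_def)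
next
  case (Suc m)
  let ?A = "res_basis R (M\<lparr>carrier := A\<rparr>)" and ?B = "res_basis R (M\<lparr>carrier := B\<rparr>)"
  let ?I = "res_basis R (M\<lparr>carrier := A \<inter> B\<rparr>)"
  interpret M: module R M by fact
  interpret N: module R N by fact
  note cx = res_complex[OF M]
  note sA = res_subcomplex[OF A M] and sB = res_subcomplex[OF B M]
  have AM: "?A k \<subseteq> res_basis R M k" and BM: "?B k \<subseteq> res_basis R M k" for k
    by (rule subcomplexD(1)[OF sA], rule subcomplexD(1)[OF sB])
  have IA: "?I k = ?A k \<inter> ?B k" for k by (simp add: res_basis_Int)
  have \<alpha>h: "\<alpha> \<in> free_hom (?A m) N" and \<beta>h: "\<beta> \<in> free_hom (?B m) N"
    using \<alpha>(1) \<beta>(1) Suc by auto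
  obtain \<gamma> where \<gamma>: "\<gamma> \<in> free_hom (?I (m - 1)) N" "\<And>v. v \<in> Fr (?I m) \<Longrightarrow> \<alpha> v \<ominus>\<^bsub>N\<^esub> \<beta> v = \<gamma> (res_d R m v)"
    using cob Suc unfolding coboundary_def by auto
  obtain \<gamma>' where \<gamma>': "\<gamma>' \<in> free_hom (?A (m - 1)) N" "\<And>v. v \<in> Fr (?I (m - 1)) \<Longrightarrow> \<gamma>' v = \<gamma> v"
  proof (rule free_hom_extend[OF N \<gamma>(1)])
    show "?I (m - 1) \<subseteq> ?A (m - 1)" using IA by simp
  qed (rule that)
  \<comment> \<open>The correction vanishes on boundaries, so \<open>\<alpha>'\<close> is still a
    primitive of \<open>h\<close> on A; by the choice of \<open>\<gamma>\<close> it agrees with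
    \<open>\<beta>\<close> on A \<inter> B.\<close>
  define \<alpha>' where "\<alpha>' v = \<alpha> v \<ominus>\<^bsub>N\<^esub> \<gamma>' (res_d R m v)" for v
  have dA: "res_d R m \<in> fhom (?A m) (?A (m - 1))"
    by (rule complexD(2)[OF res_complex[OF submodule_module[OF A M]]])
  have \<alpha>'h: "\<alpha>' \<in> free_hom (?A m) N"
    unfolding \<alpha>'_def[abs_def] by (rule hom_diff[OF N \<alpha>h hom_comp[OF dA \<gamma>'(1)]])
  have I: "submodule (A \<inter> B) R M" by (rule submodule_Int[OF A B M])
  have eq: "\<alpha>' v = \<beta> v" if v: "v \<in> Fr (?I m)" for v
  proof -
    have vA: "v \<in> Fr (?A m)" and vB: "v \<in> Fr (?B m)" using Fr_mono[OF v] IA by auto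
    have "\<alpha>' v = \<alpha> v \<ominus>\<^bsub>N\<^esub> (\<alpha> v \<ominus>\<^bsub>N\<^esub> \<beta> v)"
      using \<gamma>(2)[OF v] \<gamma>'(2)[OF subcomplexD(2)[OF res_subcomplex[OF I M] v]] by (simp add: \<alpha>'_def)
    then show ?thesis using fr_hom(1)[OF \<alpha>h N vA] fr_hom(1)[OF \<beta>h N vB]
      by (simp add: a_minus_def N.M.minus_add N.M.r_neg1 N.M.r_neg2)
  qed
  obtain \<alpha>'' where \<alpha>'': "\<alpha>'' \<in> free_hom (res_basis R M m) N"
    "\<And>v. v \<in> Fr (?A m) \<Longrightarrow> \<alpha>'' v = \<alpha>' v" "\<And>D v. v \<in> Fr D \<Longrightarrow> D \<inter> ?A m = {} \<Longrightarrow> \<alpha>'' v = \<zero>\<^bsub>N\<^esub>"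
    by (rule free_hom_extend[OF N \<alpha>'h AM]) (rule that)
  \<comment> \<open>Only the basis elements of F(B) outside F(A) are used, so that the sum
    \<open>\<eta>\<close> of the two extensions by zero restricts to \<open>\<alpha>'\<close> on
    F(A) and to \<open>\<beta>\<close> on F(B).\<close>
  have \<beta>d: "\<beta> \<in> free_hom (?B m - ?A m) N" by (rule free_hom_subset[OF \<beta>h]) auto
  obtain \<beta>' where \<beta>': "\<beta>' \<in> free_hom (res_basis R M m) N"
    "\<And>v. v \<in> Fr (?B m - ?A m) \<Longrightarrow> \<beta>' v = \<beta> v" "\<And>D v. v \<in> Fr D \<Longrightarrow> D \<inter> (?B m - ?A m) = {} \<Longrightarrow> \<beta>' v = \<zero>\<^bsub>N\<^esub>"
  proof (rule free_hom_extend[OF N \<beta>d])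
    show "?B m - ?A m \<subseteq> res_basis R M m" using BM by auto
  qed (rule that)
  define \<eta> where "\<eta> v = \<alpha>'' v \<oplus>\<^bsub>N\<^esub> \<beta>' v" for v
  have \<eta>: "\<eta> \<in> free_hom (res_basis R M m) N"
    unfolding \<eta>_def[abs_def] by (rule hom_add[OF N \<alpha>''(1) \<beta>'(1)])
  have \<eta>A: "\<eta> v = \<alpha>' v" if v: "v \<in> Fr (?A m)" for v
    using \<alpha>''(2)[OF v] \<beta>'(3)[OF v] fr_hom(1)[OF \<alpha>'h N v] by (auto simp: \<eta>_def)
  have \<eta>B': "\<eta> v = \<beta> v" if v: "v \<in> Fr (?B m - ?A m)" for v
  proof -
    have "\<alpha>'' v = \<zero>\<^bsub>N\<^esub>" by (rule \<alpha>''(3)[OF v]) auto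
    then show ?thesis using \<beta>'(2)[OF v] fr_hom(1)[OF \<beta>d N v] by (simp add: \<eta>_def)
  qed
  have \<eta>B: "\<eta> v = \<beta> v" if v: "v \<in> Fr (?B m)" for v
  proof -
    have "v \<in> Fr (?I m \<union> ?B m)" using Fr_mono[OF v] by blast
    then obtain x y where xy: "x \<in> Fr (?I m)" "y \<in> Fr (?B m - ?I m)" "v = (\<lambda>b. x b \<oplus> y b)" by (rule Fr_Un)
    have y: "y \<in> Fr (?B m - ?A m)" "y \<in> Fr (?B m)" "y \<in> res_chains M m" and x: "x \<in> Fr (?A m)" "x \<in> Fr (?B m)" "x \<in> res_chains M m"
      using Fr_mono[OF xy(2)] Fr_mono[OF xy(1)] IA[of m] AM[of m] BM[of m] by (auto simp: subset_iff)
    show ?thesis unfolding xy(3) using x y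
      by (simp add: fr_hom(2)[OF \<eta> N] fr_hom(2)[OF \<beta>h N] \<eta>A \<eta>B' eq[OF xy(1)])
  qed
  define C where "C = (\<lambda>n. ?A n \<union> ?B n)"
  define h' where "h' v = h v \<ominus>\<^bsub>N\<^esub> \<eta> (res_d R n v)" for v
  have \<eta>n: "\<eta> \<in> free_hom (res_basis R M (n - 1)) N" using \<eta> Suc by simp
  have h': "res_cocycle N M n h'"
    unfolding h'_def[abs_def] by (rule cocycle_diff[OF N cx h cocycle_d[OF N cx \<eta>n]])
  have h'h: "h' \<in> free_hom (res_basis R M n) N" and hh: "h \<in> free_hom (res_basis R M n) N"
    using h' h by (auto simp: cocycle_def)
  have hA: "h' v = \<zero>\<^bsub>N\<^esub>" if v: "v \<in> Fr (?A n)" for v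
  proof -
    have d: "res_d R n v \<in> Fr (?A m)" using subcomplexD(3)[OF sA, of v m] v Suc by simp
    have "res_d R m (res_d R n v) = (\<lambda>b. \<zero>)" using complexD(4)[OF res_complex[OF submodule_module[OF A M]]] v Suc by simp
    then have "\<alpha>' (res_d R n v) = \<alpha> (res_d R n v)" using fr_hom(4)[OF \<gamma>'(1) N] fr_hom(1)[OF \<alpha>h N d] by (simp add: \<alpha>'_def a_minus_def)
    then show ?thesis using \<alpha>(2)[OF v] \<eta>A[OF d] fr_hom(1)[OF \<alpha>h N d] by (simp add: h'_def a_minus_def N.M.r_neg)
  qed
  have hB: "h' v = \<zero>\<^bsub>N\<^esub>" if v: "v \<in> Fr (?B n)" for v
  proof -
    have d: "res_d R n v \<in> Fr (?B m)" using subcomplexD(3)[OF sB, of v m] v Suc by simp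
    then show ?thesis using \<beta>(2)[OF v] \<eta>B[OF d] fr_hom(1)[OF \<beta>h N d] by (simp add: h'_def a_minus_def N.M.r_neg)
  qed
  have "res_coboundary N M n h'"
  proof (rule relative_acyclic_coboundary[OF N cx Un_exact_mod(1)[OF A B M] Un_exact_mod(2)[OF A B M] _ h'])
    fix v assume "v \<in> Fr (?A n \<union> ?B n)"
    then obtain x y where xy: "x \<in> Fr (?A n)" "y \<in> Fr (?B n - ?A n)" "v = (\<lambda>b. x b \<oplus> y b)" by (rule Fr_Un)
    have y: "y \<in> Fr (?B n)" by (rule Fr_mono[OF xy(2)]) auto
    show "h' v = \<zero>\<^bsub>N\<^esub>" unfolding xy(3)
      using hA[OF xy(1)] hB[OF y] by (simp add: fr_hom(2)[OF h'h N Fr_mono[OF xy(1) AM] Fr_mono[OF y BM]])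
  next
    fix v assume v: "v \<in> res_chains M 1"
    \<comment> \<open>Exactness in degree 1: the augmentation of \<open>v\<close> splits into an
      element of A and one of B; subtracting lifts of both from \<open>v\<close> leaves a
      cycle.\<close>
    have ah: "res_augmentation R M \<in> free_hom (res_basis R M 1) M"
      by (rule augmentation_hom[OF M])
    obtain a b where ab: "a \<in> A" "b \<in> B" "res_augmentation R M v = a \<oplus>\<^bsub>M\<^esub> b" using sum[OF fr_hom(1)[OF ah M v]] by blast
    have lift: "\<exists>x\<in>res_chains (M\<lparr>carrier := X\<rparr>) 1. res_augmentation R M x = a" if "a \<in> X" "submodule X R M" for a X
    proof -
      have "a \<in> res_augmentation R M ` res_chains (M\<lparr>carrier := X\<rparr>) 1"
        using submodule_augmentation_image[OF that(2) M] that(1) by simp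
      then show ?thesis by blast
    qed
    obtain x y where xy: "x \<in> Fr (?A 1)" "res_augmentation R M x = a" "y \<in> Fr (?B 1)" "res_augmentation R M y = b"
      using lift[OF ab(1) A] lift[OF ab(2) B] by blast
    let ?s = "\<lambda>i. x i \<oplus> y i"
    have xyM: "x \<in> res_chains M 1" "y \<in> res_chains M 1"
      using Fr_mono[OF xy(1) AM] Fr_mono[OF xy(3) BM] by auto
    have s: "?s \<in> res_chains M 1" using xyM by (rule Fr_closed)
    have z: "(\<lambda>i. v i \<ominus> ?s i) \<in> res_chains M 1" using v s by (rule Fr_closed)
    have "a \<in> carrier M" "b \<in> carrier M" using ab submodule_in[OF A] submodule_in[OF B] by auto
    then have "res_cycle R M 1 (\<lambda>i. v i \<ominus> ?s i)"
      using ab xy by (simp add: res_cycle_def fr_hom(5)[OF ah M v s] fr_hom(2)[OF ah M xyM] M.M.minus_self)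
    then obtain w where w: "w \<in> res_chains M 2" "res_d R 2 w = (\<lambda>i. v i \<ominus> ?s i)"
      using res_cycle_exact[OF M _ z] by (auto simp: numeral_2_eq_2)
    have "agree_off (?A 1 \<union> ?B 1) (\<lambda>i. v i \<ominus> ?s i) v"
      using Fr_outside[OF xy(1)] Fr_outside[OF xy(3)] Fr_in[OF v] by (auto simp: agree_off_def a_minus_def)
    then show "\<exists>w\<in>res_chains M 2. agree_off (?A 1 \<union> ?B 1) (res_d R 2 w) v"
      by (intro bexI[OF _ w(1)]) (simp only: w(2))
  qed
  from coboundary_add[OF N this, of "\<lambda>v. \<eta> (res_d R n v)"] \<eta>n
  have "res_coboundary N M n (\<lambda>v. h' v \<oplus>\<^bsub>N\<^esub> \<eta> (res_d R n v))"
    unfolding coboundary_def by blast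
  then show ?thesis
  proof (rule coboundary_cong)
    fix v assume v: "v \<in> res_chains M n"
    have "res_d R n v \<in> res_chains M m" using complexD(5)[OF cx, of v m] v Suc by simp
    then show "h v = h' v \<oplus>\<^bsub>N\<^esub> \<eta> (res_d R n v)"
      using fr_hom(1)[OF hh N v] fr_hom(1)[OF \<eta> N] by (simp add: h'_def a_minus_def N.M.a_assoc N.M.l_neg)
  qed
qed

end

section \<open>Noetherian modules and finitely generated resolutions\<close>

lemma (in cring) ideal_of_closed:
  assumes I: "I \<subseteq> carrier R" "\<zero> \<in> I" "\<And>r s. r \<in> I \<Longrightarrow> s \<in> I \<Longrightarrow> r \<oplus> s \<in> I"
    and sm: "\<And>t r. t \<in> carrier R \<Longrightarrow> r \<in> I \<Longrightarrow> t \<otimes> r \<in> I"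
  shows "ideal I R"
proof -
  have "subgroup I (add_monoid R)"
  proof (rule add.subgroupI)
    fix a assume a: "a \<in> I"
    then have "\<ominus> a = \<ominus> \<one> \<otimes> a" using I(1) by (auto simp: l_minus)
    then show "\<ominus> a \<in> I" using sm[OF _ a, of "\<ominus> \<one>"] by simp
  qed (use I in auto)
  then show ?thesis
  proof (rule idealI[OF ring_axioms])
    fix a t assume *: "a \<in> I" "t \<in> carrier R"
    then show "t \<otimes> a \<in> I" by (rule sm[rotated])
    then show "a \<otimes> t \<in> I" using * I(1) by (metis m_comm subsetD)
  qed
qed

lemma (in cring) ideal_power_ideal': "ideal \<aa> R \<Longrightarrow> ideal (ideal_power R \<aa> n) R"
  by (induction n) (auto intro: oneideal ideal_prod_is_ideal)

lemma (in cring) ideal_power_add: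
  assumes "ideal \<aa> R"
  shows "ideal_power R \<aa> (k + l) = ideal_power R \<aa> k \<cdot> ideal_power R \<aa> l"
proof (induction k)
  case 0
  then show ?case
    using ideal_prod_commute[OF oneideal ideal_power_ideal'[OF assms]] ideal_prod_one[OF ideal_power_ideal'[OF assms]] by simp
next
  case (Suc k)
  then show ?case using ideal_prod_assoc[OF assms ideal_power_ideal'[OF assms] ideal_power_ideal'[OF assms]] by simp
qed

lemma (in noetherian_ring) maximal_ideal_exists:
  assumes "P I" "ideal I R"
  obtains J where "ideal J R" "P J" "\<And>K. ideal K R \<Longrightarrow> P K \<Longrightarrow> J \<subseteq> K \<Longrightarrow> K = J"
proof -
  let ?S = "{I. ideal I R \<and> P I}"
  have "\<exists>M\<in>?S. \<forall>X\<in>?S. M \<subseteq> X \<longrightarrow> X = M"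
  proof (rule subset_Zorn_nonempty)
    show "?S \<noteq> {}" using assms by blast
    fix C assume C: "C \<noteq> {}" "subset.chain ?S C"
    then have "subset.chain {I. ideal I R} C" by (auto simp: subset.chain_def)
    then have "\<Union>C \<in> C" using ideal_chain_is_trivial C(1) by blast
    then show "\<Union>C \<in> ?S" using C(2) by (auto simp: subset.chain_def)
  qed
  then show ?thesis using that by blast
qed

text \<open>An ideal that is maximal among those containing no power of \<open>\<aa>\<close> is prime.\<close>

lemma ideal_power_subset_of_primes:
  fixes R (structure)
  assumes "cring R" "noetherian_ring R" and \<aa>: "ideal \<aa> R" and Q: "ideal Q R"
    and primes: "\<And>p. primeideal p R \<Longrightarrow> Q \<subseteq> p \<Longrightarrow> \<aa> \<subseteq> p"
  shows "\<exists>k. ideal_power R \<aa> k \<subseteq> Q"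
proof (rule ccontr)
  interpret cring R by fact
  interpret noetherian_ring R by fact
  define P where "P J \<longleftrightarrow> Q \<subseteq> J \<and> (\<forall>k. \<not> ideal_power R \<aa> k \<subseteq> J)" for J
  assume "\<nexists>k. ideal_power R \<aa> k \<subseteq> Q"
  then have "P Q" by (auto simp: P_def)
  then obtain J where J: "ideal J R" "P J" "\<And>K. ideal K R \<Longrightarrow> P K \<Longrightarrow> J \<subseteq> K \<Longrightarrow> K = J"
    using maximal_ideal_exists[of P, OF _ Q] by blast
  interpret J: ideal J R by fact
  have bigger: "\<exists>k. ideal_power R \<aa> k \<subseteq> J <+>\<^bsub>R\<^esub> I" if I: "ideal I R" "\<not> I \<subseteq> J" for I
  proof -
    interpret I: ideal I R by fact
    have id: "ideal (J <+>\<^bsub>R\<^esub> I) R" by (rule add_ideals[OF J(1) I(1)])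
    have "x \<oplus> y \<in> J <+>\<^bsub>R\<^esub> I" if "x \<in> J" "y \<in> I" for x y
      unfolding set_add_def' using that by blast
    from this[OF _ I.zero_closed] this[OF J.zero_closed]
    have "x \<in> J \<Longrightarrow> x \<in> J <+>\<^bsub>R\<^esub> I" "x \<in> I \<Longrightarrow> x \<in> J <+>\<^bsub>R\<^esub> I" for x
      using J.Icarr I.Icarr by (metis r_zero, metis l_zero)
    then have "J \<subseteq> J <+>\<^bsub>R\<^esub> I" "J <+>\<^bsub>R\<^esub> I \<noteq> J" using I(2) by auto
    then have "\<not> P (J <+>\<^bsub>R\<^esub> I)" using J(3)[OF id] by blast
    then show ?thesis using J(2) \<open>J \<subseteq> J <+>\<^bsub>R\<^esub> I\<close> by (auto simp: P_def)
  qed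
  have "primeideal J R"
  proof (rule divides_ideal_prod_imp_primeideal[OF J(1)])
    show "J \<noteq> carrier R" using J(2) ideal.Icarr[OF ideal_power_ideal'[OF \<aa>]] unfolding P_def by blast
    fix I K assume I: "ideal I R" and K: "ideal K R" and IK: "I \<cdot> K \<subseteq> J"
    interpret I: ideal I R by fact
    interpret K: ideal K R by fact
    show "I \<subseteq> J \<or> K \<subseteq> J"
    proof (rule ccontr)
      assume "\<not> (I \<subseteq> J \<or> K \<subseteq> J)"
      then obtain k l where kl: "ideal_power R \<aa> k \<subseteq> J <+>\<^bsub>R\<^esub> I" "ideal_power R \<aa> l \<subseteq> J <+>\<^bsub>R\<^esub> K"
        using bigger[OF I] bigger[OF K] by blast
      \<comment> \<open>The product of J + I and J + K lies in J because I K does; it contains the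
        power of \<open>\<aa>\<close> with exponent \<open>k + l\<close>, against the choice of
        J.\<close>
      have "s \<in> J" if "s \<in> ideal_power R \<aa> k \<cdot> ideal_power R \<aa> l" for s
        using that
      proof (induction rule: ideal_prod.induct)
        case (prod x y)
        then obtain j i j' c where e: "x = j \<oplus> i" "y = j' \<oplus> c" "j \<in> J" "i \<in> I" "j' \<in> J" "c \<in> K"
          using kl unfolding set_add_def' by blast
        have c: "j \<in> carrier R" "i \<in> carrier R" "j' \<in> carrier R" "c \<in> carrier R"
          using e J.Icarr I.Icarr K.Icarr by auto
        have "i \<otimes> c \<in> J" using IK e by (auto intro: ideal_prod.prod)
        moreover have "x \<otimes> y = (j \<otimes> j' \<oplus> j \<otimes> c) \<oplus> (i \<otimes> j' \<oplus> i \<otimes> c)"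
          using c by (simp add: e l_distr r_distr a_ac)
        ultimately show ?case using e c J.I_l_closed J.I_r_closed J.a_closed by simp
      next
        case (sum s t) then show ?case by (simp add: J.a_closed)
      qed
      then show False using J(2) ideal_power_add[OF \<aa>, of k l] unfolding P_def by blast
    qed
  qed
  then have "\<aa> \<subseteq> J" using primes J(2) by (auto simp: P_def)
  moreover have "ideal_power R \<aa> 1 \<subseteq> \<aa>" using ideal_prod_one[OF \<aa>] by simp
  ultimately show False using J(2) unfolding P_def by (metis subset_trans)
qed

section \<open>Finitely generated submodules over a Noetherian ring\<close>

context module begin

definition module_span :: "'c set \<Rightarrow> 'c set"
  where "module_span X = \<Inter>{H. submodule H R M \<and> X \<subseteq> H}"

lemma submodule_Inter:
  assumes "\<H> \<noteq> {}" "\<And>H. H \<in> \<H> \<Longrightarrow> submodule H R M"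
  shows "submodule (\<Inter>\<H>) R M"
proof (rule submoduleI)
  show "\<Inter>\<H> \<subseteq> carrier M" using assms submoduleE(1) by blast
  show "\<zero>\<^bsub>M\<^esub> \<in> \<Inter>\<H>" using submodule_zero[OF assms(2)] by blast
  show "\<ominus>\<^bsub>M\<^esub> a \<in> \<Inter>\<H>" if "a \<in> \<Inter>\<H>" for a using that submoduleE(3)[OF assms(2)] by auto
  show "a \<oplus>\<^bsub>M\<^esub> b \<in> \<Inter>\<H>" if "a \<in> \<Inter>\<H>" "b \<in> \<Inter>\<H>" for a b using that submoduleE(5)[OF assms(2)] by auto
  show "r \<odot>\<^bsub>M\<^esub> a \<in> \<Inter>\<H>" if "r \<in> carrier R" "a \<in> \<Inter>\<H>" for r a using that submoduleE(4)[OF assms(2)] by auto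
qed

lemma span_submodule: "X \<subseteq> carrier M \<Longrightarrow> submodule (module_span X) R M"
  unfolding module_span_def using carrier_is_submodule by (intro submodule_Inter) auto

lemma span_superset: "X \<subseteq> module_span X"
  by (auto simp: module_span_def)

lemma span_minimal: "submodule H R M \<Longrightarrow> X \<subseteq> H \<Longrightarrow> module_span X \<subseteq> H"
  by (auto simp: module_span_def)

lemma span_mono: "X \<subseteq> Y \<Longrightarrow> module_span X \<subseteq> module_span Y"
  unfolding module_span_def by blast

lemma span_empty: "module_span {} = {\<zero>\<^bsub>M\<^esub>}"
proof
  have "submodule {\<zero>\<^bsub>M\<^esub>} R M" by (rule R.zero_submodule[OF module_axioms])
  then show "module_span {} \<subseteq> {\<zero>\<^bsub>M\<^esub>}" by (rule span_minimal) simp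
  show "{\<zero>\<^bsub>M\<^esub>} \<subseteq> module_span {}" using submodule_zero[OF span_submodule[of "{}"]] by simp
qed

lemma span_insert:
  assumes x: "x \<in> carrier M" and X: "X \<subseteq> carrier M" and h: "h \<in> module_span (insert x X)"
  shows "\<exists>r\<in>carrier R. \<exists>y\<in>module_span X. h = r \<odot>\<^bsub>M\<^esub> x \<oplus>\<^bsub>M\<^esub> y"
proof -
  note S = span_submodule[OF X]
  note E = submoduleE[OF S] and Z = submodule_zero[OF S]
  let ?H = "{r \<odot>\<^bsub>M\<^esub> x \<oplus>\<^bsub>M\<^esub> y |r y. r \<in> carrier R \<and> y \<in> module_span X}"
  have yc: "y \<in> carrier M" if "y \<in> module_span X" for y using E(1) that by blast
  have "submodule ?H R M"
  proof (rule submoduleI)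
    show "?H \<subseteq> carrier M" using x yc by auto
    show "\<zero>\<^bsub>M\<^esub> \<in> ?H" using Z x by (auto intro!: exI[of _ \<zero>] exI[of _ "\<zero>\<^bsub>M\<^esub>"])
  next
    fix a assume "a \<in> ?H"
    then obtain r y where *: "a = r \<odot>\<^bsub>M\<^esub> x \<oplus>\<^bsub>M\<^esub> y" "r \<in> carrier R" "y \<in> module_span X" by blast
    then have "\<ominus>\<^bsub>M\<^esub> a = (\<ominus> r) \<odot>\<^bsub>M\<^esub> x \<oplus>\<^bsub>M\<^esub> \<ominus>\<^bsub>M\<^esub> y" using x yc by (simp add: M.minus_add smult_l_minus)
    then show "\<ominus>\<^bsub>M\<^esub> a \<in> ?H" using * E(3) by blast
  next
    fix a b assume "a \<in> ?H" "b \<in> ?H"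
    then obtain r y s z where *: "a = r \<odot>\<^bsub>M\<^esub> x \<oplus>\<^bsub>M\<^esub> y" "r \<in> carrier R" "y \<in> module_span X"
      "b = s \<odot>\<^bsub>M\<^esub> x \<oplus>\<^bsub>M\<^esub> z" "s \<in> carrier R" "z \<in> module_span X" by blast
    then have "a \<oplus>\<^bsub>M\<^esub> b = (r \<oplus> s) \<odot>\<^bsub>M\<^esub> x \<oplus>\<^bsub>M\<^esub> (y \<oplus>\<^bsub>M\<^esub> z)" using x yc by (simp add: M.a_ac smult_l_distr)
    then show "a \<oplus>\<^bsub>M\<^esub> b \<in> ?H" using * E(5) by blast
  next
    fix t a assume t: "t \<in> carrier R" and "a \<in> ?H"
    then obtain r y where *: "a = r \<odot>\<^bsub>M\<^esub> x \<oplus>\<^bsub>M\<^esub> y" "r \<in> carrier R" "y \<in> module_span X" by blast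
    then have "t \<odot>\<^bsub>M\<^esub> a = (t \<otimes> r) \<odot>\<^bsub>M\<^esub> x \<oplus>\<^bsub>M\<^esub> t \<odot>\<^bsub>M\<^esub> y" using x yc t by (simp add: smult_r_distr smult_assoc1)
    then show "t \<odot>\<^bsub>M\<^esub> a \<in> ?H" using * E(4) t by blast
  qed
  moreover have "insert x X \<subseteq> ?H"
  proof
    fix z assume "z \<in> insert x X"
    then show "z \<in> ?H"
    proof
      assume "z = x" then have "z = \<one> \<odot>\<^bsub>M\<^esub> x \<oplus>\<^bsub>M\<^esub> \<zero>\<^bsub>M\<^esub>" using x by simp
      then show ?thesis using Z by blast
    next
      assume "z \<in> X" then have "z = \<zero> \<odot>\<^bsub>M\<^esub> x \<oplus>\<^bsub>M\<^esub> z" "z \<in> module_span X" using x X span_superset by auto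
      then show ?thesis by blast
    qed
  qed
  ultimately have "h \<in> ?H" using h span_minimal by blast
  then show ?thesis by blast
qed

text \<open>These are the leading coefficients of K: the coefficients at x of its elements modulo S.
  Through them the Noetherian property passes from the ring to modules.\<close>

lemma coefficient_ideal:
  assumes x: "x \<in> carrier M" and S: "submodule S R M" and K: "submodule K R M"
  shows "ideal {r \<in> carrier R. \<exists>y\<in>S. r \<odot>\<^bsub>M\<^esub> x \<oplus>\<^bsub>M\<^esub> y \<in> K} R" (is "ideal ?I R")
proof -
  note E = submoduleE[OF S] and F = submoduleE[OF K]
  have yc: "y \<in> carrier M" if "y \<in> S" for y using E(1) that by blast
  have sm: "t \<otimes> r \<in> ?I" if t: "t \<in> carrier R" and r: "r \<in> ?I" for t r
  proof -
    obtain y where y: "y \<in> S" "r \<odot>\<^bsub>M\<^esub> x \<oplus>\<^bsub>M\<^esub> y \<in> K" "r \<in> carrier R" using r by blast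
    then have "(t \<otimes> r) \<odot>\<^bsub>M\<^esub> x \<oplus>\<^bsub>M\<^esub> t \<odot>\<^bsub>M\<^esub> y = t \<odot>\<^bsub>M\<^esub> (r \<odot>\<^bsub>M\<^esub> x \<oplus>\<^bsub>M\<^esub> y)"
      using x yc t by (simp add: smult_r_distr smult_assoc1)
    then have "(t \<otimes> r) \<odot>\<^bsub>M\<^esub> x \<oplus>\<^bsub>M\<^esub> t \<odot>\<^bsub>M\<^esub> y \<in> K" using F(4)[OF t y(2)] by simp
    then show ?thesis using E(4)[OF t y(1)] t y(3) by blast
  qed
  have pl: "r \<oplus> s \<in> ?I" if r: "r \<in> ?I" and s: "s \<in> ?I" for r s
  proof -
    obtain y z where y: "y \<in> S" "r \<odot>\<^bsub>M\<^esub> x \<oplus>\<^bsub>M\<^esub> y \<in> K" "r \<in> carrier R" "z \<in> S" "s \<odot>\<^bsub>M\<^esub> x \<oplus>\<^bsub>M\<^esub> z \<in> K" "s \<in> carrier R"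
      using r s by blast
    then have "(r \<oplus> s) \<odot>\<^bsub>M\<^esub> x \<oplus>\<^bsub>M\<^esub> (y \<oplus>\<^bsub>M\<^esub> z) = (r \<odot>\<^bsub>M\<^esub> x \<oplus>\<^bsub>M\<^esub> y) \<oplus>\<^bsub>M\<^esub> (s \<odot>\<^bsub>M\<^esub> x \<oplus>\<^bsub>M\<^esub> z)"
      using x yc by (simp add: M.a_ac smult_l_distr)
    then have "(r \<oplus> s) \<odot>\<^bsub>M\<^esub> x \<oplus>\<^bsub>M\<^esub> (y \<oplus>\<^bsub>M\<^esub> z) \<in> K" using F(5)[OF y(2,5)] by simp
    then show ?thesis using E(5)[OF y(1,4)] y(3,6) by blast
  qed
  have z: "\<zero> \<in> ?I" using submodule_zero[OF S] submodule_zero[OF K] x by (auto intro!: bexI[of _ "\<zero>\<^bsub>M\<^esub>"])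
  show ?thesis by (rule R.ideal_of_closed[OF _ z pl sm]) auto
qed

text \<open>Induction on the number of generators as in Hilbert's basis theorem: finitely many
  elements of H realise generators of its ideal of leading coefficients, and the elements of H
  without leading term lie in the span of one generator less.\<close>

lemma noetherian_submodule_finite:
  assumes R: "noetherian_ring R" and "finite X" "X \<subseteq> carrier M" "submodule H R M" "H \<subseteq> module_span X"
  shows "\<exists>Y. finite Y \<and> Y \<subseteq> H \<and> H = module_span Y"
  using assms(2-)
proof (induction X arbitrary: H rule: finite_induct)
  case empty
  then have "H = module_span {}" using span_empty submodule_zero[of H R M] by auto
  then show ?case by (intro exI[of _ "{}"]) auto
next
  case (insert x X)
  have x: "x \<in> carrier M" and X: "X \<subseteq> carrier M" using insert by auto
  note S = span_submodule[OF X] and H = insert.prems(2)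
  define I where "I K = {r \<in> carrier R. \<exists>y\<in>module_span X. r \<odot>\<^bsub>M\<^esub> x \<oplus>\<^bsub>M\<^esub> y \<in> K}" for K
  have I: "ideal (I K) R" if "submodule K R M" for K unfolding I_def by (rule coefficient_ideal[OF x S that])
  obtain A where A: "A \<subseteq> carrier R" "finite A" "I H = genideal R A"
    using noetherian_ring.finetely_gen[OF R I[OF H]] by blast
  have "\<forall>r\<in>A. \<exists>y. y \<in> module_span X \<and> r \<odot>\<^bsub>M\<^esub> x \<oplus>\<^bsub>M\<^esub> y \<in> H"
    using R.genideal_self[OF A(1)] A(3) unfolding I_def by blast
  then obtain y where y: "\<And>r. r \<in> A \<Longrightarrow> y r \<in> module_span X" "\<And>r. r \<in> A \<Longrightarrow> r \<odot>\<^bsub>M\<^esub> x \<oplus>\<^bsub>M\<^esub> y r \<in> H" by metis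
  define Y1 where "Y1 = (\<lambda>r. r \<odot>\<^bsub>M\<^esub> x \<oplus>\<^bsub>M\<^esub> y r) ` A"
  have Y1: "finite Y1" "Y1 \<subseteq> H" "Y1 \<subseteq> carrier M" using A y submoduleE(1)[OF H] by (auto simp: Y1_def)
  obtain Y2 where Y2: "finite Y2" "Y2 \<subseteq> H \<inter> module_span X" "H \<inter> module_span X = module_span Y2"
    using insert.IH[OF X submodule_Int[OF H S module_axioms]] by blast
  have Y: "Y1 \<union> Y2 \<subseteq> carrier M" using Y1 Y2 submoduleE(1)[OF H] by auto
  note SY = submoduleE[OF span_submodule[OF Y]]
  have "h \<in> module_span (Y1 \<union> Y2)" if h: "h \<in> H" for h
  proof -
    obtain r u where ru: "r \<in> carrier R" "u \<in> module_span X" "h = r \<odot>\<^bsub>M\<^esub> x \<oplus>\<^bsub>M\<^esub> u"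
      using span_insert[OF x X] h insert.prems(3) by blast
    then have "r \<in> I H" using h by (auto simp: I_def)
    \<comment> \<open>Every leading coefficient of H already occurs in the span of
      \<open>Y1\<close>; subtracting from \<open>h\<close> an element of that span with the same
      coefficient leads into H \<inter> \<open>module_span X\<close>.\<close>
    moreover have "A \<subseteq> I (module_span Y1)"
      using A(1) y(1) span_superset[of Y1] unfolding I_def Y1_def by blast
    then have "I H \<subseteq> I (module_span Y1)" unfolding A(3)
      by (rule R.genideal_minimal[OF I[OF span_submodule[OF Y1(3)]]])
    ultimately obtain u' where u': "u' \<in> module_span X" "r \<odot>\<^bsub>M\<^esub> x \<oplus>\<^bsub>M\<^esub> u' \<in> module_span Y1" unfolding I_def by blast
    define z where "z = r \<odot>\<^bsub>M\<^esub> x \<oplus>\<^bsub>M\<^esub> u'"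
    have c: "u \<in> carrier M" "u' \<in> carrier M" "z \<in> carrier M" "r \<odot>\<^bsub>M\<^esub> x \<in> carrier M" "h \<in> carrier M"
      using ru(1,2) u'(1) submoduleE(1)[OF S] x h submoduleE(1)[OF H] by (auto simp: z_def)
    have zH: "z \<in> H" using u'(2) span_minimal[OF H Y1(2)] by (auto simp: z_def)
    have e: "h \<oplus>\<^bsub>M\<^esub> \<ominus>\<^bsub>M\<^esub> z = u \<oplus>\<^bsub>M\<^esub> \<ominus>\<^bsub>M\<^esub> u'"
      using c by (simp add: z_def ru(3) M.minus_add M.a_ac M.r_neg1 M.r_neg2 M.r_neg)
    have "h \<oplus>\<^bsub>M\<^esub> \<ominus>\<^bsub>M\<^esub> z \<in> H" using submoduleE(5)[OF H h] submoduleE(3)[OF H zH] by blast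
    moreover have "h \<oplus>\<^bsub>M\<^esub> \<ominus>\<^bsub>M\<^esub> z \<in> module_span X" unfolding e using submoduleE(5)[OF S ru(2)] submoduleE(3)[OF S u'(1)] by blast
    ultimately have "h \<oplus>\<^bsub>M\<^esub> \<ominus>\<^bsub>M\<^esub> z \<in> module_span (Y1 \<union> Y2)" using Y2(3) span_mono[of Y2 "Y1 \<union> Y2"] by blast
    moreover have "z \<in> module_span (Y1 \<union> Y2)" using u'(2) span_mono[of Y1 "Y1 \<union> Y2"] by (auto simp: z_def)
    ultimately have "z \<oplus>\<^bsub>M\<^esub> (h \<oplus>\<^bsub>M\<^esub> \<ominus>\<^bsub>M\<^esub> z) \<in> module_span (Y1 \<union> Y2)" using SY(5) by blast
    moreover have "z \<oplus>\<^bsub>M\<^esub> (h \<oplus>\<^bsub>M\<^esub> \<ominus>\<^bsub>M\<^esub> z) = h" using c by (simp add: M.a_lcomm[of z h] M.r_neg)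
    ultimately show ?thesis by simp
  qed
  moreover have "module_span (Y1 \<union> Y2) \<subseteq> H" using Y1 Y2 by (intro span_minimal[OF H]) auto
  ultimately show ?case using Y1 Y2 by (intro exI[of _ "Y1 \<union> Y2"]) auto
qed

lemma finitely_generated_span:
  assumes "finitely_generated_module R M"
  obtains X where "finite X" "X \<subseteq> carrier M" "module_span X = carrier M"
proof -
  obtain X where X: "X \<subseteq> carrier M" "finite X"
    "\<And>x. x \<in> carrier M \<Longrightarrow> \<exists>c\<in>X \<rightarrow> carrier R. x = (\<Oplus>\<^bsub>M\<^esub>a\<in>X. c a \<odot>\<^bsub>M\<^esub> a)"
    using assms unfolding finitely_generated_module_def by blast
  note S = span_submodule[OF X(1)]
  have fin: "(\<Oplus>\<^bsub>M\<^esub>a\<in>Y. f a) \<in> module_span X" if "finite Y" "f \<in> Y \<rightarrow> module_span X" for Y f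
    using that
  proof (induction Y rule: finite_induct)
    case empty then show ?case using submodule_zero[OF S] by simp
  next
    case (insert y Y)
    have "f \<in> Y \<rightarrow> carrier M" "f y \<in> carrier M" using insert submoduleE(1)[OF S] by auto
    then show ?case using insert submoduleE(5)[OF S] by (simp add: M.finsum_insert)
  qed
  have "x \<in> module_span X" if x: "x \<in> carrier M" for x
  proof -
    obtain c where c: "c \<in> X \<rightarrow> carrier R" "x = (\<Oplus>\<^bsub>M\<^esub>a\<in>X. c a \<odot>\<^bsub>M\<^esub> a)" using X(3)[OF x] by blast
    show ?thesis unfolding c(2) using c(1) span_superset[of X] submoduleE(4)[OF S] by (intro fin[OF X(2)]) auto
  qed
  then show ?thesis using that[OF X(2,1)] submoduleE(1)[OF S] by blast
qed

end

definition noetherian_module where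
  "noetherian_module R M \<longleftrightarrow> (\<forall>H. submodule H R M \<longrightarrow> (\<exists>Y. finite Y \<and> Y \<subseteq> H \<and> H = module.module_span R M Y))"

lemma noetherian_moduleD:
  assumes "noetherian_module R M" "submodule H R M"
  obtains Y where "finite Y" "Y \<subseteq> H" "H = module.module_span R M Y"
  using assms by (auto simp: noetherian_module_def)

lemma (in module) noetherian_module_chain:
  assumes N: "noetherian_module R M" and H: "\<And>n::nat. submodule (H n) R M" "\<And>n. H n \<subseteq> H (Suc n)"
  shows "\<exists>c. \<forall>n\<ge>c. H n = H c"
proof -
  have mono: "m \<le> n \<Longrightarrow> H m \<subseteq> H n" for m n by (rule lift_Suc_mono_le[of H, OF H(2)])
  have "submodule (\<Union>n. H n) R M"
  proof (rule submoduleI)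
    fix a b assume "a \<in> (\<Union>n. H n)" "b \<in> (\<Union>n. H n)"
    then obtain m n where "a \<in> H m" "b \<in> H n" by blast
    then have "a \<in> H (max m n)" "b \<in> H (max m n)" using mono[of m "max m n"] mono[of n "max m n"] by auto
    then show "a \<oplus>\<^bsub>M\<^esub> b \<in> (\<Union>n. H n)" using submoduleE(5)[OF H(1)] by blast
  next
    show "(\<Union>n. H n) \<subseteq> carrier M" using submoduleE(1)[OF H(1)] by blast
    show "\<zero>\<^bsub>M\<^esub> \<in> (\<Union>n. H n)" using submodule_zero[OF H(1)] by blast
    show "\<ominus>\<^bsub>M\<^esub> a \<in> (\<Union>n. H n)" if "a \<in> (\<Union>n. H n)" for a using that submoduleE(3)[OF H(1)] by auto
    show "r \<odot>\<^bsub>M\<^esub> a \<in> (\<Union>n. H n)" if "r \<in> carrier R" "a \<in> (\<Union>n. H n)" for r a using that submoduleE(4)[OF H(1)] by auto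
  qed
  then obtain Y where Y: "finite Y" "Y \<subseteq> (\<Union>n. H n)" "(\<Union>n. H n) = module_span Y"
    by (rule noetherian_moduleD[OF N])
  have "\<exists>c. Y \<subseteq> H c" using Y(1,2)
  proof (induction Y rule: finite_induct)
    case (insert y Y)
    then obtain c d where "Y \<subseteq> H c" "y \<in> H d" by blast
    then have "insert y Y \<subseteq> H (max c d)" using mono[of c "max c d"] mono[of d "max c d"] by auto
    then show ?case by blast
  qed auto
  then obtain c where "Y \<subseteq> H c" by blast
  then have "(\<Union>n. H n) \<subseteq> H c" unfolding Y(3) by (rule span_minimal[OF H(1)])
  then have "H n = H c" if "n \<ge> c" for n using mono[OF that] by blast
  then show ?thesis by blast
qed

lemma (in module) finitely_generated_noetherian:
  assumes "noetherian_ring R" "finitely_generated_module R M"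
  shows "noetherian_module R M"
proof -
  obtain X where X: "finite X" "X \<subseteq> carrier M" "module_span X = carrier M"
    using finitely_generated_span[OF assms(2)] .
  show ?thesis unfolding noetherian_module_def
    using noetherian_submodule_finite[OF assms(1) X(1,2)] X(3) submoduleE(1) by blast
qed

lemma (in module) span_restrict:
  assumes K: "submodule K R M" and X: "X \<subseteq> K"
  shows "module.module_span R (M\<lparr>carrier := K\<rparr>) X = module_span X"
proof -
  have KM: "module R (M\<lparr>carrier := K\<rparr>)" by (rule submodule.submodule_is_module[OF K module_axioms])
  interpret K: module R "M\<lparr>carrier := K\<rparr>" by fact
  have XM: "X \<subseteq> carrier M" using X submoduleE(1)[OF K] by auto
  have 1: "submodule H R M" if "submodule H R (M\<lparr>carrier := K\<rparr>)" for H
  proof -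
    have HK: "H \<subseteq> K" using K.submoduleE(1)[OF that] by simp
    have "module R (M\<lparr>carrier := H\<rparr>)" using submodule.submodule_is_module[OF that KM] by simp
    then show ?thesis using HK submoduleE(1)[OF K] by (intro module_incl_imp_submodule) auto
  qed
  show ?thesis
  proof
    show "K.module_span X \<subseteq> module_span X"
    proof (rule K.span_minimal[OF _ span_superset])
      show "submodule (module_span X) R (M\<lparr>carrier := K\<rparr>)"
        by (rule R.submodule_restrict[OF module_axioms span_submodule[OF XM] K span_minimal[OF K X]])
    qed
    show "module_span X \<subseteq> K.module_span X"
      by (rule span_minimal[OF 1[OF K.span_submodule] K.span_superset]) (use X in simp)
  qed
qed

lemma (in module) submodule_noetherian:
  assumes N: "noetherian_module R M" and K: "submodule K R M"
  shows "noetherian_module R (M\<lparr>carrier := K\<rparr>)"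
  unfolding noetherian_module_def
proof (intro allI impI)
  have KM: "module R (M\<lparr>carrier := K\<rparr>)" by (rule submodule.submodule_is_module[OF K module_axioms])
  interpret K: module R "M\<lparr>carrier := K\<rparr>" by fact
  fix H assume H: "submodule H R (M\<lparr>carrier := K\<rparr>)"
  have HK: "H \<subseteq> K" using K.submoduleE(1)[OF H] by simp
  have "module R (M\<lparr>carrier := H\<rparr>)" using submodule.submodule_is_module[OF H KM] by simp
  then have "submodule H R M" using HK submoduleE(1)[OF K] by (intro module_incl_imp_submodule) auto
  then obtain Y where "finite Y" "Y \<subseteq> H" "H = module_span Y" by (rule noetherian_moduleD[OF N])
  then show "\<exists>Y. finite Y \<and> Y \<subseteq> H \<and> H = K.module_span Y"
    using span_restrict[OF K, of Y] HK by (intro exI[of _ Y]) auto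
qed

section \<open>A resolution of finite rank in each degree inside the functorial one\<close>

context cring begin

lemma fhom_units:
  assumes f: "f \<in> fhom B C" and S: "S \<subseteq> B" "\<And>b. b \<in> S \<Longrightarrow> f (unit_vec R b) \<in> Fr T" and v: "v \<in> Fr S"
  shows "f v \<in> Fr T"
  using v
proof (induction rule: free_induct)
  case zero show ?case by (simp add: fhom(4)[OF f] Fr_closed)
next
  case (step r b v)
  have c: "unit_vec R b \<in> Fr B" "v \<in> Fr B" using unit_vec_carrier[of b B] Fr_mono[OF step(3) S(1)] step S by auto
  show ?case using step c S(2)[OF step(2)]
    by (simp add: fhom(2)[OF f] fhom(3)[OF f] Fr_closed)
qed

lemma hom_units_zero:
  assumes N: "module R N" and f: "f \<in> free_hom B N"
    and S: "S \<subseteq> B" "\<And>b. b \<in> S \<Longrightarrow> f (unit_vec R b) = \<zero>\<^bsub>N\<^esub>" and v: "v \<in> Fr S"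
  shows "f v = \<zero>\<^bsub>N\<^esub>"
proof -
  interpret N: module R N by fact
  show ?thesis
    using v
  proof (induction rule: free_induct)
    case zero show ?case by (rule fr_hom(4)[OF f N])
  next
    case (step r b v)
    have c: "unit_vec R b \<in> Fr B" "v \<in> Fr B" using unit_vec_carrier[of b B] Fr_mono[OF step(3) S(1)] step S by auto
    show ?case using step c S(2)[OF step(2)]
      by (simp add: fr_hom(2)[OF f N] fr_hom(3)[OF f N] Fr_closed)
  qed
qed

lemma free_span: "module.module_span R (free_module R S) (unit_vec R ` S) = Fr S"
proof
  interpret F: module R "free_module R S" by (rule free_module_module)
  have u: "unit_vec R ` S \<subseteq> Fr S" using unit_vec_carrier by auto
  note sp = F.span_submodule[OF u]
  show "F.module_span (unit_vec R ` S) \<subseteq> Fr S" by (rule F.submoduleE(1)[OF sp])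
  show "Fr S \<subseteq> F.module_span (unit_vec R ` S)"
  proof
    fix v assume "v \<in> Fr S"
    then show "v \<in> F.module_span (unit_vec R ` S)"
    proof (induction rule: free_induct)
      case zero then show ?case using submodule_zero[OF sp] by (simp add: free_simps)
    next
      case (step r b v)
      have "unit_vec R b \<in> F.module_span (unit_vec R ` S)" using F.span_superset step(2) by blast
      from F.submoduleE(5)[OF sp F.submoduleE(4)[OF sp step(1) this] step(4)]
      show ?case by (simp add: free_simps)
    qed
  qed
qed

text \<open>Formal combinations that represent cycles are by construction the generators one degree
  up, so a chosen cycle can be killed by one explicit basis element. The cases follow
  \<open>syz_basis\<close>, which tests first syzygies by their value in M and higher ones by
  \<open>syz_boundary\<close>.\<close>

lemma syz_of_cycle:
  fixes M :: "('a, 'm, 'x) module_scheme"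
  assumes M: "module R M" and l: "l \<in> lists (carrier R \<times> res_basis R M (Suc n))"
    and c: "res_cycle R M (Suc n) (lin_comb (free_module R UNIV) (unit_vec R) l)"
  shows "Syz l \<in> res_basis R M (Suc (Suc n))"
    "res_d R (Suc (Suc n)) (unit_vec R (Syz l)) = lin_comb (free_module R UNIV) (unit_vec R) l"
proof -
  interpret M: module R M by fact
  interpret G: module R "free_module R (UNIV::('a, 'm) syz set)" by (rule free_module_module)
  show "res_d R (Suc (Suc n)) (unit_vec R (Syz l)) = lin_comb (free_module R UNIV) (unit_vec R) l"
    using M.res_diff_syz[OF l] by simp
  show "Syz l \<in> res_basis R M (Suc (Suc n))"
  proof (cases n)
    case 0
    have l': "l \<in> lists (carrier R \<times> syz_basis R M 0)" using l 0 by (simp only: res_basis_Suc)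
    then have "lin_comb M gen_of l = \<zero>\<^bsub>M\<^esub>"
      using c res_augmentation_lin_comb[OF M l'] 0 by (simp add: res_cycle_def)
    then show ?thesis using l' 0 unfolding res_basis_Suc 0 syz_basis.simps(2) by blast
  next
    case (Suc m)
    have l': "l \<in> lists (carrier R \<times> syz_basis R M (Suc m))" using l Suc by (simp only: res_basis_Suc)
    have "lin_comb (free_module R UNIV) (syz_boundary R) l = res_diff R (lin_comb (free_module R UNIV) (unit_vec R) l)"
      unfolding res_diff_def
      by (rule G.lin_ext_lin_comb[OF l', symmetric])
        (use syz_boundary_carrier[of M m] free_carrier_mono[of "syz_basis R M m" UNIV] in \<open>auto simp: res_module_def\<close>)
    then have "lin_comb (free_module R UNIV) (syz_boundary R) l = \<zero>\<^bsub>free_module R UNIV\<^esub>"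
      using c Suc by (simp add: res_cycle_def free_simps)
    then show ?thesis using l' unfolding res_basis_Suc Suc syz_basis.simps(3) by blast
  qed
qed

text \<open>The cycles in \<open>Fr S\<close> form a submodule of a free module of finite rank, so
  finitely many generate it; each is written as a formal combination l over S and contributes the
  basis element \<open>Syz l\<close>.\<close>

lemma finite_syzygies:
  assumes R: "noetherian_ring R" and M: "module R M" and S: "finite S" "S \<subseteq> res_basis R M (Suc n)"
  shows "\<exists>S'. finite S' \<and> S' \<subseteq> res_basis R M (Suc (Suc n)) \<and> (\<forall>v\<in>Fr S'. res_d R (Suc (Suc n)) v \<in> Fr S) \<and>
    (\<forall>v\<in>Fr S. res_cycle R M (Suc n) v \<longrightarrow> (\<exists>w\<in>Fr S'. res_d R (Suc (Suc n)) w = v))"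
proof -
  interpret F: module R "free_module R S" by (rule free_module_module)
  note cx = res_complex[OF M]
  define K where "K = {v \<in> Fr S. res_cycle R M (Suc n) v}"
  have K: "submodule K R (free_module R S)"
  proof (cases n)
    case 0
    have "res_augmentation R M \<in> free_hom S M"
      using S(2) 0 by (intro free_hom_subset[OF augmentation_hom[OF M]]) simp
    from kernel_submodule[OF free_module_module M this] show ?thesis
      by (simp add: K_def res_cycle_def 0)
  next
    case (Suc m)
    have "res_d R (Suc n) \<in> fhom S (res_basis R M n)"
      by (rule free_hom_subset[OF complexD(3)[OF cx] S(2)])
    from kernel_submodule[OF free_module_module free_module_module this] show ?thesis
      by (simp add: K_def res_cycle_def Suc free_simps)
  qed
  obtain K0 where K0: "finite K0" "K0 \<subseteq> K" "K = F.module_span K0"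
  proof -
    have "unit_vec R ` S \<subseteq> Fr S" "K \<subseteq> F.module_span (unit_vec R ` S)"
      using unit_vec_carrier free_span[of S] by (auto simp: K_def)
    from F.noetherian_submodule_finite[OF R finite_imageI[OF S(1)] this(1) K this(2)] show ?thesis using that by blast
  qed
  have "\<forall>v\<in>K0. \<exists>l. l \<in> lists (carrier R \<times> S) \<and> lin_comb (free_module R UNIV) (unit_vec R) l = v"
    using K0(2) free_is_lin_comb unfolding K_def by blast
  then obtain l where l: "\<And>v. v \<in> K0 \<Longrightarrow> l v \<in> lists (carrier R \<times> S)"
    "\<And>v. v \<in> K0 \<Longrightarrow> lin_comb (free_module R UNIV) (unit_vec R) (l v) = v" by metis
  define S' where "S' = (\<lambda>v. Syz (l v)) ` K0"
  have lM: "l v \<in> lists (carrier R \<times> res_basis R M (Suc n))" if "v \<in> K0" for v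
    using l(1)[OF that] S(2) by (auto simp: in_lists_conv_set)
  have cyc: "res_cycle R M (Suc n) (lin_comb (free_module R UNIV) (unit_vec R) (l v))" if "v \<in> K0" for v
    using K0(2) l(2) that by (auto simp: K_def)
  note sy = syz_of_cycle[OF M lM cyc]
  have S'M: "S' \<subseteq> res_basis R M (Suc (Suc n))" using sy(1) by (auto simp: S'_def)
  have d: "res_d R (Suc (Suc n)) v \<in> Fr S" if "v \<in> Fr S'" for v
  proof (rule fhom_units[OF complexD(3)[OF cx] S'M _ that])
    fix b assume "b \<in> S'"
    then show "res_d R (Suc (Suc n)) (unit_vec R b) \<in> Fr S" using sy(2) l(2) K0(2) by (auto simp: S'_def K_def)
  qed
  have dh: "res_d R (Suc (Suc n)) \<in> fhom S' S"
    by (rule fhom_codomain[OF free_hom_subset[OF complexD(3)[OF cx] S'M] d])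
  have "K \<subseteq> res_d R (Suc (Suc n)) ` Fr S'"
    unfolding K0(3)
  proof (rule F.span_minimal[OF image_submodule[OF free_module_module free_module_module dh]])
    show "K0 \<subseteq> res_d R (Suc (Suc n)) ` Fr S'"
    proof
      fix v assume v: "v \<in> K0"
      have "res_d R (Suc (Suc n)) (unit_vec R (Syz (l v))) = v" using sy(2)[OF v v] l(2)[OF v] by simp
      moreover have "unit_vec R (Syz (l v)) \<in> Fr S'" using v by (intro unit_vec_carrier) (auto simp: S'_def)
      ultimately show "v \<in> res_d R (Suc (Suc n)) ` Fr S'" by (metis image_eqI)
    qed
  qed
  then have "\<forall>v\<in>Fr S. res_cycle R M (Suc n) v \<longrightarrow> (\<exists>w\<in>Fr S'. res_d R (Suc (Suc n)) w = v)"
    unfolding K_def by blast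
  then show ?thesis using S'M d K0(1) unfolding S'_def by blast
qed

text \<open>Degree 1 starts with the generators X, so the augmentation stays surjective, and every
  further degree adds finitely many syzygies. F(M) is then exact modulo this part, degree 1
  included, so a cocycle that vanishes on the finite set \<open>S n\<close> is a coboundary.\<close>

lemma finite_subresolution:
  assumes R: "noetherian_ring R" and M: "module R M" and X: "finite X" "X \<subseteq> carrier M" "module.module_span R M X = carrier M"
  obtains S where "\<And>n. finite (S n)" "subcomplex S (res_basis R M) (res_d R)" "exact_mod (res_basis R M) (res_d R) S"
    "\<And>v. v \<in> res_chains M 1 \<Longrightarrow> \<exists>w\<in>res_chains M 2. agree_off (S 1) (res_d R 2 w) v"
proof -
  interpret M: module R M by fact
  note cx = res_complex[OF M]
  define P where "P n S \<longleftrightarrow> finite S \<and> S \<subseteq> res_basis R M (Suc n) \<and> (n = 0 \<longrightarrow> S = Gen ` X)" for n :: nat and S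
  define H where "H n S S' \<longleftrightarrow> (\<forall>v\<in>Fr S'. res_d R (Suc (Suc n)) v \<in> Fr S) \<and>
    (\<forall>v\<in>Fr S. res_cycle R M (Suc n) v \<longrightarrow> (\<exists>w\<in>Fr S'. res_d R (Suc (Suc n)) w = v))" for n S S'
  have "\<exists>T. \<forall>n. P n (T n) \<and> H n (T n) (T (Suc n))"
  proof (rule dependent_nat_choice)
    show "\<exists>S. P 0 S" using X by (auto simp: P_def res_basis_Suc syz_basis.simps)
    fix S n assume "P n S"
    then have "finite S" "S \<subseteq> res_basis R M (Suc n)" by (auto simp: P_def)
    from finite_syzygies[OF R M this] show "\<exists>S'. P (Suc n) S' \<and> H n S S'" unfolding P_def H_def by blast
  qed
  then obtain T where P: "\<And>n. P n (T n)" and H: "\<And>n. H n (T n) (T (Suc n))" by blast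
  define S where "S n = (case n of 0 \<Rightarrow> {} | Suc m \<Rightarrow> T m)" for n
  have S: "S 0 = {}" "S (Suc m) = T m" for m by (auto simp: S_def)
  have fin: "finite (S n)" for n using P by (cases n) (auto simp: S P_def)
  have SB: "S n \<subseteq> res_basis R M n" for n using P by (cases n) (auto simp: S P_def)
  have sub: "subcomplex S (res_basis R M) (res_d R)"
    unfolding subcomplex_def
  proof (intro allI conjI ballI SB)
    fix n v assume v: "v \<in> Fr (S n)"
    show "res_d R n v \<in> Fr (S (n - 1))"
    proof (cases "n \<le> 1")
      case True then show ?thesis by (simp add: res_d_def Fr_closed)
    next
      case False
      then obtain m where "n = Suc (Suc m)" by (metis One_nat_def not0_implies_Suc le_SucI le_refl)
      then show ?thesis using H[of m] v by (simp add: H_def S)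
    qed
  qed
  have T0: "T 0 = Gen ` X" using P[of 0] by (simp add: P_def)
  have ah: "res_augmentation R M \<in> free_hom (T 0) M"
    using SB[of 1] by (intro free_hom_subset[OF augmentation_hom[OF M]]) (simp add: S)
  have "carrier M \<subseteq> res_augmentation R M ` Fr (T 0)"
    unfolding X(3)[symmetric]
  proof (rule M.span_minimal[OF image_submodule[OF free_module_module M ah]])
    show "X \<subseteq> res_augmentation R M ` Fr (T 0)"
    proof
      fix x assume x: "x \<in> X"
      then have "res_augmentation R M (unit_vec R (Gen x)) = x"
        unfolding res_augmentation_def using X(2) by (subst M.lin_ext_unit_vec) auto
      moreover have "unit_vec R (Gen x) \<in> Fr (T 0)" using x T0 by (intro unit_vec_carrier) auto
      ultimately show "x \<in> res_augmentation R M ` Fr (T 0)" by (metis image_eqI)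
    qed
  qed
  note surj = this
  show ?thesis
  proof (rule that[OF fin sub])
    show "exact_mod (res_basis R M) (res_d R) S"
    proof (rule res_exact_mod[OF M sub])
      fix n v assume "n > (0::nat)" "v \<in> Fr (S n)" "res_cycle R M n v"
      then show "\<exists>w\<in>Fr (S (Suc n)). res_d R (Suc n) w = v" using H[of "n - 1"] by (cases n) (auto simp: H_def S)
    qed
    fix v assume v: "v \<in> res_chains M 1"
    have "res_augmentation R M v \<in> carrier M" by (rule fr_hom(1)[OF augmentation_hom[OF M] M v])
    then obtain w where w: "w \<in> Fr (T 0)" "res_augmentation R M v = res_augmentation R M w" using surj by blast
    have wB: "w \<in> res_chains M 1" using Fr_mono[OF w(1)] SB[of 1] by (simp add: S)
    have z: "(\<lambda>b. v b \<ominus> w b) \<in> res_chains M 1" using v wB by (rule Fr_closed)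
    have "res_cycle R M 1 (\<lambda>b. v b \<ominus> w b)"
      using w(2) fr_hom(1)[OF augmentation_hom[OF M] M wB]
      by (simp add: res_cycle_def fr_hom(5)[OF augmentation_hom[OF M] M v wB] M.M.minus_self)
    then obtain u where u: "u \<in> res_chains M 2" "res_d R 2 u = (\<lambda>b. v b \<ominus> w b)"
      using res_cycle_exact[OF M _ z] by (auto simp: numeral_2_eq_2)
    have "agree_off (S 1) (\<lambda>b. v b \<ominus> w b) v"
      using Fr_outside[OF w(1)] Fr_in[OF v] by (auto simp: agree_off_def a_minus_def S)
    then show "\<exists>w\<in>res_chains M 2. agree_off (S 1) (res_d R 2 w) v"
      by (intro bexI[OF _ u(1)]) (simp only: u(2))
  qed
qed

section \<open>Ring elements that annihilate cohomology classes\<close>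

text \<open>A chain map covering the zero map from M to M' is null-homotopic: in degree 1 its values
  lie in the kernel of the augmentation and hence bound.\<close>

lemma augmentation_zero_coboundary:
  assumes N: "module R N" and M: "module R M" "module R M'"
    and f: "\<And>n. f n \<in> fhom (res_basis R M n) (res_basis R M' n)"
    and fd: "\<And>n v. v \<in> res_chains M (Suc n) \<Longrightarrow> res_d R (Suc n) (f (Suc n) v) = f n (res_d R (Suc n) v)"
    and f1: "\<And>v. v \<in> res_chains M 1 \<Longrightarrow> res_augmentation R M' (f 1 v) = \<zero>\<^bsub>M'\<^esub>"
    and h: "res_cocycle N M' n h"
  shows "res_coboundary N M n (\<lambda>v. h (f n v))"
proof (rule null_homotopic_coboundary[OF N res_complex[OF M(1)] res_complex[OF M(2)]
      empty_subcomplex[OF res_complex[OF M(2)]] _ empty_exact_mod[OF M(2)] _ h])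
  show "chain_map_mod (res_basis R M) (res_d R) (res_basis R M') (res_d R) (\<lambda>n. {}) f"
    using f fd by (simp add: chain_map_mod_def)
  show "\<exists>w\<in>res_chains M' 2. agree_off {} (res_d R 2 w) (f 1 v)" if v: "v \<in> res_chains M 1" for v
    using res_cycle_exact[OF M(2) _ fhom(1)[OF f v]] f1[OF v] by (simp add: res_cycle_def numeral_2_eq_2)
  show "h v = \<zero>\<^bsub>N\<^esub>" if "v \<in> Fr {}" for v
    using that h fr_hom(4)[OF _ N] by (auto simp: cocycle_def)
qed

lemma smult_fhom:
  assumes "r \<in> carrier R" shows "(\<lambda>v b. r \<otimes> v b) \<in> fhom B B"
proof (rule fhomI)
  fix u assume u: "u \<in> Fr B"
  show "(\<lambda>b. r \<otimes> u b) \<in> Fr B" using u assms by (rule Fr_closed)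
  show "(\<lambda>b. r \<otimes> (u b \<oplus> v b)) = (\<lambda>b. r \<otimes> u b \<oplus> r \<otimes> v b)" if "v \<in> Fr B" for v
    using assms Fr_in[OF u] Fr_in[OF that] by (simp add: r_distr)
  show "(\<lambda>b. r \<otimes> (t \<otimes> u b)) = (\<lambda>b. t \<otimes> (r \<otimes> u b))" if "t \<in> carrier R" for t
    using assms Fr_in[OF u] that by (simp add: m_lcomm)
qed

text \<open>Multiplication by j on F(M) is a chain map covering multiplication by j on M, which is
  zero.\<close>

lemma annihilator_coboundary:
  assumes N: "module R N" and M: "module R M" and j: "j \<in> carrier R" "\<And>x. x \<in> carrier M \<Longrightarrow> j \<odot>\<^bsub>M\<^esub> x = \<zero>\<^bsub>M\<^esub>"
    and h: "res_cocycle N M n h"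
  shows "res_coboundary N M n (\<lambda>v. j \<odot>\<^bsub>N\<^esub> h v)"
proof (rule coboundary_cong)
  note cx = res_complex[OF M]
  note ah = augmentation_hom[OF M]
  show "res_coboundary N M n (\<lambda>v. h (\<lambda>b. j \<otimes> v b))"
  proof (rule augmentation_zero_coboundary[OF N M M _ _ _ h, of "\<lambda>n v b. j \<otimes> v b"])
    show "(\<lambda>v b. j \<otimes> v b) \<in> fhom (res_basis R M n) (res_basis R M n)" for n
      by (rule smult_fhom[OF j(1)])
    show "res_d R (Suc n) (\<lambda>b. j \<otimes> v b) = (\<lambda>b. j \<otimes> res_d R (Suc n) v b)" if "v \<in> res_chains M (Suc n)" for n v
      using fhom(3)[OF complexD(3)[OF cx] that j(1)] .
    show "res_augmentation R M (\<lambda>b. j \<otimes> v b) = \<zero>\<^bsub>M\<^esub>" if v: "v \<in> res_chains M 1" for v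
      using fr_hom(3)[OF ah M v j(1)] j(2)[OF fr_hom(1)[OF ah M v]] by simp
  qed
  show "j \<odot>\<^bsub>N\<^esub> h v = h (\<lambda>b. j \<otimes> v b)" if "v \<in> res_chains M n" for v
    using h fr_hom(3)[OF _ N that j(1)] by (auto simp: cocycle_def)
qed

text \<open>Decompositions for different elements multiply: in (j + e)(j' + e') all products except
  e e' lie in J, and e e' annihilates whatever e or e' annihilates. The exponents add up, so
  finitely many elements share one exponent.\<close>

lemma power_sum_finite:
  assumes N: "module R N" and a: "a \<in> carrier R" and J: "ideal J R"
    and tor: "\<And>x. x \<in> carrier N \<Longrightarrow> \<exists>k::nat. \<exists>j\<in>J. \<exists>e\<in>carrier R. a [^] k = j \<oplus> e \<and> e \<odot>\<^bsub>N\<^esub> x = \<zero>\<^bsub>N\<^esub>"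
    and X: "finite X" "X \<subseteq> carrier N"
  shows "\<exists>k::nat. \<exists>j\<in>J. \<exists>e\<in>carrier R. a [^] k = j \<oplus> e \<and> (\<forall>x\<in>X. e \<odot>\<^bsub>N\<^esub> x = \<zero>\<^bsub>N\<^esub>)"
  using X
proof (induction X rule: finite_induct)
  interpret J: ideal J R by fact
  interpret N: module R N by fact
  case empty
  show ?case using J.zero_closed by (intro exI[of _ 0] bexI[of _ \<zero>] bexI[of _ \<one>]) auto
next
  interpret J: ideal J R by fact
  interpret N: module R N by fact
  case (insert x X)
  then obtain k j e where 1: "j \<in> J" "e \<in> carrier R" "a [^] (k::nat) = j \<oplus> e" "\<forall>x\<in>X. e \<odot>\<^bsub>N\<^esub> x = \<zero>\<^bsub>N\<^esub>" by auto
  obtain k' j' e' where 2: "j' \<in> J" "e' \<in> carrier R" "a [^] (k'::nat) = j' \<oplus> e'" "e' \<odot>\<^bsub>N\<^esub> x = \<zero>\<^bsub>N\<^esub>"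
    using tor[of x] insert by auto
  have c: "j \<in> carrier R" "j' \<in> carrier R" using 1 2 J.Icarr by auto
  let ?j = "j \<otimes> j' \<oplus> (j \<otimes> e' \<oplus> e \<otimes> j')"
  have "a [^] (k + k') = (j \<oplus> e) \<otimes> (j' \<oplus> e')" using a 1 2 by (simp add: nat_pow_mult[symmetric])
  also have "\<dots> = ?j \<oplus> e \<otimes> e'" using c 1 2 by (simp add: l_distr r_distr a_ac)
  finally have "a [^] (k + k') = ?j \<oplus> e \<otimes> e'" .
  moreover have "?j \<in> J" using 1 2 c by (simp add: J.I_l_closed J.I_r_closed)
  moreover have "(e \<otimes> e') \<odot>\<^bsub>N\<^esub> y = \<zero>\<^bsub>N\<^esub>" if y: "y \<in> insert x X" for y
  proof (cases "y = x")
    case True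
    then show ?thesis using 1 2 insert by (simp add: N.smult_assoc1)
  next
    case False
    then have "y \<in> X" "y \<in> carrier N" using y insert by auto
    then show ?thesis using 1 2 by (simp add: m_comm[of e e'] N.smult_assoc1)
  qed
  ultimately show ?case using 1 2 by (intro exI[of _ "k + k'"] bexI[of _ ?j] bexI[of _ "e \<otimes> e'"]) auto
qed

text \<open>If \<open>a\<^sup>k = j + e\<close> with \<open>j\<close> annihilating \<open>M\<close> and \<open>e\<close> annihilating the finitely many values of \<open>h\<close> on
  a basis of a finitely generated resolution, then both \<open>j h\<close> and \<open>e h\<close> are coboundaries.\<close>

lemma power_smult_coboundary:
  assumes R: "noetherian_ring R" and M: "module R M" and X: "finite X" "X \<subseteq> carrier M" "module.module_span R M X = carrier M"
    and N: "module R N" and a: "a \<in> carrier R" and J: "ideal J R" "\<And>j x. j \<in> J \<Longrightarrow> x \<in> carrier M \<Longrightarrow> j \<odot>\<^bsub>M\<^esub> x = \<zero>\<^bsub>M\<^esub>"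
    and tor: "\<And>x. x \<in> carrier N \<Longrightarrow> \<exists>k::nat. \<exists>j\<in>J. \<exists>e\<in>carrier R. a [^] k = j \<oplus> e \<and> e \<odot>\<^bsub>N\<^esub> x = \<zero>\<^bsub>N\<^esub>"
    and h: "res_cocycle N M n h"
  shows "\<exists>k::nat. res_coboundary N M n (\<lambda>v. a [^] k \<odot>\<^bsub>N\<^esub> h v)"
proof -
  interpret N: module R N by fact
  interpret J: ideal J R by fact
  note cx = res_complex[OF M]
  obtain S where S: "\<And>n. finite (S n)" "subcomplex S (res_basis R M) (res_d R)" "exact_mod (res_basis R M) (res_d R) S"
    "\<And>v. v \<in> res_chains M 1 \<Longrightarrow> \<exists>w\<in>res_chains M 2. agree_off (S 1) (res_d R 2 w) v"
    using finite_subresolution[OF R M X] by metis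
  have SB: "S n \<subseteq> res_basis R M n" for n by (rule subcomplexD(1)[OF S(2)])
  have hh: "h \<in> free_hom (res_basis R M n) N" using h by (simp add: cocycle_def)
  have "h (unit_vec R b) \<in> carrier N" if "b \<in> S n" for b
    by (rule fr_hom(1)[OF hh N unit_vec_carrier[OF subsetD[OF SB that]]])
  then have "(\<lambda>b. h (unit_vec R b)) ` S n \<subseteq> carrier N" by (rule image_subsetI)
  from power_sum_finite[OF N a J(1) tor finite_imageI[OF S(1)] this]
  obtain k j e where kje: "j \<in> J" "e \<in> carrier R" "a [^] (k::nat) = j \<oplus> e"
    and e: "\<forall>x\<in>(\<lambda>b. h (unit_vec R b)) ` S n. e \<odot>\<^bsub>N\<^esub> x = \<zero>\<^bsub>N\<^esub>" by blast
  have e': "e \<odot>\<^bsub>N\<^esub> h (unit_vec R b) = \<zero>\<^bsub>N\<^esub>" if "b \<in> S n" for b using e that by simp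
  have jc: "j \<in> carrier R" using kje J.Icarr by auto
  have 1: "res_coboundary N M n (\<lambda>v. j \<odot>\<^bsub>N\<^esub> h v)"
    by (rule annihilator_coboundary[OF N M jc J(2)[OF kje(1)] h])
  have 2: "res_coboundary N M n (\<lambda>v. e \<odot>\<^bsub>N\<^esub> h v)"
    by (rule relative_acyclic_coboundary[OF N cx S(2,3,4) cocycle_smult[OF N cx h kje(2)]
       hom_units_zero[OF N hom_smult[OF N hh kje(2)] SB e']])
  have "res_coboundary N M n (\<lambda>v. a [^] k \<odot>\<^bsub>N\<^esub> h v)"
    using coboundary_add[OF N 1 2]
    by (rule coboundary_cong) (use kje jc fr_hom(1)[OF hh N] in \<open>auto simp: N.smult_l_distr\<close>)
  then show ?thesis by blast
qed

section \<open>Induced maps, and restriction to multiples by powers of one element\<close>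

lemma res_map_fhom:
  assumes "module R M" "module R M'" "f \<in> module_hom R M M'"
  shows "res_map R f \<in> fhom (res_basis R M n) (res_basis R M' n)"
proof (cases n)
  case 0
  then show ?thesis using fhom(4)[OF res_map_hom_UNIV, of f] by (auto intro!: fhomI)
next
  case (Suc m)
  then show ?thesis using res_map_hom[OF assms, of m] by (simp add: res_module_def res_basis_Suc)
qed

lemma res_d_res_map:
  assumes "module R M" "module R M'" "f \<in> module_hom R M M'" "v \<in> res_chains M n"
  shows "res_d R n (res_map R f v) = res_map R f (res_d R n v)"
proof (cases "n \<le> 1")
  case True
  then show ?thesis using fhom(4)[OF res_map_hom_UNIV, of f] by (simp add: res_d_def)
next
  case False
  then obtain m where "n = Suc (Suc m)" by (metis One_nat_def not0_implies_Suc le_SucI le_refl)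
  then show ?thesis using res_diff_res_map[OF assms(1-3), of v m] assms(4) by (simp add: res_module_def res_basis_Suc)
qed

lemma augmentation_map:
  assumes "module R M" "module R M'" "f \<in> module_hom R M M'" "v \<in> res_chains M 1"
  shows "res_augmentation R M' (res_map R f v) = f (res_augmentation R M v)"
  using augmentation_res_map[OF assms(1-3), of v] assms(4) by (simp add: res_module_def res_basis_Suc)

lemma cocycle_res_map:
  assumes "module R M" "module R M'" "f \<in> module_hom R M M'" "res_cocycle N M' n h" "module R N"
  shows "res_cocycle N M n (\<lambda>v. h (res_map R f v))"
  using assms(4) hom_comp[OF res_map_fhom[OF assms(1-3), of n], of h N] res_d_res_map[OF assms(1-3), symmetric]
    fhom(1)[OF res_map_fhom[OF assms(1-3)]]
  by (auto simp: cocycle_def)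

lemma coboundary_res_map:
  assumes "module R M" "module R M'" "f \<in> module_hom R M M'" "res_coboundary N M' n h"
  shows "res_coboundary N M n (\<lambda>v. h (res_map R f v))"
proof -
  obtain g where g: "g\<in>free_hom (res_basis R M' (n - 1)) N" "\<forall>v\<in>res_chains M' n. h v = g (res_d R n v)"
    using assms(4) by (auto simp: coboundary_def)
  show ?thesis unfolding coboundary_def
    using hom_comp[OF res_map_fhom[OF assms(1-3), of "n - 1"] g(1)] g(2) res_d_res_map[OF assms(1-3)] fhom(1)[OF res_map_fhom[OF assms(1-3)]]
    by (intro bexI[of _ "\<lambda>v. g (res_map R f v)"]) auto
qed

lemma smult_image_submodule:
  assumes "module R M" "r \<in> carrier R"
  shows "submodule ((\<lambda>x. r \<odot>\<^bsub>M\<^esub> x) ` carrier M) R M"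
proof -
  interpret M: module R M by fact
  have "(\<lambda>x. r \<odot>\<^bsub>M\<^esub> x) \<in> module_hom R M M"
    using assms(2) by (auto simp: module_hom_def M.smult_r_distr M.smult_assoc1[symmetric] m_comm)
  from image_submodule[OF assms(1,1) this] show ?thesis .
qed

text \<open>On \<open>L = a\<^sup>c M\<close> with \<open>c\<close> large, multiplication by \<open>a\<^sup>k\<close> is injective, so restricting to \<open>a\<^sup>k L\<close> amounts
  to multiplying the cohomology class by \<open>a\<^sup>k\<close>.\<close>

lemma power_submodule_coboundary:
  assumes M: "module R M" and noeth: "noetherian_module R M" and N: "module R N" and a: "a \<in> carrier R"
    and h: "res_cocycle N M n h"
    and tor: "\<And>K. submodule K R M \<Longrightarrow> \<exists>k::nat. res_coboundary N (M\<lparr>carrier := K\<rparr>) n (\<lambda>v. a [^] k \<odot>\<^bsub>N\<^esub> h v)"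
  shows "\<exists>m::nat. res_coboundary N (M\<lparr>carrier := (\<lambda>x. a [^] m \<odot>\<^bsub>M\<^esub> x) ` carrier M\<rparr>) n h"
proof -
  interpret M: module R M by fact
  interpret N: module R N by fact
  define I where "I m = (\<lambda>x. a [^] (m::nat) \<odot>\<^bsub>M\<^esub> x) ` carrier M" for m
  have I: "submodule (I m) R M" for m unfolding I_def using a by (intro smult_image_submodule[OF M]) simp
  define Z where "Z m = {x \<in> carrier M. a [^] (m::nat) \<odot>\<^bsub>M\<^esub> x = \<zero>\<^bsub>M\<^esub>}" for m
  have Z: "submodule (Z m) R M" for m unfolding Z_def
    using a by (intro kernel_submodule[OF M M]) (auto simp: module_hom_def M.smult_r_distr M.smult_assoc1[symmetric] m_comm)
  have powS: "a [^] (m + k) \<odot>\<^bsub>M\<^esub> x = a [^] m \<odot>\<^bsub>M\<^esub> (a [^] k \<odot>\<^bsub>M\<^esub> x)" if "x \<in> carrier M" for m k :: nat and x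
    using a that by (simp add: nat_pow_mult[symmetric] M.smult_assoc1)
  have "Z m \<subseteq> Z (Suc m)" for m
    using powS[of _ 1 m] a by (auto simp: Z_def)
  \<comment> \<open>The kernels of the powers of \<open>a\<close> increase and stop at
    \<open>c\<close>: if \<open>a [^] (k + c)\<close> kills z, then so does \<open>a [^] c\<close>.
    This is the injectivity of \<open>a [^] k\<close> on the multiples of
    \<open>a [^] c\<close>.\<close>
  from M.noetherian_module_chain[where H = Z, OF noeth Z this] obtain c where c: "\<forall>m\<ge>c. Z m = Z c" ..
  define L where "L = M\<lparr>carrier := I c\<rparr>"
  have Lm: "module R L" unfolding L_def by (rule submodule_module[OF I M])
  interpret L: module R L by fact
  have Lc: "carrier L = I c" "x \<in> carrier L \<Longrightarrow> x \<in> carrier M" for x using M.submoduleE(1)[OF I] by (auto simp: L_def)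
  have Lops: "x \<oplus>\<^bsub>L\<^esub> y = x \<oplus>\<^bsub>M\<^esub> y" "r \<odot>\<^bsub>L\<^esub> x = r \<odot>\<^bsub>M\<^esub> x" "\<zero>\<^bsub>L\<^esub> = \<zero>\<^bsub>M\<^esub>" for x y r by (simp_all add: L_def)
  \<comment> \<open>\<open>k\<close> belongs to L and is thus chosen after \<open>c\<close>, which
    is why \<open>tor\<close> is assumed for all submodules. The exponent finally obtained is
    \<open>k + c\<close>.\<close>
  obtain k where k: "res_coboundary N L n (\<lambda>v. a [^] (k::nat) \<odot>\<^bsub>N\<^esub> h v)"
    using tor[OF I[of c]] unfolding L_def by blast
  have ak: "a [^] k \<in> carrier R" using a by simp
  have inj: "x = y" if "x \<in> carrier L" "y \<in> carrier L" "a [^] k \<odot>\<^bsub>M\<^esub> x = a [^] k \<odot>\<^bsub>M\<^esub> y" for x y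
  proof -
    have "x \<ominus>\<^bsub>L\<^esub> y \<in> carrier L" using that by simp
    then obtain z where z: "z \<in> carrier M" "x \<ominus>\<^bsub>L\<^esub> y = a [^] c \<odot>\<^bsub>M\<^esub> z" using Lc(1) by (auto simp: I_def)
    have "a [^] k \<odot>\<^bsub>L\<^esub> (x \<ominus>\<^bsub>L\<^esub> y) = \<zero>\<^bsub>L\<^esub>"
      using that ak by (simp add: a_minus_def L.smult_r_distr L.smult_r_minus L.M.r_neg Lops(2)[symmetric] del: Lops)
    then have "z \<in> Z (k + c)" using z powS by (simp add: Z_def Lops)
    moreover have "Z (k + c) = Z c" by (rule c[rule_format]) simp
    ultimately have "z \<in> Z c" by blast
    then have "x \<ominus>\<^bsub>L\<^esub> y = \<zero>\<^bsub>L\<^esub>" using z by (simp add: Z_def Lops)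
    then show ?thesis using that L.M.minus_eq_zeroD by blast
  qed
  define K where "K = M\<lparr>carrier := I (k + c)\<rparr>"
  have Km: "module R K" unfolding K_def by (rule submodule_module[OF I M])
  have Kops: "x \<oplus>\<^bsub>K\<^esub> y = x \<oplus>\<^bsub>M\<^esub> y" "r \<odot>\<^bsub>K\<^esub> x = r \<odot>\<^bsub>M\<^esub> x" "carrier K = I (k + c)" for x y r by (simp_all add: K_def)
  have Iimg: "I (k + c) = (\<lambda>x. a [^] k \<odot>\<^bsub>M\<^esub> x) ` carrier L"
    unfolding Lc(1) I_def image_image using powS by (intro image_cong) auto
  \<comment> \<open>Multiplication by \<open>a [^] k\<close> maps L bijectively onto K, and
    \<open>\<phi>\<close> is its inverse; so the inclusion of K in L is \<open>a [^] k\<close> times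
    \<open>\<phi>\<close>.\<close>
  define \<phi> where "\<phi> = inv_into (carrier L) (\<lambda>x. a [^] k \<odot>\<^bsub>M\<^esub> x)"
  have \<phi>: "\<phi> y \<in> carrier L" "a [^] k \<odot>\<^bsub>M\<^esub> \<phi> y = y" if "y \<in> carrier K" for y
    using that unfolding \<phi>_def Kops Iimg by (rule inv_into_into, rule f_inv_into_f)
  interpret K: module R K by fact
  have \<phi>h: "\<phi> \<in> module_hom R K L"
    unfolding module_hom_def
  proof (intro CollectI conjI ballI Pi_I \<phi>(1))
    fix x y assume x: "x \<in> carrier K" and y: "y \<in> carrier K"
    show "\<phi> (x \<oplus>\<^bsub>K\<^esub> y) = \<phi> x \<oplus>\<^bsub>L\<^esub> \<phi> y"
    proof (rule inj)
      show "\<phi> (x \<oplus>\<^bsub>K\<^esub> y) \<in> carrier L" "\<phi> x \<oplus>\<^bsub>L\<^esub> \<phi> y \<in> carrier L" using x y \<phi>(1) by auto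
      have "a [^] k \<odot>\<^bsub>M\<^esub> \<phi> (x \<oplus>\<^bsub>K\<^esub> y) = x \<oplus>\<^bsub>K\<^esub> y" using x y by (intro \<phi>(2)) simp
      also have "\<dots> = a [^] k \<odot>\<^bsub>M\<^esub> (\<phi> x \<oplus>\<^bsub>L\<^esub> \<phi> y)"
        using x y \<phi> ak Lc(2) by (simp add: Kops Lops M.smult_r_distr)
      finally show "a [^] k \<odot>\<^bsub>M\<^esub> \<phi> (x \<oplus>\<^bsub>K\<^esub> y) = a [^] k \<odot>\<^bsub>M\<^esub> (\<phi> x \<oplus>\<^bsub>L\<^esub> \<phi> y)" .
    qed
  next
    fix r x assume r: "r \<in> carrier R" and x: "x \<in> carrier K"
    show "\<phi> (r \<odot>\<^bsub>K\<^esub> x) = r \<odot>\<^bsub>L\<^esub> \<phi> x"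
    proof (rule inj)
      show "\<phi> (r \<odot>\<^bsub>K\<^esub> x) \<in> carrier L" "r \<odot>\<^bsub>L\<^esub> \<phi> x \<in> carrier L" using r x \<phi>(1) by auto
      have "a [^] k \<odot>\<^bsub>M\<^esub> \<phi> (r \<odot>\<^bsub>K\<^esub> x) = r \<odot>\<^bsub>K\<^esub> x" using r x by (intro \<phi>(2)) simp
      also have "\<dots> = r \<odot>\<^bsub>M\<^esub> (a [^] k \<odot>\<^bsub>M\<^esub> \<phi> x)" using x \<phi> by (simp add: Kops)
      also have "\<dots> = a [^] k \<odot>\<^bsub>M\<^esub> (r \<odot>\<^bsub>L\<^esub> \<phi> x)"
        using r x \<phi>(1) ak Lc(2) by (simp add: Lops M.smult_assoc1[symmetric] m_comm)
      finally show "a [^] k \<odot>\<^bsub>M\<^esub> \<phi> (r \<odot>\<^bsub>K\<^esub> x) = a [^] k \<odot>\<^bsub>M\<^esub> (r \<odot>\<^bsub>L\<^esub> \<phi> x)" .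
    qed
  qed
  have KL: "I (k + c) \<subseteq> I c"
  proof -
    have "I (k + c) = (\<lambda>x. a [^] k \<odot>\<^bsub>L\<^esub> x) ` carrier L" by (simp add: Iimg Lops)
    then show ?thesis using L.smult_closed[OF ak] Lc(1) by auto
  qed
  have hL: "res_cocycle N L n h"
    unfolding L_def by (rule cocycle_subset[OF h res_subcomplex[OF I M]])
  have hhL: "h \<in> free_hom (res_basis R L n) N" using hL by (simp add: cocycle_def)
  have KsubL: "submodule (I (k + c)) R L" unfolding L_def by (rule submodule_restrict[OF M I I KL])
  have KLeq: "K = L\<lparr>carrier := I (k + c)\<rparr>" by (simp add: K_def L_def)
  have KinL: "v \<in> res_chains L n" if "v \<in> res_chains K n" for v n
    using that subcomplexD(1)[OF res_subcomplex[OF KsubL Lm]] Fr_mono unfolding KLeq by blast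
  note mp = res_map_fhom[OF Km Lm \<phi>h]
  note cxL = res_complex[OF Lm]
  \<comment> \<open>The inclusion of F(K) in F(L) and \<open>a [^] k\<close> times the map induced
    by \<open>\<phi>\<close> cover the same map from K to L, so their difference has augmentation
    zero. Hence \<open>h\<close> on K differs by a coboundary from the pullback along
    \<open>\<phi>\<close> of \<open>a [^] k\<close> times \<open>h\<close>, and this is a coboundary
    by \<open>k\<close>.\<close>
  let ?f = "\<lambda>n v b. v b \<ominus> (a [^] k \<otimes> res_map R \<phi> v b)"
  have mm: "v \<in> res_chains L n" "res_map R \<phi> v \<in> res_chains L n" "(\<lambda>b. a [^] k \<otimes> res_map R \<phi> v b) \<in> res_chains L n"
    if "v \<in> res_chains K n" for v n
    using KinL[OF that] fhom(1)[OF mp that] Fr_closed(4)[OF fhom(1)[OF mp that] ak] by auto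
  have "res_coboundary N K n (\<lambda>v. h (?f n v))"
  proof (rule augmentation_zero_coboundary[OF N Km Lm _ _ _ hL, of ?f])
    show "?f n \<in> fhom (res_basis R K n) (res_basis R L n)" for n
    proof (rule fhomI)
      fix u assume u: "u \<in> res_chains K n"
      show "?f n u \<in> res_chains L n" using mm[OF u] by (intro Fr_closed(3))
      show "?f n (\<lambda>b. u b \<oplus> v b) = (\<lambda>c. ?f n u c \<oplus> ?f n v c)" if v: "v \<in> res_chains K n" for v
        using ak Fr_in[OF mm(1)[OF u]] Fr_in[OF mm(2)[OF u]] Fr_in[OF mm(1)[OF v]] Fr_in[OF mm(2)[OF v]]
        by (simp add: fhom(2)[OF mp u v] a_minus_def r_distr minus_add a_ac)
      show "?f n (\<lambda>b. r \<otimes> u b) = (\<lambda>c. r \<otimes> ?f n u c)" if r: "r \<in> carrier R" for r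
        using ak r Fr_in[OF mm(1)[OF u]] Fr_in[OF mm(2)[OF u]]
        by (simp add: fhom(3)[OF mp u r] a_minus_def r_distr r_minus m_lcomm)
    qed
    show "res_d R (Suc n) (?f (Suc n) v) = ?f n (res_d R (Suc n) v)" if v: "v \<in> res_chains K (Suc n)" for n v
      using mm[OF v] by (simp add: fhom(5)[OF complexD(3)[OF cxL]] fhom(3)[OF complexD(3)[OF cxL] _ ak] res_d_res_map[OF Km Lm \<phi>h v])
    show "res_augmentation R L (?f 1 v) = \<zero>\<^bsub>L\<^esub>" if v: "v \<in> res_chains K 1" for v
    proof -
      note ah = augmentation_hom[OF Lm]
      have augv: "res_augmentation R K v = res_augmentation R L v"
        using res_augmentation_submodule[OF KsubL Lm] v unfolding KLeq by blast
      have vK: "res_augmentation R K v \<in> carrier K" by (rule fr_hom(1)[OF augmentation_hom[OF Km] Km v])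
      have "res_augmentation R L (?f 1 v) = res_augmentation R L v \<ominus>\<^bsub>L\<^esub> a [^] k \<odot>\<^bsub>L\<^esub> \<phi> (res_augmentation R K v)"
        using mm[OF v] ak by (simp only: fr_hom(5)[OF ah Lm] fr_hom(3)[OF ah Lm] augmentation_map[OF Km Lm \<phi>h v])
      also have "\<dots> = \<zero>\<^bsub>L\<^esub>" using \<phi>(2)[OF vK] augv fr_hom(1)[OF ah Lm mm(1)[OF v]] by (simp add: Lops(2) L.M.minus_self)
      finally show ?thesis .
    qed
  qed
  from coboundary_add[OF N this coboundary_res_map[OF Km Lm \<phi>h k]]
  have "res_coboundary N K n (\<lambda>v. h (?f n v) \<oplus>\<^bsub>N\<^esub> a [^] k \<odot>\<^bsub>N\<^esub> h (res_map R \<phi> v))" .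
  then have "res_coboundary N K n h"
  proof (rule coboundary_cong)
    fix v assume v: "v \<in> res_chains K n"
    have "h (?f n v) = h v \<ominus>\<^bsub>N\<^esub> a [^] k \<odot>\<^bsub>N\<^esub> h (res_map R \<phi> v)"
      using mm[OF v] ak by (simp add: fr_hom(5)[OF hhL N] fr_hom(3)[OF hhL N])
    then show "h v = h (?f n v) \<oplus>\<^bsub>N\<^esub> a [^] k \<odot>\<^bsub>N\<^esub> h (res_map R \<phi> v)"
      using fr_hom(1)[OF hhL N mm(1)[OF v]] fr_hom(1)[OF hhL N mm(2)[OF v]] ak
      by (simp add: a_minus_def N.M.a_assoc N.M.l_neg)
  qed
  then show ?thesis unfolding K_def I_def by blast
qed

end

section \<open>Vanishing on large submodules\<close>

lemma (in module) noetherian_module_maximal: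
  assumes N: "noetherian_module R M" and P: "P H0" and sub: "\<And>H. P H \<Longrightarrow> submodule H R M"
  obtains H where "P H" "\<And>K. P K \<Longrightarrow> H \<subseteq> K \<Longrightarrow> K = H"
proof (rule ccontr)
  assume "\<not> thesis"
  then have step: "\<forall>H. P H \<longrightarrow> (\<exists>K. P K \<and> H \<subset> K)" using that by blast
  have "\<exists>H. \<forall>n. P (H n) \<and> H n \<subset> H (Suc n)"
    by (rule dependent_nat_choice) (use P step in auto)
  then obtain H :: "nat \<Rightarrow> 'c set" where H: "\<And>n. P (H n)" "\<And>n. H n \<subset> H (Suc n)" by blast
  have "H n \<subseteq> H (Suc n)" for n using H(2)[of n] by blast
  from noetherian_module_chain[where H = H, OF N sub[OF H(1)] this] obtain c where c: "\<forall>n\<ge>c. H n = H c" ..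
  have "H (Suc c) = H c" using c[rule_format, of "Suc c"] by simp
  then show False using H(2)[of c] by blast
qed

lemma (in module) submodule_sum:
  assumes A: "submodule A R M" and B: "submodule B R M"
  shows "submodule {x \<oplus>\<^bsub>M\<^esub> y |x y. x \<in> A \<and> y \<in> B} R M" (is "submodule ?S R M")
    and "A \<subseteq> {x \<oplus>\<^bsub>M\<^esub> y |x y. x \<in> A \<and> y \<in> B}" "B \<subseteq> {x \<oplus>\<^bsub>M\<^esub> y |x y. x \<in> A \<and> y \<in> B}"
proof -
  note EA = submoduleE[OF A] and EB = submoduleE[OF B] and Z = submodule_zero[OF A] submodule_zero[OF B]
  have c: "x \<in> A \<Longrightarrow> x \<in> carrier M" "x \<in> B \<Longrightarrow> x \<in> carrier M" for x using EA(1) EB(1) by auto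
  show "A \<subseteq> ?S"
  proof
    fix x assume x: "x \<in> A"
    then have "x = x \<oplus>\<^bsub>M\<^esub> \<zero>\<^bsub>M\<^esub>" using c by simp
    then show "x \<in> ?S" using x Z by blast
  qed
  show "B \<subseteq> ?S"
  proof
    fix x assume x: "x \<in> B"
    then have "x = \<zero>\<^bsub>M\<^esub> \<oplus>\<^bsub>M\<^esub> x" using c by simp
    then show "x \<in> ?S" using x Z by blast
  qed
  show "submodule ?S R M"
  proof (rule submoduleI)
    show "?S \<subseteq> carrier M" using c by auto
    show "\<zero>\<^bsub>M\<^esub> \<in> ?S" using Z \<open>A \<subseteq> ?S\<close> by blast
  next
    fix a assume "a \<in> ?S"
    then obtain x y where *: "a = x \<oplus>\<^bsub>M\<^esub> y" "x \<in> A" "y \<in> B" by blast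
    then have "\<ominus>\<^bsub>M\<^esub> a = \<ominus>\<^bsub>M\<^esub> x \<oplus>\<^bsub>M\<^esub> \<ominus>\<^bsub>M\<^esub> y" using c by (simp add: M.minus_add)
    then show "\<ominus>\<^bsub>M\<^esub> a \<in> ?S" using EA(3) EB(3) * by blast
  next
    fix a b assume "a \<in> ?S" "b \<in> ?S"
    then obtain x y u v where *: "a = x \<oplus>\<^bsub>M\<^esub> y" "x \<in> A" "y \<in> B" "b = u \<oplus>\<^bsub>M\<^esub> v" "u \<in> A" "v \<in> B" by blast
    then have "a \<oplus>\<^bsub>M\<^esub> b = (x \<oplus>\<^bsub>M\<^esub> u) \<oplus>\<^bsub>M\<^esub> (y \<oplus>\<^bsub>M\<^esub> v)" using c by (simp add: M.a_ac)
    then show "a \<oplus>\<^bsub>M\<^esub> b \<in> ?S" using EA(5) EB(5) * by blast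
  next
    fix r a assume r: "r \<in> carrier R" and "a \<in> ?S"
    then obtain x y where *: "a = x \<oplus>\<^bsub>M\<^esub> y" "x \<in> A" "y \<in> B" by blast
    then have "r \<odot>\<^bsub>M\<^esub> a = r \<odot>\<^bsub>M\<^esub> x \<oplus>\<^bsub>M\<^esub> r \<odot>\<^bsub>M\<^esub> y" using c r by (simp add: smult_r_distr)
    then show "r \<odot>\<^bsub>M\<^esub> a \<in> ?S" using EA(4) EB(4) * r by blast
  qed
qed

text \<open>This replaces the Artin-Rees lemma: take for \<open>A'\<close> a submodule of \<open>A\<close> that is maximal with
  \<open>A' \<inter> B \<subseteq> C\<close>.\<close>

lemma (in module) separating_submodule:
  assumes N: "noetherian_module R M" and A: "submodule A R M" and B: "submodule B R M" and C: "submodule C R M"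
    and CAB: "C \<subseteq> A \<inter> B" and X: "finite X" "X \<subseteq> carrier R"
    and m: "\<And>x y. x \<in> X \<Longrightarrow> y \<in> A \<inter> B \<Longrightarrow> x [^] (m::nat) \<odot>\<^bsub>M\<^esub> y \<in> C"
  shows "\<exists>A' k. submodule A' R M \<and> A' \<subseteq> A \<and> A' \<inter> B \<subseteq> C \<and> (\<forall>x\<in>X. \<forall>y\<in>A. x [^] (k::nat) \<odot>\<^bsub>M\<^esub> y \<in> A')"
proof -
  define P where "P H \<longleftrightarrow> submodule H R M \<and> C \<subseteq> H \<and> H \<subseteq> A \<and> H \<inter> B \<subseteq> C" for H
  have "P C" using C CAB by (auto simp: P_def)
  from noetherian_module_maximal[of P, OF N this]
  obtain H where H: "P H" "\<And>K. P K \<Longrightarrow> H \<subseteq> K \<Longrightarrow> K = H" unfolding P_def by blast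
  have Hs: "submodule H R M" "C \<subseteq> H" "H \<subseteq> A" "H \<inter> B \<subseteq> C" using H(1) by (auto simp: P_def)
  have Ac: "y \<in> carrier M" if "y \<in> A" for y using submoduleE(1)[OF A] that by blast
  have one: "\<exists>k. \<forall>y\<in>A. x [^] (k::nat) \<odot>\<^bsub>M\<^esub> y \<in> H" if x: "x \<in> X" for x
  proof -
    have xR: "x \<in> carrier R" using x X by auto
    have powS: "x [^] (i + j) \<odot>\<^bsub>M\<^esub> y = x [^] i \<odot>\<^bsub>M\<^esub> (x [^] j \<odot>\<^bsub>M\<^esub> y)" if "y \<in> carrier M" for i j :: nat and y
      using xR that by (simp add: R.nat_pow_mult[symmetric] smult_assoc1)
    have swap: "u \<odot>\<^bsub>M\<^esub> (t \<odot>\<^bsub>M\<^esub> y) = t \<odot>\<^bsub>M\<^esub> (u \<odot>\<^bsub>M\<^esub> y)" if "u \<in> carrier R" "t \<in> carrier R" "y \<in> carrier M" for t u y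
      using that R.m_comm[of t u] by (metis smult_assoc1)
    \<comment> \<open>This ascending chain of submodules becomes constant at \<open>c\<close>, the
      exponent for which \<open>x\<close> will be shown to carry A into H.\<close>
    define Z where "Z k = {y \<in> carrier M. x [^] (k::nat) \<odot>\<^bsub>M\<^esub> y \<in> H}" for k
    have Z: "submodule (Z k) R M" for k
    proof (rule submoduleI)
      fix r y assume r: "r \<in> carrier R" and y: "y \<in> Z k"
      have "x [^] k \<odot>\<^bsub>M\<^esub> (r \<odot>\<^bsub>M\<^esub> y) = r \<odot>\<^bsub>M\<^esub> (x [^] k \<odot>\<^bsub>M\<^esub> y)"
        using swap[OF _ r] xR y by (simp add: Z_def)
      then show "r \<odot>\<^bsub>M\<^esub> y \<in> Z k" using r y submoduleE(4)[OF Hs(1)] by (simp add: Z_def)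
    qed (use xR submodule_zero[OF Hs(1)] submoduleE(3,5)[OF Hs(1)] in \<open>auto simp: Z_def smult_r_distr smult_r_minus\<close>)
    have "Z k \<subseteq> Z (Suc k)" for k
      using powS[of _ 1 k] xR submoduleE(4)[OF Hs(1)] by (auto simp: Z_def)
    from noetherian_module_chain[where H = Z, OF N Z this] obtain c where c: "\<forall>k\<ge>c. Z k = Z c" ..
    define I where "I = (\<lambda>y. x [^] c \<odot>\<^bsub>M\<^esub> y) ` A"
    have I: "submodule I R M"
      unfolding I_def using R.image_submodule[OF submodule.submodule_is_module[OF A module_axioms] module_axioms, of "\<lambda>y. x [^] c \<odot>\<^bsub>M\<^esub> y"]
        xR Ac swap[of "x [^] c"] by (auto simp: module_hom_def smult_r_distr)
    have IA: "I \<subseteq> A" using submoduleE(4)[OF A] xR by (auto simp: I_def)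
    \<comment> \<open>Adding the multiples \<open>I\<close> of A to H keeps the intersection with B
      inside C: for z = h + x^c y in K \<inter> B the element x^m z lies in C, so y lies in
      \<open>Z (m + c)\<close>, which equals \<open>Z c\<close>, and z was already in H. By
      maximality \<open>I\<close> then lies in H.\<close>
    define K where "K = {h \<oplus>\<^bsub>M\<^esub> y |h y. h \<in> H \<and> y \<in> I}"
    have K: "submodule K R M" "H \<subseteq> K" "I \<subseteq> K" unfolding K_def by (rule submodule_sum[OF Hs(1) I])+
    have "K \<subseteq> A" using Hs(3) IA submoduleE(5)[OF A] by (auto simp: K_def)
    moreover have "K \<inter> B \<subseteq> C"
    proof
      fix z assume z: "z \<in> K \<inter> B"
      then obtain h y where hy: "h \<in> H" "y \<in> A" "z = h \<oplus>\<^bsub>M\<^esub> x [^] c \<odot>\<^bsub>M\<^esub> y" by (auto simp: K_def I_def)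
      have cc: "h \<in> carrier M" "y \<in> carrier M" using hy Hs(3) Ac by auto
      have "x [^] m \<odot>\<^bsub>M\<^esub> z \<in> H" using m[OF x, of z] z \<open>K \<subseteq> A\<close> Hs(2) by blast
      moreover have "x [^] m \<odot>\<^bsub>M\<^esub> z = x [^] m \<odot>\<^bsub>M\<^esub> h \<oplus>\<^bsub>M\<^esub> x [^] (m + c) \<odot>\<^bsub>M\<^esub> y"
        using cc xR by (simp add: hy(3) smult_r_distr powS)
      moreover have mh: "x [^] m \<odot>\<^bsub>M\<^esub> h \<in> H" using submoduleE(4)[OF Hs(1) _ hy(1)] xR by simp
      ultimately have "x [^] (m + c) \<odot>\<^bsub>M\<^esub> y \<in> H"
        using submoduleE(5)[OF Hs(1) submoduleE(3)[OF Hs(1) mh], of "x [^] m \<odot>\<^bsub>M\<^esub> z"] cc xR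
        by (simp add: M.r_neg1)
      then have "y \<in> Z (m + c)" using cc by (simp add: Z_def)
      then have "y \<in> Z c" using c[rule_format, of "m + c"] by simp
      then have "z \<in> H" using hy submoduleE(5)[OF Hs(1) hy(1)] by (simp add: Z_def)
      then show "z \<in> C" using z Hs(4) by blast
    qed
    ultimately have "P K" using K Hs(2) by (auto simp: P_def)
    then have "K = H" using H(2) K(2) by blast
    then show ?thesis using K(3) by (auto simp: I_def)
  qed
  have "\<exists>k. \<forall>x\<in>Y. \<forall>y\<in>A. x [^] (k::nat) \<odot>\<^bsub>M\<^esub> y \<in> H" if "finite Y" "Y \<subseteq> X" for Y
    using that
  proof (induction Y rule: finite_induct)
    case (insert x Y)
    then obtain k l where kl: "\<forall>x\<in>Y. \<forall>y\<in>A. x [^] (k::nat) \<odot>\<^bsub>M\<^esub> y \<in> H" "\<forall>y\<in>A. x [^] (l::nat) \<odot>\<^bsub>M\<^esub> y \<in> H"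
      using one[of x] by auto
    have up: "z [^] (i + j) \<odot>\<^bsub>M\<^esub> y \<in> H" "z [^] (j + i) \<odot>\<^bsub>M\<^esub> y \<in> H"
      if "z \<in> carrier R" "y \<in> A" "z [^] j \<odot>\<^bsub>M\<^esub> y \<in> H" for i j :: nat and y z
    proof -
      have "z [^] (i + j) \<odot>\<^bsub>M\<^esub> y = z [^] i \<odot>\<^bsub>M\<^esub> (z [^] j \<odot>\<^bsub>M\<^esub> y)"
        using that Ac by (simp add: R.nat_pow_mult[symmetric] smult_assoc1)
      then show "z [^] (i + j) \<odot>\<^bsub>M\<^esub> y \<in> H" using submoduleE(4)[OF Hs(1) _ that(3)] that(1) by simp
      then show "z [^] (j + i) \<odot>\<^bsub>M\<^esub> y \<in> H" by (simp add: add.commute)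
    qed
    show ?case
    proof (intro exI[of _ "k + l"] ballI)
      fix z y assume z: "z \<in> insert x Y" and y: "y \<in> A"
      then have zR: "z \<in> carrier R" using insert.prems X(2) by auto
      show "z [^] (k + l) \<odot>\<^bsub>M\<^esub> y \<in> H"
      proof (cases "z \<in> Y")
        case True then show ?thesis using up(2)[OF zR y, of k l] kl(1) y by blast
      next
        case False then show ?thesis using up(1)[OF zR y, of l k] kl(2) y z by blast
      qed
    qed
  qed simp
  then obtain k where "\<forall>x\<in>X. \<forall>y\<in>A. x [^] (k::nat) \<odot>\<^bsub>M\<^esub> y \<in> H" using X(1) by blast
  then show ?thesis using Hs by blast
qed

section \<open>Gluing primitives over the generators of the ideal\<close>

context cring begin

lemma coboundary_diff:
  assumes "module R N" "coboundary N B d n f" "coboundary N B d n g"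
  shows "coboundary N B d n (\<lambda>v. f v \<ominus>\<^bsub>N\<^esub> g v)"
proof -
  from assms obtain a b where ab: "a\<in>free_hom (B (n - 1)) N" "\<forall>v\<in>Fr (B n). f v = a (d n v)"
    "b\<in>free_hom (B (n - 1)) N" "\<forall>v\<in>Fr (B n). g v = b (d n v)"
    unfolding coboundary_def by blast
  show ?thesis unfolding coboundary_def
    by (rule bexI[OF _ hom_diff[OF assms(1) ab(1,3)]]) (simp add: ab)
qed

lemma nested_subcomplex:
  assumes M: "module R M" and A: "submodule A R M" and B: "submodule B R M" and AB: "A \<subseteq> B"
  shows "subcomplex (res_basis R (M\<lparr>carrier := A\<rparr>)) (res_basis R (M\<lparr>carrier := B\<rparr>)) (res_d R)"
  using res_subcomplex[OF submodule_restrict[OF M A B AB] submodule_module[OF B M]] by simp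

text \<open>Given primitives of \<open>h\<close> on \<open>A\<close> and on \<open>B\<close>, their difference is a cocycle of lower degree on
  \<open>A \<inter> B\<close>; it has a primitive on a submodule \<open>C\<close> by induction on the degree, and after shrinking \<open>A\<close> so
  that \<open>A \<inter> B \<subseteq> C\<close> the primitives glue by Mayer-Vietoris.\<close>

lemma coboundary_on_large_submodule:
  assumes M: "module R M" and noeth: "noetherian_module R M" and N: "module R N"
    and X: "finite X" "X \<subseteq> carrier R"
    and tor: "\<And>a n K h. a \<in> X \<Longrightarrow> submodule K R M \<Longrightarrow> res_cocycle N (M\<lparr>carrier := K\<rparr>) n h \<Longrightarrow>
      \<exists>k::nat. res_coboundary N (M\<lparr>carrier := K\<rparr>) n (\<lambda>v. a [^] k \<odot>\<^bsub>N\<^esub> h v)"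
    and L: "submodule L R M" and h: "res_cocycle N (M\<lparr>carrier := L\<rparr>) n h"
  shows "\<exists>A k. submodule A R M \<and> A \<subseteq> L \<and> (\<forall>a\<in>X. \<forall>y\<in>L. a [^] (k::nat) \<odot>\<^bsub>M\<^esub> y \<in> A) \<and>
    res_coboundary N (M\<lparr>carrier := A\<rparr>) n h"
  using L h
proof (induction n arbitrary: L h)
  case 0
  note Lm = submodule_module[OF 0(1) M]
  interpret L: module R "M\<lparr>carrier := L\<rparr>" by (rule Lm)
  have "h (\<lambda>b. \<zero>) = \<zero>\<^bsub>N\<^esub>" using 0(2) fr_hom(4)[OF _ N] by (auto simp: cocycle_def)
  then have cob: "res_coboundary N (M\<lparr>carrier := L\<rparr>) 0 h"
    by (intro coboundary_0[OF N res_complex[OF Lm]])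
  show ?case
    using 0(1) cob by (intro exI[of _ L] exI[of _ "0::nat"]) (auto simp: L.smult_one[simplified])
next
  case (Suc n)
  note L = Suc.prems(1) and h = Suc.prems(2)
  interpret M: module R M by fact
  interpret N: module R N by fact
  note Lm = submodule_module[OF L M]
  interpret L: module R "M\<lparr>carrier := L\<rparr>" by (rule Lm)
  have Lc: "y \<in> carrier M" if "y \<in> L" for y using M.submoduleE(1)[OF L] that by blast
  \<comment> \<open>Inner induction over the generators treated so far. For none of them the zero
    submodule serves, since F(0) carries no cohomology.\<close>
  have "\<exists>A k. submodule A R M \<and> A \<subseteq> L \<and> (\<forall>a\<in>Y. \<forall>y\<in>L. a [^] (k::nat) \<odot>\<^bsub>M\<^esub> y \<in> A) \<and>
    res_coboundary N (M\<lparr>carrier := A\<rparr>) (Suc n) h" if "finite Y" "Y \<subseteq> X" for Y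
    using that
  proof (induction Y rule: finite_induct)
    case empty
    have "submodule {\<zero>\<^bsub>M\<^esub>} R M" by (rule zero_submodule[OF M])
    moreover have "res_coboundary N (M\<lparr>carrier := {\<zero>\<^bsub>M\<^esub>}\<rparr>) (Suc n) h"
      using zero_submodule_coboundary[OF N Lm h] by simp
    ultimately show ?case using submodule_zero[OF L] by (intro exI[of _ "{\<zero>\<^bsub>M\<^esub>}"]) auto
  next
    case (insert b Y)
    then obtain A k where A: "submodule A R M" "A \<subseteq> L" "\<forall>a\<in>Y. \<forall>y\<in>L. a [^] (k::nat) \<odot>\<^bsub>M\<^esub> y \<in> A"
      "res_coboundary N (M\<lparr>carrier := A\<rparr>) (Suc n) h" by auto
    have bR: "b \<in> carrier R" and bX: "b \<in> X" using insert X by auto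
    have sub: "submodule K R M" if "submodule K R (M\<lparr>carrier := L\<rparr>)" for K
    proof -
      have "module R (M\<lparr>carrier := K\<rparr>)" using submodule.submodule_is_module[OF that Lm] by simp
      then show ?thesis using L.submoduleE(1)[OF that] Lc by (intro M.module_incl_imp_submodule) auto
    qed
    have "\<exists>k::nat. res_coboundary N ((M\<lparr>carrier := L\<rparr>)\<lparr>carrier := K\<rparr>) (Suc n) (\<lambda>v. b [^] k \<odot>\<^bsub>N\<^esub> h v)"
      if K: "submodule K R (M\<lparr>carrier := L\<rparr>)" for K
      using tor[OF bX sub[OF K]] cocycle_subset[OF h res_subcomplex[OF K Lm]] by simp
    from power_submodule_coboundary[OF Lm M.submodule_noetherian[OF noeth L] N bR h this]
    obtain l where l: "res_coboundary N (M\<lparr>carrier := (\<lambda>x. b [^] (l::nat) \<odot>\<^bsub>M\<^esub> x) ` L\<rparr>) (Suc n) h"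
      by auto
    define B where "B = (\<lambda>x. b [^] l \<odot>\<^bsub>M\<^esub> x) ` L"
    have B: "submodule B R M" using sub[OF smult_image_submodule[OF Lm, of "b [^] l"]] bR by (simp add: B_def)
    have BL: "B \<subseteq> L" using M.submoduleE(4)[OF L] bR by (auto simp: B_def)
    have hB: "res_coboundary N (M\<lparr>carrier := B\<rparr>) (Suc n) h" using l by (simp add: B_def)
    obtain \<alpha> where \<alpha>: "\<alpha> \<in> free_hom (res_basis R (M\<lparr>carrier := A\<rparr>) n) N"
      "\<And>v. v \<in> res_chains (M\<lparr>carrier := A\<rparr>) (Suc n) \<Longrightarrow> h v = \<alpha> (res_d R (Suc n) v)"
      using A(4) unfolding coboundary_def diff_Suc_1 by blast
    obtain \<beta> where \<beta>: "\<beta> \<in> free_hom (res_basis R (M\<lparr>carrier := B\<rparr>) n) N"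
      "\<And>v. v \<in> res_chains (M\<lparr>carrier := B\<rparr>) (Suc n) \<Longrightarrow> h v = \<beta> (res_d R (Suc n) v)"
      using hB unfolding coboundary_def diff_Suc_1 by blast
    have E: "submodule (A \<inter> B) R M" by (rule submodule_Int[OF A(1) B M])
    have EA: "res_basis R (M\<lparr>carrier := A \<inter> B\<rparr>) j \<subseteq> res_basis R (M\<lparr>carrier := A\<rparr>) j"
      and EB: "res_basis R (M\<lparr>carrier := A \<inter> B\<rparr>) j \<subseteq> res_basis R (M\<lparr>carrier := B\<rparr>) j" for j
      using res_basis_Int[where R=R and M=M and A=A and B=B and n=j] by auto
    have hL: "h \<in> free_hom (res_basis R (M\<lparr>carrier := L\<rparr>) (Suc n)) N" using h by (simp add: cocycle_def)
    have "res_cocycle N (M\<lparr>carrier := A \<inter> B\<rparr>) n (\<lambda>v. \<alpha> v \<ominus>\<^bsub>N\<^esub> \<beta> v)"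
      unfolding cocycle_def
    proof (intro conjI ballI)
      show "(\<lambda>v. \<alpha> v \<ominus>\<^bsub>N\<^esub> \<beta> v) \<in> free_hom (res_basis R (M\<lparr>carrier := A \<inter> B\<rparr>) n) N"
        by (rule hom_diff[OF N free_hom_subset[OF \<alpha>(1) EA] free_hom_subset[OF \<beta>(1) EB]])
      fix v assume v: "v \<in> res_chains (M\<lparr>carrier := A \<inter> B\<rparr>) (Suc n)"
      have vL: "v \<in> res_chains (M\<lparr>carrier := L\<rparr>) (Suc n)"
        using Fr_mono[OF Fr_mono[OF v EA] subcomplexD(1)[OF nested_subcomplex[OF M A(1) L A(2)]]] .
      show "\<alpha> (res_d R (Suc n) v) \<ominus>\<^bsub>N\<^esub> \<beta> (res_d R (Suc n) v) = \<zero>\<^bsub>N\<^esub>"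
        unfolding \<alpha>(2)[OF Fr_mono[OF v EA], symmetric] \<beta>(2)[OF Fr_mono[OF v EB], symmetric]
        by (rule N.M.minus_self[OF fr_hom(1)[OF hL N vL]])
    qed
    \<comment> \<open>The outer induction keeps L general so that it can be applied to A \<inter> B
      here. It kills the difference of the primitives only on C, which may be smaller than A
      \<inter> B.\<close>
    from Suc.IH[OF E this] obtain C m where C: "submodule C R M" "C \<subseteq> A \<inter> B"
      "\<And>a y. a \<in> X \<Longrightarrow> y \<in> A \<inter> B \<Longrightarrow> a [^] (m::nat) \<odot>\<^bsub>M\<^esub> y \<in> C"
      "res_coboundary N (M\<lparr>carrier := C\<rparr>) n (\<lambda>v. \<alpha> v \<ominus>\<^bsub>N\<^esub> \<beta> v)" by blast
    obtain A' k' where A': "submodule A' R M" "A' \<subseteq> A" "A' \<inter> B \<subseteq> C" "\<forall>x\<in>X. \<forall>y\<in>A. x [^] (k'::nat) \<odot>\<^bsub>M\<^esub> y \<in> A'"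
      using M.separating_submodule[OF noeth A(1) B C(1,2) X C(3)] by blast
    \<comment> \<open>With A' in place of A the overlap with B lies in C, where the two primitives
      differ by a coboundary; Mayer-Vietoris is applied to D as the ambient module.\<close>
    define D where "D = {x \<oplus>\<^bsub>M\<^esub> y |x y. x \<in> A' \<and> y \<in> B}"
    have D: "submodule D R M" "A' \<subseteq> D" "B \<subseteq> D" unfolding D_def by (rule M.submodule_sum[OF A'(1) B])+
    have DL: "D \<subseteq> L" using subset_trans[OF A'(2) A(2)] BL by (auto simp: D_def intro!: M.submoduleE(5)[OF L])
    have I': "submodule (A' \<inter> B) R M" by (rule submodule_Int[OF A'(1) B M])
    note Dm = submodule_module[OF D(1) M]
    have subA: "res_basis R (M\<lparr>carrier := A'\<rparr>) j \<subseteq> res_basis R (M\<lparr>carrier := A\<rparr>) j" for j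
      by (rule subcomplexD(1)[OF nested_subcomplex[OF M A'(1) A(1) A'(2)]])
    have "res_coboundary N (M\<lparr>carrier := D\<rparr>) (Suc n) h"
    proof (rule mayer_vietoris[OF submodule_restrict[OF M A'(1) D(1,2)] submodule_restrict[OF M B D(1,3)] Dm N, of _ _ \<alpha> \<beta>])
      show "res_cocycle N (M\<lparr>carrier := D\<rparr>) (Suc n) h"
        by (rule cocycle_subset[OF h nested_subcomplex[OF M D(1) L DL]])
      show "\<exists>a\<in>A'. \<exists>b\<in>B. x = a \<oplus>\<^bsub>M\<lparr>carrier := D\<rparr>\<^esub> b" if "x \<in> carrier (M\<lparr>carrier := D\<rparr>)" for x
        using that by (auto simp: D_def)
      show "\<alpha> \<in> free_hom (res_basis R (M\<lparr>carrier := D, carrier := A'\<rparr>) (Suc n - 1)) N"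
        using free_hom_subset[OF \<alpha>(1) subA] by simp
      show "\<beta> \<in> free_hom (res_basis R (M\<lparr>carrier := D, carrier := B\<rparr>) (Suc n - 1)) N"
        using \<beta>(1) by simp
      show "h v = \<alpha> (res_d R (Suc n) v)" if "v \<in> res_chains (M\<lparr>carrier := D, carrier := A'\<rparr>) (Suc n)" for v
        using that \<alpha>(2) Fr_mono[OF _ subA] by simp
      show "h v = \<beta> (res_d R (Suc n) v)" if "v \<in> res_chains (M\<lparr>carrier := D, carrier := B\<rparr>) (Suc n)" for v
        using that \<beta>(2) by simp
      show "res_coboundary N (M\<lparr>carrier := D, carrier := A' \<inter> B\<rparr>) (Suc n - 1) (\<lambda>v. \<alpha> v \<ominus>\<^bsub>N\<^esub> \<beta> v)"
        using coboundary_subset[OF C(4) nested_subcomplex[OF M I' C(1) A'(3)]] by simp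
    qed
    \<comment> \<open>For the new generator \<open>l\<close> leads from L into B; for the earlier
      ones \<open>k\<close> leads into A and then \<open>k'\<close> into A'. The sum serves all of
      them, the surplus factors preserving L, respectively D.\<close>
    moreover have "a [^] (l + (k' + k)) \<odot>\<^bsub>M\<^esub> y \<in> D" if a: "a \<in> insert b Y" and y: "y \<in> L" for a y
    proof -
      have aR: "a \<in> carrier R" and aX: "a \<in> X" using a insert X by auto
      have pow: "a [^] (i + j) \<odot>\<^bsub>M\<^esub> z = a [^] i \<odot>\<^bsub>M\<^esub> (a [^] j \<odot>\<^bsub>M\<^esub> z)" if "z \<in> L" for i j :: nat and z
        using aR Lc that by (simp add: nat_pow_mult[symmetric] M.smult_assoc1)
      show ?thesis
      proof (cases "a = b")
        case True
        have "b [^] (k' + k) \<odot>\<^bsub>M\<^esub> y \<in> L" using M.submoduleE(4)[OF L _ y] bR by simp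
        then have "b [^] l \<odot>\<^bsub>M\<^esub> (b [^] (k' + k) \<odot>\<^bsub>M\<^esub> y) \<in> B" unfolding B_def by (rule imageI)
        then show ?thesis using D(3) y by (auto simp: True pow[unfolded True])
      next
        case False
        then have "a [^] k \<odot>\<^bsub>M\<^esub> y \<in> A" using a A(3) y by auto
        then have "a [^] k' \<odot>\<^bsub>M\<^esub> (a [^] k \<odot>\<^bsub>M\<^esub> y) \<in> D" using A'(4) aX D(2) by blast
        from M.submoduleE(4)[OF D(1) _ this, of "a [^] l"] show ?thesis
          using aR y M.submoduleE(4)[OF L _ y] by (simp add: pow)
      qed
    qed
    ultimately show ?case using D(1) DL by blast
  qed
  then show ?case using X(1) by blast
qed

section \<open>Quotient modules: chain maps modulo the resolution of the kernel\<close>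

lemma fhom_diff:
  assumes f: "f \<in> fhom B C" and g: "g \<in> fhom B C"
  shows "(\<lambda>v b. f v b \<ominus> g v b) \<in> fhom B C"
proof (rule fhomI)
  fix u assume u: "u \<in> Fr B"
  note m = fhom(1)[OF f] fhom(1)[OF g]
  show "(\<lambda>b. f u b \<ominus> g u b) \<in> Fr C" using m[OF u] by (intro Fr_closed)
  show "(\<lambda>b. f (\<lambda>b. u b \<oplus> v b) b \<ominus> g (\<lambda>b. u b \<oplus> v b) b) = (\<lambda>c. f u c \<ominus> g u c \<oplus> (f v c \<ominus> g v c))" if v: "v \<in> Fr B" for v
    using Fr_in[OF m(1)[OF u]] Fr_in[OF m(1)[OF v]] Fr_in[OF m(2)[OF u]] Fr_in[OF m(2)[OF v]]
    by (simp add: fhom(2)[OF f u v] fhom(2)[OF g u v] a_minus_def minus_add a_ac)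
  show "(\<lambda>b. f (\<lambda>b. r \<otimes> u b) b \<ominus> g (\<lambda>b. r \<otimes> u b) b) = (\<lambda>c. r \<otimes> (f u c \<ominus> g u c))" if r: "r \<in> carrier R" for r
    using r Fr_in[OF m(1)[OF u]] Fr_in[OF m(2)[OF u]]
    by (simp add: fhom(3)[OF f u r] fhom(3)[OF g u r] a_minus_def r_distr r_minus)
qed

lemma chain_map_mod_diff:
  assumes B: "complex B dB" and Q: "complex Q dQ"
    and f: "chain_map_mod B dB Q dQ T f" and g: "chain_map_mod B dB Q dQ T g"
  shows "chain_map_mod B dB Q dQ T (\<lambda>n v b. f n v b \<ominus> g n v b)"
  unfolding chain_map_mod_def
proof (intro conjI allI ballI)
  have fh: "f n \<in> fhom (B n) (Q n)" "g n \<in> fhom (B n) (Q n)" for n using f g by (auto simp: chain_map_mod_def)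
  show "(\<lambda>v b. f n v b \<ominus> g n v b) \<in> fhom (B n) (Q n)" for n by (rule fhom_diff[OF fh])
  fix n v assume v: "v \<in> Fr (B (Suc n))"
  have "agree_off (T n) (dQ (Suc n) (f (Suc n) v)) (f n (dB (Suc n) v))"
    "agree_off (T n) (dQ (Suc n) (g (Suc n) v)) (g n (dB (Suc n) v))"
    using f g v by (auto simp: chain_map_mod_def)
  then show "agree_off (T n) (dQ (Suc n) (\<lambda>b. f (Suc n) v b \<ominus> g (Suc n) v b)) (\<lambda>b. f n (dB (Suc n) v) b \<ominus> g n (dB (Suc n) v) b)"
    using fhom(5)[OF complexD(3)[OF Q] fhom(1)[OF fh(1) v] fhom(1)[OF fh(2) v]] by (simp add: agree_off_def)
qed

text \<open>This is the degree that \<open>exact_mod\<close> leaves out: there F(M) modulo F(A) has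
  homology M/A. Subtracting from v an element of F(A) with the same augmentation leaves a cycle,
  hence a boundary.\<close>

lemma boundary_mod_submodule:
  assumes M: "module R M" and A: "submodule A R M" and v: "v \<in> res_chains M 1"
    and a: "res_augmentation R M v \<in> A"
  shows "\<exists>w\<in>res_chains M 2. agree_off (res_basis R (M\<lparr>carrier := A\<rparr>) 1) (res_d R 2 w) v"
proof -
  interpret M: module R M by fact
  note ah = augmentation_hom[OF M]
  obtain x where x: "x \<in> res_chains (M\<lparr>carrier := A\<rparr>) 1" "res_augmentation R M v = res_augmentation R M x"
    using a submodule_augmentation_image[OF A M] by blast
  have xM: "x \<in> res_chains M 1" by (rule Fr_mono[OF x(1) subcomplexD(1)[OF res_subcomplex[OF A M]]])
  have z: "(\<lambda>b. v b \<ominus> x b) \<in> res_chains M 1" using v xM by (rule Fr_closed)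
  have "res_cycle R M 1 (\<lambda>b. v b \<ominus> x b)"
    using x(2) fr_hom(1)[OF ah M xM] by (simp add: res_cycle_def fr_hom(5)[OF ah M v xM] M.M.minus_self)
  then obtain w where w: "w \<in> res_chains M 2" "res_d R 2 w = (\<lambda>b. v b \<ominus> x b)"
    using res_cycle_exact[OF M _ z] by (auto simp: numeral_2_eq_2)
  have "agree_off (res_basis R (M\<lparr>carrier := A\<rparr>) 1) (\<lambda>b. v b \<ominus> x b) v"
    using Fr_outside[OF x(1)] Fr_in[OF v] by (auto simp: agree_off_def a_minus_def)
  then show ?thesis by (intro bexI[OF _ w(1)]) (simp only: w(2))
qed

text \<open>By \<open>aug\<close>, f and g induce the same map into M'/A. Since F(M') modulo F(A)
  resolves M'/A, their difference is null-homotopic modulo F(A), which suffices because h vanishes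
  there.\<close>

lemma homotopic_coboundary:
  assumes N: "module R N" and M: "module R M" "module R M'" and A: "submodule A R M'"
    and f: "chain_map_mod (res_basis R M) (res_d R) (res_basis R M') (res_d R) (res_basis R (M'\<lparr>carrier := A\<rparr>)) f"
    and g: "chain_map_mod (res_basis R M) (res_d R) (res_basis R M') (res_d R) (res_basis R (M'\<lparr>carrier := A\<rparr>)) g"
    and aug: "\<And>v. v \<in> res_chains M 1 \<Longrightarrow> res_augmentation R M' (f 1 v) \<ominus>\<^bsub>M'\<^esub> res_augmentation R M' (g 1 v) \<in> A"
    and h: "res_cocycle N M' n h"
    and hA: "\<And>v. v \<in> res_chains (M'\<lparr>carrier := A\<rparr>) n \<Longrightarrow> h v = \<zero>\<^bsub>N\<^esub>"
  shows "res_coboundary N M n (\<lambda>v. h (f n v) \<ominus>\<^bsub>N\<^esub> h (g n v))"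
proof -
  note cx = res_complex[OF M(1)] and cx' = res_complex[OF M(2)]
  have fh: "f n \<in> fhom (res_basis R M n) (res_basis R M' n)" "g n \<in> fhom (res_basis R M n) (res_basis R M' n)" for n
    using f g by (auto simp: chain_map_mod_def)
  have hh: "h \<in> free_hom (res_basis R M' n) N" using h by (simp add: cocycle_def)
  have "res_coboundary N M n (\<lambda>v. h (\<lambda>b. f n v b \<ominus> g n v b))"
  proof (rule null_homotopic_coboundary[OF N cx cx' res_subcomplex[OF A M(2)] chain_map_mod_diff[OF cx cx' f g]
        submodule_exact_mod[OF A M(2)] _ h hA])
    fix v assume v: "v \<in> res_chains M 1"
    note m = fhom(1)[OF fh(1) v] fhom(1)[OF fh(2) v]
    show "\<exists>w\<in>res_chains M' 2. agree_off (res_basis R (M'\<lparr>carrier := A\<rparr>) 1) (res_d R 2 w) (\<lambda>b. f 1 v b \<ominus> g 1 v b)"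
      using aug[OF v] fr_hom(5)[OF augmentation_hom[OF M(2)] M(2) m]
      by (intro boundary_mod_submodule[OF M(2) A Fr_closed(3)[OF m]]) simp
  qed
  then show ?thesis
    by (rule coboundary_cong) (simp add: fr_hom(5)[OF hh N] fhom(1)[OF fh(1)] fhom(1)[OF fh(2)])
qed

lemma chain_map_id: "complex B d \<Longrightarrow> chain_map_mod B d B d T (\<lambda>n v. v)"
  by (auto simp: chain_map_mod_def module_hom_def free_simps)

lemma res_map_kernel:
  assumes M: "module R M" "module R M'" and f: "f \<in> module_hom R M M'" and A: "submodule A R M"
    and fA: "\<And>x. x \<in> A \<Longrightarrow> f x = \<zero>\<^bsub>M'\<^esub>" and v: "v \<in> res_chains (M\<lparr>carrier := A\<rparr>) n"
  shows "res_map R f v \<in> res_chains (M'\<lparr>carrier := {\<zero>\<^bsub>M'\<^esub>}\<rparr>) n"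
proof -
  have "f \<in> module_hom R (M\<lparr>carrier := A\<rparr>) (M'\<lparr>carrier := {\<zero>\<^bsub>M'\<^esub>}\<rparr>)"
    using f fA submodule_in[OF A] by (auto simp: module_hom_def)
  from fhom(1)[OF res_map_fhom[OF submodule_module[OF A M(1)] submodule_module[OF zero_submodule[OF M(2)] M(2)] this] v]
  show ?thesis .
qed

text \<open>F(M) modulo F(A) is another free resolution of M', and s lifts the identity of M' to it.
  The representatives in F(M) commute with the differentials only modulo F(A).\<close>

lemma chain_section_mod_kernel:
  fixes M :: "('a, 'm, 'x) module_scheme" and M' :: "('a, 'k, 'z) module_scheme"
  assumes M: "module R M" "module R M'" and p: "p \<in> module_hom R M M'" "p ` carrier M = carrier M'"
    and A: "submodule A R M" "\<And>x. x \<in> carrier M \<Longrightarrow> p x = \<zero>\<^bsub>M'\<^esub> \<longleftrightarrow> x \<in> A"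
  obtains s where "chain_map_mod (res_basis R M') (res_d R) (res_basis R M) (res_d R) (res_basis R (M\<lparr>carrier := A\<rparr>)) s"
    "\<And>v. v \<in> res_chains M' 1 \<Longrightarrow> p (res_augmentation R M (s 1 v)) = res_augmentation R M' v"
proof -
  interpret Q: module R "free_module R (res_basis R M 1)" by (rule free_module_module)
  note ah = augmentation_hom[OF M(1)] and ah' = augmentation_hom[OF M(2)]
  have "\<exists>y\<in>res_chains M 1. p (res_augmentation R M y) = res_augmentation R M' (unit_vec R b)" if "b \<in> res_basis R M' 1" for b
  proof -
    have "res_augmentation R M' (unit_vec R b) \<in> carrier M'" by (rule fr_hom(1)[OF ah' M(2) unit_vec_carrier[OF that]])
    also have "carrier M' = p ` res_augmentation R M ` res_chains M 1" using p(2) augmentation_image[OF M(1)] by simp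
    finally show ?thesis by force
  qed
  then obtain y where y: "\<And>b. b \<in> res_basis R M' 1 \<Longrightarrow> y b \<in> res_chains M 1"
    "\<And>b. b \<in> res_basis R M' 1 \<Longrightarrow> p (res_augmentation R M (y b)) = res_augmentation R M' (unit_vec R b)" by metis
  define f1 where "f1 = lin_ext R (free_module R (res_basis R M 1)) y"
  have f1: "f1 \<in> fhom (res_basis R M' 1) (res_basis R M 1)" unfolding f1_def using y(1) by (intro Q.lin_ext_hom) auto
  have f1u: "f1 (unit_vec R b) = y b" if "b \<in> res_basis R M' 1" for b
    unfolding f1_def using y(1)[OF that] by (rule Q.lin_ext_unit_vec)
  have aug: "p (res_augmentation R M (f1 v)) = res_augmentation R M' v" if v: "v \<in> res_chains M' 1" for v
    by (rule fr_eqI[OF M(2) hom_comp[OF f1 hom_comp[OF ah p(1)]] ah' _ v]) (simp add: f1u y(2))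
  have "\<exists>f. f 1 = f1 \<and> chain_map_mod (res_basis R M') (res_d R) (res_basis R M) (res_d R) (res_basis R (M\<lparr>carrier := A\<rparr>)) f"
  proof (rule extend_chain_map[OF res_complex[OF M(2)] res_complex[OF M(1)] res_subcomplex[OF A(1) M(1)] f1 submodule_exact_mod[OF A(1) M(1)]])
    fix v assume v: "v \<in> res_chains M' 2"
    have dv: "res_d R 2 v \<in> res_chains M' 1" using complexD(5)[OF res_complex[OF M(2)], of v 1] v by (simp add: numeral_2_eq_2)
    have "res_cycle R M' 1 (res_d R 2 v)" using res_cycle_exact[OF M(2) _ dv] v by (auto simp: numeral_2_eq_2)
    then have "p (res_augmentation R M (f1 (res_d R 2 v))) = \<zero>\<^bsub>M'\<^esub>" by (simp add: aug[OF dv] res_cycle_def)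
    moreover have f: "f1 (res_d R 2 v) \<in> res_chains M 1" by (rule fhom(1)[OF f1 dv])
    ultimately have "res_augmentation R M (f1 (res_d R 2 v)) \<in> A" using A(2)[OF fr_hom(1)[OF ah M(1) f]] by simp
    then show "\<exists>w\<in>res_chains M 2. agree_off (res_basis R (M\<lparr>carrier := A\<rparr>) 1) (res_d R 2 w) (f1 (res_d R 2 v))"
      by (rule boundary_mod_submodule[OF M(1) A(1) f])
  qed
  then show ?thesis using that aug by metis
qed

text \<open>Extension by zero on the remaining basis. Subtracting g d from h then gives a
  cohomologous cocycle that vanishes on C, the normalisation used below.\<close>

lemma extend_primitive:
  assumes N: "module R N" and C: "subcomplex C B d" and h: "coboundary N C d n h"
  obtains g where "g \<in> free_hom (B (n - 1)) N" "\<And>v. v \<in> Fr (C n) \<Longrightarrow> h v = g (d n v)"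
proof -
  obtain g0 where g0: "g0 \<in> free_hom (C (n - 1)) N" "\<And>v. v \<in> Fr (C n) \<Longrightarrow> h v = g0 (d n v)"
    using h unfolding coboundary_def by blast
  obtain g where "g \<in> free_hom (B (n - 1)) N" "\<And>v. v \<in> Fr (C (n - 1)) \<Longrightarrow> g v = g0 v"
    by (rule free_hom_extend[OF N g0(1) subcomplexD(1)[OF C]]) (rule that)
  then show ?thesis using that g0(2) subcomplexD(2)[OF C] by metis
qed

lemma cocycle_comp_chain_map_mod:
  assumes N: "module R N" and B: "complex B dB" and Q: "complex Q dQ"
    and s: "chain_map_mod B dB Q dQ T s" and h: "cocycle N Q dQ n h" and hT: "\<And>v. v \<in> Fr (T n) \<Longrightarrow> h v = \<zero>\<^bsub>N\<^esub>"
  shows "cocycle N B dB n (\<lambda>v. h (s n v))"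
  unfolding cocycle_def
proof (intro conjI ballI)
  have hh: "h \<in> free_hom (Q n) N" using h by (simp add: cocycle_def)
  have sh: "s n \<in> fhom (B n) (Q n)" for n using s by (simp add: chain_map_mod_def)
  show "(\<lambda>v. h (s n v)) \<in> free_hom (B n) N" by (rule hom_comp[OF sh hh])
  fix v assume v: "v \<in> Fr (B (Suc n))"
  have sv: "s (Suc n) v \<in> Fr (Q (Suc n))" by (rule fhom(1)[OF sh v])
  have "agree_off (T n) (dQ (Suc n) (s (Suc n) v)) (s n (dB (Suc n) v))" using s v by (simp add: chain_map_mod_def)
  then have "h (s n (dB (Suc n) v)) = h (dQ (Suc n) (s (Suc n) v))"
    by (intro hom_agree[OF N hh hT, symmetric] complexD(5)[OF Q sv] fhom(1)[OF sh] complexD(5)[OF B v])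
  then show "h (s n (dB (Suc n) v)) = \<zero>\<^bsub>N\<^esub>" using h sv by (simp add: cocycle_def)
qed

text \<open>Exactness of Ext(M', N) \<rightarrow> Ext(M, N) \<rightarrow> Ext(A, N) in the middle.
  Once h is normalised to vanish on F(A), its composite with the section s is a cocycle on F(M'); s
  after the map induced by p is homotopic to the identity modulo F(A), so this cocycle pulls back to
  the class of h.\<close>

lemma cocycle_from_quotient:
  fixes M :: "('a, 'm, 'x) module_scheme" and M' :: "('a, 'k, 'z) module_scheme"
  assumes N: "module R N" and M: "module R M" "module R M'"
    and p: "p \<in> module_hom R M M'" "p ` carrier M = carrier M'"
    and A: "submodule A R M" "\<And>x. x \<in> carrier M \<Longrightarrow> p x = \<zero>\<^bsub>M'\<^esub> \<longleftrightarrow> x \<in> A"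
    and h: "res_cocycle N M n h" and hA: "res_coboundary N (M\<lparr>carrier := A\<rparr>) n h"
  shows "\<exists>h'. res_cocycle N M' n h' \<and>
    res_coboundary N M n (\<lambda>v. h' (res_map R p v) \<ominus>\<^bsub>N\<^esub> h v)"
proof -
  interpret N: module R N by fact
  interpret M: module R M by fact
  interpret M': module R M' by fact
  note cx = res_complex[OF M(1)] and cx' = res_complex[OF M(2)] and sA = res_subcomplex[OF A(1) M(1)]
  obtain g where g: "g \<in> free_hom (res_basis R M (n - 1)) N"
    "\<And>v. v \<in> res_chains (M\<lparr>carrier := A\<rparr>) n \<Longrightarrow> h v = g (res_d R n v)"
    using extend_primitive[OF N sA hA] by blast
  define h0 where "h0 v = h v \<ominus>\<^bsub>N\<^esub> g (res_d R n v)" for v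
  have h0: "res_cocycle N M n h0"
    unfolding h0_def[abs_def] by (rule cocycle_diff[OF N cx h cocycle_d[OF N cx g(1)]])
  have hh: "h \<in> free_hom (res_basis R M n) N" "h0 \<in> free_hom (res_basis R M n) N"
    using h h0 by (auto simp: cocycle_def)
  have gd: "g (res_d R n v) \<in> carrier N" if "v \<in> res_chains M n" for v
    by (rule fr_hom(1)[OF g(1) N fhom(1)[OF complexD(2)[OF cx] that]])
  have h0A: "h0 v = \<zero>\<^bsub>N\<^esub>" if v: "v \<in> res_chains (M\<lparr>carrier := A\<rparr>) n" for v
    using gd[OF Fr_mono[OF v subcomplexD(1)[OF sA]]] by (simp add: h0_def g(2)[OF v] N.M.minus_self)
  obtain s where s: "chain_map_mod (res_basis R M') (res_d R) (res_basis R M) (res_d R) (res_basis R (M\<lparr>carrier := A\<rparr>)) s"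
    "\<And>v. v \<in> res_chains M' 1 \<Longrightarrow> p (res_augmentation R M (s 1 v)) = res_augmentation R M' v"
    using chain_section_mod_kernel[OF M p A] by blast
  have sh: "s n \<in> fhom (res_basis R M' n) (res_basis R M n)" for n using s by (simp add: chain_map_mod_def)
  note ph = res_map_fhom[OF M p(1)]
  have sp: "chain_map_mod (res_basis R M) (res_d R) (res_basis R M) (res_d R) (res_basis R (M\<lparr>carrier := A\<rparr>)) (\<lambda>n v. s n (res_map R p v))"
    unfolding chain_map_mod_def
  proof (intro conjI allI ballI)
    show "(\<lambda>v. s n (res_map R p v)) \<in> fhom (res_basis R M n) (res_basis R M n)" for n by (rule hom_comp[OF ph sh])
    fix n v assume v: "v \<in> res_chains M (Suc n)"
    show "agree_off (res_basis R (M\<lparr>carrier := A\<rparr>) n) (res_d R (Suc n) (s (Suc n) (res_map R p v))) (s n (res_map R p (res_d R (Suc n) v)))"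
      using s(1) fhom(1)[OF ph v] by (simp add: chain_map_mod_def res_d_res_map[OF M p(1) v, symmetric])
  qed
  have "res_coboundary N M n (\<lambda>v. h0 (s n (res_map R p v)) \<ominus>\<^bsub>N\<^esub> h0 v)"
  proof (rule homotopic_coboundary[OF N M(1) M(1) A(1) sp chain_map_id[OF cx] _ h0 h0A])
    fix v assume v: "v \<in> res_chains M 1"
    note ah = augmentation_hom[OF M(1)]
    have c: "res_augmentation R M (s 1 (res_map R p v)) \<in> carrier M" "res_augmentation R M v \<in> carrier M"
      using fr_hom(1)[OF ah M(1)] fhom(1)[OF sh fhom(1)[OF ph v]] v by auto
    have "p (res_augmentation R M (s 1 (res_map R p v)) \<ominus>\<^bsub>M\<^esub> res_augmentation R M v)
        = p (res_augmentation R M (s 1 (res_map R p v))) \<ominus>\<^bsub>M'\<^esub> p (res_augmentation R M v)"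
      using p(1) c M.module_hom_minus[OF M(2) p(1)] by (simp add: module_hom_def a_minus_def)
    also have "\<dots> = \<zero>\<^bsub>M'\<^esub>"
      unfolding s(2)[OF fhom(1)[OF ph v]] augmentation_map[OF M p(1) v]
      using p(1) c(2) by (intro M'.M.minus_self) (auto simp: module_hom_def)
    finally show "res_augmentation R M (s 1 (res_map R p v)) \<ominus>\<^bsub>M\<^esub> res_augmentation R M v \<in> A"
      using A(2) c by simp
  qed
  moreover have "res_coboundary N M n (\<lambda>v. g (res_d R n v))"
    using g(1) unfolding coboundary_def by blast
  ultimately have "res_coboundary N M n (\<lambda>v. h0 (s n (res_map R p v)) \<ominus>\<^bsub>N\<^esub> h0 v \<ominus>\<^bsub>N\<^esub> g (res_d R n v))"
    by (rule coboundary_diff[OF N])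
  then have "res_coboundary N M n (\<lambda>v. h0 (s n (res_map R p v)) \<ominus>\<^bsub>N\<^esub> h v)"
  proof (rule coboundary_cong)
    fix v assume v: "v \<in> res_chains M n"
    have "h0 (s n (res_map R p v)) \<in> carrier N" by (rule fr_hom(1)[OF hh(2) N fhom(1)[OF sh fhom(1)[OF ph v]]])
    then show "h0 (s n (res_map R p v)) \<ominus>\<^bsub>N\<^esub> h v = h0 (s n (res_map R p v)) \<ominus>\<^bsub>N\<^esub> h0 v \<ominus>\<^bsub>N\<^esub> g (res_d R n v)"
      using gd[OF v] fr_hom(1)[OF hh(1) N v]
      by (simp add: h0_def[of v] a_minus_def N.M.minus_add N.M.a_assoc N.M.r_neg)
  qed
  moreover have "res_cocycle N M' n (\<lambda>v. h0 (s n v))"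
    by (rule cocycle_comp_chain_map_mod[OF N cx' cx s(1) h0 h0A])
  ultimately show ?thesis by blast
qed

end

text \<open>\<open>set2_syz\<close> collects the leaves, so \<open>map_syz id f\<close> depends on f
  only through its values on the carrier. Hence homomorphisms that agree on the carrier induce the
  same map of resolutions.\<close>

lemma syz_basis_set:
  "b \<in> syz_basis R M n \<Longrightarrow> set2_syz b \<subseteq> carrier M"
proof (induction n arbitrary: b)
  case 0 then show ?case by (auto simp: syz_basis.simps)
next
  case (Suc n)
  obtain l where l: "b = Syz l" "l \<in> lists (carrier R \<times> syz_basis R M n)"
    using Suc.prems by (cases n) (auto simp: syz_basis.simps)
  then show ?case using Suc.IH by (fastforce simp: in_lists_conv_set)
qed

context cring begin

lemma res_map_comp:
  assumes M: "module R M" "module R M'" "module R M''"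
    and f: "f \<in> module_hom R M M'" "g \<in> module_hom R M' M''" "k \<in> module_hom R M M''"
    and k: "\<And>x. x \<in> carrier M \<Longrightarrow> g (f x) = k x" and v: "v \<in> res_chains M n"
  shows "res_map R g (res_map R f v) = res_map R k v"
proof (rule fr_eqI[OF free_module_module hom_comp[OF res_map_fhom[OF M(1,2) f(1)] res_map_fhom[OF M(2,3) f(2)]]
      res_map_fhom[OF M(1,3) f(3)] _ v])
  fix b assume b: "b \<in> res_basis R M n"
  then have "set2_syz b \<subseteq> carrier M" using syz_basis_set[of b R M] by (cases n) (auto simp: res_basis_Suc)
  then have "map_syz id (g \<circ> f) b = map_syz id k b" using k by (intro syz.map_cong) auto
  then show "res_map R g (res_map R f (unit_vec R b)) = res_map R k (unit_vec R b)"
    by (simp add: res_map_unit_vec syz.map_comp)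
qed

text \<open>Since g vanishes on F(A), g s is a primitive of h p s on F(M'), with s the section
  above. The composite p s is homotopic to the identity only modulo F(0), because p carries F(A)
  into F(0); hence the hypothesis \<open>h0\<close>.\<close>

lemma quotient_coboundary:
  fixes M :: "('a, 'm, 'x) module_scheme" and M' :: "('a, 'k, 'z) module_scheme"
  assumes N: "module R N" and M: "module R M" "module R M'"
    and p: "p \<in> module_hom R M M'" "p ` carrier M = carrier M'"
    and A: "submodule A R M" "\<And>x. x \<in> carrier M \<Longrightarrow> p x = \<zero>\<^bsub>M'\<^esub> \<longleftrightarrow> x \<in> A"
    and h: "res_cocycle N M' n h"
    and h0: "\<And>v. v \<in> res_chains (M'\<lparr>carrier := {\<zero>\<^bsub>M'\<^esub>}\<rparr>) n \<Longrightarrow> h v = \<zero>\<^bsub>N\<^esub>"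
    and g: "g \<in> free_hom (res_basis R M (n - 1)) N"
    and hg: "\<And>v. v \<in> res_chains M n \<Longrightarrow> h (res_map R p v) = g (res_d R n v)"
    and gA: "\<And>v. v \<in> res_chains (M\<lparr>carrier := A\<rparr>) (n - 1) \<Longrightarrow> g v = \<zero>\<^bsub>N\<^esub>"
  shows "res_coboundary N M' n h"
proof (cases n)
  case 0
  then show ?thesis using h fr_hom(4)[OF _ N] coboundary_0[OF N res_complex[OF M(2)]] by (auto simp: cocycle_def)
next
  case (Suc m)
  interpret N: module R N by fact
  interpret M: module R M by fact
  interpret M': module R M' by fact
  note cx = res_complex[OF M(1)] and cx' = res_complex[OF M(2)]
  have hh: "h \<in> free_hom (res_basis R M' n) N" using h by (simp add: cocycle_def)
  obtain s where s: "chain_map_mod (res_basis R M') (res_d R) (res_basis R M) (res_d R) (res_basis R (M\<lparr>carrier := A\<rparr>)) s"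
    "\<And>v. v \<in> res_chains M' 1 \<Longrightarrow> p (res_augmentation R M (s 1 v)) = res_augmentation R M' v"
    using chain_section_mod_kernel[OF M p A] by blast
  have sh: "s n \<in> fhom (res_basis R M' n) (res_basis R M n)" for n using s by (simp add: chain_map_mod_def)
  note ph = res_map_fhom[OF M p(1)]
  have pA: "res_map R p v \<in> res_chains (M'\<lparr>carrier := {\<zero>\<^bsub>M'\<^esub>}\<rparr>) n" if "v \<in> res_chains (M\<lparr>carrier := A\<rparr>) n" for v n
    using A(2) submodule_in[OF A(1)] by (intro res_map_kernel[OF M p(1) A(1) _ that]) auto
  have ps: "chain_map_mod (res_basis R M') (res_d R) (res_basis R M') (res_d R)
      (res_basis R (M'\<lparr>carrier := {\<zero>\<^bsub>M'\<^esub>}\<rparr>)) (\<lambda>n v. res_map R p (s n v))"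
    unfolding chain_map_mod_def
  proof (intro conjI allI ballI)
    show "(\<lambda>v. res_map R p (s n v)) \<in> fhom (res_basis R M' n) (res_basis R M' n)" for n by (rule hom_comp[OF sh ph])
    fix n v assume v: "v \<in> res_chains M' (Suc n)"
    have sv: "s (Suc n) v \<in> res_chains M (Suc n)" by (rule fhom(1)[OF sh v])
    have "agree_off (res_basis R (M\<lparr>carrier := A\<rparr>) n) (res_d R (Suc n) (s (Suc n) v)) (s n (res_d R (Suc n) v))"
      using s(1) v by (simp add: chain_map_mod_def)
    from fhom_agree[OF ph pA complexD(5)[OF cx sv] fhom(1)[OF sh complexD(5)[OF cx' v]] this]
    show "agree_off (res_basis R (M'\<lparr>carrier := {\<zero>\<^bsub>M'\<^esub>}\<rparr>) n) (res_d R (Suc n) (res_map R p (s (Suc n) v)))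
       (res_map R p (s n (res_d R (Suc n) v)))"
      unfolding res_d_res_map[OF M p(1) sv] .
  qed
  have 1: "res_coboundary N M' n (\<lambda>v. h (res_map R p (s n v)) \<ominus>\<^bsub>N\<^esub> h v)"
  proof (rule homotopic_coboundary[OF N M(2) M(2) zero_submodule[OF M(2)] ps chain_map_id[OF cx'] _ h h0])
    fix v assume v: "v \<in> res_chains M' 1"
    show "res_augmentation R M' (res_map R p (s 1 v)) \<ominus>\<^bsub>M'\<^esub> res_augmentation R M' v \<in> {\<zero>\<^bsub>M'\<^esub>}"
      unfolding augmentation_map[OF M p(1) fhom(1)[OF sh v]] s(2)[OF v]
      using M'.M.minus_self[OF fr_hom(1)[OF augmentation_hom[OF M(2)] M(2) v]] by simp
  qed
  have "(\<lambda>v. g (s (n - 1) v)) \<in> free_hom (res_basis R M' (n - 1)) N" by (rule hom_comp[OF sh g])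
  moreover have "h (res_map R p (s n v)) = g (s (n - 1) (res_d R n v))" if v: "v \<in> res_chains M' n" for v
  proof -
    have sv: "s n v \<in> res_chains M n" by (rule fhom(1)[OF sh v])
    have "agree_off (res_basis R (M\<lparr>carrier := A\<rparr>) (n - 1)) (res_d R n (s n v)) (s (n - 1) (res_d R n v))"
      using s(1) v Suc by (simp add: chain_map_mod_def)
    from hom_agree[OF N g gA _ _ this] show ?thesis
      using fhom(1)[OF complexD(2)[OF cx] sv] fhom(1)[OF sh fhom(1)[OF complexD(2)[OF cx'] v]] by (simp add: hg[OF sv])
  qed
  ultimately have 2: "res_coboundary N M' n (\<lambda>v. h (res_map R p (s n v)))"
    unfolding coboundary_def by (intro bexI[of _ "\<lambda>v. g (s (n - 1) v)"]) auto
  from coboundary_diff[OF N 2 1] show ?thesis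
  proof (rule coboundary_cong)
    fix v assume v: "v \<in> res_chains M' n"
    have "h v \<in> carrier N" "h (res_map R p (s n v)) \<in> carrier N"
      using fr_hom(1)[OF hh N] v fhom(1)[OF ph fhom(1)[OF sh v]] by auto
    then show "h v = h (res_map R p (s n v)) \<ominus>\<^bsub>N\<^esub> (h (res_map R p (s n v)) \<ominus>\<^bsub>N\<^esub> h v)"
      by (simp add: a_minus_def N.M.minus_add N.M.r_neg1 N.M.r_neg2)
  qed
qed

text \<open>Exactness one step earlier: a class of M' that dies on M comes from a class of A in one
  degree less, represented by \<open>\<alpha>\<close> below. By \<open>large\<close> this class dies
  on some \<open>H i\<close>, so the original class dies on the quotient by
  \<open>H i\<close>.\<close>

lemma coboundary_on_finer_quotient:
  fixes M :: "('a, 'm, 'x) module_scheme" and M' :: "('a, 'k, 'z) module_scheme"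
  assumes N: "module R N" and M: "module R M" "module R M'"
    and p: "p \<in> module_hom R M M'"
    and A: "submodule A R M" "\<And>x. x \<in> A \<Longrightarrow> p x = \<zero>\<^bsub>M'\<^esub>"
    and h: "res_cocycle N M' n h"
    and hp: "res_coboundary N M n (\<lambda>v. h (res_map R p v))"
    and large: "\<And>\<beta> m. res_cocycle N (M\<lparr>carrier := A\<rparr>) m \<beta> \<Longrightarrow>
      \<exists>i. submodule (H i) R M \<and> Q i \<and> res_coboundary N (M\<lparr>carrier := H i\<rparr>) m \<beta>"
    and M'': "\<And>i. Q i \<Longrightarrow> module R (M'' i)"
      "\<And>i. Q i \<Longrightarrow> p'' i \<in> module_hom R M (M'' i)" "\<And>i. Q i \<Longrightarrow> p'' i ` carrier M = carrier (M'' i)"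
      "\<And>i x. Q i \<Longrightarrow> x \<in> carrier M \<Longrightarrow> p'' i x = \<zero>\<^bsub>M'' i\<^esub> \<longleftrightarrow> x \<in> H i"
      "\<And>i. Q i \<Longrightarrow> \<rho> i \<in> module_hom R (M'' i) M'"
      "\<And>i x. Q i \<Longrightarrow> x \<in> carrier M \<Longrightarrow> \<rho> i (p'' i x) = p x"
  shows "\<exists>i. Q i \<and> res_coboundary N (M'' i) n (\<lambda>v. h (res_map R (\<rho> i) v))"
proof -
  interpret N: module R N by fact
  interpret M: module R M by fact
  interpret M': module R M' by fact
  note cx = res_complex[OF M(1)] and cx' = res_complex[OF M(2)]
  note ph = res_map_fhom[OF M p]
  have hh: "h \<in> free_hom (res_basis R M' n) N" using h by (simp add: cocycle_def)
  obtain g0 where g0: "g0 \<in> free_hom (res_basis R M' (n - 1)) N"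
    "\<And>v. v \<in> res_chains (M'\<lparr>carrier := {\<zero>\<^bsub>M'\<^esub>}\<rparr>) n \<Longrightarrow> h v = g0 (res_d R n v)"
    using extend_primitive[OF N res_subcomplex[OF zero_submodule[OF M(2)] M(2)] zero_submodule_coboundary[OF N M(2) h]] by blast
  define h0 where "h0 v = h v \<ominus>\<^bsub>N\<^esub> g0 (res_d R n v)" for v
  have h0: "res_cocycle N M' n h0"
    unfolding h0_def[abs_def] by (rule cocycle_diff[OF N cx' h cocycle_d[OF N cx' g0(1)]])
  have h0h: "h0 \<in> free_hom (res_basis R M' n) N" using h0 by (simp add: cocycle_def)
  have g0d: "g0 (res_d R n v) \<in> carrier N" if "v \<in> res_chains M' n" for v
    by (rule fr_hom(1)[OF g0(1) N fhom(1)[OF complexD(2)[OF cx'] that]])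
  have h0z: "h0 v = \<zero>\<^bsub>N\<^esub>" if v: "v \<in> res_chains (M'\<lparr>carrier := {\<zero>\<^bsub>M'\<^esub>}\<rparr>) n" for v
    using g0d[OF Fr_mono[OF v subcomplexD(1)[OF res_subcomplex[OF zero_submodule[OF M(2)] M(2)]]]]
    by (simp add: h0_def g0(2)[OF v] N.M.minus_self)
  obtain a where a: "a \<in> free_hom (res_basis R M (n - 1)) N"
    "\<And>v. v \<in> res_chains M n \<Longrightarrow> h (res_map R p v) = a (res_d R n v)"
    using hp unfolding coboundary_def by blast
  \<comment> \<open>\<open>a\<close> is a primitive of the pullback of \<open>h\<close>; the second
    term accounts for the passage from \<open>h\<close> to \<open>h0\<close>. The pullback of
    \<open>h0\<close> vanishes on F(A), which goes into F(0), so \<open>\<alpha>\<close> is a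
    cocycle on F(A): the preimage under the connecting map.\<close>
  define \<alpha> where "\<alpha> v = a v \<ominus>\<^bsub>N\<^esub> g0 (res_map R p v)" for v
  have \<alpha>: "\<alpha> \<in> free_hom (res_basis R M (n - 1)) N"
    unfolding \<alpha>_def[abs_def] by (rule hom_diff[OF N a(1) hom_comp[OF ph g0(1)]])
  have h0\<alpha>: "h0 (res_map R p v) = \<alpha> (res_d R n v)" if v: "v \<in> res_chains M n" for v
    by (simp add: h0_def \<alpha>_def a(2)[OF v] res_d_res_map[OF M p v])
  have sA: "subcomplex (res_basis R (M\<lparr>carrier := A\<rparr>)) (res_basis R M) (res_d R)" by (rule res_subcomplex[OF A(1) M(1)])
  have "res_cocycle N (M\<lparr>carrier := A\<rparr>) (n - 1) \<alpha>"
    unfolding cocycle_def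
  proof (intro conjI ballI)
    show "\<alpha> \<in> free_hom (res_basis R (M\<lparr>carrier := A\<rparr>) (n - 1)) N"
      by (rule free_hom_subset[OF \<alpha> subcomplexD(1)[OF sA]])
    fix v assume v: "v \<in> res_chains (M\<lparr>carrier := A\<rparr>) (Suc (n - 1))"
    show "\<alpha> (res_d R (Suc (n - 1)) v) = \<zero>\<^bsub>N\<^esub>"
    proof (cases n)
      case 0 then show ?thesis using fr_hom(4)[OF \<alpha> N] by simp
    next
      case (Suc m)
      then have v': "v \<in> res_chains (M\<lparr>carrier := A\<rparr>) n" using v by simp
      show ?thesis
        using h0\<alpha>[OF Fr_mono[OF v' subcomplexD(1)[OF sA]]] h0z[OF res_map_kernel[OF M p A(1,2) v']] Suc by simp
    qed
  qed
  from large[OF this] obtain i where i: "submodule (H i) R M" "Q i"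
    "res_coboundary N (M\<lparr>carrier := H i\<rparr>) (n - 1) \<alpha>" by blast
  have sH: "subcomplex (res_basis R (M\<lparr>carrier := H i\<rparr>)) (res_basis R M) (res_d R)" by (rule res_subcomplex[OF i(1) M(1)])
  obtain c where c: "c \<in> free_hom (res_basis R M (n - 1 - 1)) N"
    "\<And>v. v \<in> res_chains (M\<lparr>carrier := H i\<rparr>) (n - 1) \<Longrightarrow> \<alpha> v = c (res_d R (n - 1) v)"
    using extend_primitive[OF N sH i(3)] by blast
  \<comment> \<open>The correction is zero on boundaries, so \<open>g\<close> is still a primitive
    of the pullback of \<open>h0\<close>, and it vanishes on F(H i), as needed to descend to the
    quotient.\<close>
  define g where "g v = \<alpha> v \<ominus>\<^bsub>N\<^esub> c (res_d R (n - 1) v)" for v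
  have cd: "c (res_d R (n - 1) v) \<in> carrier N" if "v \<in> res_chains M (n - 1)" for v
    by (rule fr_hom(1)[OF c(1) N fhom(1)[OF complexD(2)[OF cx] that]])
  have g: "g \<in> free_hom (res_basis R M (n - 1)) N"
    unfolding g_def[abs_def] by (rule hom_diff[OF N \<alpha> hom_comp[OF complexD(2)[OF cx] c(1)]])
  have gH: "g v = \<zero>\<^bsub>N\<^esub>" if v: "v \<in> res_chains (M\<lparr>carrier := H i\<rparr>) (n - 1)" for v
    using cd[OF Fr_mono[OF v subcomplexD(1)[OF sH]]] by (simp add: g_def c(2)[OF v] N.M.minus_self)
  have h0g: "h0 (res_map R p v) = g (res_d R n v)" if v: "v \<in> res_chains M n" for v
  proof -
    have d: "res_d R n v \<in> res_chains M (n - 1)" by (rule fhom(1)[OF complexD(2)[OF cx] v])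
    have "res_d R (n - 1) (res_d R n v) = (\<lambda>b. \<zero>)" using complexD(4)[OF cx, of v "n - 1"] v by (cases n) auto
    then have "g (res_d R n v) = \<alpha> (res_d R n v)"
      using fr_hom(4)[OF c(1) N] fr_hom(1)[OF \<alpha> N d] by (simp add: g_def a_minus_def)
    then show ?thesis using h0\<alpha>[OF v] by simp
  qed
  note m = M''(1)[OF i(2)] and q = M''(2)[OF i(2)] M''(3)[OF i(2)] and \<rho> = M''(5)[OF i(2)]
  have "res_coboundary N (M'' i) n (\<lambda>v. h0 (res_map R (\<rho> i) v))"
  proof (rule quotient_coboundary[OF N M(1) m q i(1) M''(4)[OF i(2)] cocycle_res_map[OF m M(2) \<rho> h0 N] _ g _ gH])
    fix v assume v: "v \<in> res_chains ((M'' i)\<lparr>carrier := {\<zero>\<^bsub>M'' i\<^esub>}\<rparr>) n"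
    have "res_map R (\<rho> i) v \<in> res_chains (M'\<lparr>carrier := {\<zero>\<^bsub>M'\<^esub>}\<rparr>) n"
      by (rule res_map_kernel[OF m M(2) \<rho> zero_submodule[OF m] _ v]) (use module.module_hom_zero[OF m M(2) \<rho>] in simp)
    then show "h0 (res_map R (\<rho> i) v) = \<zero>\<^bsub>N\<^esub>" by (rule h0z)
  next
    fix v assume v: "v \<in> res_chains M n"
    show "h0 (res_map R (\<rho> i) (res_map R (p'' i) v)) = g (res_d R n v)"
      using res_map_comp[OF M(1) m M(2) q(1) \<rho> p M''(6)[OF i(2)] v] h0g[OF v] by simp
  qed
  from coboundary_add[OF N this coboundary_res_map[OF m M(2) \<rho>, of N n "\<lambda>v. g0 (res_d R n v)"]]
  have "res_coboundary N (M'' i) n (\<lambda>v. h0 (res_map R (\<rho> i) v) \<oplus>\<^bsub>N\<^esub> g0 (res_d R n (res_map R (\<rho> i) v)))"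
    using g0(1) unfolding coboundary_def by blast
  then have "res_coboundary N (M'' i) n (\<lambda>v. h (res_map R (\<rho> i) v))"
  proof (rule coboundary_cong)
    fix v assume v: "v \<in> res_chains (M'' i) n"
    have w: "res_map R (\<rho> i) v \<in> res_chains M' n" by (rule fhom(1)[OF res_map_fhom[OF m M(2) \<rho>] v])
    show "h (res_map R (\<rho> i) v) = h0 (res_map R (\<rho> i) v) \<oplus>\<^bsub>N\<^esub> g0 (res_d R n (res_map R (\<rho> i) v))"
      using fr_hom(1)[OF hh N w] g0d[OF w] by (simp add: h0_def a_minus_def N.M.a_assoc N.M.l_neg)
  qed
  then show ?thesis using i(2) by blast
qed

end

section \<open>Generalized local cohomology\<close>

text \<open>The compatible maps \<open>\<phi> n\<close> glue to the limit. By linearity injectivity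
  is tested at zero only, and an element of the kernel has to vanish merely at some later
  stage.\<close>

lemma (in dirsys) direct_limit_isomorphic:
  assumes V: "module R V" and \<phi>: "\<And>n. \<phi> n \<in> module_hom R (G n) V"
    and comp: "\<And>n x. x \<in> carrier (G n) \<Longrightarrow> \<phi> (Suc n) (f n x) = \<phi> n x"
    and surj: "\<And>y. y \<in> carrier V \<Longrightarrow> \<exists>n. \<exists>x\<in>carrier (G n). \<phi> n x = y"
    and inj: "\<And>n x. x \<in> carrier (G n) \<Longrightarrow> \<phi> n x = \<zero>\<^bsub>V\<^esub> \<Longrightarrow> \<exists>k\<ge>n. tr n k x = \<zero>\<^bsub>G k\<^esub>"
  shows "module_isomorphic R (direct_limit G f) V"
proof -
  interpret V: module R V by fact
  interpret D: module R "direct_limit G f" by (rule direct_limit_module)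
  have \<phi>tr: "\<phi> k (tr n k x) = \<phi> n x" if "n \<le> k" "x \<in> carrier (G n)" for n k x
    using that(1)
  proof (induction k rule: dec_induct)
    case (step k)
    then show ?case using comp[OF tr_closed[OF step(1) that(2)]] by simp
  qed simp
  \<comment> \<open>Two representatives of X coincide at a later stage, and \<open>\<phi>\<close>
    does not change along transition maps, so the value is unique.\<close>
  define \<psi> where "\<psi> X = (THE y. \<exists>n x. x \<in> carrier (G n) \<and> X = cl n x \<and> y = \<phi> n x)" for X
  have \<psi>: "\<psi> (cl n x) = \<phi> n x" if x: "x \<in> carrier (G n)" for n x
    unfolding \<psi>_def
  proof (rule the_equality)
    fix y assume "\<exists>m z. z \<in> carrier (G m) \<and> cl n x = cl m z \<and> y = \<phi> m z"
    then obtain m z where z: "z \<in> carrier (G m)" "cl n x = cl m z" "y = \<phi> m z" by blast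
    then obtain k where "n \<le> k" "m \<le> k" "tr n k x = tr m k z" using cl_eq[OF x z(1)] by blast
    then show "y = \<phi> n x" using \<phi>tr[OF _ x] \<phi>tr[OF _ z(1)] z(3) by metis
  qed (use x in blast)
  have rep2: "\<exists>k x y. x \<in> carrier (G k) \<and> X = cl k x \<and> y \<in> carrier (G k) \<and> Y = cl k y"
    if "X \<in> carrier (direct_limit G f)" "Y \<in> carrier (direct_limit G f)" for X Y
    using rep3[OF that that(1)] by metis
  have hom: "\<psi> \<in> module_hom R (direct_limit G f) V"
    unfolding module_hom_def
  proof (intro CollectI conjI ballI Pi_I)
    fix X Y assume X: "X \<in> carrier (direct_limit G f)" and Y: "Y \<in> carrier (direct_limit G f)"
    obtain k x y where k: "x \<in> carrier (G k)" "X = cl k x" "y \<in> carrier (G k)" "Y = cl k y" using rep2[OF X Y] by blast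
    interpret K: module R "G k" by (rule G)
    show "\<psi> X \<in> carrier V" using k \<phi>[of k] by (auto simp: \<psi> module_hom_def)
    show "\<psi> (X \<oplus>\<^bsub>direct_limit G f\<^esub> Y) = \<psi> X \<oplus>\<^bsub>V\<^esub> \<psi> Y" using k \<phi>[of k] by (simp add: add_cl \<psi> module_hom_def)
    show "\<psi> (r \<odot>\<^bsub>direct_limit G f\<^esub> X) = r \<odot>\<^bsub>V\<^esub> \<psi> X" if "r \<in> carrier R" for r
      using k \<phi>[of k] that by (simp add: smult_cl \<psi> module_hom_def)
  qed
  have "bij_betw \<psi> (carrier (direct_limit G f)) (carrier V)"
    unfolding bij_betw_def
  proof
    show "inj_on \<psi> (carrier (direct_limit G f))"
    proof (rule inj_onI)
      fix X Y assume X: "X \<in> carrier (direct_limit G f)" and Y: "Y \<in> carrier (direct_limit G f)" and e: "\<psi> X = \<psi> Y"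
      obtain k x y where k: "x \<in> carrier (G k)" "X = cl k x" "y \<in> carrier (G k)" "Y = cl k y" using rep2[OF X Y] by blast
      interpret K: module R "G k" by (rule G)
      have c: "x \<ominus>\<^bsub>G k\<^esub> y \<in> carrier (G k)" using k by simp
      have "\<phi> k (x \<ominus>\<^bsub>G k\<^esub> y) = \<phi> k x \<ominus>\<^bsub>V\<^esub> \<phi> k y"
        using k \<phi>[of k] K.module_hom_minus[OF V \<phi>] by (simp add: a_minus_def module_hom_def)
      also have "\<dots> = \<phi> k y \<ominus>\<^bsub>V\<^esub> \<phi> k y" using e k by (simp add: \<psi>)
      also have "\<dots> = \<zero>\<^bsub>V\<^esub>" using k \<phi>[of k] by (intro V.M.minus_self) (auto simp: module_hom_def)
      finally obtain l where l: "k \<le> l" "tr k l (x \<ominus>\<^bsub>G k\<^esub> y) = \<zero>\<^bsub>G l\<^esub>" using inj[OF c] by blast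
      have "cl k (x \<ominus>\<^bsub>G k\<^esub> y) = \<zero>\<^bsub>direct_limit G f\<^esub>" using cl_tr[OF l(1) c] l(2) zero_cl[of l] by simp
      then have "cl k (x \<ominus>\<^bsub>G k\<^esub> y) \<oplus>\<^bsub>direct_limit G f\<^esub> Y = Y" using Y by simp
      then have "cl k ((x \<ominus>\<^bsub>G k\<^esub> y) \<oplus>\<^bsub>G k\<^esub> y) = Y" using k c by (simp add: add_cl)
      then show "X = Y" using k by (simp add: a_minus_def K.M.a_assoc K.M.l_neg)
    qed
    show "\<psi> ` carrier (direct_limit G f) = carrier V"
    proof
      show "\<psi> ` carrier (direct_limit G f) \<subseteq> carrier V" using hom by (auto simp: module_hom_def)
      show "carrier V \<subseteq> \<psi> ` carrier (direct_limit G f)"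
      proof
        fix y assume "y \<in> carrier V"
        then obtain n x where "x \<in> carrier (G n)" "\<phi> n x = y" using surj by blast
        then show "y \<in> \<psi> ` carrier (direct_limit G f)" using \<psi> carr by (metis image_eqI)
      qed
    qed
  qed
  then show ?thesis using hom by (auto simp: module_isomorphic_def)
qed

section \<open>Ext in terms of cocycles on the shifted resolution\<close>

context cring begin

lemma res_module_eq: "res_module R M n = free_module R (res_basis R M (Suc n))"
  by (simp add: res_module_def res_basis_Suc)

text \<open>Degree n of Ext is degree \<open>Suc n\<close> of the shifted complex. Cochains of Ext
  are extensional, those used so far are arbitrary off the carrier, so they correspond up to
  restriction.\<close>

lemma Ext_cochains_iff:
  "h \<in> carrier (Ext_cochains R M N n) \<longleftrightarrow> h \<in> extensional (res_chains M (Suc n)) \<and>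
    h \<in> free_hom (res_basis R M (Suc n)) N"
  by (auto simp: Ext_cochains_def Hom_module_def res_module_eq)

lemma Ext_cocycles_iff:
  "h \<in> Ext_cocycles R M N n \<longleftrightarrow> h \<in> extensional (res_chains M (Suc n)) \<and>
    res_cocycle N M (Suc n) h"
proof -
  have "Ext_diff R M n h = \<zero>\<^bsub>Ext_cochains R M N (Suc n)\<^esub> \<longleftrightarrow>
    (\<forall>v\<in>res_chains M (Suc (Suc n)). h (res_diff R v) = \<zero>\<^bsub>N\<^esub>)"
    by (auto simp: Ext_diff_def Ext_cochains_def Hom_module_def res_module_eq fun_eq_iff)
  then show ?thesis by (auto simp: Ext_cocycles_def Ext_cochains_iff cocycle_def)
qed

lemma restrict_hom:
  "f \<in> free_hom B N \<Longrightarrow> restrict f (Fr B) \<in> free_hom B N"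
  by (rule hom_restrict[OF _ free_module_module])

text \<open>The separate clause for degree 0 of Ext agrees with the shifted complex: a primitive
  there is composed with \<open>res_d R 1\<close>, which is zero.\<close>

lemma Ext_coboundaries_iff:
  assumes N: "module R N" and M: "module R M"
  shows "h \<in> Ext_coboundaries R M N n \<longleftrightarrow> h \<in> carrier (Ext_cochains R M N n) \<and>
    res_coboundary N M (Suc n) h"
proof (cases n)
  case 0
  interpret C: module R "Ext_cochains R M N 0" by (rule Ext_cochains_module[OF N])
  have z: "\<zero>\<^bsub>Ext_cochains R M N 0\<^esub> = (\<lambda>v\<in>res_chains M 1. \<zero>\<^bsub>N\<^esub>)"
    by (simp add: Ext_cochains_def Hom_module_def res_module_eq)
  have "h = \<zero>\<^bsub>Ext_cochains R M N 0\<^esub>" if hc: "h \<in> carrier (Ext_cochains R M N 0)" and hb: "res_coboundary N M 1 h"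
  proof -
    obtain g where g: "g \<in> module_hom R (free_module R {}) N" "\<forall>v\<in>res_chains M 1. h v = g (res_d R 1 v)"
      using hb by (auto simp: coboundary_def)
    then have "h v = \<zero>\<^bsub>N\<^esub>" if "v \<in> res_chains M 1" for v using that fr_hom(4)[OF g(1) N] by simp
    then show ?thesis using hc unfolding z Ext_cochains_iff
      by (intro extensionalityI[of _ "res_chains M 1"]) auto
  qed
  moreover have "res_coboundary N M 1 \<zero>\<^bsub>Ext_cochains R M N 0\<^esub>"
    unfolding coboundary_def z by (intro bexI[of _ "\<lambda>v. \<zero>\<^bsub>N\<^esub>"] hom_zero[OF N]) simp
  ultimately show ?thesis using 0 by auto
next
  case (Suc m)
  have d: "res_diff R v \<in> res_chains M (Suc m)" if "v \<in> res_chains M (Suc (Suc m))" for v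
    using complexD(5)[OF res_complex[OF M] that] by simp
  show ?thesis
  proof
    assume "h \<in> Ext_coboundaries R M N n"
    then obtain g where g: "g \<in> carrier (Ext_cochains R M N m)" "h = Ext_diff R M m g" using Suc by auto
    then have "h \<in> carrier (Ext_cochains R M N n)" using Ext_diff_hom[OF N, of M m] Suc by (auto simp: module_hom_def)
    moreover have "res_coboundary N M (Suc n) h"
      unfolding coboundary_def using g Suc by (intro bexI[of _ g]) (auto simp: Ext_cochains_iff Ext_diff_def res_module_eq)
    ultimately show "h \<in> carrier (Ext_cochains R M N n) \<and> res_coboundary N M (Suc n) h" ..
  next
    assume h: "h \<in> carrier (Ext_cochains R M N n) \<and> res_coboundary N M (Suc n) h"
    then obtain g where g: "g \<in> free_hom (res_basis R M (Suc m)) N"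
      "\<forall>v\<in>res_chains M (Suc (Suc m)). h v = g (res_diff R v)"
      using Suc by (auto simp: coboundary_def)
    have "h = Ext_diff R M m (restrict g (res_chains M (Suc m)))"
      using h g(2) d Suc unfolding Ext_cochains_iff Ext_diff_def res_module_eq
      by (intro extensionalityI[of _ "res_chains M (Suc n)"]) auto
    moreover have "restrict g (res_chains M (Suc m)) \<in> carrier (Ext_cochains R M N m)"
      using restrict_hom[OF g(1)] by (simp add: Ext_cochains_iff)
    ultimately show "h \<in> Ext_coboundaries R M N n" using Suc by simp
  qed
qed

lemma Ext_carrier:
  "carrier (Ext R M N n) = (\<lambda>h. Ext_coboundaries R M N n +>\<^bsub>Ext_cochains R M N n\<^esub> h) ` Ext_cocycles R M N n"
  by (auto simp: Ext_def quotient_module_def A_RCOSETS_def' a_r_coset_def')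

lemma Ext_zero: "\<zero>\<^bsub>Ext R M N n\<^esub> = Ext_coboundaries R M N n"
  by (simp add: Ext_def quotient_module_def)

lemma Ext_class_eqI:
  assumes N: "module R N" and M: "module R M"
    and h: "h \<in> Ext_cocycles R M N n" and k: "k \<in> Ext_cocycles R M N n"
    and d: "res_coboundary N M (Suc n) (\<lambda>v. h v \<ominus>\<^bsub>N\<^esub> k v)"
  shows "Ext_coboundaries R M N n +>\<^bsub>Ext_cochains R M N n\<^esub> h = Ext_coboundaries R M N n +>\<^bsub>Ext_cochains R M N n\<^esub> k"
proof -
  interpret N: module R N by fact
  interpret C: module R "Ext_cochains R M N n" by (rule Ext_cochains_module[OF N])
  let ?F = "res_chains M (Suc n)"
  have hc: "h \<in> carrier (Ext_cochains R M N n)" "k \<in> carrier (Ext_cochains R M N n)" using h k by (auto simp: Ext_cocycles_def)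
  then have hh: "h \<in> free_hom (res_basis R M (Suc n)) N" "k \<in> free_hom (res_basis R M (Suc n)) N"
    "h \<in> extensional ?F" by (auto simp: Ext_cochains_iff)
  define b where "b = restrict (\<lambda>v. h v \<ominus>\<^bsub>N\<^esub> k v) ?F"
  have "b \<in> carrier (Ext_cochains R M N n)"
    using restrict_hom[OF hom_diff[OF N hh(1,2)]] by (simp add: Ext_cochains_iff b_def)
  moreover have "res_coboundary N M (Suc n) b"
    using d by (rule coboundary_cong) (simp add: b_def)
  ultimately have b: "b \<in> Ext_coboundaries R M N n" using Ext_coboundaries_iff[OF N M] by blast
  have "h = (\<lambda>v\<in>?F. b v \<oplus>\<^bsub>N\<^esub> k v)"
    using hh(3) fr_hom(1)[OF hh(1) N] fr_hom(1)[OF hh(2) N]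
    by (intro extensionalityI[of _ ?F]) (auto simp: b_def a_minus_def N.M.a_assoc N.M.l_neg)
  then have "h = b \<oplus>\<^bsub>Ext_cochains R M N n\<^esub> k" by (simp add: Ext_cochains_def Hom_module_def res_module_eq)
  then have "h \<in> Ext_coboundaries R M N n +>\<^bsub>Ext_cochains R M N n\<^esub> k" using b by (auto simp: a_r_coset_def')
  moreover have "subgroup (Ext_coboundaries R M N n) (add_monoid (Ext_cochains R M N n))"
    using Ext_coboundaries_submodule[OF N] by (auto simp: submodule_def)
  ultimately show ?thesis using C.M.a_repr_independence'[folded a_r_coset_def] hc(2) by metis
qed

lemma Ext_class_eq_zero_iff:
  assumes N: "module R N" and M: "module R M" and h: "h \<in> Ext_cocycles R M N n"
  shows "Ext_coboundaries R M N n +>\<^bsub>Ext_cochains R M N n\<^esub> h = \<zero>\<^bsub>Ext R M N n\<^esub> \<longleftrightarrow>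
    res_coboundary N M (Suc n) h"
proof -
  interpret C: module R "Ext_cochains R M N n" by (rule Ext_cochains_module[OF N])
  have hc: "h \<in> carrier (Ext_cochains R M N n)" using h by (simp add: Ext_cocycles_def)
  have S: "submodule (Ext_coboundaries R M N n) R (Ext_cochains R M N n)" by (rule Ext_coboundaries_submodule[OF N])
  interpret H: abelian_subgroup "Ext_coboundaries R M N n" "Ext_cochains R M N n"
    using S by (intro abelian_subgroupI3 additive_subgroup.intro C.M.abelian_group_axioms) (simp add: submodule_def)
  have "Ext_coboundaries R M N n +>\<^bsub>Ext_cochains R M N n\<^esub> h = Ext_coboundaries R M N n \<longleftrightarrow> h \<in> Ext_coboundaries R M N n"
    using H.a_rcos_self[OF hc] H.a_rcos_const by blast
  then show ?thesis using Ext_coboundaries_iff[OF N M] hc by (simp add: Ext_zero)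
qed

end

section \<open>Supports, annihilators and quotient modules\<close>

context module begin

text \<open>The colon ideal (A : Y). For A = 0 it is an annihilator; for an adic submodule in place
  of Y it tells which scalars push that submodule into A.\<close>

lemma transporter_ideal:
  assumes A: "submodule A R M" and Y: "Y \<subseteq> carrier M"
  shows "ideal {r \<in> carrier R. \<forall>y\<in>Y. r \<odot>\<^bsub>M\<^esub> y \<in> A} R" (is "ideal ?I R")
proof -
  note E = submoduleE[OF A]
  have sm: "t \<otimes> r \<in> ?I" if t: "t \<in> carrier R" and r: "r \<in> ?I" for t r
  proof -
    have "(t \<otimes> r) \<odot>\<^bsub>M\<^esub> y \<in> A" if y: "y \<in> Y" for y
      using E(4)[OF t, of "r \<odot>\<^bsub>M\<^esub> y"] r y Y t by (auto simp: smult_assoc1)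
    then show ?thesis using t r by simp
  qed
  have pl: "r \<oplus> s \<in> ?I" if r: "r \<in> ?I" and s: "s \<in> ?I" for r s
  proof -
    have "(r \<oplus> s) \<odot>\<^bsub>M\<^esub> y \<in> A" if y: "y \<in> Y" for y
      using E(5)[of "r \<odot>\<^bsub>M\<^esub> y" "s \<odot>\<^bsub>M\<^esub> y"] r s y Y by (auto simp: smult_l_distr)
    then show ?thesis using r s by simp
  qed
  have z: "\<zero> \<in> ?I" using submodule_zero[OF A] Y by auto
  show ?thesis by (rule R.ideal_of_closed[OF _ z pl sm]) auto
qed

lemma Supp_iff:
  assumes p: "primeideal p R"
  shows "p \<in> Supp R M \<longleftrightarrow> (\<exists>m\<in>carrier M. \<forall>u\<in>carrier R - p. u \<odot>\<^bsub>M\<^esub> m \<noteq> \<zero>\<^bsub>M\<^esub>)"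
proof -
  interpret p: primeideal p R by fact
  have "\<one> \<notin> p" using p.one_imp_carrier p.I_notcarr by auto
  moreover have "s \<otimes> t \<in> carrier R - p" if "s \<in> carrier R - p" "t \<in> carrier R - p" for s t
    using that p.I_prime by auto
  ultimately show ?thesis using localization_zero_iff[of "carrier R - p"] p by (auto simp: Supp_def)
qed

text \<open>If the localisation at p were zero, each of the finitely many generators would be killed
  by an element outside p. The product of these kills M, hence lies in p, although p is
  prime.\<close>

lemma Supp_of_annihilator:
  assumes p: "primeideal p R" and X: "finite X" "X \<subseteq> carrier M" "module_span X = carrier M"
    and J: "{r \<in> carrier R. \<forall>y\<in>carrier M. r \<odot>\<^bsub>M\<^esub> y \<in> {\<zero>\<^bsub>M\<^esub>}} \<subseteq> p"
  shows "p \<in> Supp R M"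
proof (rule ccontr)
  interpret p: primeideal p R by fact
  assume "p \<notin> Supp R M"
  then have z: "\<exists>u\<in>carrier R - p. u \<odot>\<^bsub>M\<^esub> m = \<zero>\<^bsub>M\<^esub>" if "m \<in> carrier M" for m using Supp_iff[OF p] that by blast
  have "\<exists>u\<in>carrier R - p. \<forall>m\<in>X. u \<odot>\<^bsub>M\<^esub> m = \<zero>\<^bsub>M\<^esub>"
    using X(1,2)
  proof (induction X rule: finite_induct)
    case empty
    then show ?case using p.one_imp_carrier p.I_notcarr by auto
  next
    case (insert x X)
    then obtain u w where uw: "u \<in> carrier R - p" "\<forall>m\<in>X. u \<odot>\<^bsub>M\<^esub> m = \<zero>\<^bsub>M\<^esub>" "w \<in> carrier R - p" "w \<odot>\<^bsub>M\<^esub> x = \<zero>\<^bsub>M\<^esub>"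
      using z[of x] by auto
    have "(u \<otimes> w) \<odot>\<^bsub>M\<^esub> m = \<zero>\<^bsub>M\<^esub>" if m: "m \<in> insert x X" for m
    proof (cases "m = x")
      case True then show ?thesis using uw insert.prems by (simp add: smult_assoc1)
    next
      case False
      then have "m \<in> X" "m \<in> carrier M" using m insert.prems by auto
      then show ?thesis using uw by (simp add: R.m_comm[of u w] smult_assoc1)
    qed
    moreover have "u \<otimes> w \<in> carrier R - p" using uw p.I_prime by auto
    ultimately show ?case by blast
  qed
  then obtain u where u: "u \<in> carrier R - p" "\<forall>m\<in>X. u \<odot>\<^bsub>M\<^esub> m = \<zero>\<^bsub>M\<^esub>" by blast
  have "(\<lambda>x. u \<odot>\<^bsub>M\<^esub> x) \<in> module_hom R M M"
    using u by (auto simp: module_hom_def smult_r_distr smult_assoc1[symmetric] R.m_comm)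
  from R.kernel_submodule[OF module_axioms module_axioms this]
  have "module_span X \<subseteq> {x \<in> carrier M. u \<odot>\<^bsub>M\<^esub> x = \<zero>\<^bsub>M\<^esub>}" by (rule span_minimal) (use X u in auto)
  then have "u \<in> p" using J u X(3) by auto
  then show False using u by blast
qed

lemma ideal_power_smult_submodule:
  assumes a: "ideal \<aa> R" and A: "submodule A R M"
    and *: "\<And>r y. r \<in> ideal_power R \<aa> m \<Longrightarrow> y \<in> ideal_smult (ideal_power R \<aa> j) M \<Longrightarrow> r \<odot>\<^bsub>M\<^esub> y \<in> A"
  shows "ideal_smult (ideal_power R \<aa> (m + j)) M \<subseteq> A"
proof
  fix z assume "z \<in> ideal_smult (ideal_power R \<aa> (m + j)) M"
  then show "z \<in> A"
  proof induction
    case (smult r x)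
    from smult(1) have "r \<in> ideal_power R \<aa> m \<cdot> ideal_power R \<aa> j" by (simp add: R.ideal_power_add[OF a])
    then show ?case
    proof (induction rule: ideal_prod.induct)
      case (prod s t)
      have "s \<in> carrier R" "t \<in> carrier R" using prod ideal.Icarr[OF ideal_power_ideal[OF a]] by auto
      moreover have "s \<odot>\<^bsub>M\<^esub> (t \<odot>\<^bsub>M\<^esub> x) \<in> A" using prod smult(2) by (intro *) (auto intro: ideal_smult.smult)
      ultimately show ?case using smult(2) by (simp add: smult_assoc1)
    next
      case (sum s t)
      have "s \<in> carrier R" "t \<in> carrier R"
        using sum(1,2) ideal.Icarr[OF R.ideal_prod_is_ideal[OF ideal_power_ideal[OF a] ideal_power_ideal[OF a]]] by auto
      then show ?case using smult(2) submoduleE(5)[OF A sum(3,4)] by (simp add: smult_l_distr)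
    qed
  next
    case (add x y) then show ?case using submoduleE(5)[OF A] by blast
  qed
qed

lemma power_in_ideal_power:
  "ideal \<aa> R \<Longrightarrow> a \<in> \<aa> \<Longrightarrow> a [^] n \<in> ideal_power R \<aa> n"
proof (induction n)
  case (Suc n)
  have "a \<in> carrier R" using Suc ideal.Icarr by metis
  moreover have "a \<otimes> a [^] n \<in> \<aa> \<cdot> ideal_power R \<aa> n" using Suc by (intro ideal_prod.prod) auto
  ultimately show ?case by (simp add: R.m_comm)
qed simp

lemma quotient_map:
  assumes H: "submodule H R M"
  shows "(\<lambda>x. H +>\<^bsub>M\<^esub> x) \<in> module_hom R M (quotient_module M H)"
    "(\<lambda>x. H +>\<^bsub>M\<^esub> x) ` carrier M = carrier (quotient_module M H)"
    "x \<in> carrier M \<Longrightarrow> H +>\<^bsub>M\<^esub> x = \<zero>\<^bsub>quotient_module M H\<^esub> \<longleftrightarrow> x \<in> H"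
proof -
  interpret H: abelian_subgroup H M
    using H by (intro abelian_subgroupI3 additive_subgroup.intro M.abelian_group_axioms) (simp add: submodule_def)
  show c: "(\<lambda>x. H +>\<^bsub>M\<^esub> x) ` carrier M = carrier (quotient_module M H)"
    by (auto simp: quotient_module_def A_RCOSETS_def')
  show "(\<lambda>x. H +>\<^bsub>M\<^esub> x) \<in> module_hom R M (quotient_module M H)"
    using c by (auto simp: module_hom_def quotient_add[OF H] quotient_smult[OF H])
  show "x \<in> carrier M \<Longrightarrow> H +>\<^bsub>M\<^esub> x = \<zero>\<^bsub>quotient_module M H\<^esub> \<longleftrightarrow> x \<in> H"
    using H.a_rcos_self[of x] H.a_rcos_const[of x] by (auto simp: quotient_module_def)
qed

lemma quotient_projection:
  assumes A: "submodule A R M" and B: "submodule B R M" and AB: "A \<subseteq> B"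
  shows "x \<in> carrier M \<Longrightarrow> (\<Union>y\<in>A +>\<^bsub>M\<^esub> x. B +>\<^bsub>M\<^esub> y) = B +>\<^bsub>M\<^esub> x"
    "(\<lambda>X. \<Union>y\<in>X. B +>\<^bsub>M\<^esub> y) \<in> module_hom R (quotient_module M A) (quotient_module M B)"
proof -
  have sg: "subgroup B (add_monoid M)" using B by (simp add: submodule_def)
  show E: "(\<Union>y\<in>A +>\<^bsub>M\<^esub> x. B +>\<^bsub>M\<^esub> y) = B +>\<^bsub>M\<^esub> x" if x: "x \<in> carrier M" for x
  proof -
    have "B +>\<^bsub>M\<^esub> y = B +>\<^bsub>M\<^esub> x" if y: "y \<in> A +>\<^bsub>M\<^esub> x" for y
    proof -
      have "y \<in> B +>\<^bsub>M\<^esub> x" using y AB by (auto simp: a_r_coset_def')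
      then show ?thesis using M.a_repr_independence'[OF _ _ sg, folded a_r_coset_def] x by auto
    qed
    moreover have "A +>\<^bsub>M\<^esub> x \<noteq> {}" using submoduleE(2)[OF A] by (auto simp: a_r_coset_def')
    ultimately show ?thesis by auto
  qed
  have c: "carrier (quotient_module M K) = (\<lambda>x. K +>\<^bsub>M\<^esub> x) ` carrier M" for K
    by (auto simp: quotient_module_def A_RCOSETS_def')
  show "(\<lambda>X. \<Union>y\<in>X. B +>\<^bsub>M\<^esub> y) \<in> module_hom R (quotient_module M A) (quotient_module M B)"
    unfolding module_hom_def
    by (auto simp: c E quotient_add[OF A] quotient_smult[OF A] quotient_add[OF B] quotient_smult[OF B] simp del: UN_iff)
qed

end

section \<open>From the hypothesis on supports to vanishing on adic submodules\<close>

context cring begin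

text \<open>A prime containing ann M + ann x lies in the support of M, since M is finitely
  generated, and in that of N, since x survives localisation; so it contains \<open>\<aa>\<close>.
  Hence ann M + ann x contains a power of \<open>\<aa>\<close>, whose exponent may depend on
  x.\<close>

lemma power_decomposition_of_supports:
  assumes R: "noetherian_ring R" and \<aa>: "ideal \<aa> R" and M: "module R M" and N: "module R N"
    and X: "finite X" "X \<subseteq> carrier M" "module.module_span R M X = carrier M"
    and supp: "Supp R M \<inter> Supp R N \<subseteq> prime_locus R \<aa>"
    and a: "a \<in> \<aa>" and x: "x \<in> carrier N"
  shows "\<exists>k::nat. \<exists>j\<in>{r \<in> carrier R. \<forall>y\<in>carrier M. r \<odot>\<^bsub>M\<^esub> y \<in> {\<zero>\<^bsub>M\<^esub>}}. \<exists>e\<in>carrier R.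
    a [^] k = j \<oplus> e \<and> e \<odot>\<^bsub>N\<^esub> x = \<zero>\<^bsub>N\<^esub>"
proof -
  interpret M: module R M by fact
  interpret N: module R N by fact
  define J where "J = {r \<in> carrier R. \<forall>y\<in>carrier M. r \<odot>\<^bsub>M\<^esub> y \<in> {\<zero>\<^bsub>M\<^esub>}}"
  define E where "E = {r \<in> carrier R. \<forall>y\<in>{x}. r \<odot>\<^bsub>N\<^esub> y \<in> {\<zero>\<^bsub>N\<^esub>}}"
  have J: "ideal J R" unfolding J_def by (rule M.transporter_ideal[OF zero_submodule[OF M]]) simp
  have E: "ideal E R" unfolding E_def by (rule N.transporter_ideal[OF zero_submodule[OF N]]) (use x in simp)
  interpret J: ideal J R by fact
  interpret E: ideal E R by fact
  have sub: "J \<subseteq> J <+>\<^bsub>R\<^esub> E" "E \<subseteq> J <+>\<^bsub>R\<^esub> E"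
  proof -
    have mem: "u \<oplus> w \<in> J <+>\<^bsub>R\<^esub> E" if "u \<in> J" "w \<in> E" for u w
      unfolding set_add_def' using that by blast
    show "J \<subseteq> J <+>\<^bsub>R\<^esub> E" using mem[OF _ E.zero_closed] J.Icarr by fastforce
    show "E \<subseteq> J <+>\<^bsub>R\<^esub> E" using mem[OF J.zero_closed] E.Icarr by fastforce
  qed
  have "\<exists>k. ideal_power R \<aa> k \<subseteq> J <+>\<^bsub>R\<^esub> E"
  proof (rule ideal_power_subset_of_primes[OF is_cring R \<aa> add_ideals[OF J E]])
    fix p assume p: "primeideal p R" and JE: "J <+>\<^bsub>R\<^esub> E \<subseteq> p"
    have "p \<in> Supp R M" by (rule M.Supp_of_annihilator[OF p X subset_trans[OF sub(1)[unfolded J_def] JE[unfolded J_def]]])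
    moreover have "u \<odot>\<^bsub>N\<^esub> x \<noteq> \<zero>\<^bsub>N\<^esub>" if u: "u \<in> carrier R - p" for u
    proof
      assume "u \<odot>\<^bsub>N\<^esub> x = \<zero>\<^bsub>N\<^esub>"
      then have "u \<in> E" unfolding E_def using u by simp
      then have "u \<in> p" by (rule subsetD[OF subset_trans[OF sub(2) JE]])
      then show False using u by simp
    qed
    then have "p \<in> Supp R N" using N.Supp_iff[OF p] x by blast
    ultimately show "\<aa> \<subseteq> p" using supp by (auto simp: prime_locus_def)
  qed
  then obtain k where "ideal_power R \<aa> k \<subseteq> J <+>\<^bsub>R\<^esub> E" ..
  then have "a [^] k \<in> J <+>\<^bsub>R\<^esub> E" using M.power_in_ideal_power[OF \<aa> a] by blast
  then obtain j e where "j \<in> J" "e \<in> E" "a [^] k = j \<oplus> e" unfolding set_add_def' by blast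
  then show ?thesis unfolding J_def E_def by blast
qed

text \<open>ann M also annihilates K, so the decompositions found for M serve all its submodules; K
  is finitely generated because M is Noetherian, which gives it a finite subresolution.\<close>

lemma power_smult_coboundary_submodule:
  assumes R: "noetherian_ring R" and \<aa>: "ideal \<aa> R" and M: "module R M" and fg: "finitely_generated_module R M"
    and N: "module R N" and supp: "Supp R M \<inter> Supp R N \<subseteq> prime_locus R \<aa>"
    and a: "a \<in> \<aa>" and K: "submodule K R M" and h: "res_cocycle N (M\<lparr>carrier := K\<rparr>) n h"
  shows "\<exists>k::nat. res_coboundary N (M\<lparr>carrier := K\<rparr>) n (\<lambda>v. a [^] k \<odot>\<^bsub>N\<^esub> h v)"
proof -
  interpret M: module R M by fact
  note Km = submodule_module[OF K M]
  obtain X where X: "finite X" "X \<subseteq> carrier M" "M.module_span X = carrier M"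
    using M.finitely_generated_span[OF fg] .
  obtain Y where Y: "finite Y" "Y \<subseteq> K" "K = M.module_span Y"
    using noetherian_moduleD[OF M.finitely_generated_noetherian[OF R fg] K] .
  let ?J = "{r \<in> carrier R. \<forall>y\<in>carrier M. r \<odot>\<^bsub>M\<^esub> y \<in> {\<zero>\<^bsub>M\<^esub>}}"
  have sp: "module.module_span R (M\<lparr>carrier := K\<rparr>) Y = carrier (M\<lparr>carrier := K\<rparr>)"
    using M.span_restrict[OF K Y(2)] Y(3) by simp
  show ?thesis
  proof (rule power_smult_coboundary[OF R Km Y(1) _ sp N ideal.Icarr[OF \<aa> a] _ _ _ h, of ?J])
    show "ideal ?J R" by (rule M.transporter_ideal[OF zero_submodule[OF M]]) simp
    show "Y \<subseteq> carrier (M\<lparr>carrier := K\<rparr>)" using Y(2) by simp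
    show "j \<odot>\<^bsub>M\<lparr>carrier := K\<rparr>\<^esub> x = \<zero>\<^bsub>M\<lparr>carrier := K\<rparr>\<^esub>" if "j \<in> ?J" "x \<in> carrier (M\<lparr>carrier := K\<rparr>)" for j x
      using that submodule_in[OF K] by auto
    show "\<exists>k::nat. \<exists>j\<in>?J. \<exists>e\<in>carrier R. a [^] k = j \<oplus> e \<and> e \<odot>\<^bsub>N\<^esub> x = \<zero>\<^bsub>N\<^esub>" if "x \<in> carrier N" for x
      by (rule power_decomposition_of_supports[OF R \<aa> M N X supp a that])
  qed
qed

lemma coboundary_on_adic_submodule:
  assumes R: "noetherian_ring R" and \<aa>: "ideal \<aa> R" and M: "module R M" and fg: "finitely_generated_module R M"
    and N: "module R N" and supp: "Supp R M \<inter> Supp R N \<subseteq> prime_locus R \<aa>"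
    and h: "res_cocycle N (M\<lparr>carrier := ideal_smult (ideal_power R \<aa> j) M\<rparr>) n h"
  shows "\<exists>i\<ge>j. res_coboundary N (M\<lparr>carrier := ideal_smult (ideal_power R \<aa> i) M\<rparr>) n h"
proof -
  interpret M: module R M by fact
  define H where "H k = ideal_smult (ideal_power R \<aa> k) M" for k
  have H: "submodule (H k) R M" for k
    unfolding H_def by (rule M.ideal_smult_submodule[OF ideal_power_ideal'[OF \<aa>]])
  obtain X where X: "X \<subseteq> carrier R" "finite X" "\<aa> = genideal R X"
    using noetherian_ring.finetely_gen[OF R \<aa>] by blast
  have X\<aa>: "X \<subseteq> \<aa>" unfolding X(3) by (rule genideal_self[OF X(1)])
  note noeth = M.finitely_generated_noetherian[OF R fg]
  have "\<exists>A k. submodule A R M \<and> A \<subseteq> H j \<and> (\<forall>a\<in>X. \<forall>y\<in>H j. a [^] (k::nat) \<odot>\<^bsub>M\<^esub> y \<in> A) \<and>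
      res_coboundary N (M\<lparr>carrier := A\<rparr>) n h"
    by (rule coboundary_on_large_submodule[OF M noeth N X(2,1) _ H h[folded H_def]])
      (rule power_smult_coboundary_submodule[OF R \<aa> M fg N supp], use X\<aa> in blast)
  then obtain A k where A: "submodule A R M" "\<And>a y. a \<in> X \<Longrightarrow> y \<in> H j \<Longrightarrow> a [^] (k::nat) \<odot>\<^bsub>M\<^esub> y \<in> A"
      "res_coboundary N (M\<lparr>carrier := A\<rparr>) n h" by blast
  \<comment> \<open>Q contains the k-th power of each generator of \<open>\<aa>\<close>, so primes
    above Q contain \<open>\<aa>\<close> and Q contains some m-th power of \<open>\<aa>\<close>.
    This power carries \<open>H j\<close> into A, which gives the index
    \<open>m + j\<close>.\<close>
  define Q where "Q = {r \<in> carrier R. \<forall>y\<in>H j. r \<odot>\<^bsub>M\<^esub> y \<in> A}"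
  have Q: "ideal Q R" unfolding Q_def by (rule M.transporter_ideal[OF A(1) M.submoduleE(1)[OF H]])
  have "\<exists>m. ideal_power R \<aa> m \<subseteq> Q"
  proof (rule ideal_power_subset_of_primes[OF is_cring R \<aa> Q])
    fix p assume p: "primeideal p R" and Qp: "Q \<subseteq> p"
    interpret p: primeideal p R by fact
    have "a \<in> p" if a: "a \<in> X" for a
    proof -
      have aR: "a \<in> carrier R" using a X by auto
      have "a [^] k \<in> p" using A(2)[OF a] aR Qp by (auto simp: Q_def)
      then show ?thesis
      proof (induction k)
        case 0 then show ?case using p.one_imp_carrier p.I_notcarr by auto
      next
        case (Suc k) then show ?case using p.I_prime[of "a [^] k" a] aR by auto
      qed
    qed
    then show "\<aa> \<subseteq> p" unfolding X(3) by (intro genideal_minimal p.is_ideal) auto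
  qed
  then obtain m where m: "ideal_power R \<aa> m \<subseteq> Q" ..
  have "H (m + j) \<subseteq> A" unfolding H_def
  proof (rule M.ideal_power_smult_submodule[OF \<aa> A(1)])
    fix r y assume "r \<in> ideal_power R \<aa> m" "y \<in> ideal_smult (ideal_power R \<aa> j) M"
    then show "r \<odot>\<^bsub>M\<^esub> y \<in> A" using m by (auto simp: Q_def H_def)
  qed
  then show ?thesis
    using coboundary_subset[OF A(3) nested_subcomplex[OF M H A(1)]] unfolding H_def by (intro exI[of _ "m + j"]) auto
qed

lemma res_map_ident:
  assumes M: "module R M" and f: "f \<in> module_hom R M M" "\<And>x. x \<in> carrier M \<Longrightarrow> f x = x"
    and v: "v \<in> res_chains M n"
  shows "res_map R f v = v"
proof (rule fr_eqI[OF free_module_module res_map_fhom[OF M M f(1)] _ _ v, of "\<lambda>v. v"])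
  show "(\<lambda>v. v) \<in> fhom (res_basis R M n) (res_basis R M n)" by (auto simp: module_hom_def)
  fix b assume b: "b \<in> res_basis R M n"
  then have "set2_syz b \<subseteq> carrier M" using syz_basis_set[of b R M] by (cases n) (auto simp: res_basis_Suc)
  then have "map_syz id f b = map_syz id id b" using f(2) by (intro syz.map_cong) auto
  then show "res_map R f (unit_vec R b) = unit_vec R b" by (simp add: res_map_unit_vec syz.map_id)
qed

end

section \<open>The tower of adic quotients\<close>

context module begin

lemma adic_submodule: "ideal \<aa> R \<Longrightarrow> submodule (ideal_smult (ideal_power R \<aa> n) M) R M"
  by (intro ideal_smult_submodule ideal_power_ideal)

lemma adic_submodule_antimono:
  assumes a: "ideal \<aa> R" and kl: "k \<le> l"
  shows "ideal_smult (ideal_power R \<aa> l) M \<subseteq> ideal_smult (ideal_power R \<aa> k) M"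
proof
  have "ideal_power R \<aa> l \<subseteq> ideal_power R \<aa> k"
    by (rule lift_Suc_antimono_le[of "ideal_power R \<aa>", OF ideal_power_mono[OF a] kl])
  note sub = this
  fix x assume "x \<in> ideal_smult (ideal_power R \<aa> l) M"
  then show "x \<in> ideal_smult (ideal_power R \<aa> k) M"
    by (induction rule: ideal_smult.induct) (use sub in \<open>auto intro: ideal_smult.intros\<close>)
qed

lemma adic_projection_hom_le:
  assumes a: "ideal \<aa> R" and kl: "k \<le> l"
  shows "adic_projection R \<aa> M k \<in> module_hom R (adic_quotient R \<aa> M l) (adic_quotient R \<aa> M k)"
    "x \<in> carrier M \<Longrightarrow> adic_projection R \<aa> M k (ideal_smult (ideal_power R \<aa> l) M +>\<^bsub>M\<^esub> x)
      = ideal_smult (ideal_power R \<aa> k) M +>\<^bsub>M\<^esub> x"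
  unfolding adic_projection_def[abs_def] adic_quotient_def
  by (rule quotient_projection[OF adic_submodule[OF a] adic_submodule[OF a] adic_submodule_antimono[OF a kl]], assumption?)+

abbreviation adic_map :: "'a set \<Rightarrow> nat \<Rightarrow> 'c \<Rightarrow> 'c set"
  where "adic_map \<aa> n x \<equiv> ideal_smult (ideal_power R \<aa> n) M +>\<^bsub>M\<^esub> x"

lemma adic_map:
  assumes "ideal \<aa> R"
  shows "adic_map \<aa> n \<in> module_hom R M (adic_quotient R \<aa> M n)"
    "adic_map \<aa> n ` carrier M = carrier (adic_quotient R \<aa> M n)"
    "x \<in> carrier M \<Longrightarrow> adic_map \<aa> n x = \<zero>\<^bsub>adic_quotient R \<aa> M n\<^esub> \<longleftrightarrow> x \<in> ideal_smult (ideal_power R \<aa> n) M"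
  unfolding adic_quotient_def by (rule quotient_map[OF adic_submodule[OF assms]]; assumption)+

lemma adic_projection_comp:
  assumes a: "ideal \<aa> R" and kl: "k \<le> l" "l \<le> m" and X: "X \<in> carrier (adic_quotient R \<aa> M m)"
  shows "adic_projection R \<aa> M k (adic_projection R \<aa> M l X) = adic_projection R \<aa> M k X"
proof -
  obtain x where x: "x \<in> carrier M" "X = adic_map \<aa> m x" using X adic_map(2)[OF a, of m] by blast
  show ?thesis unfolding x(2)
    using adic_projection_hom_le(2)[OF a kl(1) x(1)] adic_projection_hom_le(2)[OF a kl(2) x(1)]
      adic_projection_hom_le(2)[OF a order_trans[OF kl] x(1)] by simp
qed

lemma adic_projection_self:
  assumes a: "ideal \<aa> R" and X: "X \<in> carrier (adic_quotient R \<aa> M k)"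
  shows "adic_projection R \<aa> M k X = X"
proof -
  obtain x where x: "x \<in> carrier M" "X = adic_map \<aa> k x" using X adic_map(2)[OF a, of k] by blast
  show ?thesis unfolding x(2) by (rule adic_projection_hom_le(2)[OF a order_refl x(1)])
qed

end

context cring begin

abbreviation Ext_class where
  "Ext_class M N n h \<equiv> Ext_coboundaries R M N n +>\<^bsub>Ext_cochains R M N n\<^esub> h"

abbreviation pullback where
  "pullback M n f h \<equiv> (\<lambda>v\<in>res_chains M (Suc n). h (res_map R f v))"

lemma Ext_map_class:
  assumes "module R M" "module R M'" "module R N" "f \<in> module_hom R M M'" "h \<in> Ext_cocycles R M' N n"
  shows "pullback M n f h \<in> Ext_cocycles R M N n"
    "Ext_map R M N n f (Ext_class M' N n h) = Ext_class M N n (pullback M n f h)"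
  using Ext_map_coset[OF assms] by (simp_all add: res_module_eq)

lemma pullback_comp:
  assumes M: "module R M" "module R M'" "module R M''"
    and f: "f \<in> module_hom R M M'" "g \<in> module_hom R M' M''" "k \<in> module_hom R M M''"
    and k: "\<And>x. x \<in> carrier M \<Longrightarrow> g (f x) = k x"
  shows "pullback M n f (pullback M' n g h) = pullback M n k h"
proof (rule restrict_ext)
  fix v assume v: "v \<in> res_chains M (Suc n)"
  then show "pullback M' n g h (res_map R f v) = h (res_map R k v)"
    using fhom(1)[OF res_map_fhom[OF M(1,2) f(1)] v] by (simp add: res_map_comp[OF M f k v])
qed

text \<open>By functoriality, iterated transition maps collapse to a single pullback, so vanishing
  at a later stage becomes a statement about one cocycle.\<close>

lemma adic_transition_class:
  fixes M :: "('a, 'm, 'x) module_scheme" and N :: "('a, 'n, 'y) module_scheme"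
  assumes \<aa>: "ideal \<aa> R" and M: "module R M" and N: "module R N" and kl: "k \<le> l"
    and h: "h \<in> Ext_cocycles R (adic_quotient R \<aa> M k) N i"
  shows "fold (\<lambda>n. Ext_map R (adic_quotient R \<aa> M (Suc n)) N i (adic_projection R \<aa> M n)) [k..<l]
      (Ext_class (adic_quotient R \<aa> M k) N i h)
    = Ext_class (adic_quotient R \<aa> M l) N i (pullback (adic_quotient R \<aa> M l) i (adic_projection R \<aa> M k) h)"
  using kl
proof (induction l rule: dec_induct)
  interpret M: module R M by fact
  note Q = M.adic_quotient_module[OF \<aa>]
  note P = M.adic_projection_hom_le(1)[OF \<aa>]
  {
    case base
    have "pullback (adic_quotient R \<aa> M k) i (adic_projection R \<aa> M k) h = h"
    proof (rule extensionalityI)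
      show "h \<in> extensional (res_chains (adic_quotient R \<aa> M k) (Suc i))" using h by (simp add: Ext_cocycles_iff)
      fix v assume v: "v \<in> res_chains (adic_quotient R \<aa> M k) (Suc i)"
      then show "pullback (adic_quotient R \<aa> M k) i (adic_projection R \<aa> M k) h v = h v"
        by (simp add: res_map_ident[OF Q P[OF order_refl] M.adic_projection_self[OF \<aa>] v])
    qed simp
    then show ?case by simp
  next
    case (step l)
    note c = Ext_map_class[OF Q Q N P[OF step(1)] h]
    note d = Ext_map_class[OF Q Q N P[of l "Suc l", OF le_SucI[OF order_refl]] c(1)]
    have "k \<le> Suc l" using step(1) by simp
    note e = pullback_comp[OF Q Q Q P[of l "Suc l", OF le_SucI[OF order_refl]] P[OF step(1)] P[OF this]
        M.adic_projection_comp[OF \<aa> step(1) le_SucI[OF order_refl]]]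
    show ?case using step(1) by (simp only: upt_Suc_append fold_append fold_simps comp_apply id_apply step.IH d(2) e)
  }
qed

text \<open>A class of M vanishes on some adic submodule and therefore comes from the corresponding
  quotient, by exactness in the middle.\<close>

lemma adic_restriction_surj:
  assumes R: "noetherian_ring R" and \<aa>: "ideal \<aa> R" and M: "module R M" and fg: "finitely_generated_module R M"
    and N: "module R N" and supp: "Supp R M \<inter> Supp R N \<subseteq> prime_locus R \<aa>"
    and y: "y \<in> carrier (Ext R M N i)"
  shows "\<exists>n. \<exists>x\<in>carrier (Ext R (adic_quotient R \<aa> M n) N i). Ext_map R M N i (module.adic_map R M \<aa> n) x = y"
proof -
  interpret M: module R M by fact
  interpret N: module R N by fact
  obtain h where h: "h \<in> Ext_cocycles R M N i" "y = Ext_class M N i h" using y by (auto simp: Ext_carrier)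
  have hc: "res_cocycle N M (Suc i) h" using h by (simp add: Ext_cocycles_iff)
  have "\<exists>n\<ge>0. res_coboundary N (M\<lparr>carrier := ideal_smult (ideal_power R \<aa> n) M\<rparr>) (Suc i) h"
    by (rule coboundary_on_adic_submodule[OF R \<aa> M fg N supp cocycle_subset[OF hc res_subcomplex[OF M.adic_submodule[OF \<aa>] M]]])
  then obtain n where n: "res_coboundary N (M\<lparr>carrier := ideal_smult (ideal_power R \<aa> n) M\<rparr>) (Suc i) h"
    by blast
  let ?Q = "adic_quotient R \<aa> M n"
  note Q = M.adic_quotient_module[OF \<aa>, of n]
  note pi = M.adic_map(1)[OF \<aa>, of n]
  obtain h' where h': "res_cocycle N ?Q (Suc i) h'"
    "res_coboundary N M (Suc i) (\<lambda>v. h' (res_map R (M.adic_map \<aa> n) v) \<ominus>\<^bsub>N\<^esub> h v)"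
    using cocycle_from_quotient[OF N M Q pi M.adic_map(2)[OF \<aa>] M.adic_submodule[OF \<aa>] M.adic_map(3)[OF \<aa>] hc n] by blast
  \<comment> \<open>The lifted cocycle is cut off outside the carrier because cochains of Ext are
    extensional.\<close>
  define k where "k = restrict h' (res_chains ?Q (Suc i))"
  have kh: "k v = h' v" if "v \<in> res_chains ?Q (Suc i)" for v using that by (simp add: k_def)
  have k: "k \<in> Ext_cocycles R ?Q N i"
    unfolding Ext_cocycles_iff cocycle_def
  proof (intro conjI ballI)
    show "k \<in> free_hom (res_basis R ?Q (Suc i)) N"
      using h'(1) restrict_hom by (auto simp: k_def cocycle_def)
    show "k (res_d R (Suc (Suc i)) v) = \<zero>\<^bsub>N\<^esub>" if "v \<in> res_chains ?Q (Suc (Suc i))" for v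
      unfolding kh[OF complexD(5)[OF res_complex[OF Q] that]] using h'(1) that by (simp only: cocycle_def)
  qed (simp add: k_def)
  have "Ext_class M N i (pullback M i (M.adic_map \<aa> n) k) = Ext_class M N i h"
  proof (rule Ext_class_eqI[OF N M Ext_map_class(1)[OF M Q N pi k] h(1)])
    show "res_coboundary N M (Suc i) (\<lambda>v. pullback M i (M.adic_map \<aa> n) k v \<ominus>\<^bsub>N\<^esub> h v)"
      using h'(2) by (rule coboundary_cong) (simp add: kh fhom(1)[OF res_map_fhom[OF M Q pi]])
  qed
  then have "Ext_map R M N i (M.adic_map \<aa> n) (Ext_class ?Q N i k) = y"
    by (simp add: Ext_map_class(2)[OF M Q N pi k] h(2))
  moreover have "Ext_class ?Q N i k \<in> carrier (Ext R ?Q N i)" using k by (auto simp: Ext_carrier)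
  ultimately show ?thesis by blast
qed

text \<open>The class comes, through the connecting map, from the n-th adic submodule in one degree
  less. There it dies on a smaller adic submodule, whose index is the stage at which the given class
  vanishes.\<close>

lemma adic_restriction_inj:
  assumes R: "noetherian_ring R" and \<aa>: "ideal \<aa> R" and M: "module R M" and fg: "finitely_generated_module R M"
    and N: "module R N" and supp: "Supp R M \<inter> Supp R N \<subseteq> prime_locus R \<aa>"
    and x: "x \<in> carrier (Ext R (adic_quotient R \<aa> M n) N i)"
    and z: "Ext_map R M N i (module.adic_map R M \<aa> n) x = \<zero>\<^bsub>Ext R M N i\<^esub>"
  shows "\<exists>k\<ge>n. fold (\<lambda>n. Ext_map R (adic_quotient R \<aa> M (Suc n)) N i (adic_projection R \<aa> M n)) [n..<k] x
    = \<zero>\<^bsub>Ext R (adic_quotient R \<aa> M k) N i\<^esub>"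
proof -
  interpret M: module R M by fact
  note Q = M.adic_quotient_module[OF \<aa>]
  note pi = M.adic_map(1)[OF \<aa>] and P = M.adic_projection_hom_le[OF \<aa>]
  let ?Q = "adic_quotient R \<aa> M"
  let ?H = "\<lambda>n. ideal_smult (ideal_power R \<aa> n) M"
  obtain h where h: "h \<in> Ext_cocycles R (?Q n) N i" "x = Ext_class (?Q n) N i h" using x by (auto simp: Ext_carrier)
  have hc: "res_cocycle N (?Q n) (Suc i) h" using h by (simp add: Ext_cocycles_iff)
  note pb = Ext_map_class[OF M Q N pi h(1)]
  have "res_coboundary N M (Suc i) (pullback M i (M.adic_map \<aa> n) h)"
    using z Ext_class_eq_zero_iff[OF N M pb(1)] by (simp add: h(2) pb(2))
  then have hp: "res_coboundary N M (Suc i) (\<lambda>v. h (res_map R (M.adic_map \<aa> n) v))"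
    by (rule coboundary_cong) simp
  have "\<exists>k. n \<le> k \<and> res_coboundary N (?Q k) (Suc i) (\<lambda>v. h (res_map R (adic_projection R \<aa> M n) v))"
  proof (rule coboundary_on_finer_quotient[OF N M Q pi M.adic_submodule[OF \<aa>] _ hc hp, where H = ?H and p'' = "M.adic_map \<aa>"])
    show "M.adic_map \<aa> n x = \<zero>\<^bsub>?Q n\<^esub>" if "x \<in> ?H n" for x
      using M.adic_map(3)[OF \<aa>] M.submoduleE(1)[OF M.adic_submodule[OF \<aa>, of n]] that by blast
    show "\<exists>k. submodule (?H k) R M \<and> n \<le> k \<and> res_coboundary N (M\<lparr>carrier := ?H k\<rparr>) m \<beta>"
      if "res_cocycle N (M\<lparr>carrier := ?H n\<rparr>) m \<beta>" for m \<beta>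
      using coboundary_on_adic_submodule[OF R \<aa> M fg N supp that] M.adic_submodule[OF \<aa>] by blast
  qed (rule Q pi M.adic_map(2)[OF \<aa>] M.adic_map(3)[OF \<aa>] P; assumption)+
  then obtain k where k: "n \<le> k" "res_coboundary N (?Q k) (Suc i) (\<lambda>v. h (res_map R (adic_projection R \<aa> M n) v))"
    by blast
  have "res_coboundary N (?Q k) (Suc i) (pullback (?Q k) i (adic_projection R \<aa> M n) h)"
    using k(2) by (rule coboundary_cong) simp
  then show ?thesis
    using Ext_class_eq_zero_iff[OF N Q Ext_map_class(1)[OF Q Q N P(1)[OF k(1)] h(1)]]
      adic_transition_class[OF \<aa> M N k(1) h(1)] k(1) h(2) by auto
qed

end

section \<open>The comparison isomorphism\<close>

theorem corollary1p8:
  fixes R :: "('a, 'r) ring_scheme"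
    and M :: "('a, 'm, 'x) module_scheme"
    and N :: "('a, 'n, 'y) module_scheme"
    and \<aa> :: "'a set"
  assumes "cring R" and "noetherian_ring R" and "\<one>\<^bsub>R\<^esub> \<noteq> \<zero>\<^bsub>R\<^esub>"
    and "ideal \<aa> R"
    and "module R M" and "finitely_generated_module R M"
    and "module R N"
    and "Supp R M \<inter> Supp R N \<subseteq> prime_locus R \<aa>"
  shows "\<forall>i. module_isomorphic R (gen_local_cohomology R \<aa> M N i) (Ext R M N i)"
proof
  fix i
  interpret cring R by fact
  interpret M: module R M by fact
  note Q = M.adic_quotient_module[OF assms(4)]
  interpret dirsys R "\<lambda>n. Ext R (adic_quotient R \<aa> M n) N i"
    "\<lambda>n. Ext_map R (adic_quotient R \<aa> M (Suc n)) N i (adic_projection R \<aa> M n)"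
    by (intro dirsys.intro dirsys_axioms.intro is_cring Ext_module Ext_map_hom Q M.adic_projection_hom(1) assms)
  show "module_isomorphic R (gen_local_cohomology R \<aa> M N i) (Ext R M N i)"
    unfolding gen_local_cohomology_def
  proof (rule direct_limit_isomorphic)
    show "module R (Ext R M N i)" by (rule Ext_module[OF assms(5,7)])
    \<comment> \<open>The isomorphism is induced by the projections of M onto its adic quotients,
      which are compatible with the maps of the tower.\<close>
    show "Ext_map R M N i (M.adic_map \<aa> n) \<in> module_hom R (Ext R (adic_quotient R \<aa> M n) N i) (Ext R M N i)" for n
      by (rule Ext_map_hom[OF assms(5) Q assms(7) M.adic_map(1)[OF assms(4)]])
    fix n x assume x: "x \<in> carrier (Ext R (adic_quotient R \<aa> M n) N i)"
    then obtain h where h: "h \<in> Ext_cocycles R (adic_quotient R \<aa> M n) N i" "x = Ext_class (adic_quotient R \<aa> M n) N i h"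
      by (auto simp: Ext_carrier)
    have "n \<le> Suc n" by simp
    note P = M.adic_projection_hom_le[OF assms(4) this]
    note c = Ext_map_class[OF Q Q assms(7) P(1) h(1)]
    have e: "pullback M i (M.adic_map \<aa> (Suc n)) (pullback (adic_quotient R \<aa> M (Suc n)) i (adic_projection R \<aa> M n) h)
        = pullback M i (M.adic_map \<aa> n) h"
      by (rule pullback_comp[OF assms(5) Q Q M.adic_map(1)[OF assms(4)] P(1) M.adic_map(1)[OF assms(4)] P(2)])
    show "Ext_map R M N i (M.adic_map \<aa> (Suc n)) (Ext_map R (adic_quotient R \<aa> M (Suc n)) N i (adic_projection R \<aa> M n) x)
      = Ext_map R M N i (M.adic_map \<aa> n) x"
      unfolding h(2) c(2) Ext_map_class(2)[OF assms(5) Q assms(7) M.adic_map(1)[OF assms(4)] c(1)]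
        Ext_map_class(2)[OF assms(5) Q assms(7) M.adic_map(1)[OF assms(4)] h(1)] e ..
    show "\<exists>k\<ge>n. fold (\<lambda>n. Ext_map R (adic_quotient R \<aa> M (Suc n)) N i (adic_projection R \<aa> M n)) [n..<k] x
        = \<zero>\<^bsub>Ext R (adic_quotient R \<aa> M k) N i\<^esub>"
      if "Ext_map R M N i (M.adic_map \<aa> n) x = \<zero>\<^bsub>Ext R M N i\<^esub>"
      by (rule adic_restriction_inj[OF assms(2,4,5,6,7,8) x that])
  qed (rule adic_restriction_surj[OF assms(2,4,5,6,7,8)])
qed

end
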